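(* For every integer $s\geq 2$ it is consistent with ZFC that for every integer $k\geq 2$ we have $\mathfrak{L}_{s+1}<\mathfrak{L}_{s}=\mathfrak{v}_{k}^{g}=\mathfrak{c}$.
   Context: A tree is a set $T\subseteq\omega^{<\omega}$ closed under initial segments. A $k$-branching tree is a tree in which every node has either exactly $1$ immediate successor or exactly $k$ immediate successors. A function $f\in\omega^\omega$ is a branch of $T$ if $f\upharpoonright n\in T$ for all $n$. The $k$-localization number $\mathfrak{L}_k$ is the least cardinality of a family of $k$-branching trees such that every element of $(k+1)^{\omega}$ is a branch of some tree in the family. A $k$ globally adaptive predictor is a sequence $\pi=\langle\pi_n:n\in\omega\rangle$ with $\pi_n:\omega^n\to[\omega]^k$; it predicts $f\in\omega^\omega$ if there is $m$ such that $f(n)\in\pi_n(f\upharpoonright n)$ for all $n>m$. The number $\mathfrak{v}_k^{g}$ is the least cardinality of a set of $k$ globally adaptive predictors such that every $f\in\omega^\omega$ is predicted by one of them. $\mathfrak{c}=2^{\aleph_0}$. *)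

theory Defs
  imports Main
begin

section \<open>First-order logic of the language of set theory\<close>

text \<open>De Bruijn indices; the only terms are variables.\<close>

datatype fm =
    Bot
  | Mem nat nat
  | Equal nat nat
  | Imp fm fm
  | Forall fm

definition Neg :: "fm \<Rightarrow> fm" where "Neg p = Imp p Bot"
definition Conj :: "fm \<Rightarrow> fm \<Rightarrow> fm" where "Conj p q = Neg (Imp p (Neg q))"
definition Disj :: "fm \<Rightarrow> fm \<Rightarrow> fm" where "Disj p q = Imp (Neg p) q"
definition Iff :: "fm \<Rightarrow> fm \<Rightarrow> fm" where "Iff p q = Conj (Imp p q) (Imp q p)"
definition Exists :: "fm \<Rightarrow> fm" where "Exists p = Neg (Forall (Neg p))"

fun lift :: "(nat \<Rightarrow> nat) \<Rightarrow> nat \<Rightarrow> nat" where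
  "lift r 0 = 0"
| "lift r (Suc n) = Suc (r n)"

primrec rename :: "(nat \<Rightarrow> nat) \<Rightarrow> fm \<Rightarrow> fm" where
  "rename r Bot = Bot"
| "rename r (Mem x y) = Mem (r x) (r y)"
| "rename r (Equal x y) = Equal (r x) (r y)"
| "rename r (Imp p q) = Imp (rename r p) (rename r q)"
| "rename r (Forall p) = Forall (rename (lift r) p)"

primrec fv :: "fm \<Rightarrow> nat set" where
  "fv Bot = {}"
| "fv (Mem x y) = {x, y}"
| "fv (Equal x y) = {x, y}"
| "fv (Imp p q) = fv p \<union> fv q"
| "fv (Forall p) = {n. Suc n \<in> fv p}"

definition inst :: "nat \<Rightarrow> fm \<Rightarrow> fm" where
  "inst x = rename (case_nat x id)"

text \<open>Classical natural deduction with equality. In \<open>AllI\<close> the hypotheses are shifted, so that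
  the variable 0 is fresh for them.\<close>

inductive deriv :: "fm set \<Rightarrow> fm \<Rightarrow> bool"  (infix "\<turnstile>" 50) where
  Hyp: "p \<in> H \<Longrightarrow> H \<turnstile> p"
| ImpI: "insert p H \<turnstile> q \<Longrightarrow> H \<turnstile> Imp p q"
| ImpE: "H \<turnstile> Imp p q \<Longrightarrow> H \<turnstile> p \<Longrightarrow> H \<turnstile> q"
| Contr: "insert (Neg p) H \<turnstile> Bot \<Longrightarrow> H \<turnstile> p"
| AllI: "rename Suc ` H \<turnstile> p \<Longrightarrow> H \<turnstile> Forall p"
| AllE: "H \<turnstile> Forall p \<Longrightarrow> H \<turnstile> inst x p"
| EqI: "H \<turnstile> Equal x x"
| EqE: "H \<turnstile> Equal x y \<Longrightarrow> H \<turnstile> inst x p \<Longrightarrow> H \<turnstile> inst y p"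

definition consistent :: "fm set \<Rightarrow> bool" where
  "consistent T \<longleftrightarrow> \<not> T \<turnstile> Bot"


section \<open>Formulas with binders\<close>

text \<open>A formula template is a function of the number \<open>d\<close> of enclosing quantifiers. Within a template
  a variable is represented by its level, i.e. the number of quantifiers enclosing its own binder,
  so that the variable of level \<open>x < d\<close> has the de Bruijn index \<open>d - Suc x\<close>. This lets
  formulas be written with HOL-bound variables. A sentence is a template applied to 0.\<close>

type_synonym tmpl = "nat \<Rightarrow> fm"

definition tmem :: "nat \<Rightarrow> nat \<Rightarrow> tmpl"  (infix "\<^bold>\<in>" 75) where
  "x \<^bold>\<in> y = (\<lambda>d. Mem (d - Suc x) (d - Suc y))"
definition teq :: "nat \<Rightarrow> nat \<Rightarrow> tmpl"  (infix "\<^bold>=" 75) where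
  "x \<^bold>= y = (\<lambda>d. Equal (d - Suc x) (d - Suc y))"
definition tnot :: "tmpl \<Rightarrow> tmpl"  ("\<^bold>\<not> _" [70] 70) where
  "\<^bold>\<not> F = (\<lambda>d. Neg (F d))"
definition tand :: "tmpl \<Rightarrow> tmpl \<Rightarrow> tmpl"  (infixr "\<^bold>\<and>" 65) where
  "F \<^bold>\<and> G = (\<lambda>d. Conj (F d) (G d))"
definition tor :: "tmpl \<Rightarrow> tmpl \<Rightarrow> tmpl"  (infixr "\<^bold>\<or>" 60) where
  "F \<^bold>\<or> G = (\<lambda>d. Disj (F d) (G d))"
definition timp :: "tmpl \<Rightarrow> tmpl \<Rightarrow> tmpl"  (infixr "\<^bold>\<longrightarrow>" 55) where
  "F \<^bold>\<longrightarrow> G = (\<lambda>d. Imp (F d) (G d))"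
definition tiff :: "tmpl \<Rightarrow> tmpl \<Rightarrow> tmpl"  (infixr "\<^bold>\<longleftrightarrow>" 55) where
  "F \<^bold>\<longleftrightarrow> G = (\<lambda>d. Iff (F d) (G d))"
definition tall :: "(nat \<Rightarrow> tmpl) \<Rightarrow> tmpl"  (binder "\<^bold>\<forall>" 10) where
  "tall F = (\<lambda>d. Forall (F d (Suc d)))"
definition tex :: "(nat \<Rightarrow> tmpl) \<Rightarrow> tmpl"  (binder "\<^bold>\<exists>" 10) where
  "tex F = (\<lambda>d. Exists (F d (Suc d)))"
definition tex1 :: "(nat \<Rightarrow> tmpl) \<Rightarrow> tmpl"  (binder "\<^bold>\<exists>\<^sub>1" 10) where
  "tex1 F = (\<^bold>\<exists>x. F x \<^bold>\<and> (\<^bold>\<forall>y. F y \<^bold>\<longrightarrow> y \<^bold>= x))"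

text \<open>The formula \<open>p\<close> with its free variable \<open>i\<close> standing for the variable of level \<open>v i\<close>.\<close>

definition plug :: "fm \<Rightarrow> (nat \<Rightarrow> nat) \<Rightarrow> tmpl" where
  "plug p v = (\<lambda>d. rename (\<lambda>i. d - Suc (v i)) p)"

text \<open>The universal closure of a template over the variables of levels \<open>0, \<dots>, n - 1\<close>.\<close>

definition closure :: "nat \<Rightarrow> tmpl \<Rightarrow> fm" where
  "closure n F = (Forall ^^ n) (F n)"


section \<open>Basic set-theoretic notions\<close>

definition is_subset :: "nat \<Rightarrow> nat \<Rightarrow> tmpl"  (infix "\<^bold>\<subseteq>" 75) where
  "x \<^bold>\<subseteq> y = (\<^bold>\<forall>z. z \<^bold>\<in> x \<^bold>\<longrightarrow> z \<^bold>\<in> y)"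

definition is_empty :: "nat \<Rightarrow> tmpl" where
  "is_empty x = (\<^bold>\<forall>z. \<^bold>\<not> (z \<^bold>\<in> x))"

definition is_succ :: "nat \<Rightarrow> nat \<Rightarrow> tmpl" where
  "is_succ x y = (\<^bold>\<forall>z. z \<^bold>\<in> y \<^bold>\<longleftrightarrow> z \<^bold>\<in> x \<^bold>\<or> z \<^bold>= x)"

definition is_upair :: "nat \<Rightarrow> nat \<Rightarrow> nat \<Rightarrow> tmpl" where
  "is_upair x y p = (\<^bold>\<forall>z. z \<^bold>\<in> p \<^bold>\<longleftrightarrow> z \<^bold>= x \<^bold>\<or> z \<^bold>= y)"

definition is_pair :: "nat \<Rightarrow> nat \<Rightarrow> nat \<Rightarrow> tmpl" where
  "is_pair x y p = (\<^bold>\<exists>a. \<^bold>\<exists>b. is_upair x x a \<^bold>\<and> is_upair x y b \<^bold>\<and> is_upair a b p)"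

definition is_inductive :: "nat \<Rightarrow> tmpl" where
  "is_inductive w =
    ((\<^bold>\<exists>x. is_empty x \<^bold>\<and> x \<^bold>\<in> w) \<^bold>\<and>
     (\<^bold>\<forall>x. x \<^bold>\<in> w \<^bold>\<longrightarrow> (\<^bold>\<exists>y. is_succ x y \<^bold>\<and> y \<^bold>\<in> w)))"

definition is_omega :: "nat \<Rightarrow> tmpl" where
  "is_omega w = (is_inductive w \<^bold>\<and> (\<^bold>\<forall>v. is_inductive v \<^bold>\<longrightarrow> w \<^bold>\<subseteq> v))"

text \<open>\<open>x\<close> is the von Neumann numeral of the (metatheoretic) number \<open>n\<close>.\<close>

primrec is_numeral :: "nat \<Rightarrow> nat \<Rightarrow> tmpl" where
  "is_numeral 0 x = is_empty x"
| "is_numeral (Suc n) x = (\<^bold>\<exists>y. is_numeral n y \<^bold>\<and> is_succ y x)"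

definition app :: "nat \<Rightarrow> nat \<Rightarrow> nat \<Rightarrow> tmpl" where
  "app f x y = (\<^bold>\<exists>p. is_pair x y p \<^bold>\<and> p \<^bold>\<in> f)"

definition func_on :: "nat \<Rightarrow> nat \<Rightarrow> tmpl" where
  "func_on A f =
    ((\<^bold>\<forall>p. p \<^bold>\<in> f \<^bold>\<longrightarrow> (\<^bold>\<exists>x. \<^bold>\<exists>y. x \<^bold>\<in> A \<^bold>\<and> is_pair x y p)) \<^bold>\<and>
     (\<^bold>\<forall>x. x \<^bold>\<in> A \<^bold>\<longrightarrow> (\<^bold>\<exists>\<^sub>1y. app f x y)))"

definition func :: "nat \<Rightarrow> nat \<Rightarrow> nat \<Rightarrow> tmpl" where
  "func A B f = (func_on A f \<^bold>\<and> (\<^bold>\<forall>x. \<^bold>\<forall>y. app f x y \<^bold>\<longrightarrow> y \<^bold>\<in> B))"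

definition is_funspace :: "nat \<Rightarrow> nat \<Rightarrow> nat \<Rightarrow> tmpl" where
  "is_funspace A B X = (\<^bold>\<forall>f. f \<^bold>\<in> X \<^bold>\<longleftrightarrow> func A B f)"

definition is_restr :: "nat \<Rightarrow> nat \<Rightarrow> nat \<Rightarrow> tmpl" where
  "is_restr f A g =
    (\<^bold>\<forall>p. p \<^bold>\<in> g \<^bold>\<longleftrightarrow> p \<^bold>\<in> f \<^bold>\<and> (\<^bold>\<exists>x. \<^bold>\<exists>y. x \<^bold>\<in> A \<^bold>\<and> is_pair x y p))"

definition equinum :: "nat \<Rightarrow> nat \<Rightarrow> tmpl"  (infix "\<^bold>\<approx>" 75) where
  "A \<^bold>\<approx> B = (\<^bold>\<exists>f. func A B f \<^bold>\<and> (\<^bold>\<forall>y. y \<^bold>\<in> B \<^bold>\<longrightarrow> (\<^bold>\<exists>\<^sub>1x. app f x y)))"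

text \<open>By Foundation, \<open>\<in>\<close> is then a well-order on \<open>a\<close>.\<close>

definition ordinal :: "nat \<Rightarrow> tmpl" where
  "ordinal a =
    ((\<^bold>\<forall>x. x \<^bold>\<in> a \<^bold>\<longrightarrow> x \<^bold>\<subseteq> a) \<^bold>\<and>
     (\<^bold>\<forall>x. \<^bold>\<forall>y. x \<^bold>\<in> a \<^bold>\<and> y \<^bold>\<in> a \<^bold>\<longrightarrow> x \<^bold>\<in> y \<^bold>\<or> x \<^bold>= y \<^bold>\<or> y \<^bold>\<in> x))"

definition cardinal :: "nat \<Rightarrow> tmpl" where
  "cardinal c = (ordinal c \<^bold>\<and> (\<^bold>\<forall>b. b \<^bold>\<in> c \<^bold>\<longrightarrow> \<^bold>\<not> (b \<^bold>\<approx> c)))"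

definition least_cardinality :: "(nat \<Rightarrow> tmpl) \<Rightarrow> nat \<Rightarrow> tmpl" where
  "least_cardinality P c =
    (cardinal c \<^bold>\<and> (\<^bold>\<exists>F. P F \<^bold>\<and> F \<^bold>\<approx> c) \<^bold>\<and>
     (\<^bold>\<forall>F. \<^bold>\<forall>b. P F \<^bold>\<and> cardinal b \<^bold>\<and> F \<^bold>\<approx> b \<^bold>\<longrightarrow> c \<^bold>\<in> b \<^bold>\<or> c \<^bold>= b))"

definition is_continuum :: "nat \<Rightarrow> tmpl" where
  "is_continuum c =
    (cardinal c \<^bold>\<and>
     (\<^bold>\<exists>w. \<^bold>\<exists>t. \<^bold>\<exists>X. is_omega w \<^bold>\<and> is_numeral 2 t \<^bold>\<and> is_funspace w t X \<^bold>\<and> X \<^bold>\<approx> c))"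


section \<open>The axioms of ZFC\<close>

definition Extensionality :: fm where
  "Extensionality = closure 0 (\<^bold>\<forall>x. \<^bold>\<forall>y. (\<^bold>\<forall>z. z \<^bold>\<in> x \<^bold>\<longleftrightarrow> z \<^bold>\<in> y) \<^bold>\<longrightarrow> x \<^bold>= y)"

definition Foundation :: fm where
  "Foundation = closure 0
    (\<^bold>\<forall>x. (\<^bold>\<exists>y. y \<^bold>\<in> x) \<^bold>\<longrightarrow> (\<^bold>\<exists>y. y \<^bold>\<in> x \<^bold>\<and> \<^bold>\<not> (\<^bold>\<exists>z. z \<^bold>\<in> x \<^bold>\<and> z \<^bold>\<in> y)))"

definition Pairing :: fm where
  "Pairing = closure 0 (\<^bold>\<forall>x. \<^bold>\<forall>y. \<^bold>\<exists>p. is_upair x y p)"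

definition Union_Axiom :: fm where
  "Union_Axiom = closure 0 (\<^bold>\<forall>x. \<^bold>\<exists>u. \<^bold>\<forall>z. z \<^bold>\<in> u \<^bold>\<longleftrightarrow> (\<^bold>\<exists>y. y \<^bold>\<in> x \<^bold>\<and> z \<^bold>\<in> y))"

definition Power_Set :: fm where
  "Power_Set = closure 0 (\<^bold>\<forall>x. \<^bold>\<exists>u. \<^bold>\<forall>z. z \<^bold>\<in> u \<^bold>\<longleftrightarrow> z \<^bold>\<subseteq> x)"

definition Infinity :: fm where
  "Infinity = closure 0 (\<^bold>\<exists>w. is_inductive w)"

definition Choice :: fm where
  "Choice = closure 0
    (\<^bold>\<forall>x. (\<^bold>\<forall>y. y \<^bold>\<in> x \<^bold>\<longrightarrow> (\<^bold>\<exists>u. u \<^bold>\<in> y)) \<^bold>\<and>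
          (\<^bold>\<forall>y. \<^bold>\<forall>z. y \<^bold>\<in> x \<^bold>\<and> z \<^bold>\<in> x \<^bold>\<and> (\<^bold>\<exists>u. u \<^bold>\<in> y \<^bold>\<and> u \<^bold>\<in> z) \<^bold>\<longrightarrow> y \<^bold>= z) \<^bold>\<longrightarrow>
          (\<^bold>\<exists>c. \<^bold>\<forall>y. y \<^bold>\<in> x \<^bold>\<longrightarrow> (\<^bold>\<exists>\<^sub>1u. u \<^bold>\<in> y \<^bold>\<and> u \<^bold>\<in> c)))"

text \<open>In the schemas the parameters are the variables of levels \<open>0, \<dots>, n - 1\<close>. In Separation the
  free variables of \<open>p\<close> are the element \<open>x\<close> (index 0) and the parameters (indices \<open>1, \<dots>, n\<close>); in
  Replacement they are the argument \<open>x\<close> (index 0), the value \<open>y\<close> (index 1) and the parameters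
  (indices \<open>2, \<dots>, n + 1\<close>).\<close>

definition Separation :: "nat \<Rightarrow> fm \<Rightarrow> fm" where
  "Separation n p = closure n
    (let P = (\<lambda>x. plug p (case_nat x id))
     in \<^bold>\<forall>a. \<^bold>\<exists>b. \<^bold>\<forall>x. x \<^bold>\<in> b \<^bold>\<longleftrightarrow> x \<^bold>\<in> a \<^bold>\<and> P x)"

definition Replacement :: "nat \<Rightarrow> fm \<Rightarrow> fm" where
  "Replacement n p = closure n
    (let P = (\<lambda>x y. plug p (case_nat x (case_nat y id)))
     in \<^bold>\<forall>a. (\<^bold>\<forall>x. x \<^bold>\<in> a \<^bold>\<longrightarrow> (\<^bold>\<exists>\<^sub>1y. P x y)) \<^bold>\<longrightarrow>
             (\<^bold>\<exists>b. \<^bold>\<forall>y. y \<^bold>\<in> b \<^bold>\<longleftrightarrow> (\<^bold>\<exists>x. x \<^bold>\<in> a \<^bold>\<and> P x y)))"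

definition ZFC :: "fm set" where
  "ZFC =
    {Extensionality, Foundation, Pairing, Union_Axiom, Power_Set, Infinity, Choice} \<union>
    {Separation n p | n p. fv p \<subseteq> {..n}} \<union>
    {Replacement n p | n p. fv p \<subseteq> {..Suc n}}"


section \<open>Localization numbers\<close>

definition fin_seq :: "nat \<Rightarrow> nat \<Rightarrow> tmpl" where
  "fin_seq n t = (\<^bold>\<exists>w. is_omega w \<^bold>\<and> n \<^bold>\<in> w \<^bold>\<and> func n w t)"

definition tree :: "nat \<Rightarrow> tmpl" where
  "tree T =
    ((\<^bold>\<forall>t. t \<^bold>\<in> T \<^bold>\<longrightarrow> (\<^bold>\<exists>n. fin_seq n t)) \<^bold>\<and>
     (\<^bold>\<exists>w. is_omega w \<^bold>\<and>
       (\<^bold>\<forall>t. \<^bold>\<forall>n. \<^bold>\<forall>u. t \<^bold>\<in> T \<^bold>\<and> n \<^bold>\<in> w \<^bold>\<and> is_restr t n u \<^bold>\<longrightarrow> u \<^bold>\<in> T)))"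

definition immediate_successor :: "nat \<Rightarrow> nat \<Rightarrow> nat \<Rightarrow> tmpl" where
  "immediate_successor T t u =
    (u \<^bold>\<in> T \<^bold>\<and> (\<^bold>\<exists>n. \<^bold>\<exists>m. fin_seq n t \<^bold>\<and> is_succ n m \<^bold>\<and> fin_seq m u \<^bold>\<and> is_restr u n t))"

definition branching_tree :: "nat \<Rightarrow> nat \<Rightarrow> tmpl" where
  "branching_tree k T =
    (tree T \<^bold>\<and>
     (\<^bold>\<forall>t. t \<^bold>\<in> T \<^bold>\<longrightarrow>
       (\<^bold>\<exists>i. \<^bold>\<exists>S. is_numeral 1 i \<^bold>\<and>
         (\<^bold>\<forall>u. u \<^bold>\<in> S \<^bold>\<longleftrightarrow> immediate_successor T t u) \<^bold>\<and> (S \<^bold>\<approx> i \<^bold>\<or> S \<^bold>\<approx> k))))"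

definition branch :: "nat \<Rightarrow> nat \<Rightarrow> tmpl" where
  "branch f T =
    (\<^bold>\<exists>w. is_omega w \<^bold>\<and> func w w f \<^bold>\<and>
      (\<^bold>\<forall>n. n \<^bold>\<in> w \<^bold>\<longrightarrow> (\<^bold>\<exists>u. is_restr f n u \<^bold>\<and> u \<^bold>\<in> T)))"

definition localizing_family :: "nat \<Rightarrow> nat \<Rightarrow> tmpl" where
  "localizing_family k F =
    ((\<^bold>\<forall>T. T \<^bold>\<in> F \<^bold>\<longrightarrow> branching_tree k T) \<^bold>\<and>
     (\<^bold>\<exists>w. \<^bold>\<exists>l. is_omega w \<^bold>\<and> is_succ k l \<^bold>\<and>
       (\<^bold>\<forall>f. func w l f \<^bold>\<longrightarrow> (\<^bold>\<exists>T. T \<^bold>\<in> F \<^bold>\<and> branch f T))))"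

definition is_L :: "nat \<Rightarrow> nat \<Rightarrow> tmpl" where
  "is_L k c = least_cardinality (localizing_family k) c"


section \<open>Globally adaptive prediction numbers\<close>

definition is_subsets_of_size :: "nat \<Rightarrow> nat \<Rightarrow> nat \<Rightarrow> tmpl" where
  "is_subsets_of_size k A X = (\<^bold>\<forall>a. a \<^bold>\<in> X \<^bold>\<longleftrightarrow> a \<^bold>\<subseteq> A \<^bold>\<and> a \<^bold>\<approx> k)"

definition predictor :: "nat \<Rightarrow> nat \<Rightarrow> tmpl" where
  "predictor k \<pi> =
    (\<^bold>\<exists>w. is_omega w \<^bold>\<and> func_on w \<pi> \<^bold>\<and>
      (\<^bold>\<forall>n. \<^bold>\<forall>p. app \<pi> n p \<^bold>\<longrightarrow>
        (\<^bold>\<exists>X. \<^bold>\<exists>Y. is_funspace n w X \<^bold>\<and> is_subsets_of_size k w Y \<^bold>\<and> func X Y p)))"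

definition predicts :: "nat \<Rightarrow> nat \<Rightarrow> tmpl" where
  "predicts \<pi> f =
    (\<^bold>\<exists>w. \<^bold>\<exists>m. is_omega w \<^bold>\<and> m \<^bold>\<in> w \<^bold>\<and>
      (\<^bold>\<forall>n. n \<^bold>\<in> w \<^bold>\<and> m \<^bold>\<in> n \<^bold>\<longrightarrow>
        (\<^bold>\<exists>p. \<^bold>\<exists>u. \<^bold>\<exists>a. \<^bold>\<exists>y. app \<pi> n p \<^bold>\<and> is_restr f n u \<^bold>\<and> app p u a \<^bold>\<and>
          app f n y \<^bold>\<and> y \<^bold>\<in> a)))"

definition predicting_family :: "nat \<Rightarrow> nat \<Rightarrow> tmpl" where
  "predicting_family k F =
    ((\<^bold>\<forall>\<pi>. \<pi> \<^bold>\<in> F \<^bold>\<longrightarrow> predictor k \<pi>) \<^bold>\<and>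
     (\<^bold>\<exists>w. is_omega w \<^bold>\<and>
       (\<^bold>\<forall>f. func w w f \<^bold>\<longrightarrow> (\<^bold>\<exists>\<pi>. \<pi> \<^bold>\<in> F \<^bold>\<and> predicts \<pi> f))))"

definition is_v :: "nat \<Rightarrow> nat \<Rightarrow> tmpl" where
  "is_v k c = least_cardinality (predicting_family k) c"


section \<open>The sentence to be shown consistent\<close>

text \<open>Here \<open>s\<close> is a metatheoretic number, entering through its numeral, whereas \<open>k\<close> is quantified
  inside the theory. As cardinals are initial ordinals, \<open>a \<in> b\<close> expresses \<open>a < b\<close>, and
  \<open>t \<subseteq> k\<close> expresses \<open>2 \<le> k\<close>.\<close>

definition invariants_sentence :: "nat \<Rightarrow> fm" where
  "invariants_sentence s = closure 0
    (\<^bold>\<forall>k. (\<^bold>\<exists>w. \<^bold>\<exists>t. is_omega w \<^bold>\<and> is_numeral 2 t \<^bold>\<and> k \<^bold>\<in> w \<^bold>\<and> t \<^bold>\<subseteq> k) \<^bold>\<longrightarrow>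
      (\<^bold>\<exists>i. \<^bold>\<exists>j. \<^bold>\<exists>a. \<^bold>\<exists>b. is_numeral s i \<^bold>\<and> is_numeral (s + 1) j \<^bold>\<and>
        is_L j a \<^bold>\<and> is_L i b \<^bold>\<and> is_v k b \<^bold>\<and> is_continuum b \<^bold>\<and> a \<^bold>\<in> b))"

end

theory Submission
  imports Defs "HOL-Library.Countable_Set"
begin

text \<open>A countable model of ZFC, provided by the completeness theorem, is extended by a generic filter.
  Put \<open>k = s + 1\<close>. A condition excludes values at positions \<open>(\<alpha>, j, n)\<close>, where \<open>\<alpha>\<close> runs over
  \<open>2\<^sup>\<cc>\<close> columns, as computed in the ground model: in the columns of kind \<open>j = 0\<close> infinitely many positions
  still admit all of the \<open>k\<close> values, in those of kind \<open>1\<close> the number of admitted values is unbounded.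
  The generic filter adds a function on \<open>\<omega>\<close> for every column.

  \<^item> Fewer trees, or predictors, than the new continuum form a family indexed by a ground model set that
    does not cover \<open>2\<^sup>\<cc>\<close>. By a chain condition some column is not used for deciding the members of the
    family. At a free position its function can be made to leave a tree in which every node has at most
    \<open>s\<close> successors, since there are \<open>s + 1\<close> values, and to differ from all the \<open>K\<close> values that are
    predicted. So these invariants are equal to the continuum.

  \<^item> Given a name for \<open>f \<in> (k + 1)\<^sup>\<omega>\<close>, a fusion in which conditions are thinned so that the possible initial
    segments of \<open>f\<close> form combs yields a ground model function \<open>j\<close> with \<open>f(n) \<noteq> j(f|n)\<close> for all \<open>n\<close>.
    So the trees of the sequences avoiding such a \<open>j\<close>, whose nodes have exactly \<open>k\<close> successors,
    localize all \<open>f\<close>, and there are at most as many as ground model reals.\<close>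

section \<open>Henkin completeness and passage to a model on \<open>nat\<close>\<close>

section \<open>Semantics, soundness and completeness\<close>

text \<open>The completeness theorem supplies a model that may be ill-founded and nonstandard at
  omega. So names are not evaluated by recursion: the extension is the quotient of all names by
  forced equality. Induction, recursion and choice take place inside the model, hence for definable
  notions only; \<open>dfn\<close> and \<open>dt\<close> record this definability throughout. The
  two kinds of positions answer two demands. Escaping trees with \<open>s\<close> successors calls
  for functions into \<open>s + 1\<close>; escaping \<open>K\<close> guesses for every
  \<open>K\<close> calls for positions with unboundedly many values. Yet one of the
  \<open>k + 1\<close> next values of a decided sequence must always stay out of reach:
  \<open>k\<close> choices cannot produce them all, whereas a large set of choices has to be
  thinned. The obstacle in the fusion is that assignments agreeing on an initial segment of
  \<open>f\<close> could together still produce all \<open>k + 1\<close> next values. Each stage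
  therefore decides so much of \<open>f\<close> that assignments which still agree cannot be
  separated by any later strengthening that keeps their positions. One missing value then serves all
  of them.\<close>

primrec sat :: "('a => 'a => bool) => ('a => 'a => bool) => (nat => 'a) => fm => bool" where
 "sat eq E v Bot = False"
| "sat eq E v (Mem x y) = E (v x) (v y)"
| "sat eq E v (Equal x y) = eq (v x) (v y)"
| "sat eq E v (Imp p q) = (sat eq E v p --> sat eq E v q)"
| "sat eq E v (Forall p) = (ALL x. sat eq E (case_nat x v) p)"

lemma sat_connectives [simp]:
 "sat eq E v (Neg p) = (~ sat eq E v p)"
 "sat eq E v (Conj p q) = (sat eq E v p & sat eq E v q)"
 "sat eq E v (Disj p q) = (sat eq E v p | sat eq E v q)"
 "sat eq E v (Iff p q) = (sat eq E v p \<longleftrightarrow> sat eq E v q)"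
 "sat eq E v (Exists p) = (EX x. sat eq E (case_nat x v) p)"
 by (auto simp: Neg_def Conj_def Disj_def Iff_def Exists_def)

lemma sat_rename: "sat eq E v (rename r p) = sat eq E (%i. v (r i)) p"
proof (induction p arbitrary: v r)
 case (Forall p)
 have "(%i. case_nat x v (lift r i)) = case_nat x (%i. v (r i))" for x
  by (rule ext) (auto split: nat.split)
 then show ?case by (simp add: Forall)
qed auto

lemma sat_cong_fv: "(!!i. i : fv p ==> v i = w i) ==> sat eq E v p = sat eq E w p"
proof (induction p arbitrary: v w)
 case (Imp p q)
 then show ?case by (metis UnCI fv.simps(4) sat.simps(4))
next
 case (Forall p)
 have "sat eq E (case_nat x v) p = sat eq E (case_nat x w) p" for x
  by (rule Forall.IH) (use Forall.prems in \<open>auto split: nat.split\<close>)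
 then show ?case by simp
qed auto

lemma finite_fv: "finite (fv p)"
proof (induction p)
 case (Forall p)
 have "fv (Forall p) <= (%n. n - 1) ` fv p" by force
 then show ?case using Forall finite_surj by blast
qed auto

lemma rename_rename: "rename r (rename s p) = rename (r \<circ> s) p"
proof (induction p arbitrary: r s)
 case (Forall p)
 have "lift r \<circ> lift s = lift (r \<circ> s)" by (rule ext, case_tac x) auto
 then show ?case by (simp only: rename.simps Forall)
qed auto

lemma rename_cong: "(!!i. i : fv p ==> r i = s i) ==> rename r p = rename s p"
proof (induction p arbitrary: r s)
 case (Imp p q)
 then show ?case by (metis UnCI fv.simps(4) rename.simps(4))
next
 case (Forall p)
 have "rename (lift r) p = rename (lift s) p"
  by (rule Forall.IH, case_tac i) (use Forall.prems in auto)
 then show ?case by simp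
qed auto

lemma rename_id: "rename id p = p"
proof -
 have "lift id = id" by (rule ext, case_tac x) auto
 then show ?thesis by (induction p) auto
qed

lemma fv_rename: "fv (rename r p) = r ` fv p"
proof (induction p arbitrary: r)
 case (Forall p)
 have "(Suc n : lift r ` fv p) = (n : r ` {n. Suc n : fv p})" for n
 proof
  assume "Suc n : lift r ` fv p"
  then obtain i where "i : fv p" "Suc n = lift r i" by auto
  then show "n : r ` {n. Suc n : fv p}" by (cases i) auto
 next
  assume "n : r ` {n. Suc n : fv p}"
  then obtain i where "Suc i : fv p" "n = r i" by auto
  then show "Suc n : lift r ` fv p" by (intro image_eqI[of _ _ "Suc i"]) auto
 qed
 then show ?case by (auto simp: Forall)
qed auto

lemma rename_inst: "rename r (inst x p) = inst (r x) (rename (lift r) p)"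
proof -
 have "r \<circ> case_nat x id = case_nat (r x) id \<circ> lift r" by (rule ext, case_tac xa) auto
 then show ?thesis by (simp add: inst_def rename_rename)
qed

lemma soundness: "H \<turnstile> p ==> (!!h. h : H ==> sat (=) E v h) ==> sat (=) E v p"
proof (induction arbitrary: v rule: deriv.induct)
 case (Contr p H)
 then show ?case by (metis insert_iff sat.simps(1) sat_connectives(1))
next
 case (AllI H p)
 show ?case
 proof (simp, rule allI, rule AllI.IH)
  fix x h assume "h : rename Suc ` H"
  then show "sat (=) E (case_nat x v) h" using AllI.prems by (auto simp: sat_rename)
 qed
next
 case (AllE H p x)
 have "(%i. v (case_nat x id i)) = case_nat (v x) v" by (rule ext) (auto split: nat.split)
 then show ?case using AllE by (auto simp: inst_def sat_rename)
next
 case (EqE H x y p)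
 have eq: "sat (=) E v (inst z p) = sat (=) E (case_nat (v z) v) p" for z
 proof -
  have "(%i. v (case_nat z id i)) = case_nat (v z) v" by (rule ext) (auto split: nat.split)
  then show ?thesis by (simp add: inst_def sat_rename)
 qed
 have "v x = v y" using EqE.IH(1)[OF EqE.prems] by simp
 then show ?case using EqE.IH(2)[OF EqE.prems] by (simp add: eq)
qed auto

lemma deriv_rename: "H \<turnstile> p ==> rename r ` H \<turnstile> rename r p"
proof (induction arbitrary: r rule: deriv.induct)
 case (Hyp p H) then show ?case by (auto intro: deriv.Hyp)
next
 case (ImpI p H q) then show ?case using deriv.ImpI by simp
next
 case (ImpE H p q) then show ?case using deriv.ImpE by fastforce
next
 case (Contr p H) then show ?case using deriv.Contr by (simp add: Neg_def)
next
 case (AllI H p)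
 have "rename (lift r) ` rename Suc ` H = rename Suc ` rename r ` H"
  by (simp add: image_image rename_rename comp_def)
 then show ?case using AllI.IH[of "lift r"] deriv.AllI by simp
next
 case (AllE H p x) then show ?case using deriv.AllE by (simp add: rename_inst)
next
 case (EqI H x) then show ?case by (simp add: deriv.EqI)
next
 case (EqE H x y p) then show ?case
  using deriv.EqE[of "rename r ` H" "r x" "r y" "rename (lift r) p"] by (simp add: rename_inst)
qed

lemma deriv_mono: "H \<turnstile> p ==> H <= H' ==> H' \<turnstile> p"
proof (induction arbitrary: H' rule: deriv.induct)
 case (ImpI p H q) then show ?case by (meson deriv.ImpI insert_mono)
next
 case (Contr p H) then show ?case by (meson deriv.Contr insert_mono)
next
 case (AllI H p) then show ?case by (meson deriv.AllI image_mono)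
next
 case (EqE H x y p) then show ?case by (meson deriv.EqE)
qed (auto intro: deriv.intros)

lemma deriv_finite: "H \<turnstile> p ==> EX F<=H. finite F & F \<turnstile> p"
proof (induction rule: deriv.induct)
 case (Hyp p H) then show ?case by (intro exI[of _ "{p}"]) (auto intro: deriv.Hyp)
next
 case (ImpI p H q)
 then obtain F where "F <= insert p H" "finite F" "F \<turnstile> q" by auto
 then show ?case by (intro exI[of _ "F - {p}"]) (auto intro!: deriv.ImpI elim: deriv_mono)
next
 case (ImpE H p q)
 then obtain F F' where "F <= H" "finite F" "F \<turnstile> Imp p q" "F' <= H" "finite F'" "F' \<turnstile> p" by auto
 then show ?case
  by (intro exI[of _ "F \<union> F'"]) (meson Un_least deriv.ImpE deriv_mono finite_UnI sup_ge1 sup_ge2)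
next
 case (Contr p H)
 then obtain F where "F <= insert (Neg p) H" "finite F" "F \<turnstile> Bot" by auto
 then have "insert (Neg p) (F - {Neg p}) \<turnstile> Bot" by (auto elim: deriv_mono)
 then have "F - {Neg p} \<turnstile> p" by (rule deriv.Contr)
 then show ?case using \<open>F <= insert (Neg p) H\<close> \<open>finite F\<close>
  by (intro exI[of _ "F - {Neg p}"]) auto
next
 case (AllI H p)
 then obtain F where "F <= rename Suc ` H" "finite F" "F \<turnstile> p" by auto
 then obtain F' where "F' <= H" "finite F'" "F = rename Suc ` F'"
  by (meson finite_subset_image)
 then show ?case using \<open>F \<turnstile> p\<close> by (auto intro!: deriv.AllI)
next
 case (EqI H x) show ?case by (auto intro: deriv.EqI)
next
 case (EqE H x y p)
 then obtain F F' where "F <= H" "finite F" "F \<turnstile> Equal x y" "F' <= H" "finite F'" "F' \<turnstile> inst x p"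
  by auto
 then show ?case
  by (intro exI[of _ "F \<union> F'"]) (meson Un_least deriv.EqE deriv_mono finite_UnI sup_ge1 sup_ge2)
qed (auto intro: deriv.AllE)

text \<open>The renaming that sends \<open>y\<close> to 0 and shifts everything else acts on
  \<open>H\<close> like the plain shift, as \<open>y\<close> is not free in it, and turns
  \<open>inst y p\<close> back into \<open>p\<close>, as \<open>Suc y\<close> is not free in
  \<open>p\<close>. The premise thereby becomes that of \<open>AllI\<close>.\<close>

lemma deriv_generalize:
 assumes "H \<turnstile> inst y p" "!!h. h : H ==> y ~: fv h" "Suc y ~: fv p"
 shows "H \<turnstile> Forall p"
proof (rule AllI)
 define r where "r = (%n. if n = y then 0 else Suc n)"
 have 1: "rename r h = rename Suc h" if "h : H" for h
  by (rule rename_cong) (use assms(2)[OF that] in \<open>auto simp: r_def\<close>)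
 have "rename r (inst y p) = rename id p"
  unfolding inst_def rename_rename
  by (rule rename_cong) (use assms(3) in \<open>auto simp: r_def split: nat.split\<close>)
 moreover have "rename r ` H = rename Suc ` H" using 1 by auto
 ultimately show "rename Suc ` H \<turnstile> p" using deriv_rename[OF assms(1), of r] by (simp add: rename_id)
qed

instance fm :: countable by countable_datatype

text \<open>The language has no constants, so the witness against a refuted universal formula is a
  variable that is not yet in use; \<open>roomy\<close> keeps infinitely many such variables
  available.\<close>

definition henkin_step :: "fm set => fm => fm set" where
 "henkin_step H p = (if consistent (insert p H) then insert p H else
  insert (Neg p) H \<union> (case p of Forall q =>
   {Neg (inst (SOME y. y ~: fv p & (ALL h:H. y ~: fv h)) q)} | _ => {}))"

primrec henkin_seq :: "fm set => nat => fm set" where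
 "henkin_seq T 0 = T"
| "henkin_seq T (Suc n) = henkin_step (henkin_seq T n) (from_nat n)"

definition roomy :: "fm set => bool" where
 "roomy H \<longleftrightarrow> infinite (- (UN h:H. fv h))"

lemma roomy_insert: "roomy H ==> roomy (insert p H)"
proof -
 assume "roomy H"
 then have "infinite (- (UN h:H. fv h) - fv p)" using finite_fv by (auto simp: roomy_def)
 moreover have "- (UN h:H. fv h) - fv p = - (UN h:insert p H. fv h)" by auto
 ultimately show ?thesis by (simp add: roomy_def)
qed

lemma henkin_step_props:
 assumes "consistent H" "roomy H"
 shows "consistent (henkin_step H p)" "roomy (henkin_step H p)" "H <= henkin_step H p"
  "p : henkin_step H p | Neg p : henkin_step H p"
  "p = Forall q ==> p ~: henkin_step H p ==> EX y. Neg (inst y q) : henkin_step H p"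
proof -
 show "roomy (henkin_step H p)" using assms(2)
  by (auto simp: henkin_step_def roomy_insert split: fm.split)
 show "H <= henkin_step H p" "p : henkin_step H p | Neg p : henkin_step H p"
  by (auto simp: henkin_step_def)
 show "p = Forall q ==> p ~: henkin_step H p ==> EX y. Neg (inst y q) : henkin_step H p"
  by (auto simp: henkin_step_def split: if_splits)
 show "consistent (henkin_step H p)"
 proof (cases "consistent (insert p H)")
  case False
  then have np: "H \<turnstile> Neg p" by (simp add: consistent_def Neg_def deriv.ImpI)
  have c: "consistent (insert (Neg p) H)"
   using assms(1) np by (metis ImpE ImpI consistent_def)
  show ?thesis
  proof (cases "EX q. p = Forall q")
   case True
   then obtain q where q: "p = Forall q" by auto
   define y where "y = (SOME y. y ~: fv p & (ALL h:H. y ~: fv h))"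
   have "roomy (insert p H)" using assms(2) by (rule roomy_insert)
   then have "EX y. y : - (UN h:insert p H. fv h)" unfolding roomy_def
    by (metis ex_in_conv finite.emptyI)
   then have "EX y. y ~: fv p & (ALL h:H. y ~: fv h)" by auto
   then have y: "y ~: fv p & (ALL h:H. y ~: fv h)" unfolding y_def by (rule someI_ex)
   \<comment> \<open>If the new witness were refutable, \<open>inst y q\<close> would be derivable
     with \<open>y\<close> fresh, hence \<open>Forall q\<close>, contradicting
     \<open>Neg p\<close>.\<close>
   have "consistent (insert (Neg (inst y q)) (insert (Neg p) H))"
   proof (rule ccontr)
    assume "~ ?thesis"
    then have "insert (Neg p) H \<turnstile> inst y q" by (simp add: consistent_def deriv.Contr)
    then have "insert (Neg p) H \<turnstile> Forall q"
     by (rule deriv_generalize) (use y q in \<open>auto simp: Neg_def\<close>)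
    moreover have "insert (Neg p) H \<turnstile> Imp p Bot" by (rule deriv.Hyp) (simp add: Neg_def)
    ultimately show False using c q by (metis ImpE consistent_def)
   qed
   then show ?thesis using False q by (simp add: henkin_step_def y_def)
  next
   case no: False
   then have "henkin_step H p = insert (Neg p) H" using False
    by (auto simp: henkin_step_def split: fm.split)
   then show ?thesis using c by simp
  qed
 qed (simp add: henkin_step_def)
qed

text \<open>The model consists of the variables themselves. Equality is left as a congruence,
  because the quotient can be carried back to \<open>nat\<close> only after it is known to be
  infinite.\<close>

theorem model_existence:
 assumes "consistent T"
 shows "EX (eq :: nat => nat => bool) E v. equivp eq & (ALL x x' y y'. eq x x' --> eq y y' --> E x y = E x' y') &
  (ALL p:T. sat eq E v p)"
proof -
 \<comment> \<open>Moving all free variables to even indices frees the odd ones for witnesses;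
   halving the indices undoes this, so consistency is preserved.\<close>
 define T' where "T' = rename (%n. 2 * n) ` T"
 have "consistent T'"
 proof (rule ccontr)
  assume "~ ?thesis"
  then have "rename (%n. n div 2) ` T' \<turnstile> rename (%n. n div 2) Bot"
   unfolding consistent_def using deriv_rename by blast
  moreover have "rename (%n. n div 2) ` T' = T"
   by (simp add: T'_def image_image rename_rename comp_def flip: id_def) (simp add: rename_id)
  ultimately show False using assms by (simp add: consistent_def)
 qed
 moreover have "roomy T'"
 proof -
  have "range (%n. Suc (2 * n)) <= - (UN h:T'. fv h)"
   by (auto simp: T'_def fv_rename) presburger
  moreover have "infinite (range (%n::nat. Suc (2 * n)))"
   by (rule range_inj_infinite) (auto intro: injI)
  ultimately show ?thesis unfolding roomy_def using finite_subset by blast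
 qed
 ultimately have inv: "consistent (henkin_seq T' n) & roomy (henkin_seq T' n)" for n
  by (induction n) (auto simp: henkin_step_props)
 have mono: "henkin_seq T' m <= henkin_seq T' n" if "m \<le> n" for m n
  using that by (induction rule: dec_induct) (use henkin_step_props(3) inv in auto)
 define H where "H = (\<Union>n. henkin_seq T' n)"
 have con: "consistent H"
 proof (rule ccontr)
  assume "~ ?thesis"
  then obtain F where F: "F <= H" "finite F" "F \<turnstile> Bot" unfolding consistent_def
   using deriv_finite by blast
  have "EX n. F <= henkin_seq T' n" using F(2,1)
  proof (induction F)
   case (insert x F)
   then obtain n m where "F <= henkin_seq T' n" "x : henkin_seq T' m" by (auto simp: H_def)
   then have "insert x F <= henkin_seq T' (max n m)"
    using mono[of n "max n m"] mono[of m "max n m"] by auto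
   then show ?case by blast
  qed simp
  then show False using F(3) inv deriv_mono by (meson consistent_def)
 qed
 have max: "p : H | Neg p : H" for p
 proof -
  have "p : henkin_seq T' (Suc (to_nat p)) | Neg p : henkin_seq T' (Suc (to_nat p))"
   using henkin_step_props(4) inv by simp
  then show ?thesis unfolding H_def by blast
 qed
 have both: "~ (p : H & Neg p : H)" for p
  using con by (metis ImpE Hyp Neg_def consistent_def)
 have closed: "p : H" if "H \<turnstile> p" for p
  using that con max[of p] by (metis ImpE Hyp Neg_def consistent_def)
 have hen: "EX y. Neg (inst y q) : H" if "Forall q ~: H" for q
 proof -
  let ?n = "to_nat (Forall q)"
  have "Forall q ~: henkin_seq T' (Suc ?n)" using that by (auto simp: H_def simp del: henkin_seq.simps)
  then have "EX y. Neg (inst y q) : henkin_seq T' (Suc ?n)"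
   using henkin_step_props(5)[of "henkin_seq T' ?n" "Forall q" q] inv by simp
  then show ?thesis unfolding H_def by blast
 qed
 have neg: "Neg p : H \<longleftrightarrow> p ~: H" for p using max both by blast
 have imp: "Imp p q : H \<longleftrightarrow> (p : H --> q : H)" for p q
 proof
  assume "p : H --> q : H"
  then consider "q : H" | "Neg p : H" using neg by blast
  then show "Imp p q : H"
  proof cases
   case 1 then show ?thesis by (intro closed ImpI Hyp) auto
  next
   case 2
   then have "insert p H \<turnstile> Imp p Bot" "insert p H \<turnstile> p" by (auto intro: Hyp simp: Neg_def)
   then have "insert p H \<turnstile> Bot" by (rule ImpE)
   then have "insert (Neg q) (insert p H) \<turnstile> Bot" by (rule deriv_mono) auto
   then show ?thesis by (intro closed ImpI) (rule Contr)
  qed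
 next
  assume "Imp p q : H" then show "p : H --> q : H" by (meson ImpE Hyp closed)
 qed
 have all: "Forall p : H \<longleftrightarrow> (ALL x. inst x p : H)" for p
  using hen neg by (meson AllE Hyp closed)
 define eq where "eq = (%x y. Equal x y : H)"
 define E where "E = (%x y. Mem x y : H)"
 have sub: "inst y p : H" if "eq x y" "inst x p : H" for x y p
  using closed[OF EqE[OF Hyp[of "Equal x y" H] Hyp[of "inst x p" H]]] that unfolding eq_def by blast
 have refl: "eq x x" for x unfolding eq_def by (intro closed EqI)
 have sym: "eq y x" if "eq x y" for x y
  using sub[OF that, of "Equal 0 (Suc x)"] refl by (simp add: inst_def eq_def)
 have trans: "eq x z" if "eq x y" "eq y z" for x y z
  using sub[OF that(2), of "Equal (Suc x) 0"] that(1) by (simp add: inst_def eq_def)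
 have "equivp eq" by (intro equivpI reflpI sympI transpI) (use refl sym trans in blast)+
 moreover
 { fix x x' y y' assume "eq x x'" "eq y y'" "E x y"
  then have "E x' y" using sub[OF \<open>eq x x'\<close>, of "Mem 0 (Suc y)"] by (simp add: inst_def E_def)
  then have "E x' y'" using sub[OF \<open>eq y y'\<close>, of "Mem (Suc x') 0"] by (simp add: inst_def E_def) }
 then have "ALL x x' y y'. eq x x' --> eq y y' --> E x y = E x' y'" using sym by blast
 moreover have tl: "sat eq E v p \<longleftrightarrow> rename v p : H" for v p
 proof (induction p arbitrary: v)
  case Bot then show ?case using con by (auto simp: consistent_def intro: Hyp)
 next
  case (Forall p)
  have "case_nat x id \<circ> lift v = case_nat x v" for x by (rule ext, case_tac xa) auto
  then show ?case using Forall all[of "rename (lift v) p"] by (simp add: inst_def rename_rename)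
 qed (auto simp: eq_def E_def imp)
 have "ALL p:T. sat eq E (%n. 2 * n) p"
 proof
  fix p assume "p : T"
  then have "rename (%n. 2 * n) p : henkin_seq T' 0" by (auto simp: T'_def)
  then show "sat eq E (%n. 2 * n) p" unfolding tl H_def by blast
 qed
 ultimately show ?thesis by blast
qed

lemma quotient_map:
 fixes eq :: "nat => nat => bool"
 assumes "equivp eq" and "infinite (range (%x. Collect (eq x)))"
 obtains h :: "nat => nat" where "surj h" "!!x y. h x = h y \<longleftrightarrow> eq x y"
proof -
 let ?Q = "range (%x. Collect (eq x))"
 have b: "bij_betw (to_nat_on ?Q) ?Q UNIV" by (rule to_nat_on_infinite) (use assms in auto)
 show ?thesis
 proof (rule that[of "%x. to_nat_on ?Q (Collect (eq x))"])
  show "surj (%x. to_nat_on ?Q (Collect (eq x)))"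
   using b by (auto simp: bij_betw_def image_image)
  fix x y
  have "to_nat_on ?Q (Collect (eq x)) = to_nat_on ?Q (Collect (eq y)) \<longleftrightarrow> Collect (eq x) = Collect (eq y)"
   using b by (auto simp: bij_betw_def inj_on_eq_iff)
  also have "\<dots> \<longleftrightarrow> eq x y" using assms(1) by (metis Collect_cong equivp_def mem_Collect_eq)
  finally show "to_nat_on ?Q (Collect (eq x)) = to_nat_on ?Q (Collect (eq y)) \<longleftrightarrow> eq x y" .
 qed
qed

lemma sat_quotient:
 assumes "surj h" "!!x y. h x = h y \<longleftrightarrow> eq x y" "!!x y. E' (h x) (h y) \<longleftrightarrow> E x y"
 shows "sat (=) E' (%i. h (v i)) p \<longleftrightarrow> sat eq E v p"
proof (induction p arbitrary: v)
 case (Forall p)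
 have "case_nat (h x) (%i. h (v i)) = (%i. h (case_nat x v i))" for x
  by (rule ext) (auto split: nat.split)
 then have "(ALL x. sat (=) E' (case_nat (h x) (%i. h (v i))) p) = (ALL x. sat eq E (case_nat x v) p)"
  by (simp only: Forall)
 moreover have "(ALL y. Q y) = (ALL x. Q (h x))" for Q using assms(1) by (metis surjD)
 ultimately show ?case by simp
qed (use assms in auto)

section \<open>From formulas to HOL statements about a model\<close>

section \<open>Evaluation of formula templates\<close>

definition tenv :: "(nat => 'a) => nat => (nat => 'a) => nat => 'a" where
 "tenv u d \<rho> = (%i. if i < d then \<rho> (d - Suc i) else u (i - d))"

definition tsat :: "('a => 'a => bool) => ('a => 'a => bool) => (nat => 'a) => nat => (nat => 'a) => tmpl => bool" where
 "tsat eq E u d \<rho> F = sat eq E (tenv u d \<rho>) (F d)"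

lemma case_nat_tenv: "case_nat a (tenv u d \<rho>) = tenv u (Suc d) (\<rho>(d := a))"
 by (rule ext) (auto simp: tenv_def split: nat.split)

text \<open>Variables in scope have levels below \<open>d\<close>, so giving a value to the fresh
  level \<open>d\<close> does not affect them. With this rule nested quantifiers are evaluated
  without comparing levels for equality.\<close>

lemma upd_less: "(x::nat) < d ==> (\<rho>(d := a)) x = \<rho> x" by auto

lemma tsat_simps:
 "x < d ==> y < d ==> tsat eq E u d \<rho> (x \<^bold>\<in> y) \<longleftrightarrow> E (\<rho> x) (\<rho> y)"
 "x < d ==> y < d ==> tsat eq E u d \<rho> (x \<^bold>= y) \<longleftrightarrow> eq (\<rho> x) (\<rho> y)"
 "tsat eq E u d \<rho> (\<^bold>\<not> F) \<longleftrightarrow> ~ tsat eq E u d \<rho> F"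
 "tsat eq E u d \<rho> (F \<^bold>\<and> G) \<longleftrightarrow> tsat eq E u d \<rho> F & tsat eq E u d \<rho> G"
 "tsat eq E u d \<rho> (F \<^bold>\<or> G) \<longleftrightarrow> tsat eq E u d \<rho> F | tsat eq E u d \<rho> G"
 "tsat eq E u d \<rho> (F \<^bold>\<longrightarrow> G) \<longleftrightarrow> (tsat eq E u d \<rho> F --> tsat eq E u d \<rho> G)"
 "tsat eq E u d \<rho> (F \<^bold>\<longleftrightarrow> G) \<longleftrightarrow> (tsat eq E u d \<rho> F \<longleftrightarrow> tsat eq E u d \<rho> G)"
 "tsat eq E u d \<rho> (tall H) \<longleftrightarrow> (ALL a. tsat eq E u (Suc d) (\<rho>(d := a)) (H d))"
 "tsat eq E u d \<rho> (tex H) \<longleftrightarrow> (EX a. tsat eq E u (Suc d) (\<rho>(d := a)) (H d))"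
 by (auto simp: tsat_def tmem_def teq_def tnot_def tand_def tor_def timp_def tiff_def tall_def tex_def
   case_nat_tenv) (auto simp: tenv_def)

lemma tsat_plug:
 "(!!i. i : fv p ==> v i < d) ==> tsat eq E u d \<rho> (plug p v) \<longleftrightarrow> sat eq E (%i. \<rho> (v i)) p"
 unfolding tsat_def plug_def sat_rename
proof (rule sat_cong_fv)
 fix i assume "!!i. i : fv p ==> v i < d" "i : fv p"
 then have "v i < d" by blast
 then show "tenv u d \<rho> (d - Suc (v i)) = \<rho> (v i)" by (simp add: tenv_def)
qed

lemma sat_closure: "sat eq E u (closure n F) \<longleftrightarrow> (ALL \<rho>. tsat eq E u n \<rho> F)"
proof -
 have "sat eq E u ((Forall ^^ n) q) \<longleftrightarrow> (ALL \<rho>. sat eq E (tenv u n \<rho>) q)" for q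
 proof (induction n arbitrary: q)
  case 0 show ?case by (simp add: tenv_def)
 next
  case (Suc n)
  have "(ALL \<rho> a. sat eq E (tenv u (Suc n) (\<rho>(n := a))) q) \<longleftrightarrow> (ALL \<rho>. sat eq E (tenv u (Suc n) \<rho>) q)"
   by (metis fun_upd_triv)
  then show ?case using Suc[of "Forall q"] by (simp add: funpow_swap1 case_nat_tenv)
 qed
 then show ?thesis by (simp add: closure_def tsat_def)
qed

lemmas tsat_eval = tsat_simps upd_less fun_upd_same tex1_def

lemma sat_Pairing: "sat eq E u Pairing \<longleftrightarrow> (ALL x y. EX p. ALL z. E z p \<longleftrightarrow> eq z x | eq z y)"
 by (simp add: Pairing_def sat_closure is_upair_def tsat_eval del: fun_upd_apply)

lemma sat_Union: "sat eq E u Union_Axiom \<longleftrightarrow> (ALL x. EX w. ALL z. E z w \<longleftrightarrow> (EX y. E y x & E z y))"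
 by (simp add: Union_Axiom_def sat_closure tsat_eval del: fun_upd_apply)

lemma sat_Separation:
 assumes "fv p <= {..n}"
 shows "sat eq E u (Separation n p) \<longleftrightarrow>
  (ALL \<rho> a. EX b. ALL x. E x b \<longleftrightarrow> E x a & sat eq E (case_nat x \<rho>) p)"
proof -
 have *: "tsat eq E u (Suc (Suc (Suc n))) (\<rho>(n := a, Suc n := b, Suc (Suc n) := x))
  (plug p (case_nat (Suc (Suc n)) id)) \<longleftrightarrow> sat eq E (case_nat x \<rho>) p" for \<rho> a b x
 proof (subst tsat_plug)
  show "case_nat (Suc (Suc n)) id i < Suc (Suc (Suc n))" if "i : fv p" for i
   using that assms by (cases i) auto
  show "sat eq E (%i. (\<rho>(n := a, Suc n := b, Suc (Suc n) := x)) (case_nat (Suc (Suc n)) id i)) p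
   \<longleftrightarrow> sat eq E (case_nat x \<rho>) p"
   by (rule sat_cong_fv, case_tac i) (use assms in auto)
 qed
 show ?thesis
  by (simp add: Separation_def Let_def sat_closure tsat_eval * del: fun_upd_apply)
qed

lemma sat_Replacement:
 assumes "fv p <= {..Suc n}"
 shows "sat (=) E u (Replacement n p) \<longleftrightarrow>
  (ALL \<rho> a. (ALL x. E x a --> (EX! y. sat (=) E (case_nat x (case_nat y \<rho>)) p)) -->
   (EX b. ALL y. E y b \<longleftrightarrow> (EX x. E x a & sat (=) E (case_nat x (case_nat y \<rho>)) p)))"
proof -
 have *: "tsat (=) E u d \<rho>' (plug p (case_nat i (case_nat j id))) \<longleftrightarrow> sat (=) E (case_nat (\<rho>' i) (case_nat (\<rho>' j) \<rho>)) p"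
  if "i < d" "j < d" "n < d" "!!i. i < n ==> \<rho>' i = \<rho> i" for d \<rho>' i j \<rho>
 proof (subst tsat_plug)
  show "case_nat i (case_nat j id) k < d" if "k : fv p" for k
  proof -
   have "k \<le> Suc n" using that assms by auto
   then show ?thesis using \<open>i < d\<close> \<open>j < d\<close> \<open>n < d\<close> by (auto split: nat.split)
  qed
  show "sat (=) E (%k. \<rho>' (case_nat i (case_nat j id) k)) p
   \<longleftrightarrow> sat (=) E (case_nat (\<rho>' i) (case_nat (\<rho>' j) \<rho>)) p"
  proof (rule sat_cong_fv)
   fix k assume "k : fv p"
   then have "k \<le> Suc n" using assms by auto
   then show "\<rho>' (case_nat i (case_nat j id) k) = case_nat (\<rho>' i) (case_nat (\<rho>' j) \<rho>) k"
    using that(4) by (auto split: nat.split)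
  qed
 qed
 show ?thesis
  by (simp add: Replacement_def Let_def sat_closure tsat_simps tex1_def *)
   (simp add: Ex1_def)
qed

text \<open>Were there finitely many classes, some \<open>a\<close> would have elements in the
  largest number of them. The Russell subset \<open>b\<close> of \<open>a\<close> is no element of
  \<open>a\<close>; pairing and union yield a set containing \<open>b\<close> and all elements of
  \<open>a\<close>, which meets one class more.\<close>

lemma infinite_quotient:
 assumes "equivp eq" "ALL x x' y y'. eq x x' --> eq y y' --> E x y = E x' y'" "ALL p:ZFC. sat eq E u p"
 shows "infinite (range (%x. Collect (eq x)))"
proof
 assume fin: "finite (range (%x. Collect (eq x)))"
 let ?c = "%a. (%x. Collect (eq x)) ` {x. E x a}"
 have fc: "finite (?c a)" for a by (rule finite_subset[OF _ fin]) auto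
 have refl: "eq x x" for x using assms(1) by (simp add: equivp_reflp)
 have "card (?c a) \<le> card (range (%x. Collect (eq x)))" for a by (rule card_mono[OF fin]) auto
 then obtain a where amax: "!!b. card (?c b) \<le> card (?c a)"
  using ex_has_greatest_nat[of "%_. True" _ "%a. card (?c a)" "Suc (card (range (%x. Collect (eq x))))"]
  by (metis less_Suc_eq_le)
 have P: "ALL x y. EX p. ALL z. E z p \<longleftrightarrow> eq z x | eq z y"
  using assms(3) sat_Pairing[of eq E u] by (auto simp: ZFC_def)
 have U: "ALL x. EX w. ALL z. E z w \<longleftrightarrow> (EX y. E y x & E z y)"
  using assms(3) sat_Union[of eq E u] by (auto simp: ZFC_def)
 let ?r = "Neg (Mem 0 0)"
 have "Separation 0 ?r : ZFC" by (auto simp: ZFC_def Neg_def intro!: exI[of _ 0] exI[of _ ?r])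
 then have "sat eq E u (Separation 0 ?r)" using assms(3) by blast
 moreover have "fv ?r <= {..0}" by (simp add: Neg_def)
 ultimately have "EX b. ALL x. E x b \<longleftrightarrow> E x a & sat eq E (case_nat x u) ?r"
  using sat_Separation[of ?r 0 eq E u] by blast
 then obtain b where b: "!!x. E x b \<longleftrightarrow> E x a & ~ E x x" by auto
 have nb: "~ E b a" using b by blast
 obtain q where q: "!!z. E z q \<longleftrightarrow> eq z b" using P by metis
 obtain p where p: "!!z. E z p \<longleftrightarrow> eq z a | eq z q" using P by metis
 obtain w where w: "!!z. E z w \<longleftrightarrow> (EX y. E y p & E z y)" using U by metis
 have sub: "E z w" if "E z a | z = b" for z using that w p q refl by blast
 have "Collect (eq b) ~: ?c a"
 proof
  assume "Collect (eq b) : ?c a"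
  then obtain x where "E x a" "Collect (eq b) = Collect (eq x)" by auto
  then show False using nb assms(2) refl by blast
 qed
 moreover have "Collect (eq b) : ?c w" using sub by auto
 moreover have "?c a <= ?c w" using sub by auto
 ultimately have "?c a \<subset> ?c w" by blast
 then have "card (?c a) < card (?c w)" by (rule psubset_card_mono[OF fc])
 then show False using amax[of w] by simp
qed

section \<open>Models of set theory\<close>

text \<open>Choice is kept apart in \<open>zfc\<close>: the extension is first shown to satisfy
  these axioms, and the set theory developed from them is then available inside it for deriving
  choice.\<close>

locale zf =
 fixes E :: "'a => 'a => bool"
 assumes extensionality: "(!!z. E z x \<longleftrightarrow> E z y) ==> x = y"
  and foundation: "E y x ==> EX y. E y x & ~ (EX z. E z x & E z y)"
  and pairing: "EX p. ALL z. E z p \<longleftrightarrow> z = x | z = y"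
  and union: "EX w. ALL z. E z w \<longleftrightarrow> (EX y. E y x & E z y)"
  and power: "EX w. ALL z. E z w \<longleftrightarrow> (ALL t. E t z --> E t x)"
  and infinity: "EX w. (EX x. (ALL z. ~ E z x) & E x w) & (ALL x. E x w --> (EX y. (ALL z. E z y \<longleftrightarrow> E z x | z = x) & E y w))"
  and separation: "EX b. ALL x. E x b \<longleftrightarrow> E x a & sat (=) E (case_nat x v) p"
  and replacement: "(ALL x. E x a --> (EX! y. sat (=) E (case_nat x (case_nat y v)) p)) ==>
   EX b. ALL y. E y b \<longleftrightarrow> (EX x. E x a & sat (=) E (case_nat x (case_nat y v)) p)"

locale zfc = zf +
 assumes choice: "(ALL y. E y x --> (EX u. E u y)) ==> (ALL y z. E y x & E z x & (EX u. E u y & E u z) --> y = z) ==>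
  EX c. ALL y. E y x --> (EX! u. E u y & E u c)"

text \<open>A formula has finitely many free variables, which lie below some \<open>n\<close>; so
  the schema instances with \<open>n\<close> parameters amount to one statement for all formulas and
  all environments.\<close>

lemma sat_ZFC_iff: "(ALL p:ZFC. sat (=) E u p) \<longleftrightarrow> zfc E"
proof -
 have ext: "sat (=) E u Extensionality \<longleftrightarrow> (ALL x y. (ALL z. E z x \<longleftrightarrow> E z y) --> x = y)"
  by (simp add: Extensionality_def sat_closure tsat_eval del: fun_upd_apply)
 have found: "sat (=) E u Foundation \<longleftrightarrow> (ALL x. (EX y. E y x) --> (EX y. E y x & ~ (EX z. E z x & E z y)))"
  by (simp add: Foundation_def sat_closure tsat_eval del: fun_upd_apply)
 have power: "sat (=) E u Power_Set \<longleftrightarrow> (ALL x. EX w. ALL z. E z w \<longleftrightarrow> (ALL t. E t z --> E t x))"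
  by (simp add: Power_Set_def is_subset_def sat_closure tsat_eval del: fun_upd_apply)
 have infinity: "sat (=) E u Infinity \<longleftrightarrow>
  (EX w. (EX x. (ALL z. ~ E z x) & E x w) & (ALL x. E x w --> (EX y. (ALL z. E z y \<longleftrightarrow> E z x | z = x) & E y w)))"
  by (simp add: Infinity_def is_inductive_def is_empty_def is_succ_def sat_closure tsat_eval del: fun_upd_apply)
 have choice: "sat (=) E u Choice \<longleftrightarrow> (ALL x. (ALL y. E y x --> (EX u. E u y)) &
   (ALL y z. E y x & E z x & (EX u. E u y & E u z) --> y = z) --> (EX c. ALL y. E y x --> (EX! u. E u y & E u c)))"
  by (simp add: Choice_def sat_closure tsat_eval Ex1_def del: fun_upd_apply)
 have sep: "(ALL n p. fv p <= {..n} --> sat (=) E u (Separation n p)) \<longleftrightarrow>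
  (ALL p v a. EX b. ALL x. E x b \<longleftrightarrow> E x a & sat (=) E (case_nat x v) p)" (is "?L \<longleftrightarrow> ?R")
 proof
  assume *: ?L
  show ?R
  proof (intro allI)
   fix p v a
   obtain n where n: "fv p <= {..n}" using finite_fv[of p] by (meson finite_nat_iff_bounded_le)
   show "EX b. ALL x. E x b \<longleftrightarrow> E x a & sat (=) E (case_nat x v) p"
    using *[rule_format, OF n] unfolding sat_Separation[OF n] by blast
  qed
 next
  assume ?R then show ?L using sat_Separation[of _ _ "(=)" E u] by simp
 qed
 have rep: "(ALL n p. fv p <= {..Suc n} --> sat (=) E u (Replacement n p)) \<longleftrightarrow>
  (ALL p v a. (ALL x. E x a --> (EX! y. sat (=) E (case_nat x (case_nat y v)) p)) -->
   (EX b. ALL y. E y b \<longleftrightarrow> (EX x. E x a & sat (=) E (case_nat x (case_nat y v)) p)))"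
  (is "?L \<longleftrightarrow> ?R")
 proof
  assume *: ?L
  show ?R
  proof (intro allI)
   fix p v a
   obtain n where "fv p <= {..n}" using finite_fv[of p] by (meson finite_nat_iff_bounded_le)
   then have n: "fv p <= {..Suc n}" by auto
   show "(ALL x. E x a --> (EX! y. sat (=) E (case_nat x (case_nat y v)) p)) -->
   (EX b. ALL y. E y b \<longleftrightarrow> (EX x. E x a & sat (=) E (case_nat x (case_nat y v)) p))"
    using *[rule_format, OF n] unfolding sat_Replacement[OF n] by blast
  qed
 next
  assume ?R then show ?L using sat_Replacement[of _ _ E u] by simp
 qed
 have "(ALL p:ZFC. sat (=) E u p) \<longleftrightarrow> sat (=) E u Extensionality & sat (=) E u Foundation &
  sat (=) E u Pairing & sat (=) E u Union_Axiom & sat (=) E u Power_Set & sat (=) E u Infinity & sat (=) E u Choice &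
  (ALL n p. fv p <= {..n} --> sat (=) E u (Separation n p)) &
  (ALL n p. fv p <= {..Suc n} --> sat (=) E u (Replacement n p))" unfolding ZFC_def by blast
 also have "\<dots> \<longleftrightarrow> zfc E"
  unfolding sep rep ext found power infinity choice sat_Pairing sat_Union
 proof (rule iffI, elim conjE)
  assume 1: "ALL x y. (ALL z. E z x \<longleftrightarrow> E z y) --> x = y"
   and 2: "ALL x. (EX y. E y x) --> (EX y. E y x & ~ (EX z. E z x & E z y))"
   and 3: "ALL x y. EX p. ALL z. E z p \<longleftrightarrow> z = x | z = y"
   and 4: "ALL x. EX w. ALL z. E z w \<longleftrightarrow> (EX y. E y x & E z y)"
   and 5: "ALL x. EX w. ALL z. E z w \<longleftrightarrow> (ALL t. E t z --> E t x)"
   and 6: "EX w. (EX x. (ALL z. ~ E z x) & E x w) & (ALL x. E x w --> (EX y. (ALL z. E z y \<longleftrightarrow> E z x | z = x) & E y w))"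
   and 7: "ALL x. (ALL y. E y x --> (EX u. E u y)) & (ALL y z. E y x & E z x & (EX u. E u y & E u z) --> y = z) -->
    (EX c. ALL y. E y x --> (EX! u. E u y & E u c))"
   and 8: "ALL p v a. EX b. ALL x. E x b \<longleftrightarrow> E x a & sat (=) E (case_nat x v) p"
   and 9: "ALL p v a. (ALL x. E x a --> (EX! y. sat (=) E (case_nat x (case_nat y v)) p)) -->
    (EX b. ALL y. E y b \<longleftrightarrow> (EX x. E x a & sat (=) E (case_nat x (case_nat y v)) p))"
  show "zfc E"
  proof
   show "x = y" if "!!z. E z x \<longleftrightarrow> E z y" for x y using 1 that by blast
   show "EX y. E y x & ~ (EX z. E z x & E z y)" if "E y x" for x y using 2 that by blast
   show "EX c. ALL y. E y x --> (EX! u. E u y & E u c)"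
    if "ALL y. E y x --> (EX u. E u y)" "ALL y z. E y x & E z x & (EX u. E u y & E u z) --> y = z" for x
    using 7[rule_format, of x] that by blast
  qed (simp_all only: 3 4 5 6 8 9[rule_format])
 next
  assume "zfc E"
  then interpret zfc E .
  show "(ALL x y. (ALL z. E z x \<longleftrightarrow> E z y) --> x = y) &
   (ALL x. (EX y. E y x) --> (EX y. E y x & ~ (EX z. E z x & E z y))) &
   (ALL x y. EX p. ALL z. E z p \<longleftrightarrow> z = x | z = y) &
   (ALL x. EX w. ALL z. E z w \<longleftrightarrow> (EX y. E y x & E z y)) &
   (ALL x. EX w. ALL z. E z w \<longleftrightarrow> (ALL t. E t z --> E t x)) &
   (EX w. (EX x. (ALL z. ~ E z x) & E x w) & (ALL x. E x w --> (EX y. (ALL z. E z y \<longleftrightarrow> E z x | z = x) & E y w))) &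
   (ALL x. (ALL y. E y x --> (EX u. E u y)) & (ALL y z. E y x & E z x & (EX u. E u y & E u z) --> y = z) -->
    (EX c. ALL y. E y x --> (EX! u. E u y & E u c))) &
   (ALL p v a. EX b. ALL x. E x b \<longleftrightarrow> E x a & sat (=) E (case_nat x v) p) &
   (ALL p v a. (ALL x. E x a --> (EX! y. sat (=) E (case_nat x (case_nat y v)) p)) -->
    (EX b. ALL y. E y b \<longleftrightarrow> (EX x. E x a & sat (=) E (case_nat x (case_nat y v)) p)))"
   by (intro conjI allI impI; (elim conjE exE)?;
     (rule extensionality foundation pairing union power infinity choice separation replacement; blast?))
 qed
 finally show ?thesis .
qed

section \<open>Definable notions and elementary set theory inside a model\<close>

section \<open>Definability in a model\<close>

named_theorems dfns

context zf
begin

text \<open>Even variables range over the environment, odd ones over the parameters of the formula.\<close>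

definition mixenv :: "(nat => 'a) => (nat => 'a) => nat => 'a" where
 "mixenv v w = (%i. if even i then v (i div 2) else w (i div 2))"

text \<open>Definability with parameters, as a property of HOL predicates on environments. This is
  what Separation and Replacement ask of a predicate. It is proved by following the structure of the
  HOL term with the rules \<open>dfns\<close>, which takes the place of writing object formulas. For
  an operation, \<open>dt\<close> asks that its graph be definable, with the value at index
  0.\<close>

definition dfn :: "((nat => 'a) => bool) => bool" where
 "dfn Q \<longleftrightarrow> (EX p w. ALL v. Q v \<longleftrightarrow> sat (=) E (mixenv v w) p)"

definition dt :: "((nat => 'a) => 'a) => bool" where
 "dt t \<longleftrightarrow> dfn (%v. v 0 = t (%i. v (Suc i)))"

lemma dfn_mem0: "dfn (%v. E (v i) (v j))"
 unfolding dfn_def by (intro exI[of _ "Mem (2 * i) (2 * j)"]) (simp add: mixenv_def)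

lemma dfn_eq0: "dfn (%v. v i = v j)"
 unfolding dfn_def by (intro exI[of _ "Equal (2 * i) (2 * j)"]) (simp add: mixenv_def)

lemma dfn_imp [dfns]: assumes "dfn P" "dfn Q" shows "dfn (%v. P v --> Q v)"
proof -
 obtain p w where p: "!!v. P v \<longleftrightarrow> sat (=) E (mixenv v w) p" using assms(1) by (auto simp: dfn_def)
 obtain q x where q: "!!v. Q v \<longleftrightarrow> sat (=) E (mixenv v x) q" using assms(2) by (auto simp: dfn_def)
 \<comment> \<open>The parameters of the two formulas are interleaved: those of \<open>p\<close> go
   to the indices 1 modulo 4, those of \<open>q\<close> to the indices 3 modulo 4.\<close>
 let ?r = "%i. if even i then i else 4 * (i div 2) + 1" and ?s = "%i. if even i then i else 2 * (2 * (i div 2) + 1) + 1"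
 have "P v = sat (=) E (mixenv v (mixenv w x)) (rename ?r p)" for v
  unfolding p sat_rename by (rule arg_cong[where f="%e. sat (=) E e p"]) (rule ext, auto simp: mixenv_def elim!: oddE)
 moreover have "Q v = sat (=) E (mixenv v (mixenv w x)) (rename ?s q)" for v
  unfolding q sat_rename by (rule arg_cong[where f="%e. sat (=) E e q"]) (rule ext, auto simp: mixenv_def elim!: oddE)
 ultimately show ?thesis unfolding dfn_def
  by (intro exI[of _ "Imp (rename ?r p) (rename ?s q)"] exI[of _ "mixenv w x"]) simp
qed

lemma dfn_ren: assumes "dfn Q" shows "dfn (%v. Q (%i. v (f i)))"
proof -
 obtain p w where p: "!!v. Q v \<longleftrightarrow> sat (=) E (mixenv v w) p" using assms by (auto simp: dfn_def)
 have "Q (%i. v (f i)) = sat (=) E (mixenv v w) (rename (%i. if even i then 2 * f (i div 2) else i) p)" for v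
  unfolding p sat_rename by (rule arg_cong[where f="%e. sat (=) E e p"]) (rule ext, simp add: mixenv_def)
 then show ?thesis unfolding dfn_def by blast
qed

lemma dfn_all [dfns]: assumes "dfn (%v. Q (v 0) (%i. v (Suc i)))" shows "dfn (%v. ALL x. Q x v)"
proof -
 obtain p w where p: "!!v. Q (v 0) (%i. v (Suc i)) \<longleftrightarrow> sat (=) E (mixenv v w) p"
  using assms by (auto simp: dfn_def)
 \<comment> \<open>\<open>Forall\<close> prepends a value and so shifts every index by one, which
   would exchange even and odd; the renaming puts each entry back on the side where it
   belongs.\<close>
 let ?r = "%i. if i = 0 then 0 else if even i then i - 1 else i + 1"
 have "Q x v \<longleftrightarrow> sat (=) E (case_nat x (mixenv v w)) (rename ?r p)" for x v
 proof -
  have "Q x v \<longleftrightarrow> sat (=) E (mixenv (case_nat x v) w) p" using p[of "case_nat x v"] by simp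
  also have "mixenv (case_nat x v) w = (%i. case_nat x (mixenv v w) (?r i))"
  proof
   fix i
   consider "i = 0" | k where "i = 2 * Suc k" | k where "i = 2 * k + 1"
    by (metis evenE oddE not0_implies_Suc mult_0_right)
   then show "mixenv (case_nat x v) w i = case_nat x (mixenv v w) (?r i)"
    by cases (auto simp: mixenv_def)
  qed
  finally show ?thesis by (simp add: sat_rename)
 qed
 then show ?thesis unfolding dfn_def by (intro exI[of _ "Forall (rename ?r p)"] exI[of _ w]) simp
qed

lemma dfn_const [dfns]: "dfn (%v. c)"
proof (cases c)
 case True then show ?thesis using dfn_eq0[of 0 0] by simp
next
 case False then show ?thesis unfolding dfn_def by (intro exI[of _ Bot]) simp
qed

lemma dfn_not [dfns]: "dfn P ==> dfn (%v. ~ P v)"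
 using dfn_imp[OF _ dfn_const[of False]] by simp

lemma dfn_and [dfns]: "dfn P ==> dfn Q ==> dfn (%v. P v & Q v)"
 using dfn_not[OF dfn_imp[OF _ dfn_not]] by simp

lemma dfn_or [dfns]: "dfn P ==> dfn Q ==> dfn (%v. P v | Q v)"
 using dfn_imp[OF dfn_not] by (simp add: imp_conv_disj)

lemma dfn_iff [dfns]: "dfn P ==> dfn Q ==> dfn (%v. P v = Q v)"
 using dfn_and[OF dfn_imp dfn_imp, of P Q Q P] by (simp add: iff_conv_conj_imp)

lemma dfn_ex [dfns]: "dfn (%v. Q (v 0) (%i. v (Suc i))) ==> dfn (%v. EX x. Q x v)"
 using dfn_not[OF dfn_all[OF dfn_not], of Q] by simp

lemma dt_proj [dfns]: "dt (%v. v i)"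
 unfolding dt_def using dfn_eq0[of 0 "Suc i"] by simp

lemma dt_const [dfns]: "dt (%v. c)"
 unfolding dt_def dfn_def by (intro exI[of _ "Equal 0 1"] exI[of _ "%_. c"]) (simp add: mixenv_def)

lemma dfn_comp1:
 assumes "dfn (%v. P (v 0))" "dt t" shows "dfn (%v. P (t v))"
proof -
 have "dfn (%v. EX x. x = t v & P x)"
  by (rule dfn_ex, rule dfn_and) (use assms in \<open>simp_all add: dt_def\<close>)
 then show ?thesis by simp
qed

lemma dt_shift: "dt t ==> dt (%v. t (%i. v (Suc i)))"
 unfolding dt_def using dfn_ren[where f="case_nat 0 (%i. Suc (Suc i))"] by force

lemma dfn_comp2:
 assumes "dfn (%v. P (v 0) (v 1))" "dt t" "dt u" shows "dfn (%v. P (t v) (u v))"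
proof -
 have 1: "dfn (%v. v 0 = u (%i. v (Suc (Suc i))))" using dt_shift[OF assms(3)] by (simp add: dt_def)
 have 2: "dfn (%v. P (v 1) (v 0))"
  using dfn_ren[OF assms(1), of "%i. if i = 0 then 1 else 0"] by simp
 have "dfn (%v. EX x. x = t v & (EX y. y = u v & P x y))"
  by (rule dfn_ex, rule dfn_and, use assms(2) in \<open>simp add: dt_def\<close>, rule dfn_ex, rule dfn_and)
   (use 1 2 in simp_all)
 then show ?thesis by simp
qed

lemma dfn_comp3:
 assumes "dfn (%v. P (v 0) (v 1) (v 2))" "dt t" "dt u" "dt w" shows "dfn (%v. P (t v) (u v) (w v))"
proof -
 have 1: "dfn (%v. v 0 = u (%i. v (Suc (Suc i))))" using dt_shift[OF assms(3)] by (simp add: dt_def)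
 have 2: "dfn (%v. v 0 = w (%i. v (Suc (Suc (Suc i)))))"
  using dt_shift[OF dt_shift[OF assms(4)]] by (simp add: dt_def)
 have 3: "dfn (%v. P (v 2) (v 1) (v 0))"
  using dfn_ren[OF assms(1), of "%i. if i = 0 then 2 else if i = 1 then 1 else 0"] by simp
 have "dfn (%v. EX x. x = t v & (EX y. y = u v & (EX z. z = w v & P x y z)))"
  by (rule dfn_ex, rule dfn_and, use assms(2) in \<open>simp add: dt_def\<close>, rule dfn_ex, rule dfn_and,
    use 1 in simp, rule dfn_ex, rule dfn_and)
   (use 2 3 in \<open>simp_all add: numeral_2_eq_2\<close>)
 then show ?thesis by simp
qed

lemma dt_comp1: "dt (%v. f (v 0)) ==> dt t ==> dt (%v. f (t v))"
 unfolding dt_def[of "%v. f (t v)"]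
 by (rule dfn_comp2[where P="%y x. y = f x"]) (simp_all add: dt_def dt_shift[unfolded dt_def] dfns[unfolded dt_def])

lemma dt_comp2: "dt (%v. f (v 0) (v 1)) ==> dt t ==> dt u ==> dt (%v. f (t v) (u v))"
 unfolding dt_def[of "%v. f (t v) (u v)"]
 by (rule dfn_comp3[where P="%y x z. y = f x z"])
  (simp_all add: dt_def dt_shift[unfolded dt_def] dfns[unfolded dt_def] numeral_2_eq_2)

lemma dfn_eq [dfns]: "dt t ==> dt u ==> dfn (%v. t v = u v)"
 by (rule dfn_comp2[where P="(=)"]) (use dfn_eq0[of 0 1] in auto)

lemma dfn_mem: "dt t ==> dt u ==> dfn (%v. E (t v) (u v))"
 by (rule dfn_comp2[where P=E]) (use dfn_mem0[of 0 1] in auto)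

lemma dt_if [dfns]: "dfn P ==> dt t ==> dt u ==> dt (%v. if P v then t v else u v)"
proof -
 assume a: "dfn P" "dt t" "dt u"
 have "dfn (%v. (P (%i. v (Suc i)) --> v 0 = t (%i. v (Suc i))) & (~ P (%i. v (Suc i)) --> v 0 = u (%i. v (Suc i))))"
  by (intro dfn_and dfn_imp dfn_not dfn_ren[OF a(1), of Suc])
   (use a in \<open>simp_all add: dt_def\<close>)
 then show ?thesis unfolding dt_def by (rule back_subst[of dfn]) auto
qed

section \<open>Sets of a model as sets of the metatheory\<close>

text \<open>\<open>el\<close> turns a set of the model into a set of HOL, \<open>S\<close> singles
  out the HOL sets arising in this way, and \<open>mk\<close> goes back. Operations are thus written
  in HOL notation, and what remains is to show that the results are sets of the model.\<close>

definition el :: "'a => 'a set" where "el a = {x. E x a}"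
definition S :: "'a set => bool" where "S X \<longleftrightarrow> (EX a. el a = X)"
definition mk :: "'a set => 'a" where "mk X = (THE a. el a = X)"

lemma el_inject [simp]: "el a = el b \<longleftrightarrow> a = b"
 using extensionality[of a b] by (auto simp: el_def)

lemma mk_el [simp]: "mk (el a) = a" by (simp add: mk_def)

lemma el_mk: "S X ==> el (mk X) = X" by (auto simp: S_def)

lemma S_el [simp]: "S (el a)" by (auto simp: S_def)

lemma mk_eq_iff: "S X ==> mk X = a \<longleftrightarrow> X = el a" by (auto simp: S_def)

lemma dfn_el [dfns]: "dt t ==> dt u ==> dfn (%v. t v : el (u v))"
 unfolding el_def mem_Collect_eq by (rule dfn_mem)

lemma dfn_ball [dfns]: "dt t ==> dfn (%v. Q (v 0) (%i. v (Suc i))) ==> dfn (%v. ALL x:el (t v). Q x v)"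
 unfolding Ball_def by (rule dfn_all, rule dfn_imp, rule dfn_el, rule dt_proj, rule dt_shift)

lemma dfn_bex [dfns]: "dt t ==> dfn (%v. Q (v 0) (%i. v (Suc i))) ==> dfn (%v. EX x:el (t v). Q x v)"
 unfolding Bex_def by (rule dfn_ex, rule dfn_and, rule dfn_el, rule dt_proj, rule dt_shift)

lemma dfn_sub [dfns]: "dt t ==> dt u ==> dfn (%v. el (t v) <= el (u v))"
 unfolding subset_iff by (intro dfns dt_shift)

lemma S_sub:
 assumes "S X" "Y <= X" "dfn (%v. v 0 : Y)"
 shows "S Y"
proof -
 obtain a where a: "el a = X" using assms(1) by (auto simp: S_def)
 obtain p w where p: "!!v. v 0 : Y \<longleftrightarrow> sat (=) E (mixenv v w) p" using assms(3) by (auto simp: dfn_def)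
 have "x : Y \<longleftrightarrow> sat (=) E (case_nat x (%i. w (i div 2))) p'" if "p' = rename (%i. if odd i then i else 0) p" for x p'
 proof -
  have "(%i. case_nat x (%i. w (i div 2)) (if odd i then i else 0)) = mixenv (%_. x) w"
  proof
   fix i show "case_nat x (%i. w (i div 2)) (if odd i then i else 0) = mixenv (%_. x) w i"
    by (cases "even i") (auto simp: mixenv_def elim: oddE)
  qed
  then show ?thesis using p[of "%_. x"] that by (simp add: sat_rename)
 qed
 then have "EX b. ALL x. E x b \<longleftrightarrow> E x a & x : Y"
  using separation[of a "%i. w (i div 2)" "rename (%i. if odd i then i else 0) p"] by simp
 then obtain b where "!!x. E x b \<longleftrightarrow> E x a & x : Y" by blast
 then have "el b = Y" using a assms(2) by (auto simp: el_def)
 then show ?thesis by (auto simp: S_def)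
qed

lemma S_img:
 assumes "S X" "dt (%v. F (v 0))" shows "S (F ` X)"
proof -
 obtain a where a: "el a = X" using assms(1) by (auto simp: S_def)
 have "dfn (%v. v 1 = F (v 0))"
  by (intro dfn_eq assms dfns)
 then obtain p w where p: "!!v. v 1 = F (v 0) \<longleftrightarrow> sat (=) E (mixenv v w) p" by (auto simp: dfn_def)
 let ?r = "%i. if odd i then Suc i else if i = 0 then 0 else 1"
 have q: "y = F x \<longleftrightarrow> sat (=) E (case_nat x (case_nat y (%i. w (i div 2)))) (rename ?r p)" for x y
 proof -
  have "(%i. case_nat x (case_nat y (%i. w (i div 2))) (?r i)) = mixenv (case_nat x (%_. y)) w"
  proof
   fix i
   consider "i = 0" | k where "i = 2 * Suc k" | k where "i = 2 * k + 1"
    by (metis evenE oddE not0_implies_Suc mult_0_right)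
   then show "case_nat x (case_nat y (%i. w (i div 2))) (?r i) = mixenv (case_nat x (%_. y)) w i"
    by cases (auto simp: mixenv_def)
  qed
  then show ?thesis using p[of "case_nat x (%_. y)"] by (simp add: sat_rename)
 qed
 have "EX b. ALL y. E y b \<longleftrightarrow> (EX x. E x a & sat (=) E (case_nat x (case_nat y (%i. w (i div 2)))) (rename ?r p))"
  by (rule replacement) (simp flip: q)
 then obtain b where "!!y. E y b \<longleftrightarrow> (EX x. E x a & y = F x)" unfolding q[symmetric] by blast
 then have "el b = F ` X" using a by (auto simp: el_def)
 then show ?thesis by (auto simp: S_def)
qed

lemma dt_mk: "(!!v. S (X v)) ==> dfn (%v. v 0 : X (%i. v (Suc i))) ==> dt (%v. mk (X v))"
proof -
 assume S: "!!v. S (X v)" and d: "dfn (%v. v 0 : X (%i. v (Suc i)))"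
 have "dfn (%v. ALL z. z : el (v 0) \<longleftrightarrow> z : X (%i. v (Suc i)))"
  by (intro dfns, use dfn_ren[OF d, of "%i. if i = 0 then 0 else Suc i"] in simp)
 moreover have "y = mk (X v) \<longleftrightarrow> (ALL z. z : el y \<longleftrightarrow> z : X v)" for y v
  using mk_eq_iff[OF S, of v y] by auto
 ultimately show ?thesis unfolding dt_def by simp
qed

end

context zf
begin

section \<open>Basic set operations\<close>

lemma dfn_fix:
 assumes "dfn Q" shows "dfn (%u. Q (%i. if i < k then u i else c i))"
proof -
 obtain p w where p: "!!v. Q v \<longleftrightarrow> sat (=) E (mixenv v w) p" using assms by (auto simp: dfn_def)
 let ?r = "%i. if even i then (if i div 2 < k then i else 2 * (2 * (i div 2)) + 1) else 2 * (2 * (i div 2) + 1) + 1"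
 have "Q (%i. if i < k then u i else c i) = sat (=) E (mixenv u (mixenv c w)) (rename ?r p)" for u
  unfolding p sat_rename
  by (rule arg_cong[where f="%e. sat (=) E e p"]) (rule ext, auto simp: mixenv_def elim!: oddE)
 then show ?thesis unfolding dfn_def by blast
qed

lemma dt_fix: "dt (%v. F (v 0) (%i. v (Suc i))) ==> dt (%u. F (u 0) v)"
proof -
 assume "dt (%v. F (v 0) (%i. v (Suc i)))"
 then have "dfn (%v. v 0 = F (v 1) (%i. v (Suc (Suc i))))" by (simp add: dt_def)
 from dfn_fix[OF this, of 2 "%i. v (i - 2)"] show ?thesis by (simp add: dt_def)
qed

lemma dfn_S: "S X ==> dt t ==> dfn (%v. t v : X)"
 by (auto simp: S_def intro: dfns)

lemma dfn_Collect [dfns]: "dfn (%v. Q (t v) v) ==> dfn (%v. t v : {x. Q x v})" by simp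
lemma dfn_insert [dfns]: "dt t ==> dt u ==> dfn (%v. t v : X v) ==> dfn (%v. t v : insert (u v) (X v))"
 unfolding insert_iff by (intro dfns)
lemma dfn_empty [dfns]: "dfn (%v. t v : {})" unfolding empty_iff by (intro dfns)
lemma dfn_Un [dfns]: "dfn (%v. t v : X v) ==> dfn (%v. t v : Y v) ==> dfn (%v. t v : X v \<union> Y v)"
 unfolding Un_iff by (intro dfns)
lemma dfn_Int [dfns]: "dfn (%v. t v : X v) ==> dfn (%v. t v : Y v) ==> dfn (%v. t v : X v \<inter> Y v)"
 unfolding Int_iff by (intro dfns)
lemma dfn_Diff [dfns]: "dfn (%v. t v : X v) ==> dfn (%v. t v : Y v) ==> dfn (%v. t v : X v - Y v)"
 unfolding Diff_iff by (intro dfns)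

lemma S_empty [simp]: "S {}" by (rule S_sub[OF S_el]) (auto intro: dfns)

lemma S_Collect: "S X ==> dfn (%v. Q (v 0)) ==> S {x : X. Q x}"
 by (rule S_sub, assumption) (auto intro!: dfns dfn_S)

lemma S_pair: "S {a, b}"
proof -
 obtain p where "!!z. E z p \<longleftrightarrow> z = a | z = b" using pairing by blast
 then have "el p = {a, b}" by (auto simp: el_def)
 then show ?thesis by (auto simp: S_def)
qed

lemma S_single [simp]: "S {a}" using S_pair[of a a] by simp

lemma S_Union: "S X ==> S (UN x:X. el x)"
proof -
 assume "S X"
 then obtain a where a: "X = el a" by (auto simp: S_def)
 obtain w where "!!z. E z w \<longleftrightarrow> (EX y. E y a & E z y)" using union by blast
 then have "el w = (UN x:X. el x)" by (auto simp: el_def a)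
 then show ?thesis by (auto simp: S_def)
qed

lemma S_UN: "S X ==> dt (%v. F (v 0)) ==> S (UN x:X. el (F x))"
 using S_Union[OF S_img, of X F] by simp

lemma S_Un [intro]: "S X ==> S Y ==> S (X \<union> Y)"
proof -
 assume "S X" "S Y"
 then obtain a b where "X = el a" "Y = el b" by (auto simp: S_def)
 then show ?thesis using S_Union[OF S_pair[of a b]] by simp
qed

lemma S_insert [simp]: "S X ==> S (insert a X)"
 using S_Un[OF S_single] by simp

lemma S_Diff: "S X ==> S Y ==> S (X - Y)"
 by (rule S_sub, assumption) (auto intro!: dfns dfn_S)

lemma S_Int: "S X ==> S Y ==> S (X \<inter> Y)"
 by (rule S_sub, assumption) (auto intro!: dfns dfn_S)

lemma S_Pow: "S {x. el x <= el a}"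
proof -
 obtain w where "!!z. E z w \<longleftrightarrow> (ALL t. E t z --> E t a)" using power by blast
 then have "el w = {x. el x <= el a}" by (auto simp: el_def)
 then show ?thesis by (auto simp: S_def)
qed

definition emp :: 'a where "emp = mk {}"
definition up :: "'a => 'a => 'a" where "up a b = mk {a, b}"
definition pr :: "'a => 'a => 'a" where "pr a b = up (up a a) (up a b)"
definition un :: "'a => 'a" where "un a = mk (UN x:el a. el x)"
definition un2 :: "'a => 'a => 'a" where "un2 a b = mk (el a \<union> el b)"
definition df :: "'a => 'a => 'a" where "df a b = mk (el a - el b)"
definition ins :: "'a => 'a => 'a" where "ins x a = mk (insert x (el a))"
definition pw :: "'a => 'a" where "pw a = mk {x. el x <= el a}"

lemma el_emp [simp]: "el emp = {}" by (simp add: emp_def el_mk)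
lemma el_up [simp]: "el (up a b) = {a, b}" by (simp add: up_def el_mk)
lemma el_un [simp]: "el (un a) = (UN x:el a. el x)" by (simp add: un_def el_mk S_Union)
lemma el_un2 [simp]: "el (un2 a b) = el a \<union> el b" by (simp add: un2_def el_mk S_Un)
lemma el_df [simp]: "el (df a b) = el a - el b" by (simp add: df_def el_mk S_Diff)
lemma el_ins [simp]: "el (ins x a) = insert x (el a)" by (simp add: ins_def el_mk)
lemma el_pw [simp]: "el (pw a) = {x. el x <= el a}" by (simp add: pw_def el_mk S_Pow)

lemma eqI: "el a = el b ==> a = b" by simp

lemma up_eq_iff: "up a b = up c d \<longleftrightarrow> (a = c & b = d) | (a = d & b = c)"
 using el_inject[of "up a b" "up c d"] by (simp add: doubleton_eq_iff)

lemma pr_inject [simp]: "pr a b = pr c d \<longleftrightarrow> a = c & b = d"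
 unfolding pr_def up_eq_iff by auto

lemma dt_up [dfns]: "dt t ==> dt u ==> dt (%v. up (t v) (u v))"
 by (rule dt_comp2[where f=up, rotated], assumption+, unfold up_def, rule dt_mk, simp, intro dfns)
lemma dt_pr [dfns]: "dt t ==> dt u ==> dt (%v. pr (t v) (u v))"
 unfolding pr_def by (intro dfns)
lemma dfn_UN [dfns]: "dt u ==> dfn (%v. t (%i. v (Suc i)) : X (v 0) (%i. v (Suc i))) ==>
 dfn (%v. t v : (UN x:el (u v). X x v))"
 unfolding UN_iff by (intro dfns)
lemma dt_un [dfns]: "dt t ==> dt (%v. un (t v))"
 by (rule dt_comp1[where f=un, rotated], assumption+, unfold un_def, rule dt_mk, simp add: S_Union, intro dfns)
lemma dt_un2 [dfns]: "dt t ==> dt u ==> dt (%v. un2 (t v) (u v))"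
 by (rule dt_comp2[where f=un2, rotated], assumption+, unfold un2_def, rule dt_mk, simp add: S_Un, intro dfns)
lemma dt_df [dfns]: "dt t ==> dt u ==> dt (%v. df (t v) (u v))"
 by (rule dt_comp2[where f=df, rotated], assumption+, unfold df_def, rule dt_mk, simp add: S_Diff, intro dfns)
lemma dt_ins [dfns]: "dt t ==> dt u ==> dt (%v. ins (t v) (u v))"
 by (rule dt_comp2[where f=ins, rotated], assumption+, unfold ins_def, rule dt_mk, simp, intro dfns)
lemma dt_pw [dfns]: "dt t ==> dt (%v. pw (t v))"
 by (rule dt_comp1[where f=pw, rotated], assumption+, unfold pw_def, rule dt_mk, simp add: S_Pow, intro dfns)

definition tms :: "'a => 'a => 'a" where "tms A B = mk {z. EX x:el A. EX y:el B. z = pr x y}"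

lemma S_tms: "S {z. EX x:el A. EX y:el B. z = pr x y}"
proof -
 have i: "S ((%y. pr x y) ` el B)" for x by (rule S_img) (auto intro: dfns)
 have d: "dt (%v. mk ((%y. pr (v 0) y) ` el B))"
  by (rule dt_mk, rule i) (unfold image_iff, intro dfns)
 have "S (UN x:el A. el (mk ((%y. pr x y) ` el B)))" by (rule S_UN[OF S_el d])
 also have "(UN x:el A. el (mk ((%y. pr x y) ` el B))) = {z. EX x:el A. EX y:el B. z = pr x y}"
  by (auto simp: el_mk[OF i])
 finally show ?thesis .
qed

lemma el_tms [simp]: "el (tms A B) = {z. EX x:el A. EX y:el B. z = pr x y}" by (simp add: tms_def el_mk S_tms)

lemma dt_tms [dfns]: "dt t ==> dt u ==> dt (%v. tms (t v) (u v))"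
 by (rule dt_comp2[where f=tms, rotated], assumption+, unfold tms_def, rule dt_mk, rule S_tms, intro dfns)

definition lam :: "'a => ('a => 'a) => 'a" where "lam A F = mk {z. EX x:el A. z = pr x (F x)}"
text \<open>The union of all \<open>y\<close> with \<open>pr x y\<close> in \<open>f\<close> is a
  set whatever \<open>f\<close> is, so application is total; if there is exactly one such
  \<open>y\<close>, the union is \<open>y\<close> itself.\<close>

definition ap :: "'a => 'a => 'a" where "ap f x = mk {z. EX y. pr x y : el f & z : el y}"
text \<open>The equation \<open>f = lam A (ap f)\<close> says at once that \<open>f\<close> consists
  of pairs, has domain \<open>A\<close> and is single-valued.\<close>

definition isf :: "'a => 'a => 'a => bool" where
 "isf f A B \<longleftrightarrow> f = lam A (ap f) & (ALL x:el A. ap f x : el B)"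

lemma S_lam: "dt (%v. F (v 0)) ==> S {z. EX x:el A. z = pr x (F x)}"
proof -
 assume "dt (%v. F (v 0))"
 then have "S ((%x. pr x (F x)) ` el A)" by (intro S_img S_el dfns)
 also have "(%x. pr x (F x)) ` el A = {z. EX x:el A. z = pr x (F x)}" by auto
 finally show ?thesis .
qed

lemma el_lam: "dt (%v. F (v 0)) ==> el (lam A F) = {z. EX x:el A. z = pr x (F x)}"
 by (simp add: lam_def el_mk S_lam)

lemma dt_lam [dfns]:
 assumes "dt t" "dt (%v. F (v 0) (%i. v (Suc i)))" shows "dt (%v. lam (t v) (%x. F x v))"
proof -
 have 1: "dt (%v. F (v 0) (%i. v (Suc (Suc i))))"
  unfolding dt_def using dfn_ren[OF assms(2)[unfolded dt_def], of "%i. if i < 2 then i else Suc i"] by simp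
 show ?thesis unfolding lam_def
  by (rule dt_mk, rule S_lam, rule dt_fix[OF assms(2)]) (intro dfns dt_shift[OF assms(1)] 1)
qed

lemma pr_in_un: "pr x y : el f ==> x : el (un (un f)) & y : el (un (un f))"
proof -
 assume a: "pr x y : el f"
 have "up x y : el (pr x y)" by (simp add: pr_def)
 then have "up x y : el (un f)" using a by auto
 moreover have "x : el (up x y)" "y : el (up x y)" by auto
 ultimately show ?thesis by (subst (1 2) el_un) blast
qed

lemma S_ap: "S {z. EX y. pr x y : el f & z : el y}"
proof (rule S_sub[OF S_el[of "un (un (un f))"]])
 show "{z. EX y. pr x y : el f & z : el y} <= el (un (un (un f)))"
  using pr_in_un[of x _ f] by (subst el_un) blast
qed (intro dfns)

lemma dt_ap [dfns]: "dt t ==> dt u ==> dt (%v. ap (t v) (u v))"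
 by (rule dt_comp2[where f=ap, rotated], assumption+, unfold ap_def, rule dt_mk, rule S_ap, intro dfns)

lemma ap_eq: "pr x y : el f ==> (!!z. pr x z : el f ==> z = y) ==> ap f x = y"
 unfolding ap_def by (subst mk_eq_iff[OF S_ap]) blast

lemma ap_lam: "dt (%v. F (v 0)) ==> x : el A ==> ap (lam A F) x = F x"
 by (rule ap_eq) (auto simp: el_lam)

lemma lam_cong: "(!!x. x : el A ==> F x = G x) ==> lam A F = lam A G"
 unfolding lam_def by (rule arg_cong[where f=mk]) auto

lemma dt_ap1 [simp]: "dt (%v. ap f (v 0))" by (intro dfns)

lemma isfI: "dt (%v. F (v 0)) ==> (!!x. x : el A ==> F x : el B) ==> isf (lam A F) A B"
 unfolding isf_def using lam_cong[of A F "ap (lam A F)"] by (auto simp: ap_lam)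

lemma isf_in: "isf f A B ==> x : el A ==> ap f x : el B" by (simp add: isf_def)
lemma isf_eta: "isf f A B ==> lam A (ap f) = f" by (simp add: isf_def)
lemma isf_el: "isf f A B ==> el f = {z. EX x:el A. z = pr x (ap f x)}"
 using el_lam[of "ap f" A] by (simp add: isf_eta)
lemma isf_pr: "isf f A B ==> pr x y : el f \<longleftrightarrow> x : el A & y = ap f x" by (auto simp: isf_el)
lemma isf_ext: "isf f A B ==> isf g A C ==> (!!x. x : el A ==> ap f x = ap g x) ==> f = g"
 by (metis isf_eta lam_cong)
lemma isf_mono: "isf f A B ==> el B <= el C ==> isf f A C" by (auto simp: isf_def)

lemma isf_rel:
 assumes "!!z. z : el f ==> EX x:el A. EX y:el B. z = pr x y" "!!x. x : el A ==> EX y. pr x y : el f"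
  "!!x y y'. pr x y : el f ==> pr x y' : el f ==> y = y'"
 shows "isf f A B" "pr x y : el f ==> ap f x = y"
proof -
 show a: "pr x y : el f ==> ap f x = y" for x y by (rule ap_eq) (use assms in auto)
 have "el (lam A (ap f)) = el f" unfolding el_lam[OF dt_ap1]
 proof (safe)
  fix x assume "x : el A" then show "pr x (ap f x) : el f" using assms(2) a by metis
 next
  fix z assume "z : el f" then show "EX x:el A. z = pr x (ap f x)" using assms(1) a by metis
 qed
 moreover have "ap f x : el B" if "x : el A" for x
  using assms(1,2) a that by (metis pr_inject)
 ultimately show "isf f A B" by (simp add: isf_def)
qed

lemma dfn_isf [dfns]: "dt t ==> dt u ==> dt w ==> dfn (%v. isf (t v) (u v) (w v))"
 by (rule dfn_comp3[where P=isf]; (assumption | (unfold isf_def, intro dfns)))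

definition fs :: "'a => 'a => 'a" where "fs A B = mk {f. isf f A B}"

lemma S_fs: "S {f. isf f A B}"
 by (rule S_sub[OF S_el[of "pw (tms A B)"]]) (auto simp: isf_el isf_in intro: dfns)

lemma el_fs [simp]: "el (fs A B) = {f. isf f A B}" by (simp add: fs_def el_mk S_fs)

lemma dt_fs [dfns]: "dt t ==> dt u ==> dt (%v. fs (t v) (u v))"
 by (rule dt_comp2[where f=fs, rotated], assumption+, unfold fs_def, rule dt_mk, rule S_fs, intro dfns)

definition fst' :: "'a => 'a" where "fst' z = mk {t. EX x y. z = pr x y & t : el x}"
definition snd' :: "'a => 'a" where "snd' z = mk {t. EX x y. z = pr x y & t : el y}"

lemma S_fst: "S {t. EX x y. z = pr x y & t : el x}"
 by (rule S_sub[OF S_el[of "un (un z)"]]) (auto simp: pr_def intro!: dfns)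
lemma S_snd: "S {t. EX x y. z = pr x y & t : el y}"
 by (rule S_sub[OF S_el[of "un (un z)"]]) (auto simp: pr_def intro!: dfns)
lemma fst_pr [simp]: "fst' (pr x y) = x" unfolding fst'_def by (subst mk_eq_iff[OF S_fst]) auto
lemma snd_pr [simp]: "snd' (pr x y) = y" unfolding snd'_def by (subst mk_eq_iff[OF S_snd]) auto
lemma dt_fst [dfns]: "dt t ==> dt (%v. fst' (t v))"
 by (rule dt_comp1[where f=fst', rotated], assumption+, unfold fst'_def, rule dt_mk, rule S_fst, intro dfns)
lemma dt_snd [dfns]: "dt t ==> dt (%v. snd' (t v))"
 by (rule dt_comp1[where f=snd', rotated], assumption+, unfold snd'_def, rule dt_mk, rule S_snd, intro dfns)

lemma set_foundation: "S X ==> X ~= {} ==> EX y:X. el y \<inter> X = {}"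
 using foundation by (fastforce simp: S_def el_def)

lemma mem_irrefl [simp]: "x ~: el x" using set_foundation[OF S_single, of x] by auto
lemma mem_asym: "x : el y ==> y ~: el x" using set_foundation[OF S_pair, of x y] by auto

end

context zf
begin

section \<open>Natural numbers and recursion\<close>

abbreviation sc :: "'a => 'a" where "sc x == ins x x"

definition indset :: "'a => bool" where
 "indset w \<longleftrightarrow> emp : el w & (ALL x:el w. sc x : el w)"
definition om :: 'a where "om = mk {x. ALL w. indset w --> x : el w}"

lemma dfn_indset [dfns]: "dt t ==> dfn (%v. indset (t v))"
 by (rule dfn_comp1[where P=indset]; (assumption | (unfold indset_def, intro dfns)))

lemma indset_ex: "EX w. indset w"
proof -
 obtain w x where w: "ALL z. ~ E z x" "E x w" "ALL x. E x w --> (EX y. (ALL z. E z y \<longleftrightarrow> E z x | z = x) & E y w)"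
  using infinity by blast
 have "x = emp" by (rule eqI) (use w(1) in \<open>auto simp: el_def[of x]\<close>)
 moreover have "sc x : el w" if xw: "x : el w" for x
 proof -
  obtain y where y: "ALL z. E z y \<longleftrightarrow> E z x | z = x" "E y w" using w(3) xw by (auto simp: el_def)
  have "y = sc x" by (rule eqI) (use y(1) in \<open>auto simp: el_def[of y] el_def[of x]\<close>)
  then show ?thesis using y by (simp add: el_def)
 qed
 ultimately show ?thesis using w(2) by (auto simp: indset_def el_def)
qed

lemma el_om: "el om = {x. ALL w. indset w --> x : el w}"
 unfolding om_def
proof (rule el_mk)
 obtain w where w: "indset w" using indset_ex by blast
 show "S {x. ALL w. indset w --> x : el w}" by (rule S_sub[OF S_el[of w]]) (use w in \<open>auto intro!: dfns\<close>)
qed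

lemma zero_om [simp]: "emp : el om" and sc_om [simp]: "n : el om ==> sc n : el om"
 by (auto simp: el_om indset_def)

lemma indset_om: "indset om" by (simp add: indset_def)

text \<open>The \<open>om\<close> of the model may have nonstandard elements, so induction along it
  is confined to definable properties.\<close>

lemma om_induct:
 assumes "n : el om" "dfn (%v. Q (v 0))" "Q emp" "!!n. n : el om ==> Q n ==> Q (sc n)"
 shows "Q n"
proof -
 have s: "S {n : el om. Q n}" by (rule S_Collect[OF S_el assms(2)])
 have "indset (mk {n : el om. Q n})" using assms by (simp add: indset_def el_mk[OF s])
 then have "n : el (mk {n : el om. Q n})" using assms(1) el_om by blast
 then show ?thesis by (simp add: el_mk[OF s])
qed

lemma om_cases: "n : el om ==> n = emp | (EX m:el om. n = sc m)"
 by (rule om_induct[of n]) (auto intro!: dfns)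

definition trans :: "'a => bool" where "trans a \<longleftrightarrow> (ALL x:el a. el x <= el a)"
lemma dfn_trans [dfns]: "dt t ==> dfn (%v. trans (t v))"
 by (rule dfn_comp1[where P=trans]; (assumption | (unfold trans_def, intro dfns)))

lemma om_trans_el: "n : el om ==> trans n"
 by (rule om_induct[of n]) (auto simp: trans_def intro!: dfns)

lemma om_elem: "n : el om ==> m : el n ==> m : el om"
proof -
 have "n : el om ==> el n <= el om" by (rule om_induct[of n]) (auto intro!: dfns)
 then show "n : el om ==> m : el n ==> m : el om" by blast
qed

lemma sc_mem: "n : el om ==> m : el n ==> sc m = n | sc m : el n"
proof -
 have "n : el om ==> ALL m:el n. sc m = n | sc m : el n"
  by (rule om_induct[of n]) (auto intro!: dfns)
 then show "n : el om ==> m : el n ==> sc m = n | sc m : el n" by blast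
qed

lemma om_zero_mem: "n : el om ==> n = emp | emp : el n"
 by (rule om_induct[of n]) (auto intro!: dfns)

lemma om_linear: "m : el om ==> n : el om ==> m : el n | m = n | n : el m"
proof -
 assume m: "m : el om" and n: "n : el om"
 show ?thesis
 proof (rule om_induct[OF m])
  show "dfn (%v. v 0 : el n | v 0 = n | n : el (v 0))" by (intro dfns)
  show "emp : el n | emp = n | n : el emp" using om_zero_mem[OF n] by auto
  fix k assume "k : el om" "k : el n | k = n | n : el k"
  then show "sc k : el n | sc k = n | n : el (sc k)" using sc_mem[OF n, of k] by auto
 qed
qed

lemma om_mem_trans: "n : el om ==> m : el n ==> k : el m ==> k : el n"
 using om_trans_el[of n] by (auto simp: trans_def)

lemma om_max: "m : el om ==> n : el om ==> EX k:el om. el m <= el k & el n <= el k"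
 using om_linear[of m n] om_trans_el[of m] om_trans_el[of n] unfolding trans_def
 by (metis order_refl)

definition fn :: "'a => 'a => bool" where "fn f A \<longleftrightarrow> f = lam A (ap f)"
lemma dfn_fn [dfns]: "dt t ==> dt u ==> dfn (%v. fn (t v) (u v))"
 by (rule dfn_comp2[where P=fn]; (assumption | (unfold fn_def, intro dfns)))
lemma fn_lam: "dt (%v. F (v 0)) ==> fn (lam A F) A"
 unfolding fn_def by (rule lam_cong) (simp add: ap_lam)
lemma isf_iff_fn: "isf f A B \<longleftrightarrow> fn f A & (ALL x:el A. ap f x : el B)" by (simp add: isf_def fn_def)
lemma dt_THE:
 assumes "dfn (%v. R (v 0) (v 1))" "!!x. EX! y. R x y"
 shows "dt (%v. THE y. R (v 0) y)"
proof -
 have "y = (THE y. R x y) \<longleftrightarrow> R x y" for x y using assms(2)[of x] by (metis the_equality)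
 moreover have "dfn (%v. R (v 1) (v 0))" using dfn_ren[OF assms(1), of "%i. if i = 0 then 1 else 0"] by simp
 ultimately show ?thesis unfolding dt_def by simp
qed

lemma fun_of_rel:
 assumes "dfn (%v. R (v 0) (v 1))" "!!x. x : el A ==> EX! y. R x y"
 shows "EX f. fn f A & (ALL x:el A. R x (ap f x))"
proof -
 define R' where "R' x y \<longleftrightarrow> (x : el A & R x y) | (x ~: el A & y = emp)" for x y
 have ex: "EX! y. R' x y" for x using assms(2) unfolding R'_def by (cases "x : el A") auto
 have "dfn (%v. R' (v 0) (v 1))" unfolding R'_def by (intro dfns assms)
 then have d: "dt (%v. THE y. R' (v 0) y)" using ex by (rule dt_THE)
 let ?f = "lam A (%x. THE y. R' x y)"
 have "R x (ap ?f x)" if "x : el A" for x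
 proof -
  have "R' x y ==> R x y" for y using that by (simp add: R'_def)
  then show ?thesis using theI'[OF ex[of x]] unfolding ap_lam[OF d that] by blast
 qed
 then show ?thesis using fn_lam[OF d] by blast
qed

definition img :: "'a => 'a => 'a" where "img f a = mk (ap f ` el a)"
lemma S_img_ap [simp]: "S (ap f ` el a)" by (rule S_img) (auto intro: dfns)
lemma el_img [simp]: "el (img f a) = ap f ` el a" by (simp add: img_def el_mk)
lemma dt_img [dfns]: "dt t ==> dt u ==> dt (%v. img (t v) (u v))"
 by (rule dt_comp2[where f=img, rotated], assumption+, unfold img_def, rule dt_mk, simp, unfold image_iff, intro dfns)

text \<open>Approximations, that is functions on \<open>sc n\<close> obeying the equations, agree
  where both are defined and can be prolonged by one value. The recursive function collects their
  last values.\<close>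

lemma om_rec:
 assumes F: "dt (%v. F (v 0))"
 shows "EX f. fn f om & ap f emp = a & (ALL n:el om. ap f (sc n) = F (ap f n))"
proof -
 have dF: "dt t ==> dt (%v. F (t v))" for t using dt_comp1[OF F] .
 define appr where "appr n g \<longleftrightarrow> fn g (sc n) & ap g emp = a & (ALL m:el n. ap g (sc m) = F (ap g m))" for n g
 have dappr: "dt t ==> dt u ==> dfn (%v. appr (t v) (u v))" for t u
  by (rule dfn_comp2[where P=appr]; (assumption | (unfold appr_def, intro dfns dF)))
 have uniq: "ap g m = ap h m" if "n : el om" "appr n g" "appr n h" "m : el (sc n)" for n g h m
 proof -
  have m: "m : el om" using that(1,4) om_elem by auto
  have "m : el (sc n) --> ap g m = ap h m"
  proof (rule om_induct[OF m])
   show "dfn (%v. v 0 : el (sc n) --> ap g (v 0) = ap h (v 0))" by (intro dfns)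
   show "emp : el (sc n) --> ap g emp = ap h emp" using that by (simp add: appr_def)
   fix k assume k: "k : el om" "k : el (sc n) --> ap g k = ap h k"
   have "k : el n" if "sc k : el (sc n)"
    using that om_mem_trans[OF \<open>n : el om\<close>, of "sc k" k] by auto
   then show "sc k : el (sc n) --> ap g (sc k) = ap h (sc k)" using that k by (auto simp: appr_def)
  qed
  then show ?thesis using that(4) by blast
 qed
 have ex: "EX g. appr n g" if "n : el om" for n
 proof (rule om_induct[OF that])
  show "dfn (%v. EX g. appr (v 0) g)" by (intro dfns dappr)
  show "EX g. appr emp g" unfolding appr_def
   by (intro exI[of _ "lam (sc emp) (%_. a)"]) (auto simp: fn_lam ap_lam dfns)
  fix n assume n: "n : el om" "EX g. appr n g"
  then obtain g where g: "appr n g" by blast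
  have d: "dt (%v. if v 0 : el (sc n) then ap g (v 0) else F (ap g n))" by (intro dfns)
  let ?h = "lam (sc (sc n)) (%m. if m : el (sc n) then ap g m else F (ap g n))"
  have h: "ap ?h m = (if m : el (sc n) then ap g m else F (ap g n))" if "m : el (sc (sc n))" for m
   using ap_lam[OF d that] .
  have "ap ?h (sc m) = F (ap ?h m)" if m: "m : el (sc n)" for m
  proof (cases "m = n")
   case True
   have "sc n ~: el (sc n)" by (rule mem_irrefl)
   then have "ap ?h (sc n) = F (ap g n)" "ap ?h n = ap g n"
    by (subst h, simp, simp)+
   then show ?thesis using True by simp
  next
   case False
   then have "m : el n" "sc m : el (sc n)" using m sc_mem[OF n(1), of m] by auto
   then show ?thesis using g m by (subst (1 2) h) (auto simp: appr_def)
  qed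
  moreover have "emp : el (sc n)" using om_zero_mem[OF n(1)] by auto
  ultimately show "EX g. appr (sc n) g" using g fn_lam[OF d] h[of emp] unfolding appr_def
   by (intro exI[of _ ?h]) auto
 qed
 have "EX f. fn f om & (ALL n:el om. EX g. appr n g & ap f n = ap g n)"
 proof (rule fun_of_rel[where R="%n y. EX g. appr n g & y = ap g n"])
  show "dfn (%v. EX g. appr (v 0) g & v 1 = ap g (v 0))" by (intro dfns dappr)
  fix n assume n: "n : el om"
  then show "EX! y. EX g. appr n g & y = ap g n" using ex[OF n] uniq[OF n] by (metis el_ins insertI1)
 qed
 then obtain f where f: "fn f om" "!!n. n : el om ==> EX g. appr n g & ap f n = ap g n" by blast
 have "ap f emp = a" using f(2)[of emp] by (auto simp: appr_def)
 moreover have "ap f (sc n) = F (ap f n)" if n: "n : el om" for n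
 proof -
  obtain g h where g: "appr n g" "ap f n = ap g n" and h: "appr (sc n) h" "ap f (sc n) = ap h (sc n)"
   using f(2)[OF n] f(2)[OF sc_om[OF n]] by blast
  let ?h = "lam (sc n) (ap h)"
  have "emp : el (sc n)" using om_zero_mem[OF n] by auto
  then have "appr n ?h" using h(1) sc_mem[OF n] unfolding appr_def
   by (auto simp: fn_lam ap_lam)
  then have "ap g n = ap h n" using uniq[OF n g(1), of ?h n] by (simp add: ap_lam)
  then show ?thesis using g h by (simp add: appr_def)
 qed
 ultimately show ?thesis using f(1) by blast
qed

lemma trans_superset: "EX t. trans t & x : el t"
proof -
 obtain f where f: "fn f om" "ap f emp = ins x emp" "!!n. n : el om ==> ap f (sc n) = un (ap f n)"
  using om_rec[of un "ins x emp", OF dt_un[OF dt_proj]] by blast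
 let ?t = "un (img f om)"
 have "trans ?t" unfolding trans_def
 proof (safe)
  fix y z assume "y : el ?t" "z : el y"
  then obtain n where n: "n : el om" "y : el (ap f n)" by auto
  then have "z : el (ap f (sc n))" using f(3) \<open>z : el y\<close> by auto
  then show "z : el ?t" using n by auto
 qed
 moreover have "x : el ?t" using f(2) by (auto intro!: bexI[of _ emp])
 ultimately show ?thesis by blast
qed

lemma eps_min: "dfn (%v. Q (v 0)) ==> Q x ==> EX m. Q m & (ALL y:el m. ~ Q y)"
proof -
 assume d: "dfn (%v. Q (v 0))" and q: "Q x"
 obtain t where t: "trans t" "x : el t" using trans_superset by blast
 have "S {y : el t. Q y}" by (rule S_Collect[OF S_el d])
 then obtain m where "m : {y : el t. Q y}" "el m \<inter> {y : el t. Q y} = {}"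
  using set_foundation t(2) q by fastforce
 then show ?thesis using t(1) by (auto simp: trans_def)
qed

lemma eps_induct: "dfn (%v. Q (v 0)) ==> (!!x. (!!y. y : el x ==> Q y) ==> Q x) ==> Q x"
 using eps_min[of "%x. ~ Q x" x] dfn_not by blast

text \<open>\<open>F\<close> is given the mere set of earlier values, which is enough for check
  names, the cumulative hierarchy and transfinite choices. The approximations live on transitive
  sets and agree by epsilon-induction.\<close>

lemma eps_rec:
 assumes F: "dt (%v. F (v 0))"
 shows "EX H. dt (%v. H (v 0)) & (ALL x. H x = F (mk (H ` el x)))"
proof -
 have dF: "dt t ==> dt (%v. F (t v))" for t using dt_comp1[OF F] .
 define appr where "appr f t \<longleftrightarrow> trans t & fn f t & (ALL x:el t. ap f x = F (img f x))" for f t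
 have dappr: "dt t ==> dt u ==> dfn (%v. appr (t v) (u v))" for t u
  by (rule dfn_comp2[where P=appr]; (assumption | (unfold appr_def, intro dfns dF)))
 define R where "R x y \<longleftrightarrow> (EX f t. appr f t & x : el t & y = ap f x)" for x y
 have dR: "dt t ==> dt u ==> dfn (%v. R (t v) (u v))" for t u
  by (rule dfn_comp2[where P=R]; (assumption | (unfold R_def, intro dfns dappr)))
 have uniq: "ALL y y'. R x y --> R x y' --> y = y'" for x
 proof (rule eps_induct[where x=x])
  show "dfn (%v. ALL y y'. R (v 0) y --> R (v 0) y' --> y = y')" by (intro dfns dR)
  fix x assume IH: "!!z. z : el x ==> ALL y y'. R z y --> R z y' --> y = y'"
  show "ALL y y'. R x y --> R x y' --> y = y'"
  proof (intro allI impI)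
   fix y y' assume "R x y" "R x y'"
   then obtain f t g u where f: "appr f t" "x : el t" "y = ap f x" and g: "appr g u" "x : el u" "y' = ap g x"
    by (auto simp: R_def)
   have "ap f z = ap g z" if "z : el x" for z
   proof -
    have "z : el t" "z : el u" using f g that by (auto simp: appr_def trans_def)
    then show ?thesis using IH[OF that] f(1) g(1) unfolding R_def by blast
   qed
   then have "img f x = img g x" by (intro eqI) auto
   then show "y = y'" using f g by (simp add: appr_def)
  qed
 qed
 have ex: "EX y. R x y" for x
 proof (rule eps_induct[where x=x])
  show "dfn (%v. EX y. R (v 0) y)" by (intro dfns dR)
  fix x assume IH: "!!z. z : el x ==> EX y. R z y"
  obtain t where t: "trans t" "x : el t" using trans_superset by blast
  have s: "S {z : el t. EX w. R z w}" by (rule S_Collect[OF S_el]) (intro dfns dR)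
  define t' where "t' = mk {z : el t. EX w. R z w}"
  have et: "el t' = {z : el t. EX w. R z w}" using el_mk[OF s] by (simp add: t'_def)
  have tt: "trans t'" unfolding trans_def et
  proof (safe)
   fix z w u assume z: "z : el t" "R z w" "u : el z"
   then show "u : el t" using t(1) by (auto simp: trans_def)
   show "EX w. R u w" using z by (auto simp: R_def appr_def trans_def)
  qed
  obtain f where f: "fn f t'" "!!z. z : el t' ==> R z (ap f z)"
   using fun_of_rel[of R t'] dR[OF dt_proj dt_proj] uniq et by blast
  have fF: "ap f z = F (img f z)" if "z : el t'" for z
  proof -
   obtain g u where g: "appr g u" "z : el u" "ap f z = ap g z"
    using f(2)[of z] \<open>z : el t'\<close> by (auto simp: R_def)
   have "ap f w = ap g w" if "w : el z" for w
   proof -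
    have "w : el t'" "w : el u" using tt g that \<open>z : el t'\<close> by (auto simp: appr_def trans_def)
    then show ?thesis using uniq f(2) g(1) unfolding R_def by blast
   qed
   then have "img f z = img g z" by (intro eqI) auto
   then show ?thesis using g by (simp add: appr_def)
  qed
  have sub: "el x <= el t'" using IH t by (auto simp: et trans_def)
  let ?h = "%z. if z : el t' then ap f z else F (img f x)"
  let ?u = "ins x t'" let ?g = "lam ?u ?h"
  have d: "dt (%v. ?h (v 0))" by (intro dfns)
  have gz: "ap ?g z = ?h z" if "z : el ?u" for z using ap_lam[OF d that] .
  have im: "img ?g z = img f z" if "z : el ?u" for z
  proof -
   have "el z <= el t'" using that sub tt by (auto simp: trans_def)
   then have "ap ?g ` el z = ap f ` el z" by (intro image_cong refl) (subst gz, auto)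
   then show ?thesis by (simp add: img_def)
  qed
  have "appr ?g ?u" unfolding appr_def
  proof (intro conjI ballI)
   show "trans ?u" using tt sub by (auto simp: trans_def)
   show "fn ?g ?u" by (rule fn_lam[OF d])
   fix z assume z: "z : el ?u"
   show "ap ?g z = F (img ?g z)"
    using z fF by (cases "z : el t'") (auto simp: gz im)
  qed
  then show "EX y. R x y" unfolding R_def by (intro exI[of _ "ap ?g x"] exI[of _ ?g] exI[of _ ?u]) simp
 qed
 have ex1: "EX! y. R x y" for x using ex uniq by blast
 define H where "H x = (THE y. R x y)" for x
 have d: "dt (%v. H (v 0))" unfolding H_def by (rule dt_THE[OF dR ex1]) (intro dfns)+
 have RH: "R x (H x)" for x unfolding H_def using theI'[OF ex1] .
 have "H x = F (mk (H ` el x))" for x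
 proof -
  obtain f t where f: "appr f t" "x : el t" "H x = ap f x" using RH[of x] by (auto simp: R_def)
  have "H z = ap f z" if "z : el x" for z
  proof -
   have "z : el t" using f that by (auto simp: appr_def trans_def)
   then have "R z (ap f z)" using f(1) by (auto simp: R_def)
   then show ?thesis using RH ex1 by blast
  qed
  then have "H ` el x = ap f ` el x" by auto
  then show ?thesis using f by (simp add: appr_def img_def)
 qed
 then show ?thesis using d by blast
qed

end

context zf
begin

section \<open>Ordinals and Collection\<close>

definition Ord :: "'a => bool" where
 "Ord a \<longleftrightarrow> (ALL x:el a. el x <= el a) & (ALL x:el a. ALL y:el a. x : el y | x = y | y : el x)"

lemma dfn_Ord [dfns]: "dt t ==> dfn (%v. Ord (t v))"
 by (rule dfn_comp1[where P=Ord]; (assumption | (unfold Ord_def, intro dfns)))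

lemma no_3_cycle: "x : el y ==> y : el z ==> z ~: el x"
 using set_foundation[OF S_insert[OF S_pair], of x y z] by auto

lemma Ord_elem: "Ord a ==> x : el a ==> Ord x"
 unfolding Ord_def
proof (intro conjI ballI subsetI)
 assume a: "(ALL x:el a. el x <= el a) & (ALL x:el a. ALL y:el a. x : el y | x = y | y : el x)" and x: "x : el a"
 fix y assume y: "y : el x"
 then have ya: "y : el a" using a x by blast
 { fix z assume z: "z : el y"
  then have "z : el a" using a ya by blast
  then have "z : el x | z = x | x : el z" using a x by blast
  then show "z : el x" using y z mem_asym no_3_cycle by blast }
 { fix z assume z: "z : el x"
  then have "z : el a" using a x by blast
  then show "y : el z | y = z | z : el y" using a ya by blast }
qed

lemma Ord_trans: "Ord a ==> x : el a ==> y : el x ==> y : el a" by (auto simp: Ord_def)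
lemma Ord_elem_sub: "Ord a ==> x : el a ==> el x <= el a" by (auto simp: Ord_def)

lemma Ord_sub_mem:
 assumes "Ord a" "Ord b" "el a <= el b" "a ~= b" shows "a : el b"
proof -
 have "el b - el a ~= {}" using assms(3,4) by auto
 then obtain m where m: "m : el b - el a" "el m \<inter> (el b - el a) = {}"
  using set_foundation[OF S_Diff[OF S_el S_el]] by blast
 have "el m = el a"
 proof
  show "el m <= el a" using m Ord_elem_sub[OF assms(2), of m] by blast
  show "el a <= el m"
  proof
   fix x assume x: "x : el a"
   then have "x : el m | x = m | m : el x" using assms m(1) unfolding Ord_def by blast
   then show "x : el m" using x m(1) Ord_trans[OF assms(1)] by blast
  qed
 qed
 then show ?thesis using m(1) by simp
qed

lemma Ord_linear: "Ord a ==> Ord b ==> a : el b | a = b | b : el a"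
proof -
 assume a: "Ord a" and b: "Ord b"
 let ?c = "mk (el a \<inter> el b)"
 have c: "el ?c = el a \<inter> el b" by (rule el_mk) (simp add: S_Int)
 then have o: "Ord ?c" using a b unfolding Ord_def c by (metis Int_iff Int_greatest order_trans)
 have "~ (?c : el a & ?c : el b)" using c mem_irrefl[of ?c] by blast
 then have "?c = a | ?c = b" using Ord_sub_mem[OF o a] Ord_sub_mem[OF o b] c by blast
 then have "el a <= el b | el b <= el a" using c by (metis Int_lower1 Int_lower2)
 then show ?thesis using Ord_sub_mem[OF a b] Ord_sub_mem[OF b a] by blast
qed

lemma Ord_sub_iff: "Ord a ==> Ord b ==> el a <= el b \<longleftrightarrow> a = b | a : el b"
 using Ord_sub_mem Ord_elem_sub by blast

lemma Ord_not_mem: "Ord a ==> Ord b ==> a ~: el b ==> el b <= el a"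
 using Ord_linear[of a b] Ord_elem_sub by blast

lemma Ord_least:
 assumes "dfn (%v. Q (v 0))" "Ord a" "Q a"
 shows "EX m. Ord m & Q m & (ALL b. Ord b --> Q b --> el m <= el b)"
proof -
 have "dfn (%v. Ord (v 0) & Q (v 0))" by (intro dfns assms)
 then obtain m where "Ord m & Q m" "ALL y:el m. ~ (Ord y & Q y)" using eps_min[of "%x. Ord x & Q x" a] assms by blast
 then show ?thesis using Ord_not_mem by blast
qed

lemma Ord_sc: "Ord a ==> Ord (sc a)" by (auto simp: Ord_def)
lemma Ord_emp: "Ord emp" by (simp add: Ord_def)
lemma Ord_nat: "n : el om ==> Ord n" by (rule om_induct[of n]) (auto intro!: dfns Ord_sc Ord_emp)
lemma Ord_un: "(!!x. x : el A ==> Ord x) ==> Ord (un A)"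
proof -
 assume a: "!!x. x : el A ==> Ord x"
 have "Ord x" if "x : el (un A)" for x using that a Ord_elem by auto
 then have "ALL x:el (un A). ALL y:el (un A). x : el y | x = y | y : el x" using Ord_linear by blast
 moreover have "ALL x:el (un A). el x <= el (un A)" using Ord_trans[OF a] by fastforce
 ultimately show ?thesis unfolding Ord_def by blast
qed

lemma no_Ord_set: "EX b. Ord b & b ~: el a"
proof (rule ccontr)
 assume "~ ?thesis"
 then have a: "Ord b ==> b : el a" for b by blast
 have s: "S {b : el a. Ord b}" by (rule S_Collect) (auto intro: dfns)
 let ?o = "mk {b : el a. Ord b}"
 have e: "el ?o = {b. Ord b}" using el_mk[OF s] a by auto
 have "Ord ?o" using Ord_linear Ord_elem unfolding Ord_def[of ?o] e by blast
 then have "?o : el ?o" using e by simp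
 then show False by simp
qed

text \<open>Scott's trick. \<open>V\<close> is the cumulative hierarchy: \<open>z\<close> belongs to
  \<open>V x\<close> iff it is a subset of \<open>V y\<close> for some \<open>y\<close> in
  \<open>x\<close>. For each \<open>x\<close> in \<open>A\<close> the first ordinal stage containing
  a suitable \<open>y\<close> is taken, and these stages are united.\<close>

lemma collection:
 assumes "dfn (%v. R (v 0) (v 1))"
 shows "EX B. ALL x:el A. (EX y. R x y) --> (EX y:el B. R x y)"
proof -
 have dR: "dt t ==> dt u ==> dfn (%v. R (t v) (u v))" for t u by (rule dfn_comp2[OF assms])
 let ?F = "%Y. mk {z. EX y:el Y. el z <= el y}"
 have sF: "S {z. EX y:el Y. el z <= el y}" for Y
  by (rule S_sub[OF S_el[of "pw (un Y)"]]) (auto intro!: dfns)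
 have "dt (%v. ?F (v 0))" by (rule dt_mk, rule sF, intro dfns)
 then obtain V where dV0: "dt (%v. V (v 0))" and V: "!!x. V x = ?F (mk (V ` el x))" using eps_rec[of ?F] by blast
 have dV: "dt t ==> dt (%v. V (t v))" for t by (rule dt_comp1[OF dV0])
 have V_iff: "z : el (V x) \<longleftrightarrow> (EX y:el x. el z <= el (V y))" for z x
 proof -
  have "el (V x) = {z. EX y:el (mk (V ` el x)). el z <= el y}" by (subst V) (rule el_mk[OF sF])
  then show ?thesis by (simp add: el_mk S_img dV0)
 qed
 have Vmono: "el y <= el x ==> el (V y) <= el (V x)" for x y
  by (meson V_iff subset_eq)
 have sing: "EX f. fn f X & (ALL x:el X. Ord (ap f x) & Q x (ap f x) & (ALL b:el (ap f x). ~ Q x b))"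
  if "dfn (%v. Q (v 0) (v 1))" and exQ: "!!x. x : el X ==> EX a. Ord a & Q x a" for Q X
 proof (rule fun_of_rel)
  have dQ: "dt t ==> dt u ==> dfn (%v. Q (t v) (u v))" for t u by (rule dfn_comp2[OF that(1)])
  show "dfn (%v. Ord (v 1) & Q (v 0) (v 1) & (ALL b:el (v 1). ~ Q (v 0) b))" by (intro dfns dQ)
  fix x assume "x : el X"
  then obtain a where "Ord a & Q x a" using exQ by blast
  moreover have "dfn (%v. Ord (v 0) & Q x (v 0))" by (intro dfns dQ)
  ultimately obtain m where "Ord m & Q x m" "ALL b:el m. ~ (Ord b & Q x b)"
   using eps_min[of "%a. Ord a & Q x a"] by blast
  then show "EX! a. Ord a & Q x a & (ALL b:el a. ~ Q x b)"
   using Ord_elem Ord_linear by blast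
 qed
 have all: "EX a. Ord a & x : el (V a)" for x
 proof (rule eps_induct[where x=x])
  show "dfn (%v. EX a. Ord a & v 0 : el (V a))" by (intro dfns dV)
  fix x assume IH: "!!y. y : el x ==> EX a. Ord a & y : el (V a)"
  have "dfn (%v. v 0 : el (V (v 1)))" by (intro dfns dV)
  then obtain f where f: "!!y. y : el x ==> Ord (ap f y) & y : el (V (ap f y))"
   using sing[of "%y a. y : el (V a)" x] IH by blast
  let ?a = "un (img f x)"
  have o: "Ord ?a" by (rule Ord_un) (use f in auto)
  have "y : el (V ?a)" if "y : el x" for y
  proof -
   have "el (ap f y) <= el ?a" using that by auto
   then show ?thesis using f[OF that] Vmono by blast
  qed
  then have "x : el (V (sc ?a))" by (subst V_iff) auto
  then show "EX a. Ord a & x : el (V a)" using Ord_sc[OF o] by blast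
 qed
 have s: "S {x : el A. EX y. R x y}" by (rule S_Collect[OF S_el]) (intro dfns dR)
 have "dfn (%v. EX y:el (V (v 1)). R (v 0) y)" by (intro dfns dV dR)
 then obtain f where f: "!!x. x : el A ==> EX y. R x y ==> EX y:el (V (ap f x)). R x y"
 proof -
  assume *: "dfn (%v. EX y:el (V (v 1)). R (v 0) y)"
   and th: "!!f. (!!x. x : el A ==> EX y. R x y ==> EX y:el (V (ap f x)). R x y) ==> thesis"
  have 1: "EX a. Ord a & (EX y:el (V a). R x y)" if "x : el (mk {x : el A. EX y. R x y})" for x
   using that all unfolding el_mk[OF s] by blast
  have "EX f. ALL x:el (mk {x : el A. EX y. R x y}). EX y:el (V (ap f x)). R x y"
   using sing[OF *, of "mk {x : el A. EX y. R x y}", OF 1] by blast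
  then show thesis using th unfolding el_mk[OF s] by blast
 qed
 have s2: "S (UN x:el A. el (V (ap f x)))" by (intro S_UN S_el dV dfns)
 show ?thesis
 proof (intro exI[of _ "mk (UN x:el A. el (V (ap f x)))"] ballI impI)
  fix x assume "x : el A" "EX y. R x y"
  then show "EX y:el (mk (UN x:el A. el (V (ap f x)))). R x y" using f[of x] unfolding el_mk[OF s2] by blast
 qed
qed

section \<open>Finite sets\<close>

definition Fin :: "'a => bool" where "Fin a \<longleftrightarrow> (EX n:el om. EX f. a = img f n)"
lemma dfn_Fin [dfns]: "dt t ==> dfn (%v. Fin (t v))"
 by (rule dfn_comp1[where P=Fin]; (assumption | (unfold Fin_def, intro dfns)))

lemma Fin_emp [simp]: "Fin emp" unfolding Fin_def
 by (rule bexI[of _ emp]) (auto intro!: exI[of _ emp] eqI)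

lemma Fin_ins [simp]: "Fin a ==> Fin (ins x a)"
proof -
 assume "Fin a"
 then obtain n f where n: "n : el om" "a = img f n" by (auto simp: Fin_def)
 define h where "h m = (if m = n then x else ap f m)" for m
 have d: "dt (%v. h (v 0))" unfolding h_def by (intro dfns)
 have "ap (lam (sc n) h) ` el (sc n) = h ` el (sc n)" by (rule image_cong[OF refl]) (rule ap_lam[OF d])
 also have "\<dots> = insert x (ap f ` el n)" by (auto simp: h_def)
 finally have "ins x a = img (lam (sc n) h) (sc n)" using n(2) by (intro eqI) simp
 then show ?thesis unfolding Fin_def using sc_om[OF n(1)] by blast
qed

lemma Fin_induct:
 assumes "Fin a" and d: "dfn (%v. Q (v 0))" and "Q emp" and step: "!!x b. Fin b ==> Q b ==> Q (ins x b)"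
 shows "Q a"
proof -
 have dQ: "dt t ==> dfn (%v. Q (t v))" for t by (rule dfn_comp1[OF d])
 have "ALL f. Fin (img f n) & Q (img f n)" if "n : el om" for n
 proof (rule om_induct[OF that])
  show "dfn (%v. ALL f. Fin (img f (v 0)) & Q (img f (v 0)))" by (intro dfns dQ)
  have "img f emp = emp" for f by (rule eqI) simp
  then show "ALL f. Fin (img f emp) & Q (img f emp)" using assms by simp
  fix n assume "n : el om" and IH: "ALL f. Fin (img f n) & Q (img f n)"
  have "img f (sc n) = ins (ap f n) (img f n)" for f by (rule eqI) simp
  then show "ALL f. Fin (img f (sc n)) & Q (img f (sc n))" using IH step by simp
 qed
 then show ?thesis using assms(1) by (auto simp: Fin_def)
qed

lemma Fin_sub: "Fin a ==> el b <= el a ==> Fin b"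
proof -
 assume "Fin a"
 then have "ALL b. el b <= el a --> Fin b"
 proof (rule Fin_induct)
  show "dfn (%v. ALL b. el b <= el (v 0) --> Fin b)" by (intro dfns)
  show "ALL b. el b <= el emp --> Fin b" using Fin_emp by (metis el_emp subset_empty el_inject)
  fix x a assume IH: "ALL b. el b <= el a --> Fin b"
  show "ALL b. el b <= el (ins x a) --> Fin b"
  proof (intro allI impI)
   fix b assume b: "el b <= el (ins x a)"
   then have "el (df b (ins x emp)) <= el a" by auto
   then have f: "Fin (df b (ins x emp))" using IH by blast
   have "b = ins x (df b (ins x emp)) | b = df b (ins x emp)"
    unfolding el_inject[symmetric, of b] by auto
   then show "Fin b" using f Fin_ins by metis
  qed
 qed
 then show "el b <= el a ==> Fin b" by blast
qed

lemma Fin_un2: "Fin a ==> Fin b ==> Fin (un2 a b)"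
proof -
 assume a: "Fin a" and b: "Fin b"
 have u: "un2 emp b = b" "un2 (ins x a) b = ins x (un2 a b)" for x a by (rule eqI, simp)+
 show ?thesis by (rule Fin_induct[OF a]) (auto intro!: dfns b simp: u)
qed

lemma Fin_img: assumes "dt (%v. F (v 0))" "Fin a" shows "Fin (mk (F ` el a))"
proof (rule Fin_induct[OF assms(2)])
 have s: "S (F ` el a)" for a by (rule S_img[OF S_el assms(1)])
 have d: "dt (%v. mk (F ` el (v 0)))"
  by (rule dt_mk[OF s]) (unfold image_iff, intro dfns dt_comp1[OF assms(1)])
 show "dfn (%v. Fin (mk (F ` el (v 0))))" by (intro dfns d)
 have "mk (F ` el (ins x b)) = ins (F x) (mk (F ` el b))" for x b
  by (rule eqI) (simp only: el_mk[OF s], simp add: el_mk[OF s])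
 then show "Fin (mk (F ` el b)) ==> Fin (mk (F ` el (ins x b)))" for x b by simp
 have "mk (F ` el emp) = emp" unfolding el_emp image_empty by (simp add: emp_def)
 then show "Fin (mk (F ` el emp))" by simp
qed

lemma Fin_tms: "Fin a ==> Fin b ==> Fin (tms a b)"
proof -
 assume a: "Fin a" and b: "Fin b"
 have s: "S (pr x ` el b)" and f: "Fin (mk (pr x ` el b))" for x by (auto intro!: S_img Fin_img dfns b)
 have u: "tms emp b = emp" "tms (ins x a) b = un2 (mk (pr x ` el b)) (tms a b)" for x a
  by (rule eqI, auto simp: el_mk[OF s])+
 show ?thesis by (rule Fin_induct[OF a]) (auto intro!: dfns Fin_un2 f simp: u)
qed

lemma fn_emp: "fn f emp \<longleftrightarrow> f = emp"
proof -
 have "lam emp (ap f) = emp" by (rule eqI) (simp add: el_lam)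
 then show ?thesis by (auto simp: fn_def)
qed

lemma Fin_fs: assumes "Fin a" "Fin b" shows "Fin (fs a b)"
proof (rule Fin_induct[OF assms(1)])
 show "dfn (%v. Fin (fs (v 0) b))" by (intro dfns)
 show "Fin (fs emp b)" by (rule Fin_sub[of "ins emp emp"]) (auto simp: isf_iff_fn fn_emp)
 fix x a assume "Fin a" and IH: "Fin (fs a b)"
 let ?F = "%z. ins (pr x (snd' z)) (fst' z)"
 have d: "dt (%v. ?F (v 0))" by (intro dfns)
 have "Fin (mk (?F ` el (tms (fs a b) b)))" by (rule Fin_img[OF d Fin_tms[OF IH assms(2)]])
 moreover have "el (fs (ins x a) b) <= ?F ` el (tms (fs a b) b)"
 proof
  fix f assume "f : el (fs (ins x a) b)"
  then have f: "isf f (ins x a) b" by simp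
  let ?g = "lam a (ap f)"
  have g: "isf ?g a b" by (rule isfI) (use isf_in[OF f] in auto)
  have "f = ins (pr x (ap f x)) ?g" by (rule eqI) (auto simp: isf_el[OF f] el_lam)
  then show "f : ?F ` el (tms (fs a b) b)"
   using g isf_in[OF f, of x] by (intro image_eqI[of _ _ "pr ?g (ap f x)"]) auto
 qed
 ultimately show "Fin (fs (ins x a) b)"
  by (elim Fin_sub) (simp only: el_mk[OF S_img[OF S_el d]])
qed

lemma Fin_nat: "n : el om ==> Fin n"
 by (rule om_induct[of n]) (auto intro!: dfns)

lemma Fin_bounded: "Fin a ==> el a <= el om ==> EX k:el om. el a <= el k"
proof -
 assume a: "Fin a"
 have "el a <= el om --> (EX k:el om. el a <= el k)"
 proof (rule Fin_induct[OF a])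
  show "dfn (%v. el (v 0) <= el om --> (EX k:el om. el (v 0) <= el k))" by (intro dfns)
  show "el emp <= el om --> (EX k:el om. el emp <= el k)" by (intro impI bexI[of _ emp]) auto
  fix x b assume IH: "el b <= el om --> (EX k:el om. el b <= el k)"
  show "el (ins x b) <= el om --> (EX k:el om. el (ins x b) <= el k)"
  proof
   assume x: "el (ins x b) <= el om"
   then obtain k where k: "k : el om" "el b <= el k" using IH by auto
   obtain l where "l : el om" "el k <= el l" "el (sc x) <= el l" using om_max[of k "sc x"] k x by auto
   then show "EX k:el om. el (ins x b) <= el k" using k(2) by (intro bexI[of _ l]) auto
  qed
 qed
 then show "el a <= el om ==> EX k:el om. el a <= el k" by blast
qed

lemma dfn_inj [dfns]: "dt t ==> dt u ==> dfn (%v. inj_on (ap (t v)) (el (u v)))"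
 by (rule dfn_comp2[where P="%f A. inj_on (ap f) (el A)"]; (assumption | (unfold inj_on_def, intro dfns)))

lemma pigeonhole: "n : el om ==> isf f (sc n) n ==> ~ inj_on (ap f) (el (sc n))"
proof -
 assume n: "n : el om"
 have "ALL f. isf f (sc n) n --> ~ inj_on (ap f) (el (sc n))"
 proof (rule om_induct[OF n])
  show "dfn (%v. ALL f. isf f (sc (v 0)) (v 0) --> ~ inj_on (ap f) (el (sc (v 0))))" by (intro dfns)
  show "ALL f. isf f (sc emp) emp --> ~ inj_on (ap f) (el (sc emp))" by (auto simp: isf_iff_fn)
  fix n assume n: "n : el om" and IH: "ALL f. isf f (sc n) n --> ~ inj_on (ap f) (el (sc n))"
  show "ALL f. isf f (sc (sc n)) (sc n) --> ~ inj_on (ap f) (el (sc (sc n)))"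
  proof (intro allI impI notI)
   fix f assume f: "isf f (sc (sc n)) (sc n)" and i: "inj_on (ap f) (el (sc (sc n)))"
   \<comment> \<open>An argument mapped to the removed value \<open>n\<close> takes over the value
     at the last argument \<open>sc n\<close>, which keeps the map injective.\<close>
   define h where "h x = (if ap f x = n then ap f (sc n) else ap f x)" for x
   have d: "dt (%v. h (v 0))" unfolding h_def by (intro dfns)
   have ne: "x ~= sc n" if "x : el (sc n)" for x using that mem_irrefl[of "sc n"] by blast
   have x2: "x : el (sc (sc n))" if "x : el (sc n)" for x using that by auto
   have fin: "ap f x = n | ap f x : el n" if "x : el (sc (sc n))" for x using isf_in[OF f that] by auto
   have neq: "ap f x ~= ap f (sc n)" if "x : el (sc n)" for x
    using inj_onD[OF i, of x "sc n"] x2[OF that] ne[OF that] by auto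
   have "h x : el n" if "x : el (sc n)" for x
    using fin[OF x2[OF that]] fin[of "sc n"] neq[OF that] by (auto simp: h_def)
   then have "isf (lam (sc n) h) (sc n) n" by (intro isfI[OF d])
   moreover have "inj_on h (el (sc n))"
   proof (rule inj_onI)
    fix x y assume x: "x : el (sc n)" and y: "y : el (sc n)" and h: "h x = h y"
    have "ap f x = ap f y" using h neq[OF x] neq[OF y] unfolding h_def by (metis (full_types))
    then show "x = y" by (rule inj_onD[OF i _ x2[OF x] x2[OF y]])
   qed
   then have "inj_on (ap (lam (sc n) h)) (el (sc n))"
    using inj_on_cong[of "el (sc n)" "ap (lam (sc n) h)" h] by (simp add: ap_lam[OF d])
   ultimately show False using IH by blast
  qed
 qed
 then show "isf f (sc n) n ==> ~ inj_on (ap f) (el (sc n))" by blast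
qed

end

section \<open>Sizes inside a model: coverings, bijections and ordinals\<close>

context zf
begin

text \<open>This is how the extension obtains choice: every set there is covered by a family indexed
  by an ordinal, so each member of \<open>x\<close> contributes its element of least index.\<close>

lemma choice_from_enumerations:
 assumes enum: "!!x. EX f a. Ord a & el x <= ap f ` el a"
  and "ALL y. E y x --> (EX u. E u y)" "ALL y z. E y x & E z x & (EX u. E u y & E u z) --> y = z"
 shows "EX c. ALL y. E y x --> (EX! u. E u y & E u c)"
proof -
 have ne: "EX u. u : el y" if "y : el x" for y using assms(2) that by (auto simp: el_def)
 have disj: "y = z" if "y : el x" "z : el x" "u : el y" "u : el z" for y z u
  using assms(3) that by (auto simp: el_def)
 obtain f a where a: "Ord a" "el (un x) <= ap f ` el a" using enum by blast
 define Q where "Q z \<beta> y \<longleftrightarrow> z = ap f \<beta> & z : el y & (ALL \<gamma>:el \<beta>. ap f \<gamma> ~: el y)" for z \<beta> y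
 have s: "S {z : el (un x). EX \<beta>:el a. EX y:el x. Q z \<beta> y}"
  by (rule S_Collect[OF S_el]) (unfold Q_def, intro dfns)
 obtain c where c: "el c = {z : el (un x). EX \<beta>:el a. EX y:el x. Q z \<beta> y}" using s by (auto simp: S_def)
 have "EX! u. u : el y & u : el c" if y: "y : el x" for y
 proof -
  obtain u where u: "u : el y" using ne y by blast
  then obtain \<beta> where "\<beta> : el a" "ap f \<beta> : el y" using a(2) y by auto
  moreover have "dfn (%v. v 0 : el a & ap f (v 0) : el y)" by (intro dfns)
  ultimately obtain \<beta> where b: "\<beta> : el a" "ap f \<beta> : el y" "ALL \<gamma>:el \<beta>. ~ (\<gamma> : el a & ap f \<gamma> : el y)"
   using eps_min[of "%b. b : el a & ap f b : el y" \<beta>] by blast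
  have q: "Q (ap f \<beta>) \<beta> y" using b Ord_trans[OF a(1)] by (auto simp: Q_def)
  have "u = ap f \<beta>" if u: "u : el y" "u : el c" for u
  proof -
   obtain \<beta>' y' where u': "\<beta>' : el a" "y' : el x" "Q u \<beta>' y'" using u(2) c by blast
   then have "y' = y" using disj[OF _ y, of y' u] u by (auto simp: Q_def)
   moreover have "Ord \<beta>" "Ord \<beta>'" using Ord_elem[OF a(1)] b u' by auto
   ultimately have "\<beta>' = \<beta>" using Ord_linear[of \<beta> \<beta>'] u'(3) q by (auto simp: Q_def)
   then show ?thesis using u'(3) by (simp add: Q_def)
  qed
  moreover have "ap f \<beta> : el c" using q b(1) y c by (auto simp: Q_def)
  ultimately show ?thesis using b(2) by blast
 qed
 then show ?thesis by (auto simp: el_def)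
qed

section \<open>Covering and equinumerosity\<close>

text \<open>The map in \<^term>\<open>cov\<close> need not be a function from \<^term>\<open>A\<close>; \<^term>\<open>ap\<close> is total.\<close>

definition cov :: "'a => 'a => bool" where "cov A B \<longleftrightarrow> (EX f. el B <= ap f ` el A)"
definition lep :: "'a => 'a => bool" where "lep A B \<longleftrightarrow> (EX f. isf f A B & inj_on (ap f) (el A))"
definition eqp :: "'a => 'a => bool" where "eqp A B \<longleftrightarrow> (EX f. isf f A B & bij_betw (ap f) (el A) (el B))"
definition Card :: "'a => bool" where "Card c \<longleftrightarrow> Ord c & (ALL b:el c. ~ eqp b c)"

lemma dfn_cov [dfns]: "dt t ==> dt u ==> dfn (%v. cov (t v) (u v))"
 by (rule dfn_comp2[where P=cov]; (assumption | (unfold cov_def subset_iff image_iff, intro dfns)))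
lemma dfn_eqp [dfns]: "dt t ==> dt u ==> dfn (%v. eqp (t v) (u v))"
 by (rule dfn_comp2[where P=eqp]; (assumption |
  (unfold eqp_def bij_betw_def inj_on_def set_eq_iff image_iff, intro dfns)))
lemma dfn_Card [dfns]: "dt t ==> dfn (%v. Card (t v))"
 by (rule dfn_comp1[where P=Card]; (assumption | (unfold Card_def, intro dfns)))

lemma covI: "dt (%v. F (v 0)) ==> el B <= F ` el A ==> cov A B"
 unfolding cov_def by (rule exI[of _ "lam A F"]) (auto simp: ap_lam image_iff subset_iff)

lemma cov_refl: "cov A A" by (rule covI[of "%x. x"]) (auto intro: dfns)
lemma cov_sub: "el B <= el A ==> cov A B" by (rule covI[of "%x. x"]) (auto intro: dfns)

lemma cov_trans: "cov A B ==> cov B C ==> cov A C"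
proof -
 assume "cov A B" "cov B C"
 then obtain f g where f: "el B <= ap f ` el A" and g: "el C <= ap g ` el B" by (auto simp: cov_def)
 show ?thesis by (rule covI[of "%x. ap g (ap f x)"]) (intro dfns, use f g in blast)
qed

lemma cov_tms: "cov A A' ==> cov B B' ==> cov (tms A B) (tms A' B')"
proof -
 assume "cov A A'" "cov B B'"
 then obtain f g where f: "el A' <= ap f ` el A" and g: "el B' <= ap g ` el B" by (auto simp: cov_def)
 show ?thesis
 proof (rule covI[of "%z. pr (ap f (fst' z)) (ap g (snd' z))"])
  show "el (tms A' B') <= (%z. pr (ap f (fst' z)) (ap g (snd' z))) ` el (tms A B)"
  proof
   fix z assume "z : el (tms A' B')"
   then obtain x y where "x : el A" "y : el B" "z = pr (ap f x) (ap g y)" using f g by fastforce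
   then show "z : (%z. pr (ap f (fst' z)) (ap g (snd' z))) ` el (tms A B)"
    by (intro image_eqI[of _ _ "pr x y"]) auto
  qed
 qed (intro dfns)
qed

lemma Fin_iff_cov: "Fin a \<longleftrightarrow> (EX n:el om. cov n a)"
proof
 assume "Fin a" then show "EX n:el om. cov n a" unfolding Fin_def cov_def by (metis el_img order_refl)
next
 assume "EX n:el om. cov n a"
 then obtain n f where "n : el om" "el a <= el (img f n)" by (auto simp: cov_def)
 moreover from this have "Fin (img f n)" unfolding Fin_def by blast
 ultimately show "Fin a" using Fin_sub by blast
qed

lemma lep_cov: "lep B A ==> cov A B"
proof -
 assume "lep B A"
 then obtain f where f: "isf f B A" "inj_on (ap f) (el B)" by (auto simp: lep_def)
 let ?R = "%x y. (y : el B & ap f y = x) | ((ALL z:el B. ap f z ~= x) & y = emp)"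
 have "EX g. fn g A & (ALL x:el A. ?R x (ap g x))"
 proof (rule fun_of_rel)
  show "EX! y. ?R x y" for x using f(2) by (auto simp: inj_on_def)
 qed (intro dfns)
 then obtain g where g: "!!x. x : el A ==> ?R x (ap g x)" by blast
 have "y : ap g ` el A" if y: "y : el B" for y
 proof -
  have x: "ap f y : el A" using isf_in[OF f(1) y] .
  then have "ap g (ap f y) = y" using g[OF x] f(2) y by (auto simp: inj_on_def)
  then show ?thesis using x by force
 qed
 then show ?thesis by (auto simp: cov_def)
qed

lemma eqpI: "dt (%v. F (v 0)) ==> bij_betw F (el A) (el B) ==> eqp A B"
proof -
 assume d: "dt (%v. F (v 0))" and b: "bij_betw F (el A) (el B)"
 have "bij_betw (ap (lam A F)) (el A) (el B)"
  using b bij_betw_cong[of "el A" "ap (lam A F)" F] by (simp add: ap_lam[OF d])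
 moreover have "isf (lam A F) A B" by (rule isfI[OF d]) (use b bij_betwE in blast)
 ultimately show ?thesis by (auto simp: eqp_def)
qed

lemma eqp_refl: "eqp A A" by (rule eqpI[of "%x. x"]) (auto intro: dfns simp: bij_betw_def)

lemma eqp_cov: "eqp A B ==> cov A B" by (auto simp: eqp_def cov_def bij_betw_def)

lemma eqp_trans: "eqp A B ==> eqp B C ==> eqp A C"
proof -
 assume "eqp A B" "eqp B C"
 then obtain f g where f: "bij_betw (ap f) (el A) (el B)" and g: "bij_betw (ap g) (el B) (el C)"
  by (auto simp: eqp_def)
 show ?thesis by (rule eqpI[of "%x. ap g (ap f x)"])
   (intro dfns, use bij_betw_trans[OF f g] in \<open>simp add: comp_def\<close>)
qed

lemma eqp_sym: "eqp A B ==> eqp B A"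
proof -
 assume "eqp A B"
 then obtain f where f: "isf f A B" "bij_betw (ap f) (el A) (el B)" by (auto simp: eqp_def)
 have "EX g. fn g B & (ALL y:el B. ap g y : el A & ap f (ap g y) = y)"
 proof (rule fun_of_rel)
  show "EX! x. x : el A & ap f x = y" if "y : el B" for y
  proof -
   have "y : ap f ` el A" using f(2) that by (simp add: bij_betw_def)
   then obtain x where "x : el A" "ap f x = y" by blast
   moreover have "inj_on (ap f) (el A)" using f(2) by (simp add: bij_betw_def)
   ultimately show ?thesis by (intro ex1I[of _ x]) (auto dest: inj_onD)
  qed
 qed (intro dfns)
 then obtain g where g: "fn g B" "!!y. y : el B ==> ap g y : el A & ap f (ap g y) = y" by blast
 have "bij_betw (ap g) (el B) (el A)"
 proof (rule bij_betw_byWitness[where f'="ap f"])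
  have "ap g (ap f x) = x" if "x : el A" for x
   using f that g(2)[OF isf_in[OF f(1) that]] by (auto simp: bij_betw_def inj_on_def)
  then show "ALL x:el A. ap g (ap f x) = x" by blast
 qed (use g isf_in[OF f(1)] in auto)
 then show ?thesis using g by (auto simp: eqp_def isf_iff_fn)
qed

lemma cantor_bernstein:
 assumes "lep A B" "lep B A" shows "eqp A B"
proof -
 obtain f where f: "isf f A B" "inj_on (ap f) (el A)" using assms(1) by (auto simp: lep_def)
 obtain g where g: "isf g B A" "inj_on (ap g) (el B)" using assms(2) by (auto simp: lep_def)
 define cl where "cl Z \<longleftrightarrow> (ALL x:el A. (ALL y:el B. ap g y ~= x) --> x : el Z) & (ALL x:el Z. ap g (ap f x) : el Z)" for Z
 have dcl: "dt t ==> dfn (%v. cl (t v))" for t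
  by (rule dfn_comp1[where P=cl]; (assumption | (unfold cl_def, intro dfns)))
 have clA: "cl A" using isf_in[OF f(1)] isf_in[OF g(1)] by (auto simp: cl_def)
 \<comment> \<open>\<open>D\<close> is the least part of \<open>A\<close> containing what
   \<open>g\<close> does not reach and closed under \<open>g\<close> after \<open>f\<close>. The
   bijection is \<open>f\<close> on \<open>D\<close> and the inverse of \<open>g\<close>
   elsewhere.\<close>
 define D where "D = {x : el A. ALL Z. cl Z --> x : el Z}"
 have sD: "S D" unfolding D_def by (rule S_Collect[OF S_el]) (intro dfns dcl)
 have D1: "x : D" if "x : el A" "ALL y:el B. ap g y ~= x" for x using that by (auto simp: D_def cl_def)
 have D2: "ap g (ap f x) : D" if "x : D" for x
  using that isf_in[OF f(1)] isf_in[OF g(1)] by (auto simp: D_def cl_def)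
 have D3: "EX x':D. x = ap g (ap f x')" if x: "x : D" and y: "y : el B" "ap g y = x" for x y
 proof (rule ccontr)
  assume no: "~ ?thesis"
  have s: "S (D - {x})" by (rule S_Diff[OF sD]) simp
  have "cl (mk (D - {x}))" unfolding cl_def el_mk[OF s] using D1 D2 no y by auto
  then have "x : D - {x}" using x by (auto simp: D_def el_mk[OF s, unfolded D_def])
  then show False by simp
 qed
 have "EX h. fn h A & (ALL x:el A. ap h x : el B & (x : D --> ap h x = ap f x) & (x ~: D --> ap g (ap h x) = x))"
 proof (rule fun_of_rel)
  show "EX! y. y : el B & (x : D --> y = ap f x) & (x ~: D --> ap g y = x)" if "x : el A" for x
   using that isf_in[OF f(1)] D1[OF that] g(2) by (cases "x : D") (auto simp: inj_on_def)
 qed (intro dfns dfn_S[OF sD])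
 then obtain h where h: "fn h A" "!!x. x : el A ==> ap h x : el B"
  "!!x. x : el A ==> x : D ==> ap h x = ap f x" "!!x. x : el A ==> x ~: D ==> ap g (ap h x) = x" by blast
 have DA: "x : el A" if "x : D" for x using that by (auto simp: D_def)
 have "inj_on (ap h) (el A)"
 proof (rule inj_onI)
  fix x y assume xy: "x : el A" "y : el A" "ap h x = ap h y"
  have *: False if "a : el A" "b : el A" "a : D" "b ~: D" "ap h a = ap h b" for a b
   using D2[OF that(3)] that h by metis
  show "x = y"
  proof (cases "x : D")
   case True
   then have "y : D" using * xy by blast
   then show ?thesis using True xy h(3) f(2) by (metis inj_onD)
  next
   case False
   then have "y ~: D" using *[of y x] xy by auto
   then show ?thesis using False xy h(4) by metis
  qed
 qed
 moreover have "y : ap h ` el A" if y: "y : el B" for y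
 proof (cases "ap g y : D")
  case True
  then obtain x where x: "x : D" "ap g y = ap g (ap f x)" using D3[OF True y refl] by blast
  then have "y = ap f x" using g(2) y isf_in[OF f(1) DA[OF x(1)]] by (auto simp: inj_on_def)
  then show ?thesis using x(1) h(3) DA by (metis imageI)
 next
  case False
  have a: "ap g y : el A" using isf_in[OF g(1) y] .
  then have "ap h (ap g y) = y" using h(2,4)[OF a] False g(2) y by (auto simp: inj_on_def)
  then show ?thesis using a by force
 qed
 ultimately have "bij_betw (ap h) (el A) (el B)" using h(2) by (auto simp: bij_betw_def)
 then show ?thesis using h(1,2) by (auto simp: eqp_def isf_iff_fn)
qed

lemma cantor: "~ cov A (pw A)"
proof
 assume "cov A (pw A)"
 then obtain f where f: "el (pw A) <= ap f ` el A" by (auto simp: cov_def)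
 have "S {x : el A. x ~: el (ap f x)}" by (rule S_Collect) (auto intro!: dfns)
 then obtain d where d: "el d = {x : el A. x ~: el (ap f x)}" by (auto simp: S_def)
 then have "d : el (pw A)" by auto
 then show False using f d by blast
qed

text \<open>The antidiagonals are walked through: from (i + 1, j) to (i, j + 1), and from (0, j) to
  (j + 1, 0). The orbit of \<open>nx\<close> plays the part of a pairing polynomial.\<close>

lemma countable_square: "cov om (tms om om)"
proof -
 define nx where "nx z = (if fst' z = emp then pr (sc (snd' z)) emp else pr (un (fst' z)) (sc (snd' z)))" for z
 have dn: "dt (%v. nx (v 0))" unfolding nx_def by (intro dfns)
 obtain f where f: "ap f emp = pr emp emp" "!!n. n : el om ==> ap f (sc n) = nx (ap f n)"
  using om_rec[OF dn] by blast
 define Rch where "Rch i j \<longleftrightarrow> (EX n:el om. ap f n = pr i j)" for i j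
 have dR: "dt t ==> dt u ==> dfn (%v. Rch (t v) (u v))" for t u
  by (rule dfn_comp2[where P=Rch]; (assumption | (unfold Rch_def, intro dfns)))
 have un_sc: "un (sc i) = i" if "i : el om" for i
  by (rule eqI) (use om_trans_el[OF that] in \<open>auto simp: trans_def\<close>)
 have nx: "EX n:el om. ap f n = nx (pr i j)" if "Rch i j" for i j
  using that f(2) sc_om unfolding Rch_def by metis
 have step: "Rch i (sc j)" if "Rch (sc i) j" "i : el om" for i j
 proof -
  have "sc i ~= emp" unfolding el_inject[symmetric] by simp
  then have "nx (pr (sc i) j) = pr i (sc j)" by (simp add: nx_def un_sc[OF that(2)])
  then show ?thesis using nx[OF that(1)] by (simp add: Rch_def)
 qed
 have turn: "Rch (sc j) emp" if "Rch emp j" for j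
  using nx[OF that] by (simp add: Rch_def nx_def)
 \<comment> \<open>\<open>Sm i j c\<close> expresses i + j = c, through a function that counts
   upwards from \<open>i\<close>.\<close>
 define Sm where "Sm i j c \<longleftrightarrow> i : el om & (EX g. ap g emp = i & (ALL n:el om. ap g (sc n) = sc (ap g n)) & ap g j = c)" for i j c
 have Sm_step: "Sm (sc i) j c" if sm: "Sm i (sc j) c" and jo: "j : el om" for i j c
 proof -
  obtain g where g: "i : el om" "ap g emp = i" "!!n. n : el om ==> ap g (sc n) = sc (ap g n)" "ap g (sc j) = c"
   using sm unfolding Sm_def by blast
  have d: "dt (%v. sc (ap g (v 0)))" by (intro dfns)
  have "ap (lam om (%n. sc (ap g n))) n = sc (ap g n)" if "n : el om" for n by (rule ap_lam[OF d that])
  then show ?thesis using g jo unfolding Sm_def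
   by (intro conjI exI[of _ "lam om (%n. sc (ap g n))"]) auto
 qed
 have row0: "Rch c emp" if "c : el om" for c
 proof (rule om_induct[OF that])
  show "dfn (%v. Rch (v 0) emp)" by (intro dfns dR)
  show "Rch emp emp" using f(1) zero_om unfolding Rch_def by blast
  fix c assume c: "c : el om" "Rch c emp"
  have "ALL i. Sm i j c --> Rch i j" if "j : el om" for j
  proof (rule om_induct[OF that])
   show "dfn (%v. ALL i. Sm i (v 0) c --> Rch i (v 0))" unfolding Sm_def by (intro dfns dR)
   show "ALL i. Sm i emp c --> Rch i emp" using c(2) by (auto simp: Sm_def)
   fix j assume j: "j : el om" "ALL i. Sm i j c --> Rch i j"
   show "ALL i. Sm i (sc j) c --> Rch i (sc j)"
    using Sm_step[OF _ j(1)] j(2) step unfolding Sm_def by blast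
  qed
  moreover have "Sm emp c c" unfolding Sm_def
  proof (intro conjI exI[of _ "lam om (%n. n)"] ballI)
   have i: "ap (lam om (%n. n)) n = n" if "n : el om" for n by (rule ap_lam[OF dt_proj that])
   show "ap (lam om (%n. n)) emp = emp" "ap (lam om (%n. n)) c = c" using i c by auto
   show "ap (lam om (%n. n)) (sc n) = sc (ap (lam om (%n. n)) n)" if "n : el om" for n
    using i[OF that] i[OF sc_om[OF that]] by simp
  qed simp
  ultimately show "Rch (sc c) emp" using turn c(1) by blast
 qed
 have "ALL i:el om. Rch i j" if "j : el om" for j
 proof (rule om_induct[OF that])
  show "dfn (%v. ALL i:el om. Rch i (v 0))" by (intro dfns dR)
  show "ALL i:el om. Rch i emp" using row0 by blast
  show "ALL i:el om. Rch i (sc n)" if "n : el om" "ALL i:el om. Rch i n" for n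
   using that step by (meson sc_om)
 qed
 then have "el (tms om om) <= ap f ` el om" unfolding Rch_def by force
 then show ?thesis by (auto simp: cov_def)
qed

text \<open>Currying: a function from \<open>B\<close> to subsets of \<open>A\<close> is a subset of
  \<open>A\<close> times \<open>B\<close>, and such a subset is coded by a subset of
  \<open>A\<close> through the given covering.\<close>

lemma cov_pw_fs:
 assumes "cov A (tms A B)" shows "cov (pw A) (fs B (pw A))"
proof -
 obtain g where g: "el (tms A B) <= ap g ` el A" using assms by (auto simp: cov_def)
 have s: "S {a. a : el A & (EX k:el X. ap g k = pr a b)}" for b X
  by (rule S_sub[OF S_el[of A]]) (auto intro!: dfns)
 define F where "F X = lam B (%b. mk {a. a : el A & (EX k:el X. ap g k = pr a b)})" for X
 have d1: "dt (%v. mk {a. a : el A & (EX k:el X. ap g k = pr a (v 0))})" for X by (rule dt_mk, rule s, intro dfns)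
 have d2: "dt (%v. mk {a. a : el A & (EX k:el (v 1). ap g k = pr a (v 0))})" by (rule dt_mk, rule s, intro dfns)
 have d: "dt (%v. F (v 0))" unfolding F_def by (intro dfns) (use d2 in simp)
 show ?thesis
 proof (rule covI[OF d], rule subsetI)
  fix f assume "f : el (fs B (pw A))"
  then have f: "isf f B (pw A)" by simp
  have "S {k : el A. EX a:el A. EX b:el B. ap g k = pr a b & a : el (ap f b)}" by (rule S_Collect) (auto intro!: dfns)
  then obtain X where X: "el X = {k : el A. EX a:el A. EX b:el B. ap g k = pr a b & a : el (ap f b)}" by (auto simp: S_def)
  have "mk {a. a : el A & (EX k:el X. ap g k = pr a b)} = ap f b" if b: "b : el B" for b
  proof (rule eqI, unfold el_mk[OF s], safe)
   show "a : el (ap f b)" if "k : el X" "ap g k = pr a b" for a k using that X by auto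
   fix a assume a: "a : el (ap f b)"
   then show aA: "a : el A" using isf_in[OF f b] by auto
   then have "pr a b : ap g ` el A" using g b by auto
   then show "EX k:el X. ap g k = pr a b" using X a aA b by force
  qed
  then have "F X = lam B (ap f)" unfolding F_def by (rule lam_cong)
  then show "f : F ` el (pw A)" using isf_eta[OF f] X by (intro image_eqI[of _ _ X]) auto
 qed
qed

end

section \<open>Consequences of choice\<close>

context zfc
begin

text \<open>The axiom speaks of disjoint families, so the candidates for \<open>x\<close> are made
  disjoint from the others by pairing them with \<open>x\<close>.\<close>

lemma ac:
 assumes dR0: "dfn (%v. R (v 0) (v 1))" and ex: "!!x. x : el A ==> EX y:el B. R x y"
 shows "EX f. isf f A B & (ALL x:el A. R x (ap f x))"
proof -
 have dR: "dt t ==> dt u ==> dfn (%v. R (t v) (u v))" for t u by (rule dfn_comp2[OF dR0])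
 define F where "F x = mk {z. EX y:el B. z = pr x y & R x y}" for x
 have s: "S {z. EX y:el B. z = pr x y & R x y}" for x
  by (rule S_sub[OF S_el[of "tms (ins x emp) B"]]) (auto intro!: dfns dR)
 have eF: "el (F x) = {z. EX y:el B. z = pr x y & R x y}" for x by (simp add: F_def el_mk[OF s])
 have dF: "dt (%v. F (v 0))" unfolding F_def by (rule dt_mk, rule s, intro dfns dR)
 obtain X where X: "el X = F ` el A" using S_img[OF S_el[of A] dF] unfolding S_def by blast
 have "EX c. ALL y. E y X --> (EX! u. E u y & E u c)"
 proof (rule choice)
  show "ALL y. E y X --> (EX u. E u y)"
  proof (intro allI impI)
   fix y assume "E y X"
   then obtain x where x: "x : el A" "y = F x" using X by (auto simp: el_def)
   then obtain z where "z : el y" using ex[OF x(1)] eF by blast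
   then show "EX u. E u y" by (auto simp: el_def)
  qed
  show "ALL y z. E y X & E z X & (EX u. E u y & E u z) --> y = z"
  proof (intro allI impI)
   fix y z assume "E y X & E z X & (EX u. E u y & E u z)"
   then obtain u where "y : el X" "z : el X" and u: "u : el y" "u : el z" by (auto simp: el_def)
   then obtain x x' where "y = F x" "z = F x'" using X by blast
   then show "y = z" using eF u by auto
  qed
 qed
 then obtain c where c: "!!y. y : el X ==> EX! u. u : el y & u : el c" by (auto simp: el_def)
 have "EX f. fn f A & (ALL x:el A. ap f x : el B & R x (ap f x) & pr x (ap f x) : el c)"
 proof (rule fun_of_rel)
  show "EX! y. y : el B & R x y & pr x y : el c" if xA: "x : el A" for x
  proof -
   obtain u where u: "u : el (F x)" "u : el c" "!!w. w : el (F x) ==> w : el c ==> w = u"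
   proof -
    have "F x : el X" using X xA by blast
    from c[OF this] show thesis
    proof (rule ex1E)
     fix u assume a: "u : el (F x) & u : el c" "ALL y. y : el (F x) & y : el c --> y = u"
     show thesis by (rule that[of u]) (use a in blast)+
    qed
   qed
   then obtain y where "u = pr x y" "y : el B" "R x y" using eF by blast
   moreover from this have "y' = y" if "y' : el B" "R x y'" "pr x y' : el c" for y'
    using u(3)[of "pr x y'"] that eF by auto
   ultimately show ?thesis using u(2) by blast
  qed
 qed (intro dfns dR)
 then show ?thesis unfolding isf_iff_fn by blast
qed

lemma ac_class:
 assumes "dfn (%v. R (v 0) (v 1))" and ex: "!!x. x : el A ==> EX y. R x y"
 shows "EX f. fn f A & (ALL x:el A. R x (ap f x))"
proof -
 obtain B where "ALL x:el A. (EX y. R x y) --> (EX y:el B. R x y)" using collection[OF assms(1)] by blast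
 then obtain f where "isf f A B & (ALL x:el A. R x (ap f x))" using ac[OF assms(1), of A B] ex by blast
 then show ?thesis by (auto simp: isf_iff_fn)
qed

lemma cov_right_inverse: "el B <= ap f ` el A ==> EX g. isf g B A & (ALL y:el B. ap f (ap g y) = y)"
proof (rule ac)
 show "dfn (%v. ap f (v 1) = v 0)" by (intro dfns)
 show "!!y. el B <= ap f ` el A ==> y : el B ==> EX x:el A. ap f x = y" by blast
qed

lemma cov_lep: "cov A B ==> lep B A"
proof -
 assume "cov A B"
 then obtain f g where "isf g B A" "ALL y:el B. ap f (ap g y) = y"
  using cov_right_inverse unfolding cov_def by blast
 then show ?thesis unfolding lep_def by (metis inj_on_inverseI)
qed

lemma lep_iff_cov: "lep B A \<longleftrightarrow> cov A B" using cov_lep lep_cov by blast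

lemma cov_antisym: "cov A B ==> cov B A ==> eqp A B"
 using cov_lep cantor_bernstein by blast

text \<open>Elements not yet reached are chosen along the ordinals. If \<open>X\<close> were never
  exhausted, \<open>H\<close> would be injective on the ordinals, and its inverse would map
  \<open>X\<close> onto a set containing all of them.\<close>

lemma well_ordering: "EX a f. Ord a & isf f a X & bij_betw (ap f) (el a) (el X)"
proof -
 have "EX f. isf f (df (pw X) (ins emp emp)) X & (ALL Y:el (df (pw X) (ins emp emp)). ap f Y : el Y)"
 proof (rule ac)
  fix Y assume "Y : el (df (pw X) (ins emp emp))"
  then have "el Y <= el X" "el Y ~= {}" using el_inject[of Y emp] by auto
  then show "EX y:el X. y : el Y" by blast
 qed (intro dfns)
 then obtain ch where "ALL Y:el (df (pw X) (ins emp emp)). ap ch Y : el Y" by blast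
 then have ch: "ap ch Y : el Y" if "el Y <= el X" "el Y ~= {}" for Y using that by auto
 define F where "F Y = ap ch (df X Y)" for Y
 have "dt (%v. F (v 0))" unfolding F_def by (intro dfns)
 then obtain H where dH0: "dt (%v. H (v 0))" and H: "!!x. H x = F (mk (H ` el x))" using eps_rec by blast
 have dH: "dt t ==> dt (%v. H (t v))" for t by (rule dt_comp1[OF dH0])
 have Hin: "H a : el X - H ` el a" if "~ el X <= H ` el a" for a
 proof -
  let ?Y = "mk (H ` el a)"
  have "el (df X ?Y) = el X - H ` el a" by (simp add: el_mk S_img dH0)
  then have "ap ch (df X ?Y) : el X - H ` el a" using ch[of "df X ?Y"] that by auto
  then show ?thesis using H[of a] by (simp add: F_def)
 qed
 have "EX a. Ord a & el X <= H ` el a"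
 proof (rule ccontr)
  assume no: "~ ?thesis"
  have inj: "a = b" if "Ord a" "Ord b" "H a = H b" for a b
   using Ord_linear[OF that(1,2)] Hin[of a] Hin[of b] no that by (metis Diff_iff imageI)
  have "EX f. fn f X & (ALL x:el X. (Ord (ap f x) & H (ap f x) = x) | ((ALL a. Ord a --> H a ~= x) & ap f x = emp))"
  proof (rule fun_of_rel)
   show "EX! a. (Ord a & H a = x) | ((ALL a. Ord a --> H a ~= x) & a = emp)" for x using inj by blast
  qed (intro dfns dH)
  then obtain f where f: "!!x. x : el X ==> (Ord (ap f x) & H (ap f x) = x) | (ALL a. Ord a --> H a ~= x)" by blast
  obtain b where b: "Ord b" "b ~: el (img f X)" using no_Ord_set by blast
  have "H b : el X" using Hin[of b] b no by blast
  then have "ap f (H b) = b" using f b inj by blast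
  then show False using b \<open>H b : el X\<close> by force
 qed
 moreover have dX: "dfn (%v. el X <= H ` el (v 0))" unfolding subset_iff image_iff by (intro dfns dH)
 ultimately obtain a where a: "Ord a" "el X <= H ` el a" "ALL b. Ord b --> el X <= H ` el b --> el a <= el b"
  using Ord_least[OF dX] by blast
 have Hb: "H b : el X - H ` el b" if "b : el a" for b
  using Hin[of b] a(3) Ord_elem[OF a(1) that] that mem_irrefl by blast
 have "inj_on H (el a)"
 proof (rule inj_onI)
  fix x y assume "x : el a" "y : el a" "H x = H y"
  then show "x = y" using Ord_linear[of x y] Ord_elem[OF a(1)] Hb by (metis Diff_iff imageI)
 qed
 then have "bij_betw H (el a) (el X)" using a(2) Hb by (auto simp: bij_betw_def)
 then have "eqp a X" by (rule eqpI[OF dH0])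
 then show ?thesis using a(1) by (auto simp: eqp_def)
qed

lemma card_ex: "EX c. Card c & eqp X c"
proof -
 obtain a where "Ord a" "eqp a X" using well_ordering[of X] by (auto simp: eqp_def)
 moreover have "dfn (%v. eqp (v 0) X)" by (intro dfns)
 ultimately obtain c where c: "Ord c" "eqp c X" "ALL b. Ord b --> eqp b X --> el c <= el b"
  using Ord_least[of "%a. eqp a X"] by blast
 have "~ eqp b c" if b: "b : el c" for b
  using c(3) eqp_trans[OF _ c(2), of b] Ord_elem[OF c(1) b] b mem_irrefl by blast
 then show ?thesis using c eqp_sym by (auto simp: Card_def)
qed

lemma Card_cov: assumes "Card c" "Ord b" "cov b c" shows "el c <= el b"
proof (rule ccontr)
 assume "~ ?thesis"
 then have b: "b : el c" using Ord_not_mem[of b c] assms by (auto simp: Card_def)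
 then have "el b <= el c" using assms(1) Ord_elem_sub by (auto simp: Card_def)
 then have "eqp b c" using assms(3) cov_sub cov_antisym by blast
 then show False using assms(1) b by (auto simp: Card_def)
qed

lemma cov_UN:
 assumes dF: "dt (%v. F (v 0))" and "!!x. x : el X ==> cov A (F x)"
 shows "cov (tms X A) (mk (UN x:el X. el (F x)))"
proof -
 note dF' = dt_comp1[OF dF]
 have "EX f. fn f X & (ALL x:el X. el (F x) <= ap (ap f x) ` el A)"
 proof (rule ac_class)
  show "dfn (%v. el (F (v 0)) <= ap (v 1) ` el A)" unfolding subset_iff image_iff by (intro dfns dF')
  show "EX g. el (F x) <= ap g ` el A" if "x : el X" for x using assms(2)[OF that] by (simp add: cov_def)
 qed
 then obtain f where f: "!!x. x : el X ==> el (F x) <= ap (ap f x) ` el A" by blast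
 show ?thesis
 proof (rule covI[of "%z. ap (ap f (fst' z)) (snd' z)"])
  show "el (mk (UN x:el X. el (F x))) <= (%z. ap (ap f (fst' z)) (snd' z)) ` el (tms X A)"
  proof
   fix y assume "y : el (mk (UN x:el X. el (F x)))"
   then obtain x where x: "x : el X" "y : el (F x)" by (auto simp: el_mk S_UN dF)
   then obtain a where "a : el A" "y = ap (ap f x) a" using f by blast
   then show "y : (%z. ap (ap f (fst' z)) (snd' z)) ` el (tms X A)"
    using x by (intro image_eqI[of _ _ "pr x a"]) auto
  qed
 qed (intro dfns)
qed

lemma cov_fs:
 assumes "cov C D" "cov B' B" and d: "d : el D" shows "cov (fs B' C) (fs B D)"
proof -
 obtain e where e: "el D <= ap e ` el C" using assms(1) by (auto simp: cov_def)
 then obtain e' where e': "isf e' D C" "ALL y:el D. ap e (ap e' y) = y" using cov_right_inverse by blast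
 obtain s where s: "el B <= ap s ` el B'" using assms(2) by (auto simp: cov_def)
 then obtain r where r: "isf r B B'" "ALL y:el B. ap s (ap r y) = y" using cov_right_inverse by blast
  have d1: "dt (%v. lam B (%b. ap e (ap (v 0) (ap r b))))" by (intro dfns)
  show ?thesis
  proof (rule covI[OF d1], rule subsetI)
   fix f assume "f : el (fs B D)"
   then have f: "isf f B D" by simp
   define h where "h x = (if ap s x : el B then ap e' (ap f (ap s x)) else ap e' d)" for x
   have dh: "dt (%v. h (v 0))" unfolding h_def by (intro dfns)
   have "isf (lam B' h) B' C" by (rule isfI[OF dh]) (auto simp: h_def intro!: isf_in[OF e'(1)] isf_in[OF f] d)
   moreover have "ap e (ap (lam B' h) (ap r b)) = ap f b" if "b : el B" for b
   proof -
    have "ap (lam B' h) (ap r b) = h (ap r b)" by (rule ap_lam[OF dh isf_in[OF r(1) that]])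
    then show ?thesis using r(2) e'(2) that isf_in[OF f that] by (simp add: h_def)
   qed
   then have "lam B (%b. ap e (ap (lam B' h) (ap r b))) = lam B (ap f)" by (rule lam_cong)
   ultimately show "f : (%h. lam B (%b. ap e (ap h (ap r b)))) ` el (fs B' C)"
    using isf_eta[OF f] by (intro image_eqI[of _ _ "lam B' h"]) auto
  qed
qed

lemma cov_pair_fs: assumes "cov C (fs B C)" "x : el B" "y : el B" "x ~= y" shows "cov C (tms C C)"
proof (rule cov_trans[OF assms(1)])
 show "cov (fs B C) (tms C C)"
 proof (rule covI[of "%f. pr (ap f x) (ap f y)"], intro dfns, rule subsetI)
  fix z assume "z : el (tms C C)"
  then obtain a b where z: "a : el C" "b : el C" "z = pr a b" by auto
  define h where "h t = (if t = x then a else b)" for t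
  have d: "dt (%v. h (v 0))" unfolding h_def by (intro dfns)
  have "isf (lam B h) B C" by (rule isfI[OF d]) (use z in \<open>auto simp: h_def\<close>)
  moreover have "ap (lam B h) x = a" "ap (lam B h) y = b"
   using assms by (auto simp: ap_lam[OF d] h_def)
  ultimately show "z : (%f. pr (ap f x) (ap f y)) ` el (fs B C)"
   using z(3) by (intro image_eqI[of _ _ "lam B h"]) auto
 qed
qed

text \<open>The first uncountable ordinal, as the least ordinal that \<^term>\<open>om\<close> does not cover.\<close>

lemma uncountable_ordinal:
 "EX \<Omega>. Ord \<Omega> & \<Omega> ~= emp & (ALL \<beta>:el \<Omega>. sc \<beta> : el \<Omega>) & cov (pw om) \<Omega> &
  (ALL f. (ALL n:el om. ap f n : el \<Omega>) --> (EX \<beta>:el \<Omega>. ALL n:el om. ap f n : el \<beta>))"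
proof -
 obtain a where a: "Ord a" "eqp a (pw om)" using well_ordering[of "pw om"] by (auto simp: eqp_def)
 have "~ cov om a" using cantor cov_trans[OF _ eqp_cov[OF a(2)]] by blast
 moreover have "dfn (%v. ~ cov om (v 0))" by (intro dfns)
 ultimately obtain W where W: "Ord W" "~ cov om W" "ALL b. Ord b --> ~ cov om b --> el W <= el b"
  using Ord_least[of "%a. ~ cov om a"] a(1) by blast
 have cb: "cov om b" if "b : el W" for b
  using W(3) Ord_elem[OF W(1) that] that mem_irrefl by blast
 have cW: "cov (pw om) W"
  using W(3) a \<open>~ cov om a\<close> by (meson cov_sub cov_trans eqp_cov eqp_sym)
 \<comment> \<open>Regularity of the first uncountable ordinal: countably many countable ordinals
   have a countable union.\<close>
 have bound: "EX \<beta>:el W. ALL n:el om. ap f n : el \<beta>" if f: "ALL n:el om. ap f n : el W" for f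
 proof -
  let ?F = "%n. sc (ap f n)" let ?u = "mk (UN n:el om. el (?F n))"
  have d: "dt (%v. ?F (v 0))" by (intro dfns)
  have eu: "el ?u = (UN n:el om. el (?F n))" by (rule el_mk[OF S_UN[OF S_el d]])
  have sF: "S (?F ` el om)" by (rule S_img[OF S_el d])
  have "?u = un (mk (?F ` el om))" by (rule eqI) (simp only: eu el_un el_mk[OF sF], simp)
  moreover have "Ord (un (mk (?F ` el om)))"
   by (rule Ord_un, unfold el_mk[OF sF]) (use f Ord_elem[OF W(1)] Ord_sc in auto)
  ultimately have o: "Ord ?u" by simp
  have "cov om (?F n)" if "n : el om" for n
  proof -
   have "cov om (ap f n)" using cb f that by blast
   then obtain g where g: "el (ap f n) <= ap g ` el om" by (auto simp: cov_def)
   define h where "h m = (if m = emp then ap f n else ap g (un m))" for m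
   have dh: "dt (%v. h (v 0))" unfolding h_def by (intro dfns)
   show ?thesis
   proof (rule covI[OF dh], rule subsetI)
    fix x assume "x : el (?F n)"
    then consider "x = ap f n" | m where "m : el om" "x = ap g m" using g by auto
    then show "x : h ` el om"
    proof cases
     case 1 then show ?thesis by (intro image_eqI[of _ _ emp]) (auto simp: h_def)
    next
     case 2
     have "un (sc m) = m" by (rule eqI) (use om_trans_el[OF 2(1)] in \<open>auto simp: trans_def\<close>)
     moreover have "sc m ~= emp" unfolding el_inject[symmetric] by simp
     ultimately show ?thesis using 2 by (intro image_eqI[of _ _ "sc m"]) (auto simp: h_def)
    qed
   qed
  qed
  then have "cov (tms om om) ?u" by (rule cov_UN[OF d])
  then have "cov om ?u" using countable_square cov_trans by blast
  then have "?u : el W" using W(1,2) o Ord_not_mem cov_sub cov_trans by blast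
  then show ?thesis using eu by (intro bexI[of _ ?u]) auto
 qed
 have "emp : el W"
 proof -
  have "W ~= emp" using W(2) cov_sub[of emp om] by auto
  then show ?thesis using Ord_linear[OF W(1) Ord_emp] by auto
 qed
 \<comment> \<open>Closure under successors is the boundedness of a constant sequence.\<close>
 moreover have "sc \<beta> : el W" if "\<beta> : el W" for \<beta>
 proof -
  have c: "ap (lam om (%_. \<beta>)) n = \<beta>" if "n : el om" for n by (rule ap_lam[OF dt_const that])
  then have "EX \<gamma>:el W. ALL n:el om. ap (lam om (%_. \<beta>)) n : el \<gamma>" using bound[of "lam om (%_. \<beta>)"] that by simp
  then have "EX \<gamma>:el W. \<beta> : el \<gamma>" using c zero_om by metis
  then obtain \<gamma> where "\<gamma> : el W" "\<beta> : el \<gamma>" by blast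
  moreover have "Ord \<beta>" "Ord \<gamma>" using Ord_elem[OF W(1)] that calculation by auto
  ultimately show ?thesis
   using Ord_not_mem[of \<gamma> "sc \<beta>"] Ord_sc[of \<beta>] Ord_sub_iff[of "sc \<beta>" \<gamma>] Ord_trans[OF W(1)] mem_asym
    Ord_linear[of "sc \<beta>" \<gamma>] mem_irrefl by (metis el_ins insertE)
 qed
 ultimately show ?thesis using W(1) cW bound by (intro exI[of _ W]) auto
qed

end

section \<open>Forcing over an arbitrary model\<close>

section \<open>The forcing relation\<close>

text \<open>Conditions are the elements of \<^term>\<open>P\<close>, ordered by reverse inclusion. Every set is a name;
 only its elements of the form \<^term>\<open>pr \<sigma> r\<close> with \<^term>\<open>r \<in> el P\<close> matter.\<close>

locale forcing = zfc +
 fixes P :: 'a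
 assumes emp_P: "emp : el P"
begin

definition le :: "'a => 'a => bool" where "le q p \<longleftrightarrow> q : el P & el p <= el q"

lemma dfn_le [dfns]: "dt t ==> dt u ==> dfn (%v. le (t v) (u v))"
 by (rule dfn_comp2[where P=le]; (assumption | (unfold le_def, intro dfns)))
lemma le_refl: "p : el P ==> le p p" by (simp add: le_def)
lemma le_trans: "le r q ==> le q p ==> le r p" by (auto simp: le_def)
lemma le_P: "le q p ==> q : el P" by (simp add: le_def)

definition nm :: "'a => 'a => 'a => bool" where "nm \<tau> \<pi> r \<longleftrightarrow> pr \<pi> r : el \<tau> & r : el P"
lemma dfn_nm [dfns]: "dt t ==> dt u ==> dt w ==> dfn (%v. nm (t v) (u v) (w v))"
 by (rule dfn_comp3[where P=nm]; (assumption | (unfold nm_def, intro dfns)))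

abbreviation tr :: "'a => 'a => 'a => 'a" where "tr p \<sigma> \<tau> == pr p (pr \<sigma> \<tau>)"

text \<open>Equality of names is forced when some set of triples is a bisimulation; by Foundation this
 greatest fixed point is the usual recursion, which is thereby avoided.\<close>

definition bis :: "'a => bool" where
 "bis W \<longleftrightarrow> (ALL p \<sigma> \<tau>. tr p \<sigma> \<tau> : el W --> p : el P &
  (ALL \<pi> r q. nm \<sigma> \<pi> r --> le q p --> le q r --> (EX q' \<pi>' r'. le q' q & nm \<tau> \<pi>' r' & le q' r' & tr q' \<pi> \<pi>' : el W)) &
  (ALL \<pi>' r' q. nm \<tau> \<pi>' r' --> le q p --> le q r' --> (EX q' \<pi> r. le q' q & nm \<sigma> \<pi> r & le q' r & tr q' \<pi> \<pi>' : el W)))"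

definition EQ :: "'a => 'a => 'a => bool" where
 "EQ p \<sigma> \<tau> \<longleftrightarrow> (EX W. bis W & tr p \<sigma> \<tau> : el W)"

lemma dfn_EQ [dfns]: "dt t ==> dt u ==> dt w ==> dfn (%v. EQ (t v) (u v) (w v))"
 by (rule dfn_comp3[where P=EQ]; (assumption | (unfold EQ_def bis_def, intro dfns)))

definition EQstep :: "'a => 'a => 'a => bool" where
 "EQstep p \<sigma> \<tau> \<longleftrightarrow> p : el P &
  (ALL \<pi> r q. nm \<sigma> \<pi> r --> le q p --> le q r --> (EX q' \<pi>' r'. le q' q & nm \<tau> \<pi>' r' & le q' r' & EQ q' \<pi> \<pi>')) &
  (ALL \<pi>' r' q. nm \<tau> \<pi>' r' --> le q p --> le q r' --> (EX q' \<pi> r. le q' q & nm \<sigma> \<pi> r & le q' r & EQ q' \<pi> \<pi>'))"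

lemma nm_trans: "trans A ==> \<sigma> : el A ==> nm \<sigma> \<pi> r ==> \<pi> : el A"
proof -
 assume A: "trans A" and s: "\<sigma> : el A" and n: "nm \<sigma> \<pi> r"
 have 1: "pr \<pi> r : el A" using A s n by (auto simp: nm_def trans_def)
 have "up \<pi> \<pi> : el (pr \<pi> r)" by (simp add: pr_def)
 then have 2: "up \<pi> \<pi> : el A" using A 1 by (auto simp: trans_def)
 have "\<pi> : el (up \<pi> \<pi>)" by simp
 then show "\<pi> : el A" using A 2 by (auto simp: trans_def)
qed

text \<open>All bisimulations together do not form a set. Hence only triples of names from a
  transitive set containing both names are collected; adjoining the triple in question gives a
  bisimulation again, because subnames stay inside the transitive set.\<close>

lemma EQ_iff: "EQ p \<sigma> \<tau> \<longleftrightarrow> EQstep p \<sigma> \<tau>"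
proof
 assume "EQ p \<sigma> \<tau>"
 then obtain W where W: "bis W" "tr p \<sigma> \<tau> : el W" by (auto simp: EQ_def)
 have "EQ q \<pi> \<pi>'" if "tr q \<pi> \<pi>' : el W" for q \<pi> \<pi>' using W(1) that by (auto simp: EQ_def)
 then show "EQstep p \<sigma> \<tau>" using W(1)[unfolded bis_def, rule_format, OF W(2)] unfolding EQstep_def by meson
next
 assume st: "EQstep p \<sigma> \<tau>"
 obtain A0 where A0: "trans A0" "pr \<sigma> \<tau> : el A0" using trans_superset by blast
 have "up \<sigma> \<tau> : el (pr \<sigma> \<tau>)" by (simp add: pr_def)
 then have "up \<sigma> \<tau> : el A0" using A0 by (auto simp: trans_def)
 then have A: "\<sigma> : el A0" "\<tau> : el A0" using A0(1) by (auto simp: trans_def)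
 have s: "S {z. EX q:el P. EX x:el A0. EX y:el A0. z = tr q x y & EQ q x y}"
  by (rule S_sub[OF S_el[of "tms P (tms A0 A0)"]]) (auto intro!: dfns)
 then obtain B where B: "el B = {z. EX q:el P. EX x:el A0. EX y:el A0. z = tr q x y & EQ q x y}" by (auto simp: S_def)
 have BI: "tr q x y : el B" if "EQ q x y" "q : el P" "x : el A0" "y : el A0" for q x y using that B by auto
 let ?W = "ins (tr p \<sigma> \<tau>) B"
 have EQs: "EQstep q x y" if "EQ q x y" for q x y
 proof -
  obtain W where W: "bis W" "tr q x y : el W" using \<open>EQ q x y\<close> by (auto simp: EQ_def)
  have "EQ q \<pi> \<pi>'" if "tr q \<pi> \<pi>' : el W" for q \<pi> \<pi>' using W(1) that by (auto simp: EQ_def)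
  then show ?thesis using W(1)[unfolded bis_def, rule_format, OF W(2)] unfolding EQstep_def by meson
 qed
 have "bis ?W" unfolding bis_def
 proof (intro allI impI)
  fix q x y assume "tr q x y : el ?W"
  then have st: "EQstep q x y" and xA: "x : el A0" and yA: "y : el A0" using st EQs B A by auto
  have *: "tr q' u w : el ?W" if "EQ q' u w" "le q' r" "nm x u r1" "nm y w r2" for q' u w r r1 r2
   using BI[OF that(1) le_P[OF that(2)] nm_trans[OF A0(1) xA that(3)] nm_trans[OF A0(1) yA that(4)]] by simp
  show "q : el P &
  (ALL \<pi> r q'. nm x \<pi> r --> le q' q --> le q' r --> (EX q'' \<pi>' r'. le q'' q' & nm y \<pi>' r' & le q'' r' & tr q'' \<pi> \<pi>' : el ?W)) &
  (ALL \<pi>' r' q'. nm y \<pi>' r' --> le q' q --> le q' r' --> (EX q'' \<pi> r. le q'' q' & nm x \<pi> r & le q'' r & tr q'' \<pi> \<pi>' : el ?W))"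
   using st * unfolding EQstep_def by meson
 qed
 then show "EQ p \<sigma> \<tau>" by (auto simp: EQ_def)
qed

text \<open>A subname lies three membership steps below its name, because of the encoding of pairs;
  therefore the epsilon-induction carries the claim for two further levels.\<close>

lemma nm_induct:
 assumes d: "dfn (%v. Q (v 0))" and step: "!!\<sigma>. (!!\<pi> r. nm \<sigma> \<pi> r ==> Q \<pi>) ==> Q \<sigma>"
 shows "Q \<sigma>"
proof -
 have dQ: "dt t ==> dfn (%v. Q (t v))" for t by (rule dfn_comp1[OF d])
 have "Q \<sigma> & (ALL y:el \<sigma>. Q y) & (ALL y:el \<sigma>. ALL z:el y. Q z)"
 proof (rule eps_induct[where x=\<sigma>])
  show "dfn (%v. Q (v 0) & (ALL y:el (v 0). Q y) & (ALL y:el (v 0). ALL z:el y. Q z))" by (intro dfns dQ)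
  fix x assume IH: "!!y. y : el x ==> Q y & (ALL z:el y. Q z) & (ALL z:el y. ALL w:el z. Q w)"
  have "Q x"
  proof (rule step)
   fix \<pi> r assume n: "nm x \<pi> r"
   have "up \<pi> \<pi> : el (pr \<pi> r)" by (simp add: pr_def)
   moreover have "\<pi> : el (up \<pi> \<pi>)" by simp
   ultimately show "Q \<pi>" using IH[of "pr \<pi> r"] n unfolding nm_def by blast
  qed
  then show "Q x & (ALL y:el x. Q y) & (ALL y:el x. ALL z:el y. Q z)" using IH by blast
 qed
 then show ?thesis by blast
qed

lemmas EQ_unfold = trans[OF EQ_iff EQstep_def]

lemma EQ_P: "EQ p \<sigma> \<tau> ==> p : el P" unfolding EQ_unfold[of p \<sigma> \<tau>] by blast

lemma EQ_mono: "EQ p \<sigma> \<tau> ==> le q p ==> EQ q \<sigma> \<tau>"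
 unfolding EQ_unfold[of p \<sigma> \<tau>] EQ_unfold[of q \<sigma> \<tau>] by (meson le_P le_trans)

lemma EQ_dense: "p : el P ==> (!!q. le q p ==> EX r. le r q & EQ r \<sigma> \<tau>) ==> EQ p \<sigma> \<tau>"
proof -
 assume p: "p : el P" and d: "!!q. le q p ==> EX r. le r q & EQ r \<sigma> \<tau>"
 show ?thesis unfolding EQ_unfold[of p \<sigma> \<tau>]
 proof (intro conjI allI impI p)
  fix \<pi> r q assume a: "nm \<sigma> \<pi> r" "le q p" "le q r"
  obtain s where s: "le s q" "EQ s \<sigma> \<tau>" using d[OF a(2)] by blast
  then show "EX q' \<pi>' r'. le q' q & nm \<tau> \<pi>' r' & le q' r' & EQ q' \<pi> \<pi>'"
   using s(2)[THEN EQ_unfold[THEN iffD1]] a by (meson le_P le_refl le_trans)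
 next
  fix \<pi>' r' q assume a: "nm \<tau> \<pi>' r'" "le q p" "le q r'"
  obtain s where s: "le s q" "EQ s \<sigma> \<tau>" using d[OF a(2)] by blast
  then show "EX q' \<pi> r. le q' q & nm \<sigma> \<pi> r & le q' r & EQ q' \<pi> \<pi>'"
   using s(2)[THEN EQ_unfold[THEN iffD1]] a by (meson le_P le_refl le_trans)
 qed
qed

lemma EQ_refl: "p : el P ==> EQ p \<sigma> \<sigma>"
proof -
 have "ALL p:el P. EQ p \<sigma> \<sigma>"
 proof (rule nm_induct)
  show "dfn (%v. ALL p:el P. EQ p (v 0) (v 0))" by (intro dfns)
  fix \<sigma> assume IH: "!!\<pi> r. nm \<sigma> \<pi> r ==> ALL p:el P. EQ p \<pi> \<pi>"
  show "ALL p:el P. EQ p \<sigma> \<sigma>" unfolding EQ_unfold[of _ \<sigma> \<sigma>] using IH by (meson le_P le_refl)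
 qed
 then show "p : el P ==> EQ p \<sigma> \<sigma>" by blast
qed

lemma EQ_sym: "EQ p \<sigma> \<tau> ==> EQ p \<tau> \<sigma>"
proof -
 have "ALL p \<tau>. EQ p \<sigma> \<tau> --> EQ p \<tau> \<sigma>"
 proof (rule nm_induct)
  show "dfn (%v. ALL p \<tau>. EQ p (v 0) \<tau> --> EQ p \<tau> (v 0))" by (intro dfns)
  fix \<sigma> assume IH: "!!\<pi> r. nm \<sigma> \<pi> r ==> ALL p \<tau>. EQ p \<pi> \<tau> --> EQ p \<tau> \<pi>"
  show "ALL p \<tau>. EQ p \<sigma> \<tau> --> EQ p \<tau> \<sigma>"
  proof (intro allI impI)
   fix p \<tau> assume "EQ p \<sigma> \<tau>"
   then show "EQ p \<tau> \<sigma>" unfolding EQ_unfold[of _ \<sigma> \<tau>] EQ_unfold[of _ \<tau> \<sigma>] using IH by meson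
  qed
 qed
 then show "EQ p \<sigma> \<tau> ==> EQ p \<tau> \<sigma>" by blast
qed

lemma EQ_trans: "EQ p \<sigma> \<tau> ==> EQ p \<tau> \<rho> ==> EQ p \<sigma> \<rho>"
proof -
 have "ALL p \<tau> \<rho>. EQ p \<sigma> \<tau> --> EQ p \<tau> \<rho> --> EQ p \<sigma> \<rho>"
 proof (rule nm_induct)
  show "dfn (%v. ALL p \<tau> \<rho>. EQ p (v 0) \<tau> --> EQ p \<tau> \<rho> --> EQ p (v 0) \<rho>)" by (intro dfns)
  fix \<sigma> assume IH: "!!\<pi> r. nm \<sigma> \<pi> r ==> ALL p \<tau> \<rho>. EQ p \<pi> \<tau> --> EQ p \<tau> \<rho> --> EQ p \<pi> \<rho>"
  show "ALL p \<tau> \<rho>. EQ p \<sigma> \<tau> --> EQ p \<tau> \<rho> --> EQ p \<sigma> \<rho>"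
  proof (intro allI impI)
   fix p \<tau> \<rho> assume e: "EQ p \<sigma> \<tau>" "EQ p \<tau> \<rho>"
   note st = e(1)[THEN EQ_unfold[THEN iffD1]] and tr = e(2)[THEN EQ_unfold[THEN iffD1]]
   show "EQ p \<sigma> \<rho>" unfolding EQ_unfold[of p \<sigma> \<rho>]
   proof (intro conjI allI impI)
    show "p : el P" using EQ_P e by blast
    fix \<pi> r q assume a: "nm \<sigma> \<pi> r" "le q p" "le q r"
    then obtain q1 \<pi>1 r1 where 1: "le q1 q" "nm \<tau> \<pi>1 r1" "le q1 r1" "EQ q1 \<pi> \<pi>1" using st by meson
    then obtain q2 \<pi>2 r2 where 2: "le q2 q1" "nm \<rho> \<pi>2 r2" "le q2 r2" "EQ q2 \<pi>1 \<pi>2"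
     using tr a by (meson le_trans)
    then have "EQ q2 \<pi> \<pi>2" using IH[OF a(1)] EQ_mono[OF 1(4) 2(1)] by blast
    then show "EX q' \<pi>' r'. le q' q & nm \<rho> \<pi>' r' & le q' r' & EQ q' \<pi> \<pi>'" using 1 2 le_trans by blast
   next
    fix \<pi>2 r2 q assume a: "nm \<rho> \<pi>2 r2" "le q p" "le q r2"
    then obtain q1 \<pi>1 r1 where 1: "le q1 q" "nm \<tau> \<pi>1 r1" "le q1 r1" "EQ q1 \<pi>1 \<pi>2" using tr by meson
    then obtain q2 \<pi> r where 2: "le q2 q1" "nm \<sigma> \<pi> r" "le q2 r" "EQ q2 \<pi> \<pi>1"
     using st a by (meson le_trans)
    then have "EQ q2 \<pi> \<pi>2" using IH[OF 2(2)] EQ_mono[OF 1(4) 2(1)] by blast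
    then show "EX q' \<pi> r. le q' q & nm \<sigma> \<pi> r & le q' r & EQ q' \<pi> \<pi>2" using 1 2 le_trans by blast
   qed
  qed
 qed
 then show "EQ p \<sigma> \<tau> ==> EQ p \<tau> \<rho> ==> EQ p \<sigma> \<rho>" by blast
qed

definition MEM :: "'a => 'a => 'a => bool" where
 "MEM p \<sigma> \<tau> \<longleftrightarrow> p : el P & (ALL q. le q p --> (EX q' \<pi> r. le q' q & nm \<tau> \<pi> r & le q' r & EQ q' \<sigma> \<pi>))"

lemma dfn_MEM [dfns]: "dt t ==> dt u ==> dt w ==> dfn (%v. MEM (t v) (u v) (w v))"
 by (rule dfn_comp3[where P=MEM]; (assumption | (unfold MEM_def, intro dfns)))

lemma MEM_mono: "MEM p \<sigma> \<tau> ==> le q p ==> MEM q \<sigma> \<tau>"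
 unfolding MEM_def by (meson le_P le_trans)

lemma MEM_dense: "p : el P ==> (!!q. le q p ==> EX r. le r q & MEM r \<sigma> \<tau>) ==> MEM p \<sigma> \<tau>"
 unfolding MEM_def by (meson le_P le_refl le_trans)

lemma MEM_cong:
 assumes "MEM p \<sigma> \<tau>" "EQ p \<sigma> \<sigma>'" "EQ p \<tau> \<tau>'" shows "MEM p \<sigma>' \<tau>'"
 unfolding MEM_def
proof (intro conjI allI impI)
 show "p : el P" using assms(2) EQ_P by blast
 fix q assume q: "le q p"
 then obtain q1 \<pi> r where 1: "le q1 q" "nm \<tau> \<pi> r" "le q1 r" "EQ q1 \<sigma> \<pi>" using assms(1) unfolding MEM_def by meson
 have "le q1 p" using 1 q le_trans by blast
 then obtain q2 \<pi>' r' where 2: "le q2 q1" "nm \<tau>' \<pi>' r'" "le q2 r'" "EQ q2 \<pi> \<pi>'"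
  using assms(3)[THEN EQ_unfold[THEN iffD1]] 1 by (meson le_P le_refl)
 have "EQ q2 \<sigma>' \<sigma>" using assms(2) 1 2 q by (meson EQ_sym EQ_mono le_trans)
 then have "EQ q2 \<sigma>' \<pi>'" using EQ_trans EQ_mono[OF 1(4) 2(1)] 2(4) by blast
 then show "EX q' \<pi> r. le q' q & nm \<tau>' \<pi> r & le q' r & EQ q' \<sigma>' \<pi>" using 1 2 le_trans by blast
qed

text \<open>The clauses are those of Kripke semantics. They give classical forcing because the
  atomic relations hold as soon as they hold densely, and implication and universal quantification
  inherit this property (\<open>force_dense\<close>).\<close>

primrec force :: "fm => 'a => (nat => 'a) => bool" where
 "force Bot p v = False"
| "force (Mem x y) p v = MEM p (v x) (v y)"
| "force (Equal x y) p v = EQ p (v x) (v y)"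
| "force (Imp \<phi> \<psi>) p v = (p : el P & (ALL q. le q p --> force \<phi> q v --> force \<psi> q v))"
| "force (Forall \<phi>) p v = (ALL x. force \<phi> p (case_nat x v))"

lemma force_mono: "force \<phi> p v ==> le q p ==> force \<phi> q v"
 by (induction \<phi> arbitrary: v p q) (auto simp: MEM_mono EQ_mono le_P intro: le_trans)

lemma force_dense: "p : el P ==> (!!q. le q p ==> EX r. le r q & force \<phi> r v) ==> force \<phi> p v"
proof (induction \<phi> arbitrary: v p)
 case Bot then show ?case using le_refl by fastforce
next
 case (Mem x y) then show ?case by (simp add: MEM_dense)
next
 case (Equal x y) then show ?case by (simp add: EQ_dense)
next
 case (Imp \<phi> \<psi>)
 show ?case unfolding force.simps
 proof (intro conjI allI impI)
  fix q assume q: "le q p" "force \<phi> q v"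
  show "force \<psi> q v"
  proof (rule Imp.IH(2)[OF le_P[OF q(1)]])
   fix r assume r: "le r q"
   then obtain s where s: "le s r" "force (Imp \<phi> \<psi>) s v" using Imp.prems(2) q le_trans by blast
   then have "force \<phi> s v" using q(2) r force_mono le_trans by blast
   then show "EX s. le s r & force \<psi> s v" using s le_refl le_P by fastforce
  qed
 qed (rule Imp.prems)
next
 case (Forall \<phi>)
 show ?case unfolding force.simps
 proof (rule allI, rule Forall.IH[OF Forall.prems(1)])
  show "EX r. le r q & force \<phi> r (case_nat x v)" if "le q p" for x q
   using Forall.prems(2)[OF that] by auto
 qed
qed

text \<open>Each formula gets its own definition of forcing, by induction on formulas in the
  metatheory.\<close>

lemma dfn_force: "dfn (%v. force \<phi> (v 0) (%i. v (Suc i)))"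
proof (induction \<phi>)
 case (Imp \<phi> \<psi>)
 have *: "dfn (%v. force \<chi> (v 0) (%i. v (Suc (Suc i))))" if "dfn (%v. force \<chi> (v 0) (%i. v (Suc i)))" for \<chi>
  using dfn_ren[OF that, of "case_nat 0 (%i. Suc (Suc i))"] by simp
 show ?case unfolding force.simps by (intro dfns *[OF Imp.IH(1)] *[OF Imp.IH(2)])
next
 case (Forall \<phi>)
 have "(%i. v (case_nat 1 (case_nat 0 (%i. Suc (Suc i))) (Suc i))) = case_nat (v 0) (%i. v (Suc (Suc i)))" for v :: "nat => 'a"
  by (rule ext) (auto split: nat.split)
 then have "dfn (%v. force \<phi> (v 1) (case_nat (v 0) (%i. v (Suc (Suc i)))))"
  using dfn_ren[OF Forall, of "case_nat 1 (case_nat 0 (%i. Suc (Suc i)))"] by simp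
 then show ?case unfolding force.simps by (intro dfns) simp
qed (auto intro!: dfns)

lemma dfn_force1: "dfn (%u. force \<phi> (u 0) v)"
proof -
 have "dfn (%u. force \<phi> (u 0) (%i. v i))"
  using dfn_fix[OF dfn_force, of \<phi> 1 "%i. v (i - 1)"] by simp
 then show ?thesis by simp
qed

lemma dfn_force2: "dfn (%u. force \<phi> (u 0) (case_nat (u 1) v))"
proof -
 have "(%i. if Suc i < 2 then u (Suc i) else v (Suc i - 2)) = case_nat (u 1) v" for u :: "nat => 'a"
  by (rule ext) (auto split: nat.split)
 then show ?thesis using dfn_fix[OF dfn_force, of \<phi> 2 "%i. v (i - 2)"] by simp
qed

lemma dfn_force3: "dfn (%u. force \<phi> (u 0) (case_nat (u 1) (case_nat (u 2) v)))"
proof -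
 have "(%i. if Suc i < 3 then u (Suc i) else v (Suc i - 3)) = case_nat (u 1) (case_nat (u 2) v)" for u :: "nat => 'a"
  by (rule ext) (auto split: nat.split simp: numeral_2_eq_2 numeral_3_eq_3)
 then show ?thesis using dfn_fix[OF dfn_force, of \<phi> 3 "%i. v (i - 3)"] by simp
qed

end

section \<open>The generic extension\<close>

context forcing
begin

definition chkF :: "'a => 'a" where "chkF Y = mk {z. EX d:el Y. z = pr d emp}"
lemma el_chkF: "el (chkF Y) = {z. EX d:el Y. z = pr d emp}"
 unfolding chkF_def by (rule el_mk, rule S_sub[OF S_el[of "tms Y (ins emp emp)"]]) (auto intro!: dfns)
lemma dt_chkF0: "dt (%v. chkF (v 0))"
 unfolding chkF_def by (rule dt_mk, rule S_sub[OF S_el[of "tms _ (ins emp emp)"]]) (auto intro!: dfns)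

definition chk :: "'a => 'a" where
 "chk = (SOME H. dt (%v. H (v 0)) & (ALL x. H x = chkF (mk (H ` el x))))"
lemma chk_props: "dt (%v. chk (v 0)) & (ALL x. chk x = chkF (mk (chk ` el x)))"
 using someI_ex[OF eps_rec[OF dt_chkF0]] unfolding chk_def .
lemma dt_chk [dfns]: "dt t ==> dt (%v. chk (t v))" using dt_comp1 chk_props by blast
lemma el_chk: "el (chk x) = {z. EX y:el x. z = pr (chk y) emp}"
proof -
 have "chk x = chkF (mk (chk ` el x))" using chk_props by (rule conjunct2[THEN spec])
 then have "el (chk x) = {z. EX d:el (mk (chk ` el x)). z = pr d emp}"
  using el_chkF[of "mk (chk ` el x)"] by simp
 moreover have "el (mk (chk ` el x)) = chk ` el x" by (intro el_mk S_img S_el dfns)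
 ultimately show ?thesis by auto
qed

lemma EQ_chk: "EQ p (chk x) (chk y) ==> x = y"
proof -
 have "ALL p y. EQ p (chk x) (chk y) --> x = y"
 proof (rule eps_induct[where x=x])
  show "dfn (%v. ALL p y. EQ p (chk (v 0)) (chk y) --> v 0 = y)" by (intro dfns)
  fix x assume IH: "!!z. z : el x ==> ALL p y. EQ p (chk z) (chk y) --> z = y"
  show "ALL p y. EQ p (chk x) (chk y) --> x = y"
  proof (intro allI impI eqI equalityI subsetI)
   fix p y z assume e: "EQ p (chk x) (chk y)"
   note u = e[THEN EQ_unfold[THEN iffD1]]
   have pe: "le p emp" using EQ_P[OF e] by (simp add: le_def)
   have nme: "nm (chk x) (chk z) emp \<longleftrightarrow> z : el x" if "z : el x" for z x using that emp_P by (auto simp: nm_def el_chk)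
   { assume z: "z : el x"
    then have "EX q' \<pi>' r'. le q' p & nm (chk y) \<pi>' r' & le q' r' & EQ q' (chk z) \<pi>'"
     using u nme[OF z] pe EQ_P[OF e] le_refl by blast
    then obtain q' w where "w : el y" "EQ q' (chk z) (chk w)" by (auto simp: nm_def el_chk)
    then show "z : el y" using IH[OF z] by blast }
   { assume z: "z : el y"
    then have "EX q' \<pi> r. le q' p & nm (chk x) \<pi> r & le q' r & EQ q' \<pi> (chk z)"
     using u nme[OF z] pe EQ_P[OF e] le_refl by blast
    then obtain q' w where "w : el x" "EQ q' (chk w) (chk z)" by (auto simp: nm_def el_chk)
    then show "z : el x" using IH by blast }
  qed
 qed
 then show "EQ p (chk x) (chk y) ==> x = y" by blast
qed

end

text \<open>\<open>val\<close> identifies names whose equality is forced by an element of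
  \<open>G\<close>, and \<open>val_eq\<close> and \<open>val_mem\<close> characterize the extension
  completely. They take the place of the recursive evaluation of names, which an ill-founded model
  does not permit.\<close>

locale generic = forcing E P for E :: "'a => 'a => bool" and P :: 'a +
 fixes G :: "'a set" and val :: "'a => 'b" and EN :: "'b => 'b => bool"
 assumes G_P: "G <= el P"
  and G_up: "p : G ==> le p q ==> q : el P ==> q : G"
  and G_dir: "p : G ==> q : G ==> EX r:G. le r p & le r q"
  and G_gen: "S D ==> D <= el P ==> (!!p. p : el P ==> EX q:D. le q p) ==> EX p:G. p : D"
  and surj_val: "surj val"
  and val_eq: "val \<sigma> = val \<tau> \<longleftrightarrow> (EX p:G. EQ p \<sigma> \<tau>)"
  and val_mem: "EN (val \<sigma>) (val \<tau>) \<longleftrightarrow> (EX p:G. MEM p \<sigma> \<tau>)"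
begin

lemma dfn_force_at: "dt t ==> dfn (%u. force \<phi> (t u) v)"
 by (rule dfn_comp1[OF dfn_force1])
lemma dfn_force_at2: "dt t ==> dt s ==> dfn (%u. force \<phi> (t u) (case_nat (s u) v))"
 using dfn_comp2[OF dfn_force2] .
lemma dfn_force_at3: "dt t ==> dt s ==> dt w ==> dfn (%u. force \<phi> (t u) (case_nat (s u) (case_nat (w u) v)))"
 using dfn_comp3[OF dfn_force3] .

lemma emp_G: "emp : G"
proof -
 obtain p where "p : G" using G_gen[OF S_el[of P]] le_refl by blast
 then show ?thesis using G_up[of p emp] emp_P G_P by (auto simp: le_def)
qed

lemma generic_below:
 assumes "p : G" "dfn (%v. D (v 0))" "!!q. le q p ==> EX r. le r q & D r"
 shows "EX r:G. le r p & D r"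
proof -
 let ?D = "{r : el P. (le r p & D r) | (ALL s. le s r --> ~ le s p)}"
 have "EX r:G. r : ?D"
 proof (rule G_gen)
  show "S ?D" by (rule S_Collect[OF S_el]) (intro dfns assms)
  fix q assume q: "q : el P"
  show "EX r:?D. le r q"
  proof (cases "EX s. le s q & le s p")
   case True
   then obtain s where s: "le s q" "le s p" by blast
   then obtain r where r: "le r s" "D r" using assms(3) by blast
   then have "le r p" "le r q" using s le_trans by blast+
   then show ?thesis using r le_P by blast
  next
   case False
   then show ?thesis using q le_refl by blast
  qed
 qed auto
 then obtain r where r: "r : G" "(le r p & D r) | (ALL s. le s r --> ~ le s p)" by blast
 then show ?thesis using G_dir[OF assms(1) r(1)] by blast
qed

lemma generic_dense:
 assumes "dfn (%v. D (v 0))" "!!q. q : el P ==> EX r. le r q & D r"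
 shows "EX r:G. D r"
 using generic_below[OF emp_G assms(1)] assms(2) le_P by blast

text \<open>Genericity decides every question: conditions that force the premise of an implication
  or exclude it are dense, and so are those that force a universal formula or exclude one of its
  instances. \<open>sat_quotient\<close> then passes from names to values.\<close>

lemma truth: "sat (=) EN (%i. val (v i)) \<phi> \<longleftrightarrow> (EX p:G. force \<phi> p v)"
proof -
 let ?eq = "%\<sigma> \<tau>. EX p:G. EQ p \<sigma> \<tau>" and ?E = "%\<sigma> \<tau>. EX p:G. MEM p \<sigma> \<tau>"
 have "sat ?eq ?E v \<phi> \<longleftrightarrow> (EX p:G. force \<phi> p v)"
 proof (induction \<phi> arbitrary: v)
  case (Imp \<phi> \<psi>)
  show ?case
  proof
   assume s: "sat ?eq ?E v (Imp \<phi> \<psi>)"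
   show "EX p:G. force (Imp \<phi> \<psi>) p v"
   proof (cases "EX p:G. force \<phi> p v")
    case True
    then obtain p where "p : G" "force \<psi> p v" using s Imp by auto
    then show ?thesis using force_mono G_P by auto
   next
    case False
    have "EX r:G. force \<phi> r v | (ALL s. le s r --> ~ force \<phi> s v)"
    proof (rule generic_dense)
     show "dfn (%u. force \<phi> (u 0) v | (ALL s. le s (u 0) --> ~ force \<phi> s v))"
      by (intro dfns dfn_force_at)
     show "EX r. le r q & (force \<phi> r v | (ALL s. le s r --> ~ force \<phi> s v))" if "q : el P" for q
      using that le_refl by blast
    qed
    then obtain r where "r : G" "ALL s. le s r --> ~ force \<phi> s v" using False by blast
    then show ?thesis using G_P by auto
   qed
  next
   assume "EX p:G. force (Imp \<phi> \<psi>) p v"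
   then obtain p where p: "p : G" "ALL q. le q p --> force \<phi> q v --> force \<psi> q v" by auto
   have "EX r:G. force \<psi> r v" if "q : G" "force \<phi> q v" for q
    using G_dir[OF p(1) that(1)] p(2) that(2) force_mono by blast
   then show "sat ?eq ?E v (Imp \<phi> \<psi>)" using Imp by auto
  qed
 next
  case (Forall \<phi>)
  show ?case
  proof
   assume "sat ?eq ?E v (Forall \<phi>)"
   then have a: "EX p:G. force \<phi> p (case_nat x v)" for x using Forall by auto
   have "EX r:G. (ALL x. force \<phi> r (case_nat x v)) | (EX x. ALL s. le s r --> ~ force \<phi> s (case_nat x v))"
   proof (rule generic_dense)
    show "dfn (%u. (ALL x. force \<phi> (u 0) (case_nat x v)) | (EX x. ALL s. le s (u 0) --> ~ force \<phi> s (case_nat x v)))"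
     by (intro dfns dfn_force_at2)
    fix q assume q: "q : el P"
    show "EX r. le r q & ((ALL x. force \<phi> r (case_nat x v)) | (EX x. ALL s. le s r --> ~ force \<phi> s (case_nat x v)))"
    proof (cases "ALL x. force \<phi> q (case_nat x v)")
     case True then show ?thesis using le_refl[OF q] by blast
    next
     case False
     then obtain x where "~ force \<phi> q (case_nat x v)" by blast
     then obtain r where "le r q" "ALL s. le s r --> ~ force \<phi> s (case_nat x v)" using force_dense[OF q] by blast
     then show ?thesis by blast
    qed
   qed
   then obtain r where r: "r : G" "(ALL x. force \<phi> r (case_nat x v)) | (EX x. ALL s. le s r --> ~ force \<phi> s (case_nat x v))" by blast
   moreover have False if x: "ALL s. le s r --> ~ force \<phi> s (case_nat x v)" for x
   proof -
    obtain p where p: "p : G" "force \<phi> p (case_nat x v)" using a by blast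
    then obtain s where "le s p" "le s r" using G_dir r(1) by blast
    then show False using p(2) x force_mono by blast
   qed
   ultimately show "EX p:G. force (Forall \<phi>) p v" by auto
  next
   assume "EX p:G. force (Forall \<phi>) p v"
   then show "sat ?eq ?E v (Forall \<phi>)" using Forall by auto
  qed
 qed auto
 then show ?thesis using sat_quotient[of val ?eq EN ?E v \<phi>, OF surj_val val_eq val_mem] by blast
qed

lemma val_cases: obtains \<sigma> where "y = val \<sigma>" using surj_val by (metis surjD)

text \<open>\<open>MEM\<close> asks for a witness in the name only densely. The filter meets the
  conditions at which a witness is attained, which recovers the usual evaluation of a name.\<close>

lemma mem_val: "EN y (val \<tau>) \<longleftrightarrow> (EX \<pi> r. nm \<tau> \<pi> r & r : G & y = val \<pi>)"
proof
 assume y: "EN y (val \<tau>)"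
 obtain \<sigma> where \<sigma>: "y = val \<sigma>" by (rule val_cases)
 obtain p where p: "p : G" "MEM p \<sigma> \<tau>" using y \<sigma> val_mem by blast
 have "EX q':G. le q' p & (EX \<pi> r. nm \<tau> \<pi> r & le q' r & EQ q' \<sigma> \<pi>)"
 proof (rule generic_below[OF p(1)])
  show "dfn (%v. EX \<pi> r. nm \<tau> \<pi> r & le (v 0) r & EQ (v 0) \<sigma> \<pi>)" by (intro dfns)
  show "EX r. le r q & (EX \<pi> ra. nm \<tau> \<pi> ra & le r ra & EQ r \<sigma> \<pi>)" if "le q p" for q
   using p(2) that unfolding MEM_def by meson
 qed
 then obtain q' \<pi> r where "q' : G" "nm \<tau> \<pi> r" "le q' r" "EQ q' \<sigma> \<pi>" by blast
 then show "EX \<pi> r. nm \<tau> \<pi> r & r : G & y = val \<pi>" using \<sigma> val_eq G_up unfolding nm_def by blast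
next
 assume "EX \<pi> r. nm \<tau> \<pi> r & r : G & y = val \<pi>"
 then obtain \<pi> r where p: "nm \<tau> \<pi> r" "r : G" "y = val \<pi>" by blast
 have "MEM r \<pi> \<tau>" unfolding MEM_def using p G_P by (meson EQ_refl le_P le_refl subsetD)
 then show "EN y (val \<tau>)" using p val_mem by blast
qed

lemma N_ext: assumes "!!z. EN z x \<longleftrightarrow> EN z y" shows "x = y"
proof -
 obtain \<sigma> \<tau> where v: "x = val \<sigma>" "y = val \<tau>" by (metis val_cases)
 \<comment> \<open>\<open>?C\<close> exhibits a member of one name that is kept out of the other. It
   is dense to force equality or such a member in one of the two directions.\<close>
 let ?C = "%q \<sigma> \<tau>. EX \<pi> r. nm \<sigma> \<pi> r & le q r & (ALL q'. le q' q --> ~ MEM q' \<pi> \<tau>)"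
 have "EX q:G. EQ q \<sigma> \<tau> | ?C q \<sigma> \<tau> | ?C q \<tau> \<sigma>"
 proof (rule generic_dense)
  show "dfn (%v. EQ (v 0) \<sigma> \<tau> | ?C (v 0) \<sigma> \<tau> | ?C (v 0) \<tau> \<sigma>)" by (intro dfns)
  fix p assume p: "p : el P"
  show "EX q. le q p & (EQ q \<sigma> \<tau> | ?C q \<sigma> \<tau> | ?C q \<tau> \<sigma>)"
  proof (cases "EQ p \<sigma> \<tau>")
   case True then show ?thesis using le_refl p by blast
  next
   case False
   then consider \<pi> r q where "nm \<sigma> \<pi> r" "le q p" "le q r" "~ (EX q' \<pi>' r'. le q' q & nm \<tau> \<pi>' r' & le q' r' & EQ q' \<pi> \<pi>')"
    | \<pi> r q where "nm \<tau> \<pi> r" "le q p" "le q r" "~ (EX q' \<pi>' r'. le q' q & nm \<sigma> \<pi>' r' & le q' r' & EQ q' \<pi>' \<pi>)"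
    using p unfolding EQ_unfold[of p \<sigma> \<tau>] by blast
   then show ?thesis
   proof cases
    case 1
    then have "ALL q'. le q' q --> ~ MEM q' \<pi> \<tau>" unfolding MEM_def by (meson le_P le_refl le_trans)
    then show ?thesis using 1 by blast
   next
    case 2
    then have "ALL q'. le q' q --> ~ MEM q' \<pi> \<sigma>" unfolding MEM_def by (meson EQ_sym le_P le_refl le_trans)
    then show ?thesis using 2 by blast
   qed
  qed
 qed
 then obtain q where q: "q : G" "EQ q \<sigma> \<tau> | ?C q \<sigma> \<tau> | ?C q \<tau> \<sigma>" by blast
 have no: False if c: "?C q \<alpha> \<beta>" and e: "!!z. EN z (val \<alpha>) \<longleftrightarrow> EN z (val \<beta>)" for \<alpha> \<beta>
 proof -
  obtain \<pi> r where p: "nm \<alpha> \<pi> r" "le q r" "ALL q'. le q' q --> ~ MEM q' \<pi> \<beta>" using c by blast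
  then have "r : G" using G_up q(1) unfolding nm_def by blast
  then have "EN (val \<pi>) (val \<beta>)" using e p(1) mem_val by blast
  then obtain p' where "p' : G" "MEM p' \<pi> \<beta>" using val_mem by blast
  then show False using p(3) G_dir[OF q(1)] MEM_mono by blast
 qed
 show ?thesis using q no[of \<sigma> \<tau>] no[of \<tau> \<sigma>] assms val_eq v by blast
qed

lemma N_foundation: assumes "EN y x" shows "EX y. EN y x & ~ (EX z. EN z x & EN z y)"
proof -
 obtain \<sigma> \<tau> where v: "y = val \<sigma>" "x = val \<tau>" by (metis val_cases)
 \<comment> \<open>\<open>D q\<close> says that \<open>q\<close> puts some \<open>\<pi>\<close> into
   \<open>\<tau>\<close> and keeps all members of \<open>\<pi>\<close> out of \<open>\<tau>\<close>.
   Such conditions are dense below any one forcing a membership in \<open>\<tau>\<close>, by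
   induction on the name of the member.\<close>
 define D where "D q \<longleftrightarrow> (EX \<pi> r. nm \<tau> \<pi> r & le q r &
  (ALL q' \<pi>' r'. le q' q --> nm \<pi> \<pi>' r' --> le q' r' --> ~ MEM q' \<pi>' \<tau>))" for q
 have dD: "dt t ==> dfn (%v. D (t v))" for t
  by (rule dfn_comp1[where P=D]; (assumption | (unfold D_def, intro dfns)))
 have *: "ALL p. MEM p \<sigma> \<tau> --> (EX q. le q p & D q)" for \<sigma>
 proof (rule nm_induct[where Q="%\<sigma>. ALL p. MEM p \<sigma> \<tau> --> (EX q. le q p & D q)"])
  show "dfn (%v. ALL p. MEM p (v 0) \<tau> --> (EX q. le q p & D q))" by (intro dfns dD)
  fix \<sigma> assume IH: "!!\<pi> r. nm \<sigma> \<pi> r ==> ALL p. MEM p \<pi> \<tau> --> (EX q. le q p & D q)"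
  show "ALL p. MEM p \<sigma> \<tau> --> (EX q. le q p & D q)"
  proof (intro allI impI)
   fix p assume m: "MEM p \<sigma> \<tau>"
   then obtain q \<pi> r where q: "le q p" "nm \<tau> \<pi> r" "le q r" "EQ q \<sigma> \<pi>"
    unfolding MEM_def by (meson le_refl)
   show "EX q. le q p & D q"
   proof (cases "EX q' \<pi>' r'. le q' q & nm \<pi> \<pi>' r' & le q' r' & MEM q' \<pi>' \<tau>")
    case True
    then obtain q' \<pi>' r' where 1: "le q' q" "nm \<pi> \<pi>' r'" "le q' r'" "MEM q' \<pi>' \<tau>" by blast
    then obtain q2 \<rho> r2 where 2: "le q2 q'" "nm \<sigma> \<rho> r2" "EQ q2 \<rho> \<pi>'"
     using q(4)[THEN EQ_unfold[THEN iffD1]] by blast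
    then have "MEM q2 \<rho> \<tau>" using 1(4) MEM_mono MEM_cong EQ_sym EQ_refl le_P by meson
    then show ?thesis using IH[OF 2(2)] 1 2 q le_trans by blast
   next
    case False
    then have "D q" unfolding D_def using q by blast
    then show ?thesis using q by blast
   qed
  qed
 qed
 obtain p where p: "p : G" "MEM p \<sigma> \<tau>" using assms v val_mem by blast
 have "EX q:G. le q p & D q"
  by (rule generic_below[OF p(1)]) (use dD[OF dt_proj] * MEM_mono[OF p(2)] in blast)+
 then obtain q \<pi> r where q: "q : G" "nm \<tau> \<pi> r" "le q r"
  "ALL q' \<pi>' r'. le q' q --> nm \<pi> \<pi>' r' --> le q' r' --> ~ MEM q' \<pi>' \<tau>" by (auto simp: D_def)
 have rG: "r : G" using G_up q unfolding nm_def by blast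
 have "False" if z: "EN z x" "EN z (val \<pi>)" for z
 proof -
  obtain \<pi>' r' where 1: "nm \<pi> \<pi>' r'" "r' : G" "z = val \<pi>'" using z mem_val by blast
  then obtain s where 2: "s : G" "MEM s \<pi>' \<tau>" using z v val_mem by blast
  obtain t where 3: "t : G" "le t q" "le t r'" using G_dir q(1) 1(2) by blast
  obtain u where "u : G" "le u t" "le u s" using G_dir 3(1) 2(1) by blast
  then show False using q(4) 1(1) 2(2) 3 MEM_mono le_trans by blast
 qed
 moreover have "EN (val \<pi>) x" using v mem_val q(2) rG by blast
 ultimately show ?thesis by blast
qed

lemma N_separation: "EX b. ALL x. EN x b \<longleftrightarrow> EN x a & sat (=) EN (case_nat x v) \<phi>"
proof -
 obtain \<tau> where a: "a = val \<tau>" by (rule val_cases)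
 obtain w where w: "v = (%i. val (w i))" using surj_val by (metis surj_f_inv_f)
 have cw: "case_nat (val x) v = (%i. val (case_nat x w i))" for x by (rule ext) (auto simp: w split: nat.split)
 \<comment> \<open>Members of \<open>\<tau>\<close> are taken over with stronger conditions, namely
   those that already force the formula for them.\<close>
 let ?Q = "%z. EX \<pi> r q. z = pr \<pi> q & nm \<tau> \<pi> r & le q r & force \<phi> q (case_nat \<pi> w)"
 obtain A where A: "trans A" "\<tau> : el A" using trans_superset by blast
 have "S {z. ?Q z}"
 proof (rule S_sub[OF S_el[of "tms A P"]])
  show "{z. ?Q z} <= el (tms A P)" using nm_trans[OF A] by (auto dest: le_P)
  show "dfn (%v. v 0 : {z. ?Q z})"
   by (intro dfns dfn_force_at2)
 qed
 then obtain \<rho> where \<rho>: "el \<rho> = {z. ?Q z}" by (auto simp: S_def)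
 have "EN x (val \<rho>) \<longleftrightarrow> EN x a & sat (=) EN (case_nat x v) \<phi>" for x
 proof
  assume "EN x (val \<rho>)"
  then obtain \<pi> q where 1: "nm \<rho> \<pi> q" "q : G" "x = val \<pi>" using mem_val by blast
  then have "?Q (pr \<pi> q)" using \<rho> by (auto simp: nm_def)
  then obtain r where 2: "nm \<tau> \<pi> r" "le q r" "force \<phi> q (case_nat \<pi> w)" by auto
  then have "r : G" using G_up 1 unfolding nm_def by blast
  moreover have "sat (=) EN (case_nat x v) \<phi>" using truth[of "case_nat \<pi> w" \<phi>] 1 2 cw by auto
  ultimately show "EN x a & sat (=) EN (case_nat x v) \<phi>" using a mem_val 1 2 by blast
 next
  assume "EN x a & sat (=) EN (case_nat x v) \<phi>"
  then obtain \<pi> r where 1: "nm \<tau> \<pi> r" "r : G" "x = val \<pi>" and s: "sat (=) EN (case_nat x v) \<phi>"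
   using a mem_val by blast
  then obtain p where 2: "p : G" "force \<phi> p (case_nat \<pi> w)" using truth[of "case_nat \<pi> w" \<phi>] cw by auto
  obtain q where 3: "q : G" "le q p" "le q r" using G_dir 1 2 by blast
  then have "pr \<pi> q : el \<rho>" using \<rho> 1 2 force_mono by blast
  then have "nm \<rho> \<pi> q" using 3 G_P by (auto simp: nm_def)
  then show "EN x (val \<rho>)" using mem_val 3 1 by blast
 qed
 then show ?thesis by blast
qed

abbreviation vc :: "'a => 'b" where "vc x == val (chk x)"

lemma mem_vc: "EN z (vc x) \<longleftrightarrow> (EX y:el x. z = vc y)"
 unfolding mem_val using emp_G emp_P by (auto simp: nm_def el_chk)

lemma vc_inject [simp]: "vc x = vc y \<longleftrightarrow> x = y" using val_eq EQ_chk by blast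
lemma vc_mem [simp]: "EN (vc x) (vc y) \<longleftrightarrow> x : el y" by (auto simp: mem_vc)

definition upn :: "'a => 'a => 'a" where "upn \<sigma> \<tau> = up (pr \<sigma> emp) (pr \<tau> emp)"
lemma dt_upn [dfns]: "dt t ==> dt u ==> dt (%v. upn (t v) (u v))" unfolding upn_def by (intro dfns)
lemma mem_upn: "EN z (val (upn \<sigma> \<tau>)) \<longleftrightarrow> z = val \<sigma> | z = val \<tau>"
 unfolding mem_val using emp_G emp_P by (auto simp: nm_def upn_def)

lemma N_zf: "zf EN"
proof
 show "x = y" if "!!z. EN z x = EN z y" for x y using N_ext that by blast
 show "EX y. EN y x & ~ (EX z. EN z x & EN z y)" if "EN y x" for x y using N_foundation that by blast
 show "EX b. ALL x. EN x b \<longleftrightarrow> EN x a & sat (=) EN (case_nat x v) p" for a v p by (rule N_separation)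
 show "EX p. ALL z. EN z p \<longleftrightarrow> z = x | z = y" for x y using mem_upn by (metis val_cases)
 show "EX w. ALL z. EN z w \<longleftrightarrow> (EX y. EN y x & EN z y)" for x
 proof -
  obtain \<tau> where x: "x = val \<tau>" by (rule val_cases)
  obtain A where A: "trans A" "\<tau> : el A" using trans_superset by blast
  let ?Q = "%z. EX \<sigma> p \<pi> r q. nm \<tau> \<sigma> p & nm \<sigma> \<pi> r & le q p & le q r & z = pr \<pi> q"
  have "S {z. ?Q z}"
  proof (rule S_sub[OF S_el[of "tms A P"]])
   show "{z. ?Q z} <= el (tms A P)"
   proof
    fix z assume "z : {z. ?Q z}"
    then obtain \<sigma> p \<pi> r q where n: "nm \<tau> \<sigma> p" "nm \<sigma> \<pi> r" "le q p" "z = pr \<pi> q" by blast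
    then have "\<pi> : el A" using nm_trans[OF A(1) nm_trans[OF A n(1)] n(2)] by blast
    then show "z : el (tms A P)" using n le_P by auto
   qed
  qed (intro dfns)
  then obtain \<rho> where \<rho>: "el \<rho> = {z. ?Q z}" by (auto simp: S_def)
  have "EN z (val \<rho>) \<longleftrightarrow> (EX y. EN y x & EN z y)" for z
  proof
   assume "EN z (val \<rho>)"
   then obtain \<pi> q where 1: "nm \<rho> \<pi> q" "q : G" "z = val \<pi>" using mem_val by blast
   then have "?Q (pr \<pi> q)" using \<rho> by (auto simp: nm_def)
   then obtain \<sigma> p r where "nm \<tau> \<sigma> p" "nm \<sigma> \<pi> r" "le q p" "le q r" by auto
   moreover then have "p : G" "r : G" using G_up 1 unfolding nm_def by blast+
   ultimately show "EX y. EN y x & EN z y" using x 1 mem_val by blast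
  next
   assume "EX y. EN y x & EN z y"
   then obtain \<sigma> p \<pi> r where 1: "nm \<tau> \<sigma> p" "p : G" "nm \<sigma> \<pi> r" "r : G" "z = val \<pi>" using x mem_val by metis
   then obtain q where 2: "q : G" "le q p" "le q r" using G_dir by blast
   then have "nm \<rho> \<pi> q" using 1 \<rho> le_P unfolding nm_def by blast
   then show "EN z (val \<rho>)" using mem_val 1 2 by blast
  qed
  then show ?thesis by blast
 qed
 show "EX w. ALL z. EN z w \<longleftrightarrow> (ALL t. EN t z --> EN t x)" for x
 proof -
  obtain \<tau> where x: "x = val \<tau>" by (rule val_cases)
  obtain A where A: "trans A" "\<tau> : el A" using trans_superset by blast
  let ?w = "chkF (pw (tms A P))"
  \<comment> \<open>Every subset of \<open>x\<close> has a name that is a subset of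
    \<open>tms A P\<close>: each name occurring in \<open>\<tau>\<close> is paired with the
    conditions forcing it into the subset.\<close>
  have sup: "EN z (val ?w)" if z: "ALL t. EN t z --> EN t x" for z
  proof -
   obtain \<zeta> where \<zeta>: "z = val \<zeta>" by (rule val_cases)
   let ?Q = "%z. EX \<pi> r q. nm \<tau> \<pi> r & MEM q \<pi> \<zeta> & z = pr \<pi> q"
   have sub: "{z. ?Q z} <= el (tms A P)" using nm_trans[OF A] by (auto simp: MEM_def)
   have "S {z. ?Q z}" by (rule S_sub[OF S_el sub]) (intro dfns)
   then obtain \<rho> where \<rho>: "el \<rho> = {z. ?Q z}" by (auto simp: S_def)
   have "val \<rho> = z"
   proof (rule N_ext, rule iffI)
    fix t assume "EN t (val \<rho>)"
    then obtain \<pi> q where 1: "nm \<rho> \<pi> q" "q : G" "t = val \<pi>" using mem_val by blast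
    then have "?Q (pr \<pi> q)" using \<rho> by (auto simp: nm_def)
    then show "EN t z" using 1 \<zeta> val_mem by auto
   next
    fix t assume t: "EN t z"
    then obtain \<pi> r where 1: "nm \<tau> \<pi> r" "r : G" "t = val \<pi>" using z x mem_val by blast
    then obtain q where 2: "q : G" "MEM q \<pi> \<zeta>" using t \<zeta> val_mem by blast
    then have "nm \<rho> \<pi> q" using \<rho> 1 G_P by (auto simp: nm_def)
    then show "EN t (val \<rho>)" using mem_val 1 2 by blast
   qed
   moreover have "nm ?w \<rho> emp" using \<rho> sub emp_P by (auto simp: nm_def el_chkF)
   ultimately show ?thesis using mem_val emp_G by blast
  qed
  obtain w where w: "!!z. EN z w \<longleftrightarrow> EN z (val ?w) & sat (=) EN (case_nat z (%_. x)) (Forall (Imp (Mem 0 1) (Mem 0 2)))"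
   using N_separation by blast
  have "EN z w \<longleftrightarrow> (ALL t. EN t z --> EN t x)" for z using w sup[of z] by (simp add: numeral_2_eq_2) blast
  then show ?thesis by blast
 qed
 show "EX w. (EX x. (ALL z. ~ EN z x) & EN x w) & (ALL x. EN x w --> (EX y. (ALL z. EN z y \<longleftrightarrow> EN z x | z = x) & EN y w))"
 proof (rule exI[of _ "vc om"], intro conjI allI impI)
  show "EX x. (ALL z. ~ EN z x) & EN x (vc om)" by (rule exI[of _ "vc emp"]) (simp add: mem_vc)
  fix x assume "EN x (vc om)"
  then obtain n where n: "n : el om" "x = vc n" by (auto simp: mem_vc)
  then show "EX y. (ALL z. EN z y \<longleftrightarrow> EN z x | z = x) & EN y (vc om)"
   by (intro exI[of _ "vc (sc n)"]) (auto simp: mem_vc)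
 qed
 show "EX b. ALL y. EN y b \<longleftrightarrow> (EX x. EN x a & sat (=) EN (case_nat x (case_nat y v)) p)"
  if uniq: "ALL x. EN x a --> (EX! y. sat (=) EN (case_nat x (case_nat y v)) p)" for a v p
 proof -
  obtain \<tau> where a: "a = val \<tau>" by (rule val_cases)
  obtain w where w: "v = (%i. val (w i))" using surj_val by (metis surj_f_inv_f)
  have cw: "case_nat (val x) (case_nat (val y) v) = (%i. val (case_nat x (case_nat y w) i))" for x y
   by (rule ext) (auto simp: w split: nat.split)
  obtain A where A: "trans A" "\<tau> : el A" using trans_superset by blast
  \<comment> \<open>Collection in the ground model provides names of values for all pairs of a name
    and a condition at once; Separation in the extension then retains exactly the values.\<close>
  obtain B where B: "ALL z:el (tms A P). (EX y. force p (snd' z) (case_nat (fst' z) (case_nat y w))) -->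
    (EX y:el B. force p (snd' z) (case_nat (fst' z) (case_nat y w)))"
  proof -
   have "dfn (%v. force p (snd' (v 0)) (case_nat (fst' (v 0)) (case_nat (v 1) w)))"
    by (intro dfn_force_at3 dfns)
   from collection[OF this, of "tms A P"] show thesis using that by blast
  qed
  let ?r = "case_nat 0 (case_nat 1 (%i. Suc (Suc (Suc i))))"
  let ?\<phi> = "Exists (Conj (Mem 0 2) (rename ?r p))"
  have env: "(%i. case_nat x (case_nat y (case_nat a v)) (?r i)) = case_nat x (case_nat y v)" for x y
   by (rule ext) (auto split: nat.split)
  obtain b where b: "!!y. EN y b \<longleftrightarrow> EN y (val (chkF B)) & sat (=) EN (case_nat y (case_nat a v)) ?\<phi>"
   using N_separation by blast
  have "EN y (val (chkF B))" if y: "EN x a" "sat (=) EN (case_nat x (case_nat y v)) p" for x y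
  proof -
   obtain \<pi> r where 1: "nm \<tau> \<pi> r" "r : G" "x = val \<pi>" using y a mem_val by blast
   obtain \<upsilon> where u: "y = val \<upsilon>" by (rule val_cases)
   obtain q where q: "q : G" "force p q (case_nat \<pi> (case_nat \<upsilon> w))" using truth y(2) 1 u cw by auto
   have "pr \<pi> q : el (tms A P)" using nm_trans[OF A 1(1)] q G_P by auto
   then obtain \<upsilon>' where u': "\<upsilon>' : el B" "force p q (case_nat \<pi> (case_nat \<upsilon>' w))" using B q by fastforce
   then have "sat (=) EN (case_nat x (case_nat (val \<upsilon>') v)) p" using truth q 1 cw by auto
   then have "y = val \<upsilon>'" using uniq y by blast
   moreover have "nm (chkF B) \<upsilon>' emp" using u' emp_P by (auto simp: nm_def el_chkF)
   ultimately show ?thesis using mem_val emp_G by blast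
  qed
  moreover have "sat (=) EN (case_nat x (case_nat y (case_nat a v))) (rename ?r p) \<longleftrightarrow>
   sat (=) EN (case_nat x (case_nat y v)) p" for x y by (simp only: sat_rename env)
  then have "sat (=) EN (case_nat y (case_nat a v)) ?\<phi> \<longleftrightarrow>
   (EX x. EN x a & sat (=) EN (case_nat x (case_nat y v)) p)" for y
   by (simp only: sat_connectives) (simp add: numeral_2_eq_2)
  ultimately have "EN y b \<longleftrightarrow> (EX x. EN x a & sat (=) EN (case_nat x (case_nat y v)) p)" for y
   unfolding b by blast
  then show ?thesis by blast
 qed
qed

end

section \<open>Ground model sets in the extension\<close>

context zf
begin

lemma isf_dom_unique: "isf f A B ==> isf f A' B' ==> A = A'"
proof (rule eqI)
 assume "isf f A B" "isf f A' B'"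
 then show "el A = el A'" using isf_pr[of f A B] isf_pr[of f A' B'] by blast
qed

lemma isf_extend:
 assumes f: "isf f A B" and "x ~: el A" "y : el B"
 shows "isf (ins (pr x y) f) (ins x A) B" "ap (ins (pr x y) f) x = y"
  "z : el A ==> ap (ins (pr x y) f) z = ap f z"
proof -
 have 1: "w : el (ins (pr x y) f) ==> EX a:el (ins x A). EX b:el B. w = pr a b" for w
  using assms(3) isf_in[OF f] by (auto simp: isf_el[OF f])
 have 2: "a : el (ins x A) ==> EX b. pr a b : el (ins (pr x y) f)" for a
  by (auto simp: isf_el[OF f])
 have 3: "pr a b : el (ins (pr x y) f) ==> pr a b' : el (ins (pr x y) f) ==> b = b'" for a b b'
  using assms(2) by (auto simp: isf_el[OF f])
 note r = isf_rel[of "ins (pr x y) f" "ins x A" B, OF 1 2 3]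
 show "isf (ins (pr x y) f) (ins x A) B" by (rule r(1))
 show "ap (ins (pr x y) f) x = y" by (rule r(2)) simp_all
 show "z : el A ==> ap (ins (pr x y) f) z = ap f z" by (rule r(2)) (auto simp: isf_el[OF f])
qed

definition sq :: "'a => 'a" where "sq A = mk {u. EX n:el om. isf u n A}"

lemma S_sq: "S {u. EX n:el om. isf u n A}"
proof (rule S_sub[OF S_el[of "pw (tms om A)"]])
 show "{u. EX n:el om. isf u n A} <= el (pw (tms om A))"
 proof (safe, simp, rule subsetI)
  fix u n z assume "n : el om" "isf u n A" "z : el u"
  then obtain x where "x : el n" "z = pr x (ap u x)" "ap u x : el A" "x : el om"
   using isf_el[of u n A] isf_in[of u n A] om_elem by blast
  then show "z : {z. EX x:el om. EX y:el A. z = pr x y}" by blast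
 qed
qed (intro dfns)

lemma el_sq [simp]: "el (sq A) = {u. EX n:el om. isf u n A}" by (simp add: sq_def el_mk S_sq)

lemma dt_sq [dfns]: "dt t ==> dt (%v. sq (t v))"
 by (rule dt_comp1[where f=sq, rotated], assumption+, unfold sq_def, rule dt_mk, rule S_sq, intro dfns)

end

sublocale generic \<subseteq> N: zf EN by (rule N_zf)

context generic
begin

lemma N_mem: "EN x y \<longleftrightarrow> x : N.el y" by (simp add: N.el_def)
lemma N_el_vc: "N.el (vc x) = vc ` el x" using mem_vc by (auto simp: N_mem)
lemma vc_in [simp]: "vc x : N.el (vc y) \<longleftrightarrow> x : el y" using vc_mem by (simp add: N_mem)
lemma N_el_val: "N.el (val \<tau>) = {y. EX \<pi> r. nm \<tau> \<pi> r & r : G & y = val \<pi>}" using mem_val by (auto simp: N_mem)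
lemma val_upn: "val (upn \<sigma> \<tau>) = N.up (val \<sigma>) (val \<tau>)"
 by (rule N.eqI) (use mem_upn in \<open>auto simp: N_mem\<close>)
definition opn :: "'a => 'a => 'a" where "opn \<sigma> \<tau> = upn (upn \<sigma> \<sigma>) (upn \<sigma> \<tau>)"
lemma dt_opn [dfns]: "dt t ==> dt u ==> dt (%v. opn (t v) (u v))" unfolding opn_def by (intro dfns)
lemma val_opn: "val (opn \<sigma> \<tau>) = N.pr (val \<sigma>) (val \<tau>)" by (simp add: opn_def N.pr_def val_upn)
lemma vc_up: "vc (up a b) = N.up (vc a) (vc b)" by (rule N.eqI) (auto simp: N_el_vc)
lemma vc_pr: "vc (pr a b) = N.pr (vc a) (vc b)" by (simp add: pr_def N.pr_def vc_up)
lemma vc_ins: "vc (ins a b) = N.ins (vc a) (vc b)" by (rule N.eqI) (auto simp: N_el_vc)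
lemma vc_emp: "vc emp = N.emp" by (rule N.eqI) (auto simp: N_el_vc)

lemma N_Ord_vc: "Ord a ==> N.Ord (vc a)"
proof -
 assume a: "Ord a"
 have "N.el (vc b) <= N.el (vc a)" if "b : el a" for b
  unfolding N_el_vc using Ord_elem_sub[OF a that] by blast
 moreover have "vc b : N.el (vc c) | vc b = vc c | vc c : N.el (vc b)" if "b : el a" "c : el a" for b c
  using a that unfolding Ord_def vc_in by auto
 ultimately show ?thesis unfolding N.Ord_def N_el_vc[of a] by blast
qed

text \<open>A name for the sequence of the values of the names \<open>ap f b\<close>. It carries a
  ground model enumeration of names over to the extension.\<close>

definition seqn :: "'a => 'a => 'a" where
 "seqn f a = mk {z. EX b:el a. z = pr (opn (chk b) (ap f b)) emp}"

lemma el_seqn: "el (seqn f a) = {z. EX b:el a. z = pr (opn (chk b) (ap f b)) emp}"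
proof -
 have "S ((%b. pr (opn (chk b) (ap f b)) emp) ` el a)" by (rule S_img) (auto intro!: dfns)
 also have "(%b. pr (opn (chk b) (ap f b)) emp) ` el a = {z. EX b:el a. z = pr (opn (chk b) (ap f b)) emp}" by auto
 finally show ?thesis unfolding seqn_def by (rule el_mk)
qed

lemma N_el_seqn: "N.el (val (seqn f a)) = {z. EX b:el a. z = N.pr (vc b) (val (ap f b))}"
 unfolding N_el_val nm_def el_seqn using emp_G emp_P by (auto simp: val_opn)

lemma N_ap_seqn: "b : el a ==> N.ap (val (seqn f a)) (vc b) = val (ap f b)"
 by (rule N.ap_eq) (auto simp: N_el_seqn)

lemma N_enum: "EX f a. N.Ord a & N.el x <= N.ap f ` N.el a"
proof -
 obtain \<tau> where x: "x = val \<tau>" by (rule val_cases)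
 obtain A where A: "trans A" "\<tau> : el A" using trans_superset by blast
 obtain a f where a: "Ord a" "bij_betw (ap f) (el a) (el A)" using well_ordering[of A] by blast
 have "N.el x <= N.ap (val (seqn f a)) ` N.el (vc a)"
 proof
  fix y assume "y : N.el x"
  then obtain \<pi> r where "nm \<tau> \<pi> r" "y = val \<pi>" using x by (auto simp: N_el_val)
  then have "\<pi> : ap f ` el a" using nm_trans[OF A] a(2) by (auto simp: bij_betw_def)
  then obtain b where "b : el a" "\<pi> = ap f b" by blast
  then show "y : N.ap (val (seqn f a)) ` N.el (vc a)"
   using \<open>y = val \<pi>\<close> N_ap_seqn[of b a f] by (intro image_eqI[of _ _ "vc b"]) (auto simp: N_el_vc)
 qed
 then show ?thesis using N_Ord_vc[OF a(1)] by blast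
qed

lemma N_zfc: "zfc EN"
proof
 show "EX c. ALL y. EN y x --> (EX! u. EN u y & EN u c)"
  if "ALL y. EN y x --> (EX u. EN u y)" "ALL y z. EN y x & EN z x & (EX u. EN u y & EN u z) --> y = z" for x
  by (rule N.choice_from_enumerations[OF N_enum that])
qed

end

sublocale generic \<subseteq> N: zfc EN by (rule N_zfc)

context generic
begin

text \<open>A minimal element of \<open>vc om\<close> outside the \<open>om\<close> of the extension
  would be the successor of an element inside. So the extension has the same natural numbers as the
  model, nonstandard ones included.\<close>

lemma vc_om: "N.om = vc om"
proof (rule N.eqI, rule equalityI)
 have "N.indset (vc om)" unfolding N.indset_def
  by (auto simp: N_el_vc simp flip: vc_emp vc_ins)
 then show "N.el N.om <= N.el (vc om)" by (auto simp: N.el_om)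
 show "N.el (vc om) <= N.el N.om"
 proof (rule ccontr)
  assume "~ ?thesis"
  then have "N.el (vc om) - N.el N.om ~= {}" by blast
  then obtain m where m: "m : N.el (vc om) - N.el N.om" "N.el m \<inter> (N.el (vc om) - N.el N.om) = {}"
   using N.set_foundation[OF N.S_Diff[OF N.S_el N.S_el]] by meson
  then obtain n where n: "n : el om" "m = vc n" by (auto simp: N_el_vc)
  have "n ~= emp" using m n N.zero_om vc_emp by auto
  then obtain k where k: "k : el om" "n = sc k" using om_cases[OF n(1)] by blast
  then have "vc k : N.el N.om" using m n by (auto simp: N_el_vc)
  then have "m : N.el N.om" using N.sc_om k n vc_ins by metis
  then show False using m by blast
 qed
qed

lemma vc_isf: assumes f: "isf f A B"
 shows "N.isf (vc f) (vc A) (vc B)" "x : el A ==> N.ap (vc f) (vc x) = vc (ap f x)"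
proof -
 have 1: "w : N.el (vc f) ==> EX a:N.el (vc A). EX b:N.el (vc B). w = N.pr a b" for w
  using isf_in[OF f] by (force simp: N_el_vc isf_el[OF f] vc_pr)
 have 2: "EX b. N.pr a b : N.el (vc f)" if aA: "a : N.el (vc A)" for a
 proof -
  obtain x where x: "x : el A" "a = vc x" using aA unfolding N_el_vc by blast
  then have "vc (pr x (ap f x)) : N.el (vc f)" unfolding vc_in by (auto simp: isf_el[OF f])
  then show ?thesis using x by (auto simp: vc_pr)
 qed
 have 3: "N.pr a b : N.el (vc f) ==> N.pr a b' : N.el (vc f) ==> b = b'" for a b b'
  by (auto simp: N_el_vc isf_el[OF f] vc_pr)
 note r = N.isf_rel[of "vc f" "vc A" "vc B", OF 1 2 3]
 show "N.isf (vc f) (vc A) (vc B)" by (rule r(1))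
 show "N.ap (vc f) (vc x) = vc (ap f x)" if "x : el A"
 proof (rule r(2))
  have "vc (pr x (ap f x)) : N.el (vc f)" unfolding vc_in using that by (auto simp: isf_el[OF f])
  then show "N.pr (vc x) (vc (ap f x)) : N.el (vc f)" by (simp add: vc_pr)
 qed
qed

lemma vc_cov: "cov A B ==> N.cov (vc A) (vc B)"
proof -
 assume "cov A B"
 then obtain f where f: "el B <= ap f ` el A" by (auto simp: cov_def)
 have g: "isf (lam A (ap f)) A (img f A)" by (rule isfI) auto
 have "N.el (vc B) <= N.ap (vc (lam A (ap f))) ` N.el (vc A)"
 proof
  fix y assume "y : N.el (vc B)"
  then obtain x where "x : el A" "y = vc (ap f x)" using f by (auto simp: N_el_vc)
  then show "y : N.ap (vc (lam A (ap f))) ` N.el (vc A)"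
   using vc_isf(2)[OF g, of x] by (intro image_eqI[of _ _ "vc x"]) (auto simp: N_el_vc ap_lam)
 qed
 then show ?thesis by (auto simp: N.cov_def)
qed

text \<open>Forcing adds no finite sequences of old elements. The induction runs inside the
  extension and prolongs an old sequence by one old value.\<close>

lemma ground_sequence: "n : el om ==> N.isf t (vc n) (vc A) ==> EX u. isf u n A & t = vc u"
proof -
 assume n: "n : el om" and t: "N.isf t (vc n) (vc A)"
 have nN: "vc n : N.el N.om" using n by (simp add: vc_om N_el_vc)
 have "ALL t. N.isf t (vc n) (vc A) --> t : N.el (vc (sq A))"
 proof (rule N.om_induct[OF nN])
  show "N.dfn (%v. ALL t. N.isf t (v 0) (vc A) --> t : N.el (vc (sq A)))" by (intro dfns)
  show "ALL t. N.isf t N.emp (vc A) --> t : N.el (vc (sq A))"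
  proof (intro allI impI)
   fix t assume "N.isf t N.emp (vc A)"
   then have "t = vc emp" using N.fn_emp vc_emp by (auto simp: N.isf_iff_fn)
   moreover have "emp : el (sq A)"
    unfolding el_sq mem_Collect_eq by (rule bexI[of _ emp]) (simp_all add: isf_iff_fn fn_emp)
   ultimately show "t : N.el (vc (sq A))" by (auto simp: N_el_vc simp del: el_sq)
  qed
  fix m assume m: "m : N.el N.om" and IH: "ALL t. N.isf t m (vc A) --> t : N.el (vc (sq A))"
  obtain k where k: "k : el om" "m = vc k" using m by (auto simp: vc_om N_el_vc)
  show "ALL t. N.isf t (N.ins m m) (vc A) --> t : N.el (vc (sq A))"
  proof (intro allI impI)
   fix t assume t: "N.isf t (N.ins m m) (vc A)"
   let ?t = "N.lam m (N.ap t)"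
   have t': "N.isf ?t m (vc A)" by (rule N.isfI) (use N.isf_in[OF t] in auto)
   then obtain u l where u: "l : el om" "isf u l A" "?t = vc u" using IH by (auto simp: N_el_vc)
   have "vc l = vc k" using N.isf_dom_unique[OF vc_isf(1)[OF u(2)] t'[unfolded u(3)]] k(2) by simp
   then have "l = k" by simp
   obtain a where a: "a : el A" "N.ap t m = vc a" using N.isf_in[OF t, of m] by (auto simp: N_el_vc)
   have "t = N.ins (N.pr m (vc a)) (vc u)"
    by (rule N.eqI) (auto simp: N.isf_el[OF t] N.el_lam a(2) simp flip: u(3))
   then have "t = vc (ins (pr k a) u)" using k by (simp add: vc_ins vc_pr)
   moreover have "isf (ins (pr k a) u) (sc k) A" using isf_extend(1)[of u k A k a] u \<open>l = k\<close> a by simp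
   ultimately show "t : N.el (vc (sq A))" using sc_om[OF k(1)] by (auto simp: N_el_vc)
  qed
 qed
 then obtain u l where u: "l : el om" "isf u l A" "t = vc u" using t by (auto simp: N_el_vc)
 then have "vc l = vc n" using N.isf_dom_unique[OF vc_isf(1)[OF u(2)]] t by blast
 then have "l = n" by simp
 then show ?thesis using u by blast
qed

definition dec :: "'a => 'a => 'a => 'a => bool" where "dec \<gamma> r x y \<longleftrightarrow> MEM r (opn (chk x) (chk y)) \<gamma>"

lemma dfn_dec [dfns]: "dt t ==> dt u ==> dt w ==> dfn (%v. dec \<gamma> (t v) (u v) (w v))"
 unfolding dec_def by (intro dfns)

lemma dec_mono: "dec \<gamma> p x y ==> le q p ==> dec \<gamma> q x y" unfolding dec_def by (rule MEM_mono)

lemma dec_val: "N.isf (val \<gamma>) A B ==> r : G ==> dec \<gamma> r x y ==> N.ap (val \<gamma>) (vc x) = vc y"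
proof -
 assume f: "N.isf (val \<gamma>) A B" and "r : G" "dec \<gamma> r x y"
 then have "EN (N.pr (vc x) (vc y)) (val \<gamma>)" using val_mem val_opn unfolding dec_def by metis
 then show ?thesis using N.isf_pr[OF f] by (simp add: N_mem)
qed

lemma val_dec: "N.isf (val \<gamma>) A B ==> vc x : N.el A ==> N.ap (val \<gamma>) (vc x) = vc y ==> EX r:G. dec \<gamma> r x y"
proof -
 assume f: "N.isf (val \<gamma>) A B" and "vc x : N.el A" "N.ap (val \<gamma>) (vc x) = vc y"
 then have "EN (N.pr (vc x) (vc y)) (val \<gamma>)" using N.isf_pr[OF f] by (simp add: N_mem)
 then show ?thesis using val_mem val_opn unfolding dec_def by metis
qed

text \<open>The combinatorial content of naming a function: below \<open>p\<close> each value is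
  decided densely, and never in two ways. Only this is passed on to the fusion and to the chain
  condition.\<close>

definition fname :: "'a => 'a => 'a => 'a => bool" where
 "fname \<gamma> B V p \<longleftrightarrow> (ALL q. le q p --> (ALL x:el B. EX r. EX y:el V. le r q & dec \<gamma> r x y)) &
  (ALL q. le q p --> (ALL x:el B. ALL y:el V. ALL y':el V. dec \<gamma> q x y --> dec \<gamma> q x y' --> y = y'))"

text \<open>It is dense to satisfy \<open>fname\<close>, to leave some value undecidable, or to
  decide some value twice. For a name of a function no condition in \<open>G\<close> can do either
  of the latter.\<close>

lemma function_name: assumes f: "N.isf (val \<gamma>) (vc B) (vc V)" shows "EX p:G. fname \<gamma> B V p"
proof -
 let ?A = "%p. EX x:el B. ALL r. le r p --> (ALL y:el V. ~ dec \<gamma> r x y)"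
 let ?B = "%p. EX x:el B. EX y:el V. EX y':el V. dec \<gamma> p x y & dec \<gamma> p x y' & y ~= y'"
 have "EX p:G. fname \<gamma> B V p | ?A p | ?B p"
 proof (rule generic_dense)
  show "dfn (%v. fname \<gamma> B V (v 0) | ?A (v 0) | ?B (v 0))" unfolding fname_def by (intro dfns)
  fix q assume q: "q : el P"
  show "EX r. le r q & (fname \<gamma> B V r | ?A r | ?B r)"
  proof (cases "fname \<gamma> B V q")
   case True then show ?thesis using le_refl q by blast
  next
   case False
   then consider q' x where "le q' q" "x : el B" "~ (EX r. EX y:el V. le r q' & dec \<gamma> r x y)"
    | q' where "le q' q" "?B q'" unfolding fname_def by blast
   then show ?thesis by cases blast+
  qed
 qed
 then obtain p where p: "p : G" "fname \<gamma> B V p | ?A p | ?B p" by blast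
 have "~ ?A p"
 proof
  assume "?A p"
  then obtain x where x: "x : el B" "ALL r. le r p --> (ALL y:el V. ~ dec \<gamma> r x y)" by blast
  have "N.ap (val \<gamma>) (vc x) : N.el (vc V)" using N.isf_in[OF f] x by (auto simp: N_el_vc)
  then obtain y where y: "y : el V" "N.ap (val \<gamma>) (vc x) = vc y" by (auto simp: N_el_vc)
  then obtain r where r: "r : G" "dec \<gamma> r x y" using val_dec[OF f, of x y] x(1) by auto
  then show False using G_dir[OF p(1) r(1)] dec_mono x(2) y(1) by blast
 qed
 moreover have "~ ?B p" using dec_val[OF f p(1)] vc_inject by metis
 ultimately show ?thesis using p by blast
qed

end

section \<open>Finite combinatorics of thinning\<close>

section \<open>Pruning finite families of sequences\<close>

context zfc
begin

lemma dependent_choice: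
 assumes d: "dfn (%v. Q (v 0) (v 1))" and x0: "x0 : el X" and step: "!!x. x : el X ==> EX y:el X. Q x y"
 shows "EX f. isf f om X & ap f emp = x0 & (ALL n:el om. Q (ap f n) (ap f (sc n)))"
proof -
 obtain g where g: "isf g X X" "!!x. x : el X ==> Q x (ap g x)" using ac[OF d, of X X] step by blast
 obtain f where f: "fn f om" "ap f emp = x0" "!!n. n : el om ==> ap f (sc n) = ap g (ap f n)"
  using om_rec[of "ap g" x0] by auto
 have "ap f n : el X" if "n : el om" for n
  by (rule om_induct[OF that]) (use f x0 isf_in[OF g(1)] in \<open>auto intro!: dfns\<close>)
 then show ?thesis using f g(2) by (auto simp: isf_iff_fn)
qed

lemma lep_or_cov: "n : el om ==> lep n X | cov n X"
proof -
 assume n: "n : el om"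
 obtain d where d: "Card d" "eqp X d" using card_ex by blast
 then have "Ord d" by (simp add: Card_def)
 then consider "el n <= el d" | "el d <= el n" using Ord_linear[OF Ord_nat[OF n], of d] Ord_elem_sub Ord_nat[OF n] by blast
 then show ?thesis
 proof cases
  case 1
  then have "cov X n" using cov_trans[OF eqp_cov[OF d(2)] cov_sub] by blast
  then show ?thesis using cov_lep by blast
 next
  case 2
  then show ?thesis using cov_trans[OF cov_sub eqp_cov[OF eqp_sym[OF d(2)]]] by blast
 qed
qed

lemma not_cov_sc: "n : el om ==> ~ cov n (sc n)"
 using pigeonhole cov_lep unfolding lep_def by blast

lemma Fin_not_lep: "Fin X ==> EX n:el om. ~ lep n X"
proof -
 assume "Fin X"
 then obtain n where n: "n : el om" "cov n X" by (auto simp: Fin_iff_cov)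
 then have "~ lep (sc n) X" using lep_cov cov_trans not_cov_sc by blast
 then show ?thesis using sc_om[OF n(1)] by blast
qed

lemma lep_mono: "el X <= el Y ==> lep n X ==> lep n Y"
 unfolding lep_def using isf_mono by blast
lemma lep_trans: "lep A B ==> lep B C ==> lep A C" using lep_iff_cov cov_trans by blast
lemma lep_sub: "el A <= el B ==> lep A B" using lep_iff_cov cov_sub by blast

lemma lep_ins: assumes "lep n X" "n ~: el n" "x ~: el X" shows "lep (sc n) (ins x X)"
proof -
 obtain f where f: "isf f n X" "inj_on (ap f) (el n)" using assms(1) by (auto simp: lep_def)
 have f': "isf f n (ins x X)" by (rule isf_mono[OF f(1)]) auto
 have "x : el (ins x X)" by simp
 note e = isf_extend[OF f' assms(2) this]
 have "inj_on (ap (ins (pr n x) f)) (el (sc n))"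
 proof (rule inj_onI)
  fix a b assume ab: "a : el (sc n)" "b : el (sc n)" "ap (ins (pr n x) f) a = ap (ins (pr n x) f) b"
  have *: "ap (ins (pr n x) f) c ~= x" if "c : el n" for c using e(3)[OF that] isf_in[OF f(1) that] assms(3) by auto
  show "a = b"
  proof (cases "a = n"; cases "b = n")
   assume "a ~= n" "b ~= n"
   then show ?thesis using ab e(3) inj_onD[OF f(2)] by auto
  qed (use ab e(2) *[of a] *[of b] in auto)
 qed
 then show ?thesis using e(1) by (auto simp: lep_def)
qed

text \<open>In the tree of initial segments of the sequences \<open>ap t v\<close>, no node
  \<open>u\<close> has all the elements of \<open>c\<close> as next values.\<close>

definition thin :: "'a => 'a => 'a => 'a => bool" where
 "thin c L t V \<longleftrightarrow> (ALL n:el L. ALL u. EX i:el c. ALL v:el V. lam n (ap (ap t v)) = u --> ap (ap t v) n ~= i)"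

lemma dfn_thin [dfns]: "dt t ==> dt u ==> dt w ==> dfn (%v. thin c (t v) (u v) (w v))"
 by (rule dfn_comp3[where P="thin c"]; (assumption | (unfold thin_def, intro dfns)))

lemma dfn_lep [dfns]: "dt t ==> dt u ==> dfn (%v. lep (t v) (u v))"
 by (rule dfn_comp2[where P=lep]; (assumption | (unfold lep_def, intro dfns)))

lemma thin_sub: "thin c L t V ==> el V' <= el V ==> thin c L t V'" unfolding thin_def by blast

text \<open>The pruned set is a comb: the sequences leave a common branch one at a time, so that every node
 has at most two successors.\<close>

lemma prune_one:
 assumes c: "c : el om" "sc (sc emp) : el c" and K: "K : el om"
 shows "EX N:el om. ALL V. lep N V --> (ALL L:el om. ALL t. (ALL v:el V. isf (ap t v) L c) -->
  (EX V'. el V' <= el V & lep K V' & thin c L t V'))"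
proof (rule om_induct[OF K])
 \<comment> \<open>\<open>c\<close> has at least three elements, while a node of a comb has at most
   two successors; so a value is left over.\<close>
 have tri: "EX x:el c. x ~= i & x ~= j" for i j
 proof -
  have "sc emp : el c" "emp : el c" using om_mem_trans[OF c] by auto
  moreover have "sc emp ~= emp" "sc (sc emp) ~= emp" by (metis el_emp el_ins insert_not_empty)+
  moreover have "sc (sc emp) ~= sc emp" by (metis el_ins insertI1 mem_irrefl)
  ultimately show ?thesis using c(2) by metis
 qed
 show "dfn (%v. EX N:el om. ALL V. lep N V --> (ALL L:el om. ALL t. (ALL v:el V. isf (ap t v) L c) -->
  (EX V'. el V' <= el V & lep (v 0) V' & thin c L t V')))" by (intro dfns)
 have "lep emp V'" for V' by (rule lep_sub) simp
 moreover have "thin c L t emp" for L t using c unfolding thin_def by auto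
 ultimately show "EX N:el om. ALL V. lep N V --> (ALL L:el om. ALL t. (ALL v:el V. isf (ap t v) L c) -->
  (EX V'. el V' <= el V & lep emp V' & thin c L t V'))"
  by (intro bexI[of _ emp] allI impI ballI exI[of _ emp]) auto
 fix K assume K: "K : el om" and IH: "EX N:el om. ALL V. lep N V --> (ALL L:el om. ALL t. (ALL v:el V. isf (ap t v) L c) -->
  (EX V'. el V' <= el V & lep K V' & thin c L t V'))"
 then obtain N where N: "N : el om" "!!V L t. lep N V ==> L : el om ==> ALL v:el V. isf (ap t v) L c ==>
  EX V'. el V' <= el V & lep K V' & thin c L t V'" by blast
 \<comment> \<open>The size \<open>M0\<close> serves two counts: a set that \<open>tms c N\<close>
   does not cover has \<open>N\<close> sequences sharing their value at the splitting level, and a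
   set that \<open>sc K\<close> does not cover is itself large enough if no sequences split.\<close>
 have "Fin (un2 (tms c N) (sc K))" by (intro Fin_un2 Fin_tms Fin_nat sc_om c N K)
 then obtain M0 where M0: "M0 : el om" "~ lep M0 (un2 (tms c N) (sc K))" using Fin_not_lep by blast
 show "EX N:el om. ALL V. lep N V --> (ALL L:el om. ALL t. (ALL v:el V. isf (ap t v) L c) -->
  (EX V'. el V' <= el V & lep (sc K) V' & thin c L t V'))"
 proof (intro bexI[OF _ M0(1)] allI impI ballI)
  fix V L t assume V: "lep M0 V" and L: "L : el om" and t: "ALL v:el V. isf (ap t v) L c"
  have big: "~ cov (tms c N) V" "~ cov (sc K) V"
  proof -
   have *: False if "cov X V" "el X <= el (un2 (tms c N) (sc K))" for X
    using lep_trans[OF V lep_trans[OF cov_lep[OF that(1)] lep_sub[OF that(2)]]] M0(2) by blast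
   show "~ cov (tms c N) V" "~ cov (sc K) V" by (rule notI, erule *, subst el_un2, blast)+
  qed
  then have lepK: "lep (sc K) V" using lep_or_cov[OF sc_om[OF K]] by blast
  show "EX V'. el V' <= el V & lep (sc K) V' & thin c L t V'"
  proof (cases "EX n:el L. EX v:el V. EX v':el V. ap (ap t v) n ~= ap (ap t v') n")
   case False
   have "thin c L t V" unfolding thin_def
   proof (intro ballI allI)
    fix n u assume n: "n : el L"
    show "EX i:el c. ALL v:el V. lam n (ap (ap t v)) = u --> ap (ap t v) n ~= i"
    proof (cases "el V = {}")
     case True then show ?thesis using tri by blast
    next
     case no: False
     then obtain v0 where "v0 : el V" by blast
     then show ?thesis using tri[of "ap (ap t v0) n"] False n by metis
    qed
   qed
   then show ?thesis using lepK by blast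
  next
   case True
   let ?Q = "%n. n : el L & (EX v:el V. EX v':el V. ap (ap t v) n ~= ap (ap t v') n)"
   have "dfn (%v. ?Q (v 0))" by (intro dfns)
   then obtain n where n: "?Q n" "ALL m:el n. ~ ?Q m" using eps_min[of ?Q] True by blast
   have nL: "n : el L" using n(1) by blast
   have eqn: "ap (ap t v) m = ap (ap t v') m" if "m : el n" "v : el V" "v' : el V" for m v v'
    using n(2) that om_mem_trans[OF L nL] by blast
   define F where "F i = mk {v : el V. ap (ap t v) n = i}" for i
   have sF: "S {v : el V. ap (ap t v) n = i}" for i by (rule S_Collect[OF S_el]) (intro dfns)
   have eF: "el (F i) = {v : el V. ap (ap t v) n = i}" for i unfolding F_def by (rule el_mk[OF sF])
   have dF: "dt (%v. F (v 0))" unfolding F_def by (rule dt_mk[OF sF]) (unfold mem_Collect_eq, intro dfns)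
   have "EX i:el c. lep N (F i)"
   proof (rule ccontr)
    assume "~ ?thesis"
    then have "cov N (F i)" if "i : el c" for i using lep_or_cov[OF N(1)] that by blast
    then have "cov (tms c N) (mk (UN i:el c. el (F i)))" by (rule cov_UN[OF dF])
    moreover have "el (mk (UN i:el c. el (F i))) = el V"
     unfolding el_mk[OF S_UN[OF S_el dF]] using isf_in t nL by (auto simp: eF)
    ultimately show False using big(1) by simp
   qed
   then obtain i where i: "i : el c" "lep N (F i)" by blast
   have "ALL v:el (F i). isf (ap t v) L c" using t eF by blast
   then obtain W where W: "el W <= el (F i)" "lep K W" "thin c L t W" using N(2)[OF i(2) L] by blast
   \<comment> \<open>\<open>v0\<close> leaves the common branch at level \<open>n\<close>, where all
     of \<open>W\<close> takes the value \<open>i\<close>. It becomes the next tooth of the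
     comb.\<close>
   obtain v0 where v0: "v0 : el V" "ap (ap t v0) n ~= i" using n(1) by metis
   have WV: "v : el V" "ap (ap t v) n = i" if "v : el W" for v using W(1) eF that by auto
   have "lep (sc K) (ins v0 W)" by (rule lep_ins[OF W(2)]) (use WV v0 in auto)
   moreover have "thin c L t (ins v0 W)" unfolding thin_def
   proof (intro ballI allI)
    fix n' u assume n': "n' : el L"
    have o: "n : el om" "n' : el om" using om_elem L nL n' by auto
    have VV: "v : el V" if "v : el (ins v0 W)" for v using that WV v0 by auto
    show "EX i:el c. ALL v:el (ins v0 W). lam n' (ap (ap t v)) = u --> ap (ap t v) n' ~= i"
    proof -
     consider "n' : el n" | "n' = n" | "n : el n'" using om_linear[OF o] by blast
     then show ?thesis
     proof cases
      case 1
      obtain x where x: "x : el c" "x ~= ap (ap t v0) n'" using tri by blast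
      have "ap (ap t v) n' ~= x" if "v : el (ins v0 W)" for v using eqn[OF 1 VV[OF that] v0(1)] x(2) by metis
      then show ?thesis using x(1) by blast
     next
      case 2
      obtain x where x: "x : el c" "x ~= i" "x ~= ap (ap t v0) n" using tri by blast
      have "ap (ap t v) n' ~= x" if "v : el (ins v0 W)" for v
      proof (cases "v = v0")
       case True then show ?thesis using x(3) 2 by metis
      next
       case False then have "v : el W" using that by simp
       then show ?thesis using WV(2) x(2) 2 by metis
      qed
      then show ?thesis using x(1) by blast
     next
      case 3
      show ?thesis
      proof (cases "lam n' (ap (ap t v0)) = u")
       case True
       obtain x where x: "x : el c" "x ~= ap (ap t v0) n'" using tri by blast
       have "lam n' (ap (ap t v)) ~= u" if "v : el W" for v
       proof
        assume "lam n' (ap (ap t v)) = u"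
        then have "ap (lam n' (ap (ap t v))) n = ap (lam n' (ap (ap t v0))) n" using True by simp
        then show False using ap_lam[OF dt_ap1 3] WV(2)[OF that] v0(2) by simp
       qed
       then have "lam n' (ap (ap t v)) = u --> ap (ap t v) n' ~= x" if "v : el (ins v0 W)" for v
        using x(2) that by (metis el_ins insertE)
       then show ?thesis using x(1) by blast
      next
       case False
       obtain x where "x : el c" "ALL v:el W. lam n' (ap (ap t v)) = u --> ap (ap t v) n' ~= x"
        using W(3) n' unfolding thin_def by blast
       moreover from this have "lam n' (ap (ap t v)) = u --> ap (ap t v) n' ~= x" if "v : el (ins v0 W)" for v
        using False that by (metis el_ins insertE)
       ultimately show ?thesis by blast
      qed
     qed
    qed
   qed
   ultimately show ?thesis using W(1) eF v0(1) by (intro exI[of _ "ins v0 W"]) auto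
  qed
 qed
qed

text \<open>The families are thinned one after the other, since \<open>thin\<close> passes to
  subsets. The bound is chosen before \<open>V\<close>, the length \<open>L\<close> and the
  sequences: in the fusion the position has to be picked before it is known how much of the name is
  decided there.\<close>

lemma prune:
 assumes c: "c : el om" "sc (sc emp) : el c" and Z: "Fin Z" and K: "K : el om"
 shows "EX N:el om. ALL V. lep N V --> (ALL L:el om. ALL t. (ALL z:el Z. ALL v:el V. isf (ap (ap t z) v) L c) -->
  (EX V'. el V' <= el V & lep K V' & (ALL z:el Z. thin c L (ap t z) V')))"
proof (rule Fin_induct[OF Z])
 show "dfn (%u. EX N:el om. ALL V. lep N V --> (ALL L:el om. ALL t. (ALL z:el (u 0). ALL v:el V. isf (ap (ap t z) v) L c) -->
  (EX V'. el V' <= el V & lep K V' & (ALL z:el (u 0). thin c L (ap t z) V'))))" by (intro dfns)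
 show "EX N:el om. ALL V. lep N V --> (ALL L:el om. ALL t. (ALL z:el emp. ALL v:el V. isf (ap (ap t z) v) L c) -->
  (EX V'. el V' <= el V & lep K V' & (ALL z:el emp. thin c L (ap t z) V')))"
  using K by (intro bexI[of _ K]) auto
 fix x b assume "EX N:el om. ALL V. lep N V --> (ALL L:el om. ALL t. (ALL z:el b. ALL v:el V. isf (ap (ap t z) v) L c) -->
  (EX V'. el V' <= el V & lep K V' & (ALL z:el b. thin c L (ap t z) V')))"
 then obtain N where N: "N : el om" "!!V L t. lep N V ==> L : el om ==> ALL z:el b. ALL v:el V. isf (ap (ap t z) v) L c ==>
  EX V'. el V' <= el V & lep K V' & (ALL z:el b. thin c L (ap t z) V')" by blast
 obtain M0 where M0: "M0 : el om" "!!V L t. lep M0 V ==> L : el om ==> ALL v:el V. isf (ap t v) L c ==>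
  EX V'. el V' <= el V & lep N V' & thin c L t V'" using prune_one[OF c N(1)] by blast
 show "EX N:el om. ALL V. lep N V --> (ALL L:el om. ALL t. (ALL z:el (ins x b). ALL v:el V. isf (ap (ap t z) v) L c) -->
  (EX V'. el V' <= el V & lep K V' & (ALL z:el (ins x b). thin c L (ap t z) V')))"
 proof (intro bexI[OF _ M0(1)] allI impI ballI)
  fix V L t assume V: "lep M0 V" "L : el om" and t: "ALL z:el (ins x b). ALL v:el V. isf (ap (ap t z) v) L c"
  then obtain V1 where V1: "el V1 <= el V" "lep N V1" "thin c L (ap t x) V1" using M0(2)[OF V, of "ap t x"] by auto
  then have "ALL z:el b. ALL v:el V1. isf (ap (ap t z) v) L c" using t by auto
  then obtain V2 where "el V2 <= el V1" "lep K V2" "ALL z:el b. thin c L (ap t z) V2" using N(2)[OF V1(2) V(2)] by blast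
  then show "EX V'. el V' <= el V & lep K V' & (ALL z:el (ins x b). thin c L (ap t z) V')"
   using V1 thin_sub by (intro exI[of _ V2]) auto
 qed
qed

end

section \<open>The forcing conditions, finite changes of them, and fusion\<close>

section \<open>Conditions\<close>

context zfc
begin

lemma cov_om_ins: "cov om C ==> cov om (ins x C)"
proof -
 assume "cov om C"
 then obtain g where g: "el C <= ap g ` el om" by (auto simp: cov_def)
 define h where "h m = (if m = emp then x else ap g (un m))" for m
 have dh: "dt (%v. h (v 0))" unfolding h_def by (intro dfns)
 show ?thesis
 proof (rule covI[OF dh], rule subsetI)
  fix y assume "y : el (ins x C)"
  then consider "y = x" | m where "m : el om" "y = ap g m" using g by auto
  then show "y : h ` el om"
  proof cases
   case 1 then show ?thesis by (intro image_eqI[of _ _ emp]) (auto simp: h_def)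
  next
   case 2
   have "un (sc m) = m" by (rule eqI) (use om_trans_el[OF 2(1)] in \<open>auto simp: trans_def\<close>)
   moreover have "sc m ~= emp" by (metis el_emp el_ins insert_not_empty)
   ultimately show ?thesis using 2 by (intro image_eqI[of _ _ "sc m"]) (auto simp: h_def)
  qed
 qed
qed

lemma cov_om_Fin: "Fin D ==> cov om C ==> cov om (un2 C D)"
proof -
 assume D: "Fin D" and C: "cov om C"
 have u: "un2 C emp = C" "un2 C (ins x b) = ins x (un2 C b)" for x b by (rule eqI, simp)+
 show ?thesis by (rule Fin_induct[OF D]) (auto intro!: dfns cov_om_ins C simp: u)
qed

end

locale silver = zfc +
 fixes k :: 'a
 assumes k_om: "k : el om" and k_two: "sc emp : el k"
begin

definition RR :: 'a where "RR = pw om"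
definition JJ :: 'a where "JJ = pw RR"
text \<open>\<open>RR\<close> stands for the reals and \<open>JJ\<close> for the subsets of the
  reals. \<open>II\<close> is no larger than \<open>JJ\<close>, but as a space of functions on
  \<open>RR\<close> it allows the diagonal argument of \<open>column_outside\<close>.\<close>

definition II :: 'a where "II = fs RR JJ"
definition two :: 'a where "two = sc (sc emp)"
definition Ps :: 'a where "Ps = tms II (tms two om)"
text \<open>The number of values at a position: always finite, so that a limit of conditions cannot
  exhaust a position, but unbounded along a column of the second kind.\<close>

definition fl :: "'a => 'a" where "fl e = (if fst' (snd' e) = emp then k else sc (snd' (snd' e)))"
definition al :: "'a => 'a => 'a" where "al p e = mk {i. i : el (fl e) & pr e i ~: el p}"
definition rq :: "'a => 'a => 'a => bool" where
 "rq j K V \<longleftrightarrow> (j = emp & el k <= el V) | (j ~= emp & lep K V)"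
definition pos :: "'a => 'a => 'a => 'a" where "pos \<alpha> j n = pr \<alpha> (pr j n)"

text \<open>A condition is the set of the pairs \<^term>\<open>pr e i\<close> such that the value \<^term>\<open>i\<close> is excluded
 at the position \<^term>\<open>e\<close>; positions of kind \<^term>\<open>emp\<close> must be left completely free infinitely often,
 those of the other kind must retain arbitrarily many values.\<close>

definition cnd :: "'a => bool" where
 "cnd p \<longleftrightarrow> (ALL z:el p. EX e:el Ps. EX i:el (fl e). z = pr e i) & (ALL e:el Ps. al p e ~= emp) &
  (EX C. cov om C & (ALL z:el p. fst' (fst' z) : el C)) &
  (ALL \<alpha>:el II. ALL j:el two. ALL K:el om. EX n:el om. K : el n & rq j K (al p (pos \<alpha> j n)))"

lemma dt_fl [dfns]: "dt t ==> dt (%v. fl (t v))" unfolding fl_def by (intro dfns)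
lemma dt_pos [dfns]: "dt t ==> dt u ==> dt w ==> dt (%v. pos (t v) (u v) (w v))" unfolding pos_def by (intro dfns)

lemma S_al: "S {i. i : el (fl e) & pr e i ~: el p}"
 by (rule S_sub[OF S_el[of "fl e"]]) (auto intro!: dfns)
lemma el_al: "el (al p e) = {i. i : el (fl e) & pr e i ~: el p}" by (simp add: al_def el_mk S_al)
lemma dt_al [dfns]: "dt t ==> dt u ==> dt (%v. al (t v) (u v))"
 by (rule dt_comp2[where f=al, rotated], assumption+, unfold al_def, rule dt_mk, rule S_al, intro dfns)
lemma dfn_rq [dfns]: "dt t ==> dt u ==> dt w ==> dfn (%v. rq (t v) (u v) (w v))"
 by (rule dfn_comp3[where P=rq]; (assumption | (unfold rq_def, intro dfns)))
lemma dfn_cnd [dfns]: "dt t ==> dfn (%v. cnd (t v))"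
 by (rule dfn_comp1[where P=cnd]; (assumption | (unfold cnd_def, intro dfns)))

lemma el_two: "el two = {emp, sc emp}" by (auto simp: two_def)
lemma pos_Ps: "\<alpha> : el II ==> j : el two ==> n : el om ==> pos \<alpha> j n : el Ps" by (auto simp: Ps_def pos_def)
lemma Ps_cases: assumes "e : el Ps" obtains \<alpha> j n where "\<alpha> : el II" "j : el two" "n : el om" "e = pos \<alpha> j n"
 using assms by (auto simp: Ps_def pos_def)
lemma fl_pos: "fl (pos \<alpha> j n) = (if j = emp then k else sc n)" by (simp add: fl_def pos_def)
lemma fst_pos [simp]: "fst' (pos \<alpha> j n) = \<alpha>" by (simp add: pos_def)
lemma pos_inject [simp]: "pos \<alpha> j n = pos \<alpha>' j' n' \<longleftrightarrow> \<alpha> = \<alpha>' & j = j' & n = n'" by (simp add: pos_def)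
lemma fl_om: "e : el Ps ==> fl e : el om" by (elim Ps_cases) (auto simp: fl_pos k_om)
lemma al_fl: "el (al p e) <= el (fl e)" by (auto simp: el_al)
lemma al_mono: "el p <= el q ==> el (al q e) <= el (al p e)" by (auto simp: el_al)
lemma ne_emp: "x ~= emp \<longleftrightarrow> (EX i. i : el x)" using el_inject[of x emp] by auto
lemma rq_mono: "rq j K V ==> el V <= el V' ==> rq j K V'" unfolding rq_def using lep_mono by blast
lemma rq_less: "rq j K V ==> el K' <= el K ==> rq j K' V" unfolding rq_def using lep_trans lep_sub by blast

lemma cnd_emp: "cnd emp"
proof -
 have a: "al emp e = fl e" for e by (rule eqI) (auto simp: el_al)
 have f: "fl e ~= emp" if "e : el Ps" for e
  using that k_two by (elim Ps_cases) (auto simp: fl_pos ne_emp)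
 have r: "rq j K (fl (pos \<alpha> j (sc K)))" if "K : el om" for \<alpha> j K
  unfolding rq_def fl_pos by (auto intro!: lep_sub)
 have "cov om emp" by (rule cov_sub) simp
 moreover have "EX n:el om. K : el n & rq j K (fl (pos \<alpha> j n))" if "K : el om" for \<alpha> j K
  using r[OF that] that by (intro bexI[of _ "sc K"]) auto
 ultimately show ?thesis unfolding cnd_def a using f by auto
qed

lemma pos_index_bound: "Fin F ==> EX b:el om. ALL e:el F. snd' (snd' e) : el om --> snd' (snd' e) : el b"
proof -
 assume F: "Fin F"
 have d: "dt (%v. snd' (snd' (v 0)))" by (intro dfns)
 have s: "S ((%e. snd' (snd' e)) ` el F)" by (rule S_img[OF S_el d])
 have s2: "S ((%e. snd' (snd' e)) ` el F \<inter> el om)" by (rule S_Int[OF s S_el])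
 have "Fin (mk ((%e. snd' (snd' e)) ` el F \<inter> el om))"
  by (rule Fin_sub[OF Fin_img[OF d F]]) (simp add: el_mk[OF s] el_mk[OF s2])
 then obtain b where "b : el om" "(%e. snd' (snd' e)) ` el F \<inter> el om <= el b"
  using Fin_bounded[of "mk ((%e. snd' (snd' e)) ` el F \<inter> el om)"] by (auto simp: el_mk[OF s2])
 then show ?thesis by (intro bexI[of _ b]) auto
qed

text \<open>Finitely many positions have bounded indices, so the freedom that a condition has to
  leave is found beyond them.\<close>

lemma cnd_modify:
 assumes p: "cnd p" and F: "Fin F" and sub: "el p <= el q"
  and new: "!!z. z : el q ==> z : el p | (EX e:el F. EX i:el (fl e). e : el Ps & z = pr e i)"
  and ne: "!!e. e : el F ==> e : el Ps ==> al q e ~= emp"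
 shows "cnd q"
proof -
 have same: "al q e = al p e" if "e ~: el F" for e
 proof (rule eqI, rule equalityI)
  show "el (al q e) <= el (al p e)" using al_mono[OF sub] .
  have "pr e x ~: el q" if "pr e x ~: el p" for x using new[of "pr e x"] that \<open>e ~: el F\<close> by auto
  then show "el (al p e) <= el (al q e)" by (auto simp: el_al)
 qed
 have sp: "ALL z:el p. EX e:el Ps. EX i:el (fl e). z = pr e i" using p by (simp add: cnd_def)
 obtain C where C: "cov om C" "ALL z:el p. fst' (fst' z) : el C" using p by (auto simp: cnd_def)
 let ?D = "mk (fst' ` el F)"
 have d: "dt (%v. fst' (v 0))" by (intro dfns)
 have D: "Fin ?D" "el ?D = fst' ` el F" by (rule Fin_img[OF d F], rule el_mk[OF S_img[OF S_el d]])
 have "ALL z:el q. fst' (fst' z) : el (un2 C ?D)" using new C(2) D(2) by fastforce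
 moreover have "cov om (un2 C ?D)" by (rule cov_om_Fin[OF D(1) C(1)])
 moreover have "EX n:el om. K : el n & rq j K (al q (pos \<alpha> j n))"
  if a: "\<alpha> : el II" "j : el two" "K : el om" for \<alpha> j K
 proof -
  obtain b where b: "b : el om" "ALL e:el F. snd' (snd' e) : el om --> snd' (snd' e) : el b"
   using pos_index_bound[OF F] by blast
  obtain K' where K': "K' : el om" "el (sc K) <= el K'" "el b <= el K'" using om_max[OF sc_om[OF a(3)] b(1)] by blast
  obtain n where n: "n : el om" "K' : el n" "rq j K' (al p (pos \<alpha> j n))"
   using p a K'(1) unfolding cnd_def by blast
  have "pos \<alpha> j n ~: el F"
  proof
   assume "pos \<alpha> j n : el F"
   then have "n : el K'" using b(2) n(1) K'(3) by (force simp: pos_def)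
   then show False using n(2) mem_asym by blast
  qed
  then have "al q (pos \<alpha> j n) = al p (pos \<alpha> j n)" by (rule same)
  moreover have "K : el n" using K'(2) om_mem_trans[OF n(1,2)] by auto
  moreover have "el K <= el K'" using K'(2) by auto
  ultimately show ?thesis using n rq_less by metis
 qed
 moreover have "al q e ~= emp" if "e : el Ps" for e using ne same p that by (cases "e : el F") (auto simp: cnd_def)
 moreover have "EX e:el Ps. EX i:el (fl e). z = pr e i" if "z : el q" for z using new[OF that] sp by blast
 ultimately show ?thesis unfolding cnd_def by blast
qed

text \<open>\<open>ps p F \<sigma>\<close> is \<open>p\<close> with each position in
  \<open>F\<close> frozen to its value under \<open>\<sigma>\<close>; \<open>exc\<close> lists the
  exclusions that do so.\<close>

definition exc :: "'a => 'a => 'a" where "exc F \<sigma> = mk {z. EX e:el F. EX i:el (fl e). z = pr e i & i ~= ap \<sigma> e}"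
definition ps :: "'a => 'a => 'a => 'a" where "ps p F \<sigma> = un2 p (exc F \<sigma>)"
definition isasg :: "'a => 'a => 'a => bool" where "isasg p F \<sigma> \<longleftrightarrow> fn \<sigma> F & (ALL e:el F. ap \<sigma> e : el (al p e))"

lemma S_exc: "S {z. EX e:el F. EX i:el (fl e). z = pr e i & i ~= ap \<sigma> e}"
proof -
 let ?U = "UN e:el F. el (fl e)"
 have s: "S ?U" by (intro S_UN S_el dfns)
 show ?thesis
  by (rule S_sub[OF S_el[of "tms F (mk ?U)"]]) (auto simp: el_mk[OF s] intro!: dfns)
qed
lemma el_exc: "el (exc F \<sigma>) = {z. EX e:el F. EX i:el (fl e). z = pr e i & i ~= ap \<sigma> e}" by (simp add: exc_def el_mk S_exc)
lemma dt_exc [dfns]: "dt t ==> dt u ==> dt (%v. exc (t v) (u v))"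
 by (rule dt_comp2[where f=exc, rotated], assumption+, unfold exc_def, rule dt_mk, rule S_exc, intro dfns)
lemma dt_ps [dfns]: "dt t ==> dt u ==> dt w ==> dt (%v. ps (t v) (u v) (w v))" unfolding ps_def by (intro dfns)
lemma dfn_isasg [dfns]: "dt t ==> dt u ==> dt w ==> dfn (%v. isasg (t v) (u v) (w v))" unfolding isasg_def
 by (rule dfn_comp3[where P="%p F \<sigma>. fn \<sigma> F & (ALL e:el F. ap \<sigma> e : el (al p e))"]; (assumption | intro dfns))

lemma el_ps: "el (ps p F \<sigma>) = el p \<union> {z. EX e:el F. EX i:el (fl e). z = pr e i & i ~= ap \<sigma> e}"
 by (simp add: ps_def el_exc)

lemma al_ps: "isasg p F \<sigma> ==> e : el F ==> el (al (ps p F \<sigma>) e) = {ap \<sigma> e}"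
 "e ~: el F ==> al (ps p F \<sigma>) e = al p e"
proof -
 assume "isasg p F \<sigma>" "e : el F"
 then have "ap \<sigma> e : el (fl e)" "pr e (ap \<sigma> e) ~: el p" by (auto simp: isasg_def el_al)
 then show "el (al (ps p F \<sigma>) e) = {ap \<sigma> e}" using \<open>e : el F\<close> by (auto simp: el_al el_ps)
next
 show "e ~: el F ==> al (ps p F \<sigma>) e = al p e" by (rule eqI) (auto simp: el_al el_ps)
qed

lemma cnd_ps: assumes "cnd p" "Fin F" "el F <= el Ps" "isasg p F \<sigma>" shows "cnd (ps p F \<sigma>)"
proof (rule cnd_modify[OF assms(1,2)])
 show "al (ps p F \<sigma>) e ~= emp" if "e : el F" for e using al_ps(1)[OF assms(4) that] by (auto simp: ne_emp)
qed (use assms(3) in \<open>auto simp: el_ps\<close>)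

lemma Fin_asg: assumes "Fin F" "el F <= el Ps"
 shows "EX Z. Fin Z & el Z = {\<sigma>. isasg p F \<sigma>}"
proof -
 have "EX b:el om. ALL e:el F. el (fl e) <= el b"
 proof -
  have "el F <= el Ps --> (EX b:el om. ALL e:el F. el (fl e) <= el b)"
  proof (rule Fin_induct[OF assms(1)])
   show "dfn (%v. el (v 0) <= el Ps --> (EX b:el om. ALL e:el (v 0). el (fl e) <= el b))" by (intro dfns)
   show "el emp <= el Ps --> (EX b:el om. ALL e:el emp. el (fl e) <= el b)" by (intro impI bexI[of _ emp]) auto
   fix x F assume IH: "el F <= el Ps --> (EX b:el om. ALL e:el F. el (fl e) <= el b)"
   show "el (ins x F) <= el Ps --> (EX b:el om. ALL e:el (ins x F). el (fl e) <= el b)"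
   proof
    assume x: "el (ins x F) <= el Ps"
    then obtain b where b: "b : el om" "ALL e:el F. el (fl e) <= el b" using IH by auto
    have "fl x : el om" using fl_om x by auto
    then obtain b' where "b' : el om" "el b <= el b'" "el (fl x) <= el b'" using om_max[OF b(1)] by blast
    then show "EX b:el om. ALL e:el (ins x F). el (fl e) <= el b" using b(2) by (intro bexI[of _ b']) auto
   qed
  qed
  then show ?thesis using assms(2) by blast
 qed
 then obtain b where b: "b : el om" "ALL e:el F. el (fl e) <= el b" by blast
 have sub: "{\<sigma>. isasg p F \<sigma>} <= el (fs F b)"
  using b(2) al_fl[of p] unfolding el_fs isasg_def isf_iff_fn by blast
 have "S {\<sigma>. isasg p F \<sigma>}" by (rule S_sub[OF S_el sub]) (intro dfns)
 then obtain Z where Z: "el Z = {\<sigma>. isasg p F \<sigma>}" by (auto simp: S_def)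
 have "Fin Z" by (rule Fin_sub[OF Fin_fs[OF assms(1) Fin_nat[OF b(1)]]]) (use Z sub in auto)
 then show ?thesis using Z by blast
qed

definition ex :: "'a => 'a => 'a => bool" where
 "ex F q p \<longleftrightarrow> cnd q & el p <= el q & (ALL e:el F. al q e = al p e)"

lemma dfn_ex_ [dfns]: "dt t ==> dt u ==> dt w ==> dfn (%v. ex (t v) (u v) (w v))"
 by (rule dfn_comp3[where P=ex]; (assumption | (unfold ex_def, intro dfns)))
lemma ex_refl: "cnd p ==> ex F p p" by (simp add: ex_def)
lemma ex_trans: "ex F r q ==> ex F q p ==> ex F r p" by (auto simp: ex_def)
lemma ex_sub: "ex F q p ==> el F' <= el F ==> ex F' q p" by (auto simp: ex_def)
lemma isasg_ex: "ex F q p ==> isasg q F \<sigma> \<longleftrightarrow> isasg p F \<sigma>" by (auto simp: ex_def isasg_def)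
lemma ps_mono: "el p <= el q ==> el (ps p F \<sigma>) <= el (ps q F \<sigma>)" by (auto simp: el_ps)

lemma amalgam:
 assumes p: "cnd p" and F: "el F <= el Ps" and \<sigma>: "isasg p F \<sigma>" and r: "cnd r" "el (ps p F \<sigma>) <= el r"
 shows "EX q. ex F q p & ps q F \<sigma> = r"
proof -
 have s: "S {z : el r. fst' z ~: el F | z : el p}" by (rule S_Collect[OF S_el]) (intro dfns)
 then obtain q where q: "el q = {z : el r. fst' z ~: el F | z : el p}" by (auto simp: S_def)
 have pr: "el p <= el r" using r(2) by (auto simp: el_ps)
 have a1: "al q e = al p e" if "e : el F" for e
  by (rule eqI) (use that pr in \<open>auto simp: el_al q\<close>)
 have qr: "el (al r e) <= el (al q e)" for e by (rule al_mono) (use q in auto)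
 have "cnd q" unfolding cnd_def
 proof (intro conjI ballI)
  show "EX e:el Ps. EX i:el (fl e). z = pr e i" if "z : el q" for z using r(1) q that by (auto simp: cnd_def)
  show "al q e ~= emp" if "e : el Ps" for e
  proof -
   have "EX i. i : el (al r e)" using r(1) that unfolding cnd_def ne_emp by blast
   then show ?thesis using qr[of e] unfolding ne_emp by blast
  qed
  show "EX C. cov om C & (ALL z:el q. fst' (fst' z) : el C)" using r(1) q unfolding cnd_def by auto
  fix \<alpha> j K assume "\<alpha> : el II" "j : el two" "K : el om"
  then obtain n where "n : el om" "K : el n" "rq j K (al r (pos \<alpha> j n))" using r(1) unfolding cnd_def by blast
  then show "EX n:el om. K : el n & rq j K (al q (pos \<alpha> j n))" using rq_mono[OF _ qr] by blast
 qed
 moreover have "ps q F \<sigma> = r"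
 proof (rule eqI, rule equalityI)
  show "el (ps q F \<sigma>) <= el r" using q r(2) by (auto simp: el_ps)
  show "el r <= el (ps q F \<sigma>)"
  proof
   fix z assume z: "z : el r"
   then obtain e i where e: "e : el Ps" "i : el (fl e)" "z = pr e i" using r(1) by (auto simp: cnd_def)
   show "z : el (ps q F \<sigma>)"
   proof (cases "e : el F")
    case True
    have "i ~= ap \<sigma> e"
    proof
     assume "i = ap \<sigma> e"
     then have "el (al r e) = {}" using al_mono[OF r(2), of e] al_ps(1)[OF \<sigma> True] z e by (auto simp: el_al)
     then show False using r(1) e(1) by (auto simp: cnd_def ne_emp)
    qed
    then show ?thesis using True e by (auto simp: el_ps)
   next
    case False then show ?thesis using z e q by (auto simp: el_ps)
   qed
  qed
 qed
 ultimately show ?thesis using a1 q pr by (intro exI[of _ q]) (auto simp: ex_def)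
qed

lemma finite_requirements:
 assumes Z: "Fin Z" and d: "dfn (%v. D (v 0) (v 1))" and p: "cnd p"
  and op: "!!z q q'. z : el Z ==> D z q ==> ex F q p ==> ex F q' q ==> D z q'"
  and dn: "!!z q. z : el Z ==> ex F q p ==> EX q'. ex F q' q & D z q'"
 shows "EX q. ex F q p & (ALL z:el Z. D z q)"
proof -
 have dD: "dt t ==> dt u ==> dfn (%v. D (t v) (u v))" for t u by (rule dfn_comp2[OF d])
 have "el Z <= el Z --> (EX q. ex F q p & (ALL z:el Z. D z q))"
 proof (rule Fin_induct[OF Z, where Q="%Y. el Y <= el Z --> (EX q. ex F q p & (ALL z:el Y. D z q))"])
  show "dfn (%v. el (v 0) <= el Z --> (EX q. ex F q p & (ALL z:el (v 0). D z q)))" by (intro dfns dD)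
  show "el emp <= el Z --> (EX q. ex F q p & (ALL z:el emp. D z q))" using ex_refl[OF p] by auto
  fix x Y assume IH: "el Y <= el Z --> (EX q. ex F q p & (ALL z:el Y. D z q))"
  show "el (ins x Y) <= el Z --> (EX q. ex F q p & (ALL z:el (ins x Y). D z q))"
  proof
   assume xY: "el (ins x Y) <= el Z"
   then obtain q where q: "ex F q p" "ALL z:el Y. D z q" using IH by auto
   then obtain q' where q': "ex F q' q" "D x q'" using dn[of x q] xY by auto
   moreover have "D z q'" if "z : el Y" for z using op[of z q q'] q q' xY that by auto
   ultimately show "EX q. ex F q p & (ALL z:el (ins x Y). D z q)" using ex_trans q(1) by (intro exI[of _ q']) auto
  qed
 qed
 then show ?thesis by blast
qed

text \<open>The premise \<open>book\<close> promises that every column touched at some stage has,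
  for each kind and each bound, a position protected by some \<open>ap g m\<close> with enough
  values left. The union of the stages thus keeps the freedom a condition must have; columns never
  touched have it anyway.\<close>

lemma fusion:
 assumes f: "!!n. n : el om ==> cnd (ap f n)" and g: "!!n. n : el om ==> el (ap g n) <= el (ap g (sc n))"
  and step: "!!n. n : el om ==> ex (ap g n) (ap f (sc n)) (ap f n)"
  and book: "!!n z j K. n : el om ==> z : el (ap f n) ==> j : el two ==> K : el om ==>
   EX m:el om. EX i:el om. K : el i & pos (fst' (fst' z)) j i : el (ap g m) & rq j K (al (ap f m) (pos (fst' (fst' z)) j i))"
 shows "EX q. ALL n:el om. ex (ap g n) q (ap f n)"
proof -
 have mono: "ex (ap g m) (ap f n) (ap f m) & el (ap g m) <= el (ap g n)"
  if m: "m : el om" and n: "n : el om" and mn: "el m <= el n" for m n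
 proof -
  have "el m <= el n --> ex (ap g m) (ap f n) (ap f m) & el (ap g m) <= el (ap g n)"
  proof (rule om_induct[OF n])
   show "dfn (%v. el m <= el (v 0) --> ex (ap g m) (ap f (v 0)) (ap f m) & el (ap g m) <= el (ap g (v 0)))" by (intro dfns)
   show "el m <= el emp --> ex (ap g m) (ap f emp) (ap f m) & el (ap g m) <= el (ap g emp)"
    using ex_refl[OF f[OF m]] m ne_emp by (metis el_emp empty_iff order_refl subsetD)
   fix n assume n: "n : el om" and IH: "el m <= el n --> ex (ap g m) (ap f n) (ap f m) & el (ap g m) <= el (ap g n)"
   show "el m <= el (sc n) --> ex (ap g m) (ap f (sc n)) (ap f m) & el (ap g m) <= el (ap g (sc n))"
   proof
    assume s: "el m <= el (sc n)"
    show "ex (ap g m) (ap f (sc n)) (ap f m) & el (ap g m) <= el (ap g (sc n))"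
    proof (cases "m = sc n")
     case True then show ?thesis using ex_refl[OF f[OF m]] by simp
    next
     case False
     then have "m : el (sc n)" using Ord_sub_mem[OF Ord_nat[OF m] Ord_nat[OF sc_om[OF n]] s] by blast
     then have "el m <= el n" using om_trans_el[OF n] by (auto simp: trans_def)
     then have i: "ex (ap g m) (ap f n) (ap f m)" "el (ap g m) <= el (ap g n)" using IH by auto
     then show ?thesis using ex_trans[OF ex_sub[OF step[OF n] i(2)] i(1)] g[OF n] by blast
    qed
   qed
  qed
  then show ?thesis using mn by blast
 qed
 let ?U = "UN n:el om. el (ap f n)"
 have "S ?U" by (intro S_UN S_el dfns)
 then obtain q where q: "el q = ?U" by (auto simp: S_def)
 have alq: "el (al q e) = {i. ALL n:el om. i : el (al (ap f n) e)} \<inter> el (fl e)" for e by (auto simp: el_al q)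
 have same: "al q e = al (ap f m) e" if m: "m : el om" and e: "e : el (ap g m)" for m e
 proof (rule eqI, rule equalityI)
  show "el (al q e) <= el (al (ap f m) e)" using m by (auto simp: alq)
  show "el (al (ap f m) e) <= el (al q e)"
  proof
   fix i assume i: "i : el (al (ap f m) e)"
   have "i : el (al (ap f n) e)" if n: "n : el om" for n
   proof -
    obtain l where l: "l : el om" "el m <= el l" "el n <= el l" using om_max[OF m n] by blast
    have "al (ap f l) e = al (ap f m) e" using mono[OF m l(1,2)] e by (auto simp: ex_def)
    moreover have "el (ap f n) <= el (ap f l)" using mono[OF n l(1,3)] by (auto simp: ex_def)
    ultimately show ?thesis using al_mono[of "ap f n" "ap f l" e] i by auto
   qed
   then show "i : el (al q e)" using i al_fl by (auto simp: alq)
  qed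
 qed
 have "cnd q" unfolding cnd_def
 proof (intro conjI ballI)
  show "EX e:el Ps. EX i:el (fl e). z = pr e i" if "z : el q" for z
   using f that by (auto simp: q cnd_def)
  show "al q e ~= emp" if e: "e : el Ps" for e
  proof
   assume "al q e = emp"
   then have "EX n:el om. pr e i : el (ap f n)" if "i : el (fl e)" for i using that by (auto simp: el_al q simp flip: el_inject)
   moreover have "dfn (%v. pr e (v 0) : el (ap f (v 1)))" by (intro dfns)
   ultimately obtain h where h: "isf h (fl e) om" "ALL i:el (fl e). pr e i : el (ap f (ap h i))"
    using ac[of "%i n. pr e i : el (ap f n)" "fl e" om] by blast
   \<comment> \<open>The finitely many values at \<open>e\<close> would be excluded at finitely many
     stages, hence all at one stage, which is a condition.\<close>
   have "Fin (img h (fl e))" using Fin_img[OF dt_ap1 Fin_nat[OF fl_om[OF e]]] by (simp add: img_def)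
   moreover have "el (img h (fl e)) <= el om" using isf_in[OF h(1)] by auto
   ultimately obtain b where b: "b : el om" "el (img h (fl e)) <= el b" using Fin_bounded by blast
   have "pr e i : el (ap f b)" if i: "i : el (fl e)" for i
   proof -
    have hb: "ap h i : el b" using b(2) i by auto
    have "el (ap h i) <= el b" using om_trans_el[OF b(1)] hb by (auto simp: trans_def)
    then have "el (ap f (ap h i)) <= el (ap f b)"
     using mono[OF isf_in[OF h(1) i] b(1)] by (simp add: ex_def)
    then show ?thesis using h(2) i by auto
   qed
   then have "el (al (ap f b) e) = {}" by (auto simp: el_al)
   then show False using f[OF b(1)] e by (auto simp: cnd_def ne_emp)
  qed
  have "EX c. fn c om & (ALL n:el om. cov om (ap c n) & (ALL z:el (ap f n). fst' (fst' z) : el (ap c n)))"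
  proof (rule ac_class)
   show "EX C. cov om C & (ALL z:el (ap f n). fst' (fst' z) : el C)" if "n : el om" for n
    using f[OF that] by (auto simp: cnd_def)
  qed (intro dfns)
  then obtain c where c: "!!n. n : el om ==> cov om (ap c n)" "!!n z. n : el om ==> z : el (ap f n) ==> fst' (fst' z) : el (ap c n)" by blast
  have "cov (tms om om) (mk (UN n:el om. el (ap c n)))" by (rule cov_UN[OF dt_ap1 c(1)])
  then have "cov om (mk (UN n:el om. el (ap c n)))" using countable_square cov_trans by blast
  moreover have "ALL z:el q. fst' (fst' z) : el (mk (UN n:el om. el (ap c n)))"
   unfolding el_mk[OF S_UN[OF S_el dt_ap1]] using c(2) q by auto
  ultimately show "EX C. cov om C & (ALL z:el q. fst' (fst' z) : el C)" by blast
  fix \<alpha> j K assume a: "\<alpha> : el II" "j : el two" "K : el om"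
  show "EX n:el om. K : el n & rq j K (al q (pos \<alpha> j n))"
  proof (cases "EX z:el q. fst' (fst' z) = \<alpha>")
   case True
   then obtain z n where "n : el om" "z : el (ap f n)" "fst' (fst' z) = \<alpha>" using q by auto
   then obtain m i where "m : el om" "i : el om" "K : el i" "pos \<alpha> j i : el (ap g m)" "rq j K (al (ap f m) (pos \<alpha> j i))"
    using book[of n z j K] a by blast
   then show ?thesis using same by metis
  next
   case False
   have "al q (pos \<alpha> j (sc K)) = fl (pos \<alpha> j (sc K))" by (rule eqI) (use False in \<open>fastforce simp: el_al\<close>)
   moreover have "rq j K (fl (pos \<alpha> j (sc K)))" unfolding rq_def fl_pos by (auto intro!: lep_sub)
   ultimately show ?thesis using sc_om[OF a(3)] by (intro bexI[of _ "sc K"]) auto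
  qed
 qed
 then show ?thesis using same q by (intro exI[of _ q]) (auto simp: ex_def)
qed

end

section \<open>Confining a name for a sequence to a ground model tree\<close>

section \<open>Localization by fusion\<close>

text \<open>The name enters through the relation \<open>dec\<close> alone, so the fusion is an
  argument about conditions in the ground model. Any condition below one satisfying
  \<open>fname\<close> can serve as \<open>p0\<close>.\<close>

locale localization = silver +
 fixes dec :: "'a => 'a => 'a => bool" and p0 :: 'a
 assumes dfn_dec0: "dfn (%v. dec (v 0) (v 1) (v 2))"
  and dec_mono: "dec p x y ==> el p <= el q ==> cnd q ==> dec q x y"
  and p0: "cnd p0"
  and dec_total: "cnd q ==> el p0 <= el q ==> n : el om ==> EX r. cnd r & el q <= el r & (EX y:el (sc k). dec r n y)"
  and dec_fun: "cnd q ==> el p0 <= el q ==> n : el om ==> y : el (sc k) ==> y' : el (sc k) ==>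
   dec q n y ==> dec q n y' ==> y = y'"
begin

lemma dfn_dec [dfns]: "dt t ==> dt u ==> dt w ==> dfn (%v. dec (t v) (u v) (w v))"
 using dfn_comp3[OF dfn_dec0] .

definition ds :: "'a => 'a => 'a => bool" where
 "ds n u r \<longleftrightarrow> isf u n (sc k) & (ALL m:el n. dec r m (ap u m))"

lemma dfn_ds [dfns]: "dt t ==> dt u ==> dt w ==> dfn (%v. ds (t v) (u v) (w v))"
 by (rule dfn_comp3[where P=ds]; (assumption | (unfold ds_def, intro dfns)))

lemma ds_mono: "ds n u r ==> el r <= el q ==> cnd q ==> ds n u q"
 unfolding ds_def using dec_mono by blast

lemma ds_unique:
 assumes "n : el om" "cnd q" "el p0 <= el q" "ds n u q" "ds n u' q" shows "u = u'"
proof -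
 have u: "isf u n (sc k)" and u': "isf u' n (sc k)" using assms by (auto simp: ds_def)
 show ?thesis
 proof (rule isf_ext[OF u u'])
  fix x assume x: "x : el n"
  show "ap u x = ap u' x"
   by (rule dec_fun[OF assms(2,3) om_elem[OF assms(1) x] isf_in[OF u x] isf_in[OF u' x]])
    (use assms x in \<open>auto simp: ds_def\<close>)
 qed
qed

lemma ds_restrict:
 assumes "ds n u r" "el m <= el n" shows "ds m (lam m (ap u)) r"
proof -
 have u: "isf u n (sc k)" using assms by (auto simp: ds_def)
 have "isf (lam m (ap u)) m (sc k)" by (rule isfI) (use isf_in[OF u] assms(2) in auto)
 then show ?thesis using assms ap_lam[OF dt_ap1] unfolding ds_def by auto
qed

lemma ds_exists:
 assumes "n : el om" "cnd q" "el p0 <= el q" shows "EX r u. cnd r & el q <= el r & ds n u r"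
proof (rule om_induct[OF assms(1)])
 show "dfn (%v. EX r u. cnd r & el q <= el r & ds (v 0) u r)" by (intro dfns)
 have "ds emp emp q" by (simp add: ds_def isf_iff_fn fn_emp)
 then show "EX r u. cnd r & el q <= el r & ds emp u r" using assms by blast
 fix n assume n: "n : el om" and "EX r u. cnd r & el q <= el r & ds n u r"
 then obtain r u where r: "cnd r" "el q <= el r" "ds n u r" by blast
 then obtain r' y where r': "cnd r'" "el r <= el r'" "y : el (sc k)" "dec r' n y"
  using dec_total[OF r(1) _ n] assms(3) by blast
 have u: "isf u n (sc k)" using r by (simp add: ds_def)
 note e = isf_extend[OF u mem_irrefl r'(3)]
 have "dec r' m (ap (ins (pr n y) u) m)" if "m : el (sc n)" for m
 proof (cases "m = n")
  case True then show ?thesis using e(2) r'(4) by simp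
 next
  case False
  then have m: "m : el n" using that by simp
  then show ?thesis using e(3)[OF m] ds_mono[OF r(3) r'(2,1)] by (simp add: ds_def)
 qed
 then have "ds (sc n) (ins (pr n y) u) r'" using e(1) by (simp add: ds_def)
 then show "EX r u. cnd r & el q <= el r & ds (sc n) u r" using r r' by blast
qed

text \<open>The invariant of the fusion has three substantial clauses. Under every assignment on
  \<open>F\<close>, \<open>m\<close> values are decided. Assignments deciding these alike remain
  inseparable under all strengthenings that keep \<open>F\<close>. Every node of length below
  \<open>m\<close> has a next value that no extension of \<open>p\<close> can decide. The last
  clause is what the construction aims at; the second makes it possible to continue.\<close>

definition Good :: "'a => 'a => 'a => bool" where
 "Good p F m \<longleftrightarrow> cnd p & el p0 <= el p & Fin F & el F <= el Ps & m : el om &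
  (ALL \<sigma>. isasg p F \<sigma> --> (EX u. ds m u (ps p F \<sigma>))) &
  (ALL \<sigma> \<sigma>' u. isasg p F \<sigma> --> isasg p F \<sigma>' --> ds m u (ps p F \<sigma>) --> ds m u (ps p F \<sigma>') -->
   (ALL r w w'. ALL n:el om. ex F r p --> ds n w (ps r F \<sigma>) --> ds n w' (ps r F \<sigma>') --> w = w')) &
  (ALL n:el m. ALL u. isf u n (sc k) --> (EX i:el (sc k). ALL r. cnd r --> el p <= el r --> ~ ds (sc n) (ins (pr n i) u) r))"

lemma dfn_Good [dfns]: "dt t ==> dt u ==> dt w ==> dfn (%v. Good (t v) (u v) (w v))"
 by (rule dfn_comp3[where P=Good]; (assumption | (unfold Good_def, intro dfns)))

lemma Good_start: "Good p0 emp emp"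
proof -
 have e: "ps r emp \<sigma> = r" for r \<sigma> by (rule eqI) (simp add: el_ps)
 have d: "ds emp emp p0" by (simp add: ds_def isf_iff_fn fn_emp)
 have u: "w = w'" if "n : el om" "ex emp r p0" "ds n w r" "ds n w' r" for r w w' n
  by (rule ds_unique[OF that(1) _ _ that(3,4)]) (use that(2) in \<open>auto simp: ex_def\<close>)
 show ?thesis unfolding Good_def e
  by (intro conjI) (use p0 d u in \<open>auto simp del: el_ins\<close>)
qed

text \<open>The strengthening of \<open>r\<close> at the positions in \<open>F\<close> is undone. In
  this way a condition below a pruned one comes back into the scope of a statement made before the
  pruning.\<close>

lemma restore:
 assumes p: "cnd p" "cnd r" "el p <= el r"
 shows "EX q. cnd q & el p <= el q & el q <= el r & (ALL e:el F. al q e = al p e) & (ALL z:el r. z : el q | fst' z : el F) &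
  (ALL e. e ~: el F --> al q e = al r e)"
proof -
 have s: "S {z : el r. fst' z ~: el F | z : el p}" by (rule S_Collect[OF S_el]) (intro dfns)
 then obtain q where q: "el q = {z : el r. fst' z ~: el F | z : el p}" by (auto simp: S_def)
 have qr: "el (al r e) <= el (al q e)" for e by (rule al_mono) (use q in auto)
 have "cnd q" unfolding cnd_def
 proof (intro conjI ballI)
  show "EX e:el Ps. EX i:el (fl e). z = pr e i" if "z : el q" for z using p(2) q that by (auto simp: cnd_def)
  show "al q e ~= emp" if "e : el Ps" for e
  proof -
   have "EX i. i : el (al r e)" using p(2) that unfolding cnd_def ne_emp by blast
   then show ?thesis using qr[of e] unfolding ne_emp by blast
  qed
  show "EX C. cov om C & (ALL z:el q. fst' (fst' z) : el C)" using p(2) q unfolding cnd_def by auto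
  fix \<alpha> j K assume "\<alpha> : el II" "j : el two" "K : el om"
  then obtain n where "n : el om" "K : el n" "rq j K (al r (pos \<alpha> j n))" using p(2) unfolding cnd_def by blast
  then show "EX n:el om. K : el n & rq j K (al q (pos \<alpha> j n))" using rq_mono[OF _ qr] by blast
 qed
 moreover have "al q e = al p e" if "e : el F" for e by (rule eqI) (use that p(3) in \<open>auto simp: el_al q\<close>)
 moreover have "al q e = al r e" if "e ~: el F" for e by (rule eqI) (use that in \<open>auto simp: el_al q\<close>)
 ultimately show ?thesis using q p(3) by (intro exI[of _ q]) auto
qed

lemma isasg_exists: assumes "cnd r" "el F <= el Ps" shows "EX \<tau>. isasg r F \<tau>"
proof -
 have "EX \<tau>. fn \<tau> F & (ALL e:el F. ap \<tau> e : el (al r e))"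
 proof (rule ac_class)
  show "EX i. i : el (al r e)" if "e : el F" for e using assms that unfolding cnd_def ne_emp by blast
 qed (intro dfns)
 then show ?thesis by (simp add: isasg_def)
qed

lemma isasg_ins:
 assumes "isasg p F \<sigma>" "e ~: el F" "v : el (al p e)"
 shows "isasg p (ins e F) (ins (pr e v) \<sigma>)" "ap (ins (pr e v) \<sigma>) e = v" "x : el F ==> ap (ins (pr e v) \<sigma>) x = ap \<sigma> x"
proof -
 let ?B = "ins v (img \<sigma> F)"
 have f: "isf \<sigma> F ?B" using assms(1) by (auto simp: isasg_def isf_iff_fn)
 have v: "v : el ?B" by simp
 note i = isf_extend[OF f assms(2) v]
 show "ap (ins (pr e v) \<sigma>) e = v" "x : el F ==> ap (ins (pr e v) \<sigma>) x = ap \<sigma> x" using i(2,3) by auto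
 have "ap (ins (pr e v) \<sigma>) x : el (al p x)" if "x : el (ins e F)" for x
 proof (cases "x = e")
  case True then show ?thesis using i(2) assms(3) by simp
 next
  case False
  then show ?thesis using i(3)[of x] that assms(1) by (simp add: isasg_def)
 qed
 then show "isasg p (ins e F) (ins (pr e v) \<sigma>)" using i(1) by (simp add: isasg_def isf_iff_fn)
qed

lemma isasg_split:
 assumes "isasg p (ins e F) \<tau>" "e ~: el F"
 shows "isasg p F (lam F (ap \<tau>))" "\<tau> = ins (pr e (ap \<tau> e)) (lam F (ap \<tau>))"
proof -
 show a: "isasg p F (lam F (ap \<tau>))"
  using assms fn_lam[OF dt_ap1] ap_lam[OF dt_ap1] by (auto simp: isasg_def)
 have "fn \<tau> (ins e F)" using assms(1) by (simp add: isasg_def)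
 then have t: "el \<tau> = {z. EX x:el (ins e F). z = pr x (ap \<tau> x)}" using el_lam[OF dt_ap1] unfolding fn_def by metis
 show "\<tau> = ins (pr e (ap \<tau> e)) (lam F (ap \<tau>))"
  by (rule eqI) (simp only: t el_ins el_lam[OF dt_ap1], auto)
qed

lemma ps_ins: assumes "isasg p F \<sigma>" "e ~: el F" "v : el (al p e)"
 shows "ps p (ins e F) (ins (pr e v) \<sigma>) = ps (un2 p (exc (ins e emp) (ins (pr e v) emp))) F \<sigma>"
proof -
 note i = isasg_ins[OF assms]
 have v: "ap (ins (pr e v) emp) e = v" by (rule ap_eq) auto
 have F: "z : el (exc F (ins (pr e v) \<sigma>)) \<longleftrightarrow> z : el (exc F \<sigma>)" for z using i(3) by (auto simp: el_exc)
 show ?thesis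
 proof (rule eqI, rule set_eqI)
  fix z
  have "z : el (exc (ins e F) (ins (pr e v) \<sigma>)) \<longleftrightarrow> z : el (exc F (ins (pr e v) \<sigma>)) | (EX i:el (fl e). z = pr e i & i ~= v)"
   unfolding el_exc using i(2) by auto
  moreover have "z : el (exc (ins e emp) (ins (pr e v) emp)) \<longleftrightarrow> (EX i:el (fl e). z = pr e i & i ~= v)"
   unfolding el_exc using v by auto
  ultimately show "z : el (ps p (ins e F) (ins (pr e v) \<sigma>)) \<longleftrightarrow> z : el (ps (un2 p (exc (ins e emp) (ins (pr e v) emp))) F \<sigma>)"
   unfolding ps_def using F by auto
 qed
qed

text \<open>Each of the finitely many pairs of assignments is either separated by a decision or can
  no longer be separated at all. A level \<open>m'\<close> above all separations is then decided
  under every assignment, so assignments that agree up to \<open>m'\<close> are inseparable.\<close>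

lemma decided_front:
 assumes G: "cnd p" "el p0 <= el p" "Fin F" "el F <= el Ps" and m: "m : el om"
 shows "EX q m'. ex F q p & m' : el om & m : el m' & (ALL \<tau>. isasg p F \<tau> --> (EX u. ds m' u (ps q F \<tau>))) &
  (ALL \<tau> \<tau>' u. isasg p F \<tau> --> isasg p F \<tau>' --> ds m' u (ps q F \<tau>) --> ds m' u (ps q F \<tau>') -->
   (ALL r w w'. ALL n:el om. ex F r q --> ds n w (ps r F \<tau>) --> ds n w' (ps r F \<tau>') --> w = w'))"
proof -
 obtain Z where Z: "Fin Z" "el Z = {\<tau>. isasg p F \<tau>}" using Fin_asg[OF G(3,4)] by blast
 have cps: "cnd (ps q F \<tau>)" "el p0 <= el (ps q F \<tau>)" if "ex F q p" "isasg p F \<tau>" for q \<tau>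
 proof -
  show "cnd (ps q F \<tau>)" using cnd_ps[OF _ G(3,4)] isasg_ex[OF that(1)] that by (auto simp: ex_def)
  show "el p0 <= el (ps q F \<tau>)" using that(1) G(2) by (auto simp: ex_def el_ps)
 qed
 have psm: "el (ps q F \<tau>) <= el (ps q' F \<tau>)" if "ex F q' q" for q q' \<tau> using ps_mono that by (simp add: ex_def)
 define sep where "sep q z n \<longleftrightarrow> (EX u u'. u ~= u' & ds n u (ps q F (fst' z)) & ds n u' (ps q F (snd' z)))" for q z n
 have dsep: "dt t ==> dt u ==> dt w ==> dfn (%v. sep (t v) (u v) (w v))" for t u w
  by (rule dfn_comp3[where P=sep]; (assumption | (unfold sep_def, intro dfns)))
 define D where "D z q \<longleftrightarrow> (EX n:el om. sep q z n) | (ALL r. ex F r q --> (ALL n:el om. ~ sep r z n))" for z q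
 have dD: "dfn (%v. D (v 0) (v 1))" unfolding D_def by (intro dfns dsep)
 have sep_mono: "sep q' z n" if "sep q z n" "z : el (tms Z Z)" "ex F q' q" "ex F q p" for q q' z n
 proof -
  have c: "cnd (ps q' F (fst' z))" "cnd (ps q' F (snd' z))" using cps(1)[OF ex_trans[OF that(3,4)]] that(2) Z(2) by auto
  then show ?thesis using that(1) ds_mono[OF _ psm[OF that(3)]] unfolding sep_def by blast
 qed
 have "EX q. ex F q p & (ALL z:el (tms Z Z). D z q)"
 proof (rule finite_requirements[OF Fin_tms[OF Z(1) Z(1)] dD G(1)])
  show "D z q'" if "z : el (tms Z Z)" "D z q" "ex F q p" "ex F q' q" for z q q'
   using that sep_mono[OF _ that(1,4,3)] ex_trans[OF _ that(4)] unfolding D_def by blast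
  show "EX q'. ex F q' q & D z q'" if "z : el (tms Z Z)" "ex F q p" for z q
  proof (cases "EX r. ex F r q & (EX n:el om. sep r z n)")
   case True then show ?thesis unfolding D_def by blast
  next
   case False
   then have "D z q" unfolding D_def by blast
   moreover have "ex F q q" using that(2) ex_refl by (simp add: ex_def)
   ultimately show ?thesis by blast
  qed
 qed
 then obtain q1 where q1: "ex F q1 p" "ALL z:el (tms Z Z). D z q1" by blast
 have "EX h. isf h (tms Z Z) om & (ALL z:el (tms Z Z). sep q1 z (ap h z) | (ALL r. ex F r q1 --> (ALL n:el om. ~ sep r z n)))"
 proof (rule ac)
  show "EX n:el om. sep q1 z n | (ALL r. ex F r q1 --> (ALL n:el om. ~ sep r z n))" if "z : el (tms Z Z)" for z
   using q1(2) that zero_om unfolding D_def by blast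
 qed (intro dfns dsep)
 then obtain h where h: "isf h (tms Z Z) om"
  "!!z. z : el (tms Z Z) ==> sep q1 z (ap h z) | (ALL r. ex F r q1 --> (ALL n:el om. ~ sep r z n))" by blast
 have "Fin (img h (tms Z Z))" unfolding img_def by (rule Fin_img[OF dt_ap1 Fin_tms[OF Z(1) Z(1)]])
 moreover have "el (img h (tms Z Z)) <= el om" using isf_in[OF h(1)] by auto
 ultimately obtain m1 where m1: "m1 : el om" "el (img h (tms Z Z)) <= el m1" using Fin_bounded by blast
 obtain m' where m': "m' : el om" "el m1 <= el m'" "el (sc m) <= el m'" using om_max[OF m1(1) sc_om[OF m]] by blast
 have "EX q. ex F q q1 & (ALL \<tau>:el Z. EX u. ds m' u (ps q F \<tau>))"
 proof (rule finite_requirements[OF Z(1)])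
  show "dfn (%v. EX u. ds m' u (ps (v 1) F (v 0)))" by (intro dfns)
  show "cnd q1" using q1(1) by (simp add: ex_def)
  show "EX u. ds m' u (ps q' F \<tau>)" if "\<tau> : el Z" "EX u. ds m' u (ps q F \<tau>)" "ex F q q1" "ex F q' q" for \<tau> q q'
  proof -
   have "cnd (ps q' F \<tau>)" using cps(1)[OF ex_trans[OF that(4) ex_trans[OF that(3) q1(1)]]] that(1) Z(2) by simp
   then show ?thesis using that(2) ds_mono[OF _ psm[OF that(4)]] by blast
  qed
  show "EX q'. ex F q' q & (EX u. ds m' u (ps q' F \<tau>))" if "\<tau> : el Z" "ex F q q1" for \<tau> q
  proof -
   have qp: "ex F q p" using ex_trans that(2) q1(1) by blast
   have \<tau>: "isasg p F \<tau>" using that(1) Z(2) by simp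
   obtain r u where r: "cnd r" "el (ps q F \<tau>) <= el r" "ds m' u r" using ds_exists[OF m'(1) cps[OF qp \<tau>]] by blast
   have "EX q'. ex F q' q & ps q' F \<tau> = r"
    by (rule amalgam[OF _ G(4) _ r(1,2)]) (use qp \<tau> isasg_ex[OF qp] in \<open>auto simp: ex_def\<close>)
   then show ?thesis using r(3) by blast
  qed
 qed
 then obtain q where q: "ex F q q1" "!!\<tau>. \<tau> : el Z ==> EX u. ds m' u (ps q F \<tau>)" by blast
 have qp: "ex F q p" using ex_trans q(1) q1(1) by blast
 have "w = w'" if a: "isasg p F \<tau>" "isasg p F \<tau>'" and u: "ds m' u (ps q F \<tau>)" "ds m' u (ps q F \<tau>')"
   and n: "n : el om" and r: "ex F r q" and w: "ds n w (ps r F \<tau>)" "ds n w' (ps r F \<tau>')" for \<tau> \<tau>' u r w w' n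
 proof -
  let ?z = "pr \<tau> \<tau>'"
  have z: "?z : el (tms Z Z)" using a Z(2) by auto
  have "~ sep q1 ?z (ap h ?z)"
  proof
   assume "sep q1 ?z (ap h ?z)"
   then have "sep q ?z (ap h ?z)" using sep_mono[OF _ z q(1) q1(1)] by blast
   then obtain x x' where x: "x ~= x'" "ds (ap h ?z) x (ps q F \<tau>)" "ds (ap h ?z) x' (ps q F \<tau>')" by (auto simp: sep_def)
   have hm: "ap h ?z : el m'" using m1(2) m'(2) z by auto
   then have sub: "el (ap h ?z) <= el m'" using om_trans_el[OF m'(1)] by (auto simp: trans_def)
   have ho: "ap h ?z : el om" using isf_in[OF h(1) z] .
   have "x = lam (ap h ?z) (ap u)" using ds_unique[OF ho cps[OF qp a(1)] x(2) ds_restrict[OF u(1) sub]] .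
   moreover have "x' = lam (ap h ?z) (ap u)" using ds_unique[OF ho cps[OF qp a(2)] x(3) ds_restrict[OF u(2) sub]] .
   ultimately show False using x(1) by simp
  qed
  then have "~ sep r ?z n" using h(2)[OF z] ex_trans[OF r q(1)] n by blast
  then show ?thesis using w unfolding sep_def by auto
 qed
 then show ?thesis using qp m' q(2) Z(2) by (intro exI[of _ q] exI[of _ m']) auto
qed

end

context localization
begin

lemma Good_step:
 assumes G: "Good p F m" and e: "e : el Ps" "e ~: el F" and Z: "el Z = {\<sigma>. isasg p F \<sigma>}"
  and H: "!!L t. L : el om ==> (!!z v. z : el Z ==> v : el (al p e) ==> isf (ap (ap t z) v) L (sc k)) ==>
   EX V'. el V' <= el (al p e) & V' ~= emp & Rq V' & (ALL z:el Z. thin (sc k) L (ap t z) V')"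
 shows "EX p' m'. Good p' (ins e F) m' & m : el m' & ex F p' p & Rq (al p' e)"
proof -
 let ?F = "ins e F" let ?V = "al p e"
 have p: "cnd p" "el p0 <= el p" "Fin F" "el F <= el Ps" "m : el om"
  and Ga: "!!\<sigma>. isasg p F \<sigma> ==> EX u. ds m u (ps p F \<sigma>)"
  and Gb: "!!\<sigma> \<sigma>' u r w w' n. isasg p F \<sigma> ==> isasg p F \<sigma>' ==> ds m u (ps p F \<sigma>) ==> ds m u (ps p F \<sigma>') ==>
   n : el om ==> ex F r p ==> ds n w (ps r F \<sigma>) ==> ds n w' (ps r F \<sigma>') ==> w = w'"
  and Gc: "!!n u. n : el m ==> isf u n (sc k) ==> EX i:el (sc k). ALL r. cnd r --> el p <= el r --> ~ ds (sc n) (ins (pr n i) u) r"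
  using G unfolding Good_def by blast+
 have F': "Fin ?F" "el ?F <= el Ps" using p e by auto
 obtain q m' where q: "ex ?F q p" "m' : el om" "m : el m'"
  and qa: "!!\<tau>. isasg p ?F \<tau> ==> EX u. ds m' u (ps q ?F \<tau>)"
  and qb: "!!\<tau> \<tau>' u r w w' n. isasg p ?F \<tau> ==> isasg p ?F \<tau>' ==> ds m' u (ps q ?F \<tau>) ==> ds m' u (ps q ?F \<tau>') ==>
   n : el om ==> ex ?F r q ==> ds n w (ps r ?F \<tau>) ==> ds n w' (ps r ?F \<tau>') ==> w = w'"
  using decided_front[OF p(1,2) F' p(5)] by blast
 have cq: "cnd q" "el p <= el q" and alq: "!!x. x : el ?F ==> al q x = al p x" using q(1) by (auto simp: ex_def)
 have "EX T. fn T (tms Z ?V) & (ALL x:el (tms Z ?V). ds m' (ap T x) (ps q ?F (ins (pr e (snd' x)) (fst' x))))"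
 proof (rule ac_class)
  fix x assume "x : el (tms Z ?V)"
  then obtain \<sigma> v where x: "x = pr \<sigma> v" "isasg p F \<sigma>" "v : el ?V" using Z by auto
  then show "EX u. ds m' u (ps q ?F (ins (pr e (snd' x)) (fst' x)))"
   using qa[OF isasg_ins(1)[OF x(2) e(2) x(3)]] by simp
 qed (intro dfns)
 then obtain T where T: "ALL x:el (tms Z ?V). ds m' (ap T x) (ps q ?F (ins (pr e (snd' x)) (fst' x)))" by blast
 \<comment> \<open>\<open>ap (ap t \<sigma>) v\<close> is the initial segment of length
   \<open>m'\<close> decided under \<open>\<sigma>\<close> when \<open>e\<close> takes the value
   \<open>v\<close>.\<close>
 define t where "t = lam Z (%\<sigma>. lam ?V (%v. ap T (pr \<sigma> v)))"
 have t: "ap (ap t \<sigma>) v = ap T (pr \<sigma> v)" if "\<sigma> : el Z" "v : el ?V" for \<sigma> v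
 proof -
  have d1: "dt (%v. lam ?V (%x. ap T (pr (v 0) x)))" by (intro dfns)
  have d2: "dt (%u. ap T (pr \<sigma> (u 0)))" by (intro dfns)
  show ?thesis unfolding t_def ap_lam[OF d1 that(1)] by (rule ap_lam[OF d2 that(2)])
 qed
 have tds: "ds m' (ap (ap t \<sigma>) v) (ps q ?F (ins (pr e v) \<sigma>))" if "isasg p F \<sigma>" "v : el ?V" for \<sigma> v
 proof -
  have "pr \<sigma> v : el (tms Z ?V)" "\<sigma> : el Z" using that Z by auto
  then show ?thesis using T[rule_format, of "pr \<sigma> v"] t[of \<sigma> v] that(2) by simp
 qed
 obtain V' where V': "el V' <= el ?V" "V' ~= emp" "Rq V'" "!!z. z : el Z ==> thin (sc k) m' (ap t z) V'"
  using H[OF q(2), of t] tds Z unfolding ds_def by blast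
 have sx: "S {z. EX i:el ?V. z = pr e i & i ~: el V'}"
  by (rule S_sub[OF S_el[of "tms (ins e emp) ?V"]]) (auto intro!: dfns)
 then obtain X where X: "el X = {z. EX i:el ?V. z = pr e i & i ~: el V'}" by (auto simp: S_def)
 define p' where "p' = un2 q X"
 have ep': "el p' = el q \<union> {z. EX i:el ?V. z = pr e i & i ~: el V'}" by (simp add: p'_def X)
 have ale: "al p' e = V'"
 proof (rule eqI)
  have "al q e = ?V" using alq by simp
  then have iff: "i : el (fl e) & pr e i ~: el q \<longleftrightarrow> i : el ?V" for i using el_al[of q e] by simp
  have "i : el (al p' e) \<longleftrightarrow> i : el V'" for i
   using iff[of i] V'(1) unfolding el_al[of p' e] ep' by auto
  then show "el (al p' e) = el V'" by blast
 qed
 have alo: "al p' x = al q x" if "x ~= e" for x by (rule eqI) (use that in \<open>auto simp: el_al ep'\<close>)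
 have cp': "cnd p'"
 proof (rule cnd_modify[OF cq(1), of "ins e emp"])
  show "Fin (ins e emp)" by simp
  show "el q <= el p'" using ep' by blast
  show "z : el q | (EX x:el (ins e emp). EX i:el (fl x). x : el Ps & z = pr x i)" if "z : el p'" for z
   using that ep' al_fl[of p e] e(1) by auto
  show "al p' x ~= emp" if "x : el (ins e emp)" for x using that ale V'(2) by auto
 qed
 have exp': "ex F p' p" unfolding ex_def
 proof (intro conjI ballI cp')
  show "el p <= el p'" using cq(2) ep' by blast
  show "al p' x = al p x" if "x : el F" for x
  proof -
   have "x ~= e" using that e(2) by blast
   then show ?thesis using alo alq that by simp
  qed
 qed
 have asg': "isasg p ?F \<tau> & ap \<tau> e : el V'" if "isasg p' ?F \<tau>" for \<tau>
 proof -
  have a: "ap \<tau> x : el (al p' x)" if "x : el ?F" for x using \<open>isasg p' ?F \<tau>\<close> that unfolding isasg_def by blast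
  have "ap \<tau> x : el (al p x)" if x: "x : el ?F" for x
  proof (cases "x = e")
   case True then show ?thesis using a[OF x] ale V'(1) by auto
  next
   case False then show ?thesis using a[OF x] alo alq[OF x] by simp
  qed
  moreover have "ap \<tau> e : el V'" using a[of e] ale by simp
  ultimately show ?thesis using that unfolding isasg_def by blast
 qed
 have psp': "ps p' ?F \<tau> = ps q ?F \<tau>" if "isasg p' ?F \<tau>" for \<tau>
 proof (rule eqI)
  have "i : el (fl e) & i ~= ap \<tau> e" if "i : el ?V" "i ~: el V'" for i
   using asg'[OF \<open>isasg p' ?F \<tau>\<close>] that al_fl[of p e] by blast
  then show "el (ps p' ?F \<tau>) = el (ps q ?F \<tau>)" unfolding el_ps ep' by auto
 qed
 have "Good p' ?F m'" unfolding Good_def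
 proof (intro conjI allI impI ballI cp' F' q(2))
  show "el p0 <= el p'" using p(2) cq(2) ep' by blast
  show "EX u. ds m' u (ps p' ?F \<tau>)" if "isasg p' ?F \<tau>" for \<tau> using qa asg'[OF that] psp'[OF that] by simp
 next
  fix \<tau> \<tau>' u r w w' n
  assume a: "isasg p' ?F \<tau>" "isasg p' ?F \<tau>'" and u: "ds m' u (ps p' ?F \<tau>)" "ds m' u (ps p' ?F \<tau>')"
   and n: "n : el om" and r: "ex ?F r p'" and w: "ds n w (ps r ?F \<tau>)" "ds n w' (ps r ?F \<tau>')"
  have cr: "cnd r" "el p' <= el r" "al r e = V'" "!!x. x : el F ==> al r x = al p' x" using r ale by (auto simp: ex_def)
  \<comment> \<open>\<open>r\<close> admits at \<open>e\<close> only the values in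
    \<open>V'\<close>, whereas inseparability was arranged for \<open>q\<close>, which admits all of
    \<open>?V\<close>. The exclusions at \<open>e\<close> are lifted in order to apply it; freezing
    \<open>e\<close> makes the difference disappear.\<close>
  have "el q <= el r" using cr(2) ep' by blast
  then obtain r' where r': "cnd r'" "el q <= el r'" "el r' <= el r" "al r' e = al q e"
    "ALL z:el r. z : el r' | fst' z = e" "ALL x. x ~= e --> al r' x = al r x"
   using restore[OF cq(1) cr(1), of "ins e emp"] by auto
  have exr: "ex ?F r' q" unfolding ex_def
  proof (intro conjI ballI r')
   fix x assume x: "x : el ?F"
   show "al r' x = al q x"
   proof (cases "x = e")
    case False
    then have "x : el F" using x by simp
    then show ?thesis using r'(6) False cr(4) alo by metis
   qed (simp add: r')
  qed
  have psr: "ps r ?F \<rho> = ps r' ?F \<rho>" if "isasg p' ?F \<rho>" for \<rho>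
  proof (rule eqI, rule equalityI)
   show "el (ps r' ?F \<rho>) <= el (ps r ?F \<rho>)" by (rule ps_mono[OF r'(3)])
   show "el (ps r ?F \<rho>) <= el (ps r' ?F \<rho>)"
   proof
    fix z assume "z : el (ps r ?F \<rho>)"
    then consider "z : el r" | "EX x:el ?F. EX i:el (fl x). z = pr x i & i ~= ap \<rho> x" unfolding el_ps by blast
    then show "z : el (ps r' ?F \<rho>)"
    proof cases
     case 1
     show ?thesis
     proof (cases "z : el r'")
      case False
      then have fz: "fst' z = e" using r'(5) 1 by blast
      obtain x i where xi: "i : el (fl x)" "z = pr x i" using cr(1) 1 unfolding cnd_def by blast
      then have "x = e" using fz by simp
      then have "i ~: el V'" using 1 xi cr(3) el_al[of r e] by auto
      then have "i ~= ap \<rho> e" using asg'[OF that] by blast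
      then show ?thesis using xi \<open>x = e\<close> unfolding el_ps by auto
     qed (simp add: el_ps)
    qed (simp add: el_ps)
   qed
  qed
  show "w = w'"
   by (rule qb[OF asg'[OF a(1), THEN conjunct1] asg'[OF a(2), THEN conjunct1] _ _ n exr])
    (use u w in \<open>simp_all add: psp'[OF a(1)] psp'[OF a(2)] psr[OF a(1)] psr[OF a(2)]\<close>)
 next
  fix n u assume n: "n : el m'" and u: "isf u n (sc k)"
  have no: "n : el om" using om_elem[OF q(2) n] .
  have nm': "el n <= el m'" "el (sc n) <= el m'" using om_trans_el[OF q(2)] n by (auto simp: trans_def)
  show "EX i:el (sc k). ALL r. cnd r --> el p' <= el r --> ~ ds (sc n) (ins (pr n i) u) r"
  proof (cases "n : el m")
   case True
   then obtain i where "i : el (sc k)" "ALL r. cnd r --> el p <= el r --> ~ ds (sc n) (ins (pr n i) u) r" using Gc u by blast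
   moreover have "el p <= el p'" using cq(2) ep' by blast
   ultimately show ?thesis by (meson order_trans)
  next
   case False
   then have mn: "el m <= el n" using Ord_not_mem[OF Ord_nat[OF no] Ord_nat[OF p(5)]] by blast
   text \<open>Every extension meets some assignment, which decides the next value.\<close>
   have key: "EX \<tau> w. isasg p' ?F \<tau> & ds m' w (ps q ?F \<tau>) & lam n (ap w) = u & ap w n = i"
    if r: "cnd r" "el p' <= el r" and di: "ds (sc n) (ins (pr n i) u) r" and i: "i : el (sc k)" for r i
   proof -
    obtain \<tau> where \<tau>: "isasg r ?F \<tau>" using isasg_exists[OF r(1) F'(2)] by blast
    have "ap \<tau> x : el (al p' x)" if "x : el ?F" for x
     using \<tau> that al_mono[OF r(2), of x] unfolding isasg_def by blast
    then have \<tau>': "isasg p' ?F \<tau>" using \<tau> unfolding isasg_def by blast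
    obtain w where w: "ds m' w (ps q ?F \<tau>)" using qa asg'[OF \<tau>'] by blast
    let ?r = "ps r ?F \<tau>"
    have cr: "cnd ?r" by (rule cnd_ps[OF r(1) F' \<tau>])
    have sub: "el (ps q ?F \<tau>) <= el ?r" by (rule ps_mono) (use r(2) ep' in blast)
    have p0r: "el p0 <= el ?r" using r(2) ep' cq(2) p(2) unfolding el_ps by blast
    have "ds (sc n) (lam (sc n) (ap w)) ?r" using ds_restrict[OF ds_mono[OF w sub cr] nm'(2)] .
    moreover have "ds (sc n) (ins (pr n i) u) ?r" by (rule ds_mono[OF di _ cr]) (simp add: el_ps)
    ultimately have eq: "lam (sc n) (ap w) = ins (pr n i) u" using ds_unique[OF sc_om[OF no] cr p0r] by blast
    note ue = isf_extend[OF u mem_irrefl i]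
    have "ap w n = i" using ue(2) eq ap_lam[OF dt_ap1, of n "sc n" w] by simp
    moreover have "lam n (ap w) = u"
    proof -
     have "ap w x = ap u x" if "x : el n" for x using ue(3)[OF that] eq ap_lam[OF dt_ap1, of x "sc n" w] that by simp
     then have "lam n (ap w) = lam n (ap u)" by (rule lam_cong)
     then show ?thesis using isf_eta[OF u] by simp
    qed
    ultimately show ?thesis using \<tau>' w by blast
   qed
   show ?thesis
   proof (cases "EX \<tau>0 w0. isasg p' ?F \<tau>0 & ds m' w0 (ps q ?F \<tau>0) & lam n (ap w0) = u")
    case False
    \<comment> \<open>A node on no decided sequence is decided by no extension at all, so the value
      0 can be named as the missing one.\<close>
    have "emp : el (sc k)" using om_zero_mem[OF sc_om[OF k_om]] by (metis el_emp el_ins insert_not_empty)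
    then show ?thesis using key False by blast
   next
    case True
    then obtain \<tau>0 w0 where 0: "isasg p' ?F \<tau>0" "ds m' w0 (ps q ?F \<tau>0)" "lam n (ap w0) = u" by blast
    define \<sigma>0 where "\<sigma>0 = lam F (ap \<tau>0)"
    have s0: "isasg p F \<sigma>0" "\<tau>0 = ins (pr e (ap \<tau>0 e)) \<sigma>0"
     using isasg_split[OF asg'[OF 0(1), THEN conjunct1] e(2)] by (auto simp: \<sigma>0_def)
    have "\<sigma>0 : el Z" using Z s0(1) by simp
    then obtain i where i: "i : el (sc k)" "ALL v:el V'. lam n (ap (ap (ap t \<sigma>0) v)) = u --> ap (ap (ap t \<sigma>0) v) n ~= i"
     using V'(4) n unfolding thin_def by blast
    have "False" if r: "cnd r" "el p' <= el r" and di: "ds (sc n) (ins (pr n i) u) r" for r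
    proof -
     obtain \<tau> w where \<tau>: "isasg p' ?F \<tau>" "ds m' w (ps q ?F \<tau>)" "lam n (ap w) = u" "ap w n = i"
      using key[OF r di i(1)] by blast
     define \<sigma> where "\<sigma> = lam F (ap \<tau>)"
     have s: "isasg p F \<sigma>" "\<tau> = ins (pr e (ap \<tau> e)) \<sigma>"
      using isasg_split[OF asg'[OF \<tau>(1), THEN conjunct1] e(2)] by (auto simp: \<sigma>_def)
     have v: "ap \<tau> e : el V'" "ap \<tau> e : el ?V" using asg'[OF \<tau>(1)] V'(1) by auto
     \<comment> \<open>As \<open>m\<close> is at most \<open>n\<close>, the first \<open>m\<close>
       values of \<open>u\<close> are decided already over \<open>p\<close>, by either of the two
       assignments on \<open>F\<close>.\<close>
     have base: "ds m (lam m (ap u)) (ps p F \<rho>)"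
      if \<rho>: "isasg p F \<rho>" and rr: "isasg p' ?F \<tau>1" "\<tau>1 = ins (pr e (ap \<tau>1 e)) \<rho>" "ds m' w1 (ps q ?F \<tau>1)" "lam n (ap w1) = u" for \<rho> \<tau>1 w1
     proof -
      obtain x where x: "ds m x (ps p F \<rho>)" using Ga[OF \<rho>] by blast
      have v1: "ap \<tau>1 e : el (al p e)" using asg'[OF rr(1)] V'(1) by blast
      have c1: "cnd (ps q ?F \<tau>1)" using cnd_ps[OF cq(1) F'] asg'[OF rr(1)] isasg_ex[OF q(1)] by blast
      have sub1: "el (ps p F \<rho>) <= el (ps q ?F \<tau>1)"
      proof -
       have "ap \<tau>1 y = ap \<rho> y" if "y : el F" for y
        using isasg_ins(3)[OF \<rho> e(2) v1 that] rr(2) by simp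
       then show ?thesis using cq(2) unfolding el_ps by auto
      qed
      have p01: "el p0 <= el (ps q ?F \<tau>1)" using p(2) cq(2) unfolding el_ps by blast
      have mm': "el m <= el m'" using mn nm'(1) by blast
      have "x = lam m (ap w1)" by (rule ds_unique[OF p(5) c1 p01 ds_mono[OF x sub1 c1] ds_restrict[OF rr(3) mm']])
      also have "\<dots> = lam m (ap u)"
      proof (rule lam_cong)
       fix y assume "y : el m"
       then have "y : el n" using mn by blast
       then show "ap w1 y = ap u y" using rr(4) ap_lam[OF dt_ap1, of y n w1] by simp
      qed
      finally show ?thesis using x by simp
     qed
     have b1: "ds m (lam m (ap u)) (ps p F \<sigma>)" by (rule base[OF s(1) \<tau>(1) s(2) \<tau>(2,3)])
     have b0: "ds m (lam m (ap u)) (ps p F \<sigma>0)" by (rule base[OF s0(1) 0(1) s0(2) 0(2,3)])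
     \<comment> \<open>\<open>q\<close> with \<open>e\<close> frozen to the value taken by
       \<open>\<tau>\<close>. It extends \<open>p\<close> and keeps \<open>F\<close>, so the
       invariant of \<open>p\<close> speaks about it.\<close>
     let ?r = "un2 q (exc (ins e emp) (ins (pr e (ap \<tau> e)) emp))"
     have vq: "ap \<tau> e : el (al q e)" using v(2) alq[of e] by simp
     have sq: "isasg q F \<rho>" if "isasg p F \<rho>" for \<rho> using that isasg_ex[OF ex_sub[OF q(1)], of F \<rho>] by auto
     have ir: "isasg q (ins e emp) (ins (pr e (ap \<tau> e)) emp)"
      by (rule isasg_ins(1)) (use vq in \<open>auto simp: isasg_def fn_emp\<close>)
     have rps: "?r = ps q (ins e emp) (ins (pr e (ap \<tau> e)) emp)" by (simp add: ps_def)
     have exr: "ex F ?r p" unfolding ex_def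
     proof (intro conjI ballI)
      show "cnd ?r" unfolding rps by (rule cnd_ps[OF cq(1) _ _ ir]) (use e(1) in auto)
      show "el p <= el ?r" using cq(2) by auto
      fix x assume x: "x : el F"
      then have "x ~: el (ins e emp)" using e(2) by auto
      then show "al ?r x = al p x" unfolding rps using al_ps(2) alq x by simp
     qed
     have "ds m' w (ps ?r F \<sigma>)" using \<tau>(2) s(2) ps_ins[OF sq[OF s(1)] e(2) vq] by simp
     moreover have "ds m' (ap (ap t \<sigma>0) (ap \<tau> e)) (ps ?r F \<sigma>0)"
      using tds[OF s0(1) v(2)] ps_ins[OF sq[OF s0(1)] e(2) vq] by simp
     ultimately have "w = ap (ap t \<sigma>0) (ap \<tau> e)" using Gb[OF s(1) s0(1) b1 b0 q(2) exr] by blast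
     then show False using i(2) v(1) \<tau>(3,4) by blast
    qed
    then show ?thesis using i(1) by blast
   qed
  qed
 qed
 then show ?thesis using q(3) exp' ale V'(3) by blast
qed

text \<open>A position of the column beyond \<open>F\<close> with enough freedom is added to
  \<open>F\<close>. For kind \<open>emp\<close> all \<open>k\<close> values are kept, because
  \<open>k\<close> choices cannot lead to all \<open>k + 1\<close> next values. For the other kind
  \<open>prune\<close> leaves at least \<open>K + 1\<close> values.\<close>

lemma Good_requirement:
 assumes G: "Good p F m" and a: "\<alpha> : el II" "j : el two" "K : el om"
 shows "EX p' m' F'. Good p' F' m' & m : el m' & ex F p' p & el F <= el F' &
  (EX n:el om. K : el n & pos \<alpha> j n : el F' & rq j K (al p' (pos \<alpha> j n)))"
proof -
 have p: "cnd p" "Fin F" "el F <= el Ps" using G by (auto simp: Good_def)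
 obtain Z where Z: "Fin Z" "el Z = {\<sigma>. isasg p F \<sigma>}" using Fin_asg[OF p(2,3)] by blast
 have c: "sc k : el om" "sc (sc emp) : el (sc k)" using sc_mem[OF k_om k_two] k_om by auto
 obtain N where N: "N : el om" "!!V L t. lep N V ==> L : el om ==> ALL z:el Z. ALL v:el V. isf (ap (ap t z) v) L (sc k) ==>
  EX V'. el V' <= el V & lep (sc K) V' & (ALL z:el Z. thin (sc k) L (ap t z) V')"
  using prune[OF c Z(1) sc_om[OF a(3)]] by blast
 obtain b where b: "b : el om" "ALL e:el F. snd' (snd' e) : el om --> snd' (snd' e) : el b" using pos_index_bound[OF p(2)] by blast
 obtain K1 where K1: "K1 : el om" "el (sc K) <= el K1" "el b <= el K1" using om_max[OF sc_om[OF a(3)] b(1)] by blast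
 \<comment> \<open>\<open>K2\<close> is above \<open>K\<close>, above all indices occurring in
   \<open>F\<close>, and at least the bound \<open>N\<close> of \<open>prune\<close>.\<close>
 obtain K2 where K2: "K2 : el om" "el K1 <= el K2" "el N <= el K2" using om_max[OF K1(1) N(1)] by blast
 obtain n where n: "n : el om" "K2 : el n" "rq j K2 (al p (pos \<alpha> j n))" using p(1) a K2(1) unfolding cnd_def by blast
 let ?e = "pos \<alpha> j n"
 have eF: "?e ~: el F"
 proof
  assume "?e : el F"
  then have "n : el K2" using b(2) n(1) K1(3) K2(2) by (force simp: pos_def)
  then show False using n(2) mem_asym by blast
 qed
 have Kn: "K : el n"
 proof -
  have "K : el K2" using K1(2) K2(2) by auto
  then show ?thesis using om_mem_trans[OF n(1,2)] by blast
 qed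
 have "EX p' m'. Good p' (ins ?e F) m' & m : el m' & ex F p' p & rq j K (al p' ?e)"
 proof (rule Good_step[OF G pos_Ps[OF a(1,2) n(1)] eF Z(2)])
  fix L t assume L: "L : el om" and t: "!!z v. z : el Z ==> v : el (al p ?e) ==> isf (ap (ap t z) v) L (sc k)"
  show "EX V'. el V' <= el (al p ?e) & V' ~= emp & rq j K V' & (ALL z:el Z. thin (sc k) L (ap t z) V')"
  proof (cases "j = emp")
   case True
   have V: "al p ?e = k"
    by (rule eqI) (use n(3) al_fl[of p ?e] True in \<open>auto simp: rq_def fl_pos\<close>)
   have "thin (sc k) L (ap t z) k" if z: "z : el Z" for z unfolding thin_def
   proof (intro ballI allI, rule ccontr)
    fix n' u assume "n' : el L" and no: "~ (EX i:el (sc k). ALL v:el k. lam n' (ap (ap (ap t z) v)) = u --> ap (ap (ap t z) v) n' ~= i)"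
    have d: "dt (%w. ap (ap (ap t z) (w 0)) n')" by (intro dfns)
    have "i : (%a. ap (ap (ap t z) a) n') ` el k" if "i : el (sc k)" for i
    proof -
     have "~ (ALL v:el k. lam n' (ap (ap (ap t z) v)) = u --> ap (ap (ap t z) v) n' ~= i)" using no that by metis
     then obtain v where "v : el k" "ap (ap (ap t z) v) n' = i" by metis
     then show ?thesis by force
    qed
    then have "cov k (sc k)" by (intro covI[OF d] subsetI)
    then show False using not_cov_sc[OF k_om] by blast
   qed
   moreover have "k ~= emp" using k_two ne_emp by blast
   moreover have "rq j K k" using True by (simp add: rq_def)
   ultimately show ?thesis using V by (intro exI[of _ k]) auto
  next
   case False
   then have "lep K2 (al p ?e)" using n(3) by (simp add: rq_def)
   then have "lep N (al p ?e)" using lep_trans[OF lep_sub[OF K2(3)]] by blast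
   then obtain V' where V': "el V' <= el (al p ?e)" "lep (sc K) V'" "ALL z:el Z. thin (sc k) L (ap t z) V'"
    using N(2)[OF _ L, of "al p ?e" t] t by blast
   have "EX f. isf f (sc K) V'" using V'(2) by (auto simp: lep_def)
   then have "V' ~= emp" unfolding ne_emp using isf_in by (metis el_ins insertI1)
   moreover have "rq j K V'" using False lep_trans[OF lep_sub V'(2)] unfolding rq_def by auto
   ultimately show ?thesis using V' by blast
  qed
 qed
 then obtain p' m' where "Good p' (ins ?e F) m'" "m : el m'" "ex F p' p" "rq j K (al p' ?e)" by blast
 then show ?thesis using n(1) Kn by (intro exI[of _ p'] exI[of _ m'] exI[of _ "ins ?e F"]) auto
qed

definition met :: "'a => 'a => 'a => 'a => bool" where
 "met K F p b \<longleftrightarrow> (EX n:el om. K : el n & pos (fst' b) (snd' b) n : el F & rq (snd' b) K (al p (pos (fst' b) (snd' b) n)))"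

lemma dfn_met: "dt s ==> dt t ==> dt u ==> dt w ==> dfn (%v. met (s v) (t v) (u v) (w v))"
proof -
 assume a: "dt s" "dt t" "dt u" "dt w"
 have "dfn (%v. met (fst' (v 2)) (snd' (v 2)) (v 0) (v 1))" unfolding met_def by (intro dfns)
 from dfn_comp3[OF this, of u w "%v. pr (s v) (t v)"] show ?thesis using a by (simp add: dt_pr)
qed

lemma met_ex: "met K F p b ==> el F <= el F' ==> ex F p' p ==> met K F' p' b"
 unfolding met_def ex_def by (metis subsetD)

lemma Good_requirements:
 assumes G: "Good p F m" and B: "Fin B" "el B <= el (tms II two)" and K: "K : el om"
 shows "EX p' m' F'. Good p' F' m' & el m <= el m' & (B ~= emp --> m : el m') & ex F p' p & el F <= el F' & (ALL b:el B. met K F' p' b)"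
proof -
 have "el B <= el (tms II two) --> (EX p' m' F'. Good p' F' m' & el m <= el m' & (B ~= emp --> m : el m') & ex F p' p & el F <= el F' & (ALL b:el B. met K F' p' b))"
 proof (rule Fin_induct[OF B(1)])
  show "dfn (%v. el (v 0) <= el (tms II two) --> (EX p' m' F'. Good p' F' m' & el m <= el m' & (v 0 ~= emp --> m : el m') & ex F p' p & el F <= el F' & (ALL b:el (v 0). met K F' p' b)))"
   by (intro dfns dfn_met)
  have "ex F p p" using G ex_refl by (simp add: Good_def)
  then show "el emp <= el (tms II two) --> (EX p' m' F'. Good p' F' m' & el m <= el m' & (emp ~= emp --> m : el m') & ex F p' p & el F <= el F' & (ALL b:el emp. met K F' p' b))"
   using G by (intro impI exI[of _ p] exI[of _ m] exI[of _ F]) auto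
  fix x B assume IH: "el B <= el (tms II two) --> (EX p' m' F'. Good p' F' m' & el m <= el m' & (B ~= emp --> m : el m') & ex F p' p & el F <= el F' & (ALL b:el B. met K F' p' b))"
  show "el (ins x B) <= el (tms II two) --> (EX p' m' F'. Good p' F' m' & el m <= el m' & (ins x B ~= emp --> m : el m') & ex F p' p & el F <= el F' & (ALL b:el (ins x B). met K F' p' b))"
  proof
   assume xB: "el (ins x B) <= el (tms II two)"
   then have "el B <= el (tms II two)" unfolding el_ins by blast
   then obtain p1 m1 F1 where 1: "Good p1 F1 m1" "el m <= el m1" "ex F p1 p" "el F <= el F1" "ALL b:el B. met K F1 p1 b"
    using IH by blast
   obtain \<alpha> j where x: "x = pr \<alpha> j" "\<alpha> : el II" "j : el two" using xB by auto
   obtain p2 m2 F2 where 2: "Good p2 F2 m2" "m1 : el m2" "ex F1 p2 p1" "el F1 <= el F2"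
    "EX n:el om. K : el n & pos \<alpha> j n : el F2 & rq j K (al p2 (pos \<alpha> j n))" using Good_requirement[OF 1(1) x(2,3) K] by blast
   have o: "m : el om" "m1 : el om" "m2 : el om" using G 1 2 by (auto simp: Good_def)
   have mm: "m : el m2"
   proof (cases "m = m1")
    case False
    then have "m : el m1" using Ord_sub_mem[OF Ord_nat[OF o(1)] Ord_nat[OF o(2)] 1(2)] by blast
    then show ?thesis using om_mem_trans[OF o(3) 2(2)] by blast
   qed (use 2 in simp)
   then have "el m <= el m2" using om_trans_el[OF o(3)] by (auto simp: trans_def)
   moreover have "met K F2 p2 x" using 2(5) x by (simp add: met_def)
   moreover have "met K F2 p2 b" if "b : el B" for b using met_ex[OF _ 2(4,3)] 1(5) that by blast
   moreover have "ex F p2 p" using ex_trans[OF ex_sub[OF 2(3) 1(4)] 1(3)] .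
   moreover have "el F <= el F2" using 1(4) 2(4) by blast
   ultimately show "EX p' m' F'. Good p' F' m' & el m <= el m' & (ins x B ~= emp --> m : el m') & ex F p' p & el F <= el F' & (ALL b:el (ins x B). met K F' p' b)"
    using 2(1) mm by (intro exI[of _ p2] exI[of _ m2] exI[of _ F2]) auto
  qed
 qed
 then show ?thesis using B(2) by blast
qed

end

context localization
begin

lemma II_nonempty: "EX \<alpha>. \<alpha> : el II"
proof -
 have "isf (lam RR (%_. emp)) RR JJ" by (rule isfI) (auto simp: JJ_def intro: dfns)
 then show ?thesis by (auto simp: II_def)
qed

text \<open>The columns of a condition are enumerated in type omega, so that each stage of the
  bookkeeping can treat finitely many of them.\<close>

definition enm :: "'a => 'a => bool" where
 "enm c p \<longleftrightarrow> isf c om II & (ALL z:el p. EX i:el om. fst' (fst' z) = ap c i)"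
lemma dfn_enm [dfns]: "dt t ==> dt u ==> dfn (%v. enm (t v) (u v))"
 by (rule dfn_comp2[where P=enm]; (assumption | (unfold enm_def, intro dfns)))

lemma enm_exists: assumes "cnd p" shows "EX c. enm c p"
proof -
 obtain C f where f: "el C <= ap f ` el om" "ALL z:el p. fst' (fst' z) : el C" using assms by (auto simp: cnd_def cov_def)
 obtain \<alpha> where \<alpha>: "\<alpha> : el II" using II_nonempty by blast
 define h where "h n = (if ap f n : el II then ap f n else \<alpha>)" for n
 have d: "dt (%v. h (v 0))" unfolding h_def by (intro dfns)
 have "isf (lam om h) om II" by (rule isfI[OF d]) (auto simp: h_def \<alpha>)
 moreover have "EX i:el om. fst' (fst' z) = ap (lam om h) i" if z: "z : el p" for z
 proof -
  obtain e i where "e : el Ps" "z = pr e i" using assms z unfolding cnd_def by blast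
  then have I: "fst' (fst' z) : el II" by (elim Ps_cases) simp
  obtain n where n: "n : el om" "fst' (fst' z) = ap f n" using f z by blast
  moreover from this have "h n = fst' (fst' z)" using I by (simp add: h_def)
  ultimately have "ap (lam om h) n = fst' (fst' z)" using ap_lam[OF d n(1)] by simp
  then show ?thesis using n(1) by metis
 qed
 ultimately show ?thesis by (auto simp: enm_def)
qed

definition st :: "'a => 'a => 'a => 'a => 'a => 'a" where "st n p F m C = pr n (pr p (pr F (pr m C)))"
definition st_ok :: "'a => 'a => 'a => 'a => 'a => bool" where
 "st_ok n p F m C \<longleftrightarrow> n : el om & Good p F m & Fin C & el C <= el (fs om II) & (EX c:el C. enm c p)"
text \<open>\<open>C\<close> holds enumerations of the columns of all conditions so far. Stage
  \<open>n\<close> treats the entries up to \<open>n\<close> of each, for both kinds and with the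
  bound \<open>n\<close>; so each column of each stage is treated at all later stages from some
  point on.\<close>

definition st_next :: "'a => 'a => 'a => 'a => 'a => 'a => 'a => 'a => 'a => 'a => bool" where
 "st_next n p F m C n' p' F' m' C' \<longleftrightarrow> n' = sc n & ex F p' p & el F <= el F' & m : el m' & el C <= el C' &
  (ALL c:el C. ALL i:el (sc n). ALL j:el two. met n F' p' (pr (ap c i) j))"

lemma st_step: assumes "st_ok n p F m C" shows "EX n' p' F' m' C'. st_ok n' p' F' m' C' & st_next n p F m C n' p' F' m' C'"
proof -
 have n: "n : el om" and G: "Good p F m" and C: "Fin C" "el C <= el (fs om II)" "EX c. c : el C"
  using assms by (auto simp: st_ok_def)
 let ?h = "%z. pr (ap (fst' (fst' z)) (snd' (fst' z))) (snd' z)"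
 have d: "dt (%v. ?h (v 0))" by (intro dfns)
 let ?D = "tms (tms C (sc n)) two" let ?B = "mk (?h ` el ?D)"
 have two: "two : el om" by (simp add: two_def)
 have B: "Fin ?B" by (rule Fin_img[OF d]) (intro Fin_tms C Fin_nat sc_om n two)
 have eB: "el ?B = ?h ` el ?D" by (rule el_mk[OF S_img[OF S_el d]])
 have in_B: "pr (ap c i) j : el ?B" if "c : el C" "i : el (sc n)" "j : el two" for c i j
  unfolding eB using that by (intro image_eqI[of _ _ "pr (pr c i) j"]) auto
 have BI: "el ?B <= el (tms II two)"
 proof
  fix b assume "b : el ?B"
  then obtain z where z: "z : el ?D" "b = ?h z" unfolding eB by blast
  then obtain c i j where "c : el C" "i : el (sc n)" "j : el two" "z = pr (pr c i) j" by (auto simp del: el_ins)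
  then have b: "c : el C" "i : el (sc n)" "j : el two" "b = pr (ap c i) j" using z(2) by simp_all
  then have "isf c om II" "i : el om" using C(2) om_elem[OF sc_om[OF n]] by auto
  then show "b : el (tms II two)" using b isf_in[of c om II i] by auto
 qed
 obtain c0 where c0: "c0 : el C" using C(3) by blast
 have "n : el (sc n)" "emp : el two" by (auto simp: el_two)
 then have "?B ~= emp" using in_B[OF c0] ne_emp by blast
 then obtain p' m' F' where 1: "Good p' F' m'" "m : el m'" "ex F p' p" "el F <= el F'" "ALL b:el ?B. met n F' p' b"
  using Good_requirements[OF G B BI n] by blast
 obtain c where c: "enm c p'" using enm_exists[of p'] 1(3) unfolding ex_def by blast
 have "st_ok (sc n) p' F' m' (ins c C)" unfolding st_ok_def using n 1(1) C c by (auto simp: enm_def)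
 moreover have "st_next n p F m C (sc n) p' F' m' (ins c C)" unfolding st_next_def using 1 in_B by auto
 ultimately show ?thesis by blast
qed

text \<open>Dependent choice strings the stages together. Their levels \<open>m\<close> are
  unbounded, so every node \<open>u\<close> has a forbidden next value at some stage, and the fusion
  \<open>q\<close> inherits the prohibition. The function \<open>j\<close> collects these
  values.\<close>

theorem localize:
 "EX q j. cnd q & el p0 <= el q & isf j (sq (sc k)) (sc k) &
  (ALL n:el om. ALL u r. isf u n (sc k) --> cnd r --> el q <= el r --> ~ ds (sc n) (ins (pr n (ap j u)) u) r)"
proof -
 let ?n = "fst'" and ?p = "%x. fst' (snd' x)" and ?F = "%x. fst' (snd' (snd' x))"
  and ?m = "%x. fst' (snd' (snd' (snd' x)))" and ?C = "%x. snd' (snd' (snd' (snd' x)))"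
 let ?ok = "%x. x = st (?n x) (?p x) (?F x) (?m x) (?C x) & st_ok (?n x) (?p x) (?F x) (?m x) (?C x)"
 let ?nx = "%x y. st_next (?n x) (?p x) (?F x) (?m x) (?C x) (?n y) (?p y) (?F y) (?m y) (?C y)"
 have sel: "?n (st n p F m C) = n" "?p (st n p F m C) = p" "?F (st n p F m C) = F" "?m (st n p F m C) = m"
  "?C (st n p F m C) = C" for n p F m C by (simp_all add: st_def)
 let ?BP = "pw (pw (tms Ps om))"
 have cP: "p : el (pw (tms Ps om))" if "cnd p" for p
 proof -
  have "z : el (tms Ps om)" if "z : el p" for z
  proof -
   obtain e i where "e : el Ps" "i : el (fl e)" "z = pr e i" using \<open>cnd p\<close> \<open>z : el p\<close> unfolding cnd_def by blast
   then show ?thesis using om_elem[OF fl_om] by auto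
  qed
  then show ?thesis by auto
 qed
 \<comment> \<open>Dependent choice asks for a set of states; each component of a state ranges over
   a fixed set.\<close>
 have s: "S {x. ?ok x}"
 proof (rule S_sub[OF S_el[of "tms om (tms (pw (tms Ps om)) (tms (pw Ps) (tms om (pw (fs om II)))))"]])
  show "{x. ?ok x} <= el (tms om (tms (pw (tms Ps om)) (tms (pw Ps) (tms om (pw (fs om II))))))"
  proof
   fix x assume "x : {x. ?ok x}"
   then obtain n p F m C where x: "x = st n p F m C" "st_ok n p F m C" by blast
   then have "n : el om" "p : el (pw (tms Ps om))" "F : el (pw Ps)" "m : el om" "C : el (pw (fs om II))"
    using cP[of p] unfolding st_ok_def Good_def by auto
   then show "x : el (tms om (tms (pw (tms Ps om)) (tms (pw Ps) (tms om (pw (fs om II))))))"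
    unfolding x(1) st_def by (simp only: el_tms) blast
  qed
  show "dfn (%v. v 0 : {x. ?ok x})" unfolding st_def st_ok_def by (intro dfns)
 qed
 then obtain X where X: "el X = {x. ?ok x}" by (auto simp: S_def)
 obtain c0 where c0: "enm c0 p0" using enm_exists[OF p0] by blast
 have x0: "st emp p0 emp emp (ins c0 emp) : el X"
  unfolding X mem_Collect_eq sel st_ok_def using Good_start c0 by (auto simp: enm_def)
 have dnx: "dfn (%v. ?nx (v 0) (v 1))" unfolding st_next_def by (intro dfns dfn_met)
 have "EX y:el X. ?nx x y" if "x : el X" for x
 proof -
  obtain n' p' F' m' C' where "st_ok n' p' F' m' C'" "st_next (?n x) (?p x) (?F x) (?m x) (?C x) n' p' F' m' C'"
   using st_step X \<open>x : el X\<close> by blast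
  then show ?thesis unfolding X by (intro bexI[of _ "st n' p' F' m' C'"]) (simp_all add: sel)
 qed
 then obtain f where f: "isf f om X" "ap f emp = st emp p0 emp emp (ins c0 emp)" "!!n. n : el om ==> ?nx (ap f n) (ap f (sc n))"
  using dependent_choice[OF dnx x0] by blast
 have ok: "?ok (ap f n)" if "n : el om" for n using isf_in[OF f(1) that] X by blast
 have nn: "?n (ap f n) = n" if "n : el om" for n
 proof (rule om_induct[OF that])
  show "dfn (%v. ?n (ap f (v 0)) = v 0)" by (intro dfns)
  show "?n (ap f emp) = emp" by (simp add: f(2) sel)
  show "?n (ap f (sc n)) = sc n" if "n : el om" "?n (ap f n) = n" for n using f(3)[OF that(1)] that(2) by (simp add: st_next_def)
 qed
 have mn: "el n <= el (?m (ap f n))" if "n : el om" for n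
 proof (rule om_induct[OF that])
  show "dfn (%v. el (v 0) <= el (?m (ap f (v 0))))" by (intro dfns)
  show "el emp <= el (?m (ap f emp))" by simp
  fix n assume n: "n : el om" "el n <= el (?m (ap f n))"
  have o: "?m (ap f n) : el om" "?m (ap f (sc n)) : el om" using ok[OF n(1)] ok[OF sc_om[OF n(1)]] by (auto simp: st_ok_def Good_def)
  have i: "?m (ap f n) : el (?m (ap f (sc n)))" using f(3)[OF n(1)] by (simp add: st_next_def)
  have "n : el (?m (ap f (sc n)))"
  proof (cases "n = ?m (ap f n)")
   case False
   then have "n : el (?m (ap f n))" using Ord_sub_mem[OF Ord_nat[OF n(1)] Ord_nat[OF o(1)] n(2)] by blast
   then show ?thesis using om_mem_trans[OF o(2) i] by blast
  qed (use i in simp)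
  moreover have "el n <= el (?m (ap f (sc n)))" using n(2) om_mem_trans[OF o(2) i] by blast
  ultimately show "el (sc n) <= el (?m (ap f (sc n)))" by simp
 qed
 have Cmono: "el (?C (ap f n)) <= el (?C (ap f l))" if n: "n : el om" and l: "l : el om" and nl: "el n <= el l" for n l
 proof -
  have "el n <= el l --> el (?C (ap f n)) <= el (?C (ap f l))"
  proof (rule om_induct[OF l])
   show "dfn (%v. el n <= el (v 0) --> el (?C (ap f n)) <= el (?C (ap f (v 0))))" by (intro dfns)
   show "el n <= el emp --> el (?C (ap f n)) <= el (?C (ap f emp))" by (metis el_emp el_inject order_refl subset_empty)
   fix l assume l: "l : el om" "el n <= el l --> el (?C (ap f n)) <= el (?C (ap f l))"
   show "el n <= el (sc l) --> el (?C (ap f n)) <= el (?C (ap f (sc l)))"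
   proof
    assume s: "el n <= el (sc l)"
    show "el (?C (ap f n)) <= el (?C (ap f (sc l)))"
    proof (cases "n = sc l")
     case False
     then have "n : el (sc l)" using Ord_sub_mem[OF Ord_nat[OF n] Ord_nat[OF sc_om[OF l(1)]] s] by blast
     then have "el n <= el l" using om_trans_el[OF l(1)] by (auto simp: trans_def)
     then show ?thesis using l f(3)[OF l(1)] unfolding st_next_def by blast
    qed simp
   qed
  qed
  then show ?thesis using nl by blast
 qed
 define fp where "fp = lam om (%n. ?p (ap f n))" define gF where "gF = lam om (%n. ?F (ap f n))"
 have fp: "ap fp n = ?p (ap f n)" if "n : el om" for n unfolding fp_def by (rule ap_lam[OF _ that]) (intro dfns)
 have gF: "ap gF n = ?F (ap f n)" if "n : el om" for n unfolding gF_def by (rule ap_lam[OF _ that]) (intro dfns)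
 have "EX q. ALL n:el om. ex (ap gF n) q (ap fp n)"
 proof (rule fusion)
  fix n assume n: "n : el om"
  note n' = sc_om[OF n]
  show "cnd (ap fp n)" using ok[OF n] by (simp add: fp[OF n] st_ok_def Good_def)
  show "el (ap gF n) <= el (ap gF (sc n))" using f(3)[OF n] unfolding gF[OF n] gF[OF n'] st_next_def by blast
  show "ex (ap gF n) (ap fp (sc n)) (ap fp n)" using f(3)[OF n] unfolding gF[OF n] fp[OF n] fp[OF n'] st_next_def by blast
  fix z j K assume z: "z : el (ap fp n)" and j: "j : el two" and K: "K : el om"
  obtain c where c: "c : el (?C (ap f n))" "enm c (?p (ap f n))" using ok[OF n] unfolding st_ok_def by blast
  obtain i where i: "i : el om" "fst' (fst' z) = ap c i" using c(2) z unfolding enm_def fp[OF n] by blast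
  \<comment> \<open>Stage \<open>N\<close> already has the enumeration \<open>c\<close>, treats its
    entry \<open>i\<close>, and works with a bound of at least \<open>K\<close>.\<close>
  obtain N1 where N1: "N1 : el om" "el n <= el N1" "el (sc i) <= el N1" using om_max[OF n sc_om[OF i(1)]] by blast
  obtain N where N: "N : el om" "el N1 <= el N" "el K <= el N" using om_max[OF N1(1) K] by blast
  note N' = sc_om[OF N(1)]
  have "el n <= el N" using N1(2) N(2) by blast
  then have cN: "c : el (?C (ap f N))" using Cmono[OF n N(1)] c(1) by blast
  have iN: "i : el (sc N)" using N1(3) N(2) by auto
  have "met (?n (ap f N)) (?F (ap f (sc N))) (?p (ap f (sc N))) (pr (ap c i) j)"
   using f(3)[OF N(1)] cN iN j unfolding st_next_def nn[OF N(1)] by blast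
  then obtain l where l: "l : el om" "N : el l" "pos (fst' (fst' z)) j l : el (?F (ap f (sc N)))"
   "rq j N (al (?p (ap f (sc N))) (pos (fst' (fst' z)) j l))"
   unfolding met_def nn[OF N(1)] using i(2) by auto
  have "K : el l"
  proof (cases "K = N")
   case False
   then have "K : el N" using Ord_sub_mem[OF Ord_nat[OF K] Ord_nat[OF N(1)] N(3)] by blast
   then show ?thesis using om_mem_trans[OF l(1,2)] by blast
  qed (use l in simp)
  then show "EX m:el om. EX i:el om. K : el i & pos (fst' (fst' z)) j i : el (ap gF m) &
    rq j K (al (ap fp m) (pos (fst' (fst' z)) j i))"
   using l rq_less[OF l(4) N(3)] N' by (intro bexI[of _ "sc N"] bexI[of _ l]) (simp_all only: gF fp)
 qed
 then obtain q where q: "!!n. n : el om ==> ex (?F (ap f n)) q (?p (ap f n))" using gF fp by metis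
 have cq: "cnd q" using q[OF zero_om] by (simp add: ex_def)
 have p0q: "el p0 <= el q" using q[OF zero_om] by (simp add: ex_def f(2) sel)
 let ?Q = "%u i. ALL n:el om. isf u n (sc k) --> (ALL r. cnd r --> el q <= el r --> ~ ds (sc n) (ins (pr n i) u) r)"
 have "EX j. isf j (sq (sc k)) (sc k) & (ALL u:el (sq (sc k)). ?Q u (ap j u))"
 proof (rule ac)
  show "dfn (%v. ?Q (v 0) (v 1))" by (intro dfns)
  fix u assume "u : el (sq (sc k))"
  then obtain n where n: "n : el om" "isf u n (sc k)" by auto
  note n' = sc_om[OF n(1)]
  have "n : el (?m (ap f (sc n)))" using mn[OF n'] by auto
  then obtain i where i: "i : el (sc k)" "ALL r. cnd r --> el (?p (ap f (sc n))) <= el r --> ~ ds (sc n) (ins (pr n i) u) r"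
   using ok[OF n'] n(2) unfolding st_ok_def Good_def by blast
  have "el (?p (ap f (sc n))) <= el q" using q[OF n'] by (simp add: ex_def)
  then have "?Q u i" using i(2) isf_dom_unique[OF n(2)] by blast
  then show "EX i:el (sc k). ?Q u i" using i(1) by blast
 qed
 then obtain j where j: "isf j (sq (sc k)) (sc k)" "ALL u:el (sq (sc k)). ?Q u (ap j u)" by blast
 have "~ ds (sc n) (ins (pr n (ap j u)) u) r" if "n : el om" "isf u n (sc k)" "cnd r" "el q <= el r" for n u r
 proof -
  have "u : el (sq (sc k))" using that(1,2) by auto
  then show ?thesis using j(2) that by blast
 qed
 then show ?thesis using cq p0q j(1) by blast
qed

end

section \<open>How many conditions there are, and on which columns names depend\<close>

section \<open>Counting conditions and chain condition\<close>

context zfc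
begin

lemma cov_pw: "cov A B ==> cov (pw A) (pw B)"
proof -
 assume "cov A B"
 then obtain f where f: "el B <= ap f ` el A" by (auto simp: cov_def)
 show ?thesis
 proof (rule covI[of "%X. img f X"], intro dfns, rule subsetI)
  fix Y assume "Y : el (pw B)"
  then have Y: "el Y <= el B" by simp
  have "S {a : el A. ap f a : el Y}" by (rule S_Collect) (auto intro!: dfns)
  then obtain X where X: "el X = {a : el A. ap f a : el Y}" by (auto simp: S_def)
  have "img f X = Y" by (rule eqI) (use X Y f in auto)
  then show "Y : (%X. img f X) ` el (pw A)" using X by (intro image_eqI[of _ _ X]) auto
 qed
qed

end

context silver
begin

lemma cov_RR_fs: "cov RR (fs om RR)" unfolding RR_def by (rule cov_pw_fs[OF countable_square])
lemma cov_RR_sq: "cov RR (tms RR RR)"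
 by (rule cov_pair_fs[OF cov_RR_fs, of emp "sc emp"]) (auto simp: ne_emp[symmetric], metis el_emp el_ins insert_not_empty)
lemma cov_RR_om: "cov RR om"
 by (rule cov_sub) (use om_elem in \<open>auto simp: RR_def\<close>)
lemma cov_JJ_fs: "cov JJ (fs RR JJ)" unfolding JJ_def by (rule cov_pw_fs[OF cov_RR_sq])
lemma emp_RR: "emp : el RR" by (simp add: RR_def)
lemma cov_JJ_sq: "cov JJ (tms JJ JJ)"
proof (rule cov_pair_fs[OF cov_JJ_fs emp_RR])
 show "om : el RR" by (simp add: RR_def)
 show "emp ~= om" using zero_om by (metis el_emp empty_iff)
qed
lemma cov_JJ_RR: "cov JJ RR"
proof (rule covI[of un], intro dfns, rule subsetI)
 fix X assume "X : el RR"
 then show "X : un ` el JJ" by (intro image_eqI[of _ _ "ins X emp"]) (auto simp: JJ_def intro!: eqI)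
qed
lemma cov_mono_tms: "cov C (tms C C) ==> cov C A ==> cov C B ==> cov C (tms A B)"
 using cov_trans[OF _ cov_tms] by blast
lemma cov_RR_two: "cov RR two" using cov_trans[OF cov_RR_om cov_sub[of two om]] om_elem by (auto simp: two_def)

lemma cnd_subset: assumes "cnd r" "el q <= el r" shows "cnd q"
proof -
 have qr: "el (al r e) <= el (al q e)" for e by (rule al_mono[OF assms(2)])
 show ?thesis unfolding cnd_def
 proof (intro conjI ballI)
  show "EX e:el Ps. EX i:el (fl e). z = pr e i" if "z : el q" for z using assms that unfolding cnd_def by blast
  show "al q e ~= emp" if "e : el Ps" for e
  proof -
   have "EX i. i : el (al r e)" using assms(1) that unfolding cnd_def ne_emp by blast
   then show ?thesis using qr[of e] unfolding ne_emp by blast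
  qed
  show "EX C. cov om C & (ALL z:el q. fst' (fst' z) : el C)" using assms unfolding cnd_def by blast
  fix \<alpha> j K assume "\<alpha> : el II" "j : el two" "K : el om"
  then obtain n where "n : el om" "K : el n" "rq j K (al r (pos \<alpha> j n))" using assms(1) unfolding cnd_def by blast
  then show "EX n:el om. K : el n & rq j K (al q (pos \<alpha> j n))" using rq_mono[OF _ qr] by blast
 qed
qed

definition PA :: "'a => 'a => bool" where "PA A p \<longleftrightarrow> cnd p & (ALL z:el p. fst' (fst' z) : el A)"
lemma dfn_PA [dfns]: "dt t ==> dt u ==> dfn (%v. PA (t v) (u v))"
 by (rule dfn_comp2[where P=PA]; (assumption | (unfold PA_def, intro dfns)))
lemma PA_mono: "PA A p ==> el A <= el B ==> PA B p" by (auto simp: PA_def)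

lemma cnd_pw: "cnd p ==> p : el (pw (tms Ps om))"
proof -
 assume p: "cnd p"
 have "z : el (tms Ps om)" if z: "z : el p" for z
 proof -
  obtain e i where "e : el Ps" "i : el (fl e)" "z = pr e i" using p z unfolding cnd_def by blast
  then show ?thesis using om_elem[OF fl_om] by auto
 qed
 then show ?thesis by auto
qed
lemma S_PA: "S {p. PA A p}"
 by (rule S_sub[OF S_el[of "pw (tms Ps om)"]]) (use cnd_pw in \<open>auto simp: PA_def intro!: dfns\<close>)
definition PAs :: "'a => 'a" where "PAs A = mk {p. PA A p}"
lemma el_PAs: "el (PAs A) = {p. PA A p}" unfolding PAs_def by (rule el_mk[OF S_PA])
lemma dt_PAs [dfns]: "dt t ==> dt (%v. PAs (t v))"
 by (rule dt_comp1[where f=PAs, rotated], assumption+, unfold PAs_def, rule dt_mk, rule S_PA, intro dfns)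

definition PP :: 'a where "PP = PAs II"
lemma cnd_PA: "cnd p ==> PA II p"
proof -
 assume p: "cnd p"
 have "fst' (fst' z) : el II" if z: "z : el p" for z
 proof -
  obtain e i where "e : el Ps" "z = pr e i" using p z unfolding cnd_def by blast
  then show ?thesis by (elim Ps_cases) simp
 qed
 then show ?thesis using p by (simp add: PA_def)
qed
lemma el_PP: "el PP = {p. cnd p}" using cnd_PA by (auto simp: PP_def el_PAs PA_def)

text \<open>A condition is coded by an enumeration of its columns together with the set of its
  exclusions, each written as four numbers: place of the column in the enumeration, kind, position,
  value.\<close>

lemma cov_PAs:
 assumes "\<alpha>0 : el A" shows "cov (tms (fs om A) (pw (tms om (tms two (tms om om))))) (PAs A)"
proof -
 let ?W = "tms om (tms two (tms om om))"
 define h where "h x = mk {z. EX n:el om. EX j:el two. EX i:el om. EX v:el om.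
  pr n (pr j (pr i v)) : el (snd' x) & z = pr (pos (ap (fst' x) n) j i) v}" for x
 have s: "S {z. EX n:el om. EX j:el two. EX i:el om. EX v:el om.
  pr n (pr j (pr i v)) : el (snd' x) & z = pr (pos (ap (fst' x) n) j i) v}" for x
 proof (rule S_sub[OF S_el[of "tms (tms (img (fst' x) om) (tms two om)) om"]])
  show "{z. EX n:el om. EX j:el two. EX i:el om. EX v:el om.
   pr n (pr j (pr i v)) : el (snd' x) & z = pr (pos (ap (fst' x) n) j i) v} <= el (tms (tms (img (fst' x) om) (tms two om)) om)"
   by (auto simp: pos_def)
 qed (intro dfns)
 have dh: "dt (%v. h (v 0))" unfolding h_def by (rule dt_mk, rule s, intro dfns)
 show ?thesis
 proof (rule covI[OF dh], rule subsetI)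
  fix p assume "p : el (PAs A)"
  then have p: "cnd p" "!!z. z : el p ==> fst' (fst' z) : el A" by (auto simp: el_PAs PA_def)
  obtain C f where f: "el C <= ap f ` el om" "ALL z:el p. fst' (fst' z) : el C" using p(1) by (auto simp: cnd_def cov_def)
  define g where "g n = (if ap f n : el A then ap f n else \<alpha>0)" for n
  have dg: "dt (%v. g (v 0))" unfolding g_def by (intro dfns)
  let ?c = "lam om g"
  have c: "isf ?c om A" by (rule isfI[OF dg]) (auto simp: g_def assms)
  have cap: "ap ?c n = g n" if "n : el om" for n by (rule ap_lam[OF dg that])
  have sY: "S {y : el ?W. EX n:el om. EX j:el two. EX i:el om. EX v:el om. y = pr n (pr j (pr i v)) & pr (pos (ap ?c n) j i) v : el p}"
   by (rule S_Collect[OF S_el]) (intro dfns dg)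
  then obtain Y where Y: "el Y = {y : el ?W. EX n:el om. EX j:el two. EX i:el om. EX v:el om. y = pr n (pr j (pr i v)) & pr (pos (ap ?c n) j i) v : el p}"
   by (auto simp: S_def)
  have "h (pr ?c Y) = p"
  proof (rule eqI, rule equalityI)
   show "el (h (pr ?c Y)) <= el p" unfolding h_def el_mk[OF s] by (auto simp: Y)
   show "el p <= el (h (pr ?c Y))"
   proof
    fix z assume z: "z : el p"
    obtain e v where e: "e : el Ps" "v : el (fl e)" "z = pr e v" using p(1) z unfolding cnd_def by blast
    obtain \<alpha> j i where a: "\<alpha> : el II" "j : el two" "i : el om" "e = pos \<alpha> j i" using Ps_cases[OF e(1)] by blast
    have v: "v : el om" using om_elem[OF fl_om[OF e(1)] e(2)] .
    obtain n where n: "n : el om" "fst' (fst' z) = ap f n" using f z by blast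
    have "ap ?c n = \<alpha>" using cap[OF n(1)] n(2) p(2)[OF z] e a by (simp add: g_def)
    then have zz: "z = pr (pos (ap ?c n) j i) v" using e a by simp
    then have "pr n (pr j (pr i v)) : el Y" unfolding Y using n a v z by auto
    then show "z : el (h (pr ?c Y))" unfolding h_def el_mk[OF s] using zz n a v by auto
   qed
  qed
  moreover have "pr ?c Y : el (tms (fs om A) (pw ?W))" using c Y by auto
  ultimately show "p : h ` el (tms (fs om A) (pw ?W))" by force
 qed
qed

lemma cov_RR_PAs: assumes "\<alpha>0 : el A" "cov RR A" shows "cov RR (PAs A)"
proof (rule cov_trans[OF _ cov_PAs[OF assms(1)]], rule cov_mono_tms[OF cov_RR_sq])
 show "cov RR (fs om A)" using cov_trans[OF cov_RR_fs cov_fs[OF assms(2) cov_refl assms(1)]] .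
 have "cov om two" by (rule cov_sub) (use om_elem[of two] in \<open>auto simp: two_def\<close>)
 then have "cov om (tms om (tms two (tms om om)))"
  by (intro cov_mono_tms[OF countable_square] cov_refl)
 then show "cov RR (pw (tms om (tms two (tms om om))))" unfolding RR_def by (rule cov_pw)
qed

lemma isf_const_ex: "x : el B ==> isf (lam A (%_. x)) A B" by (rule isfI) (auto intro: dfns)
lemma emp_JJ: "emp : el JJ" by (simp add: JJ_def)
lemma II_ex: "EX \<alpha>. \<alpha> : el II" using isf_const_ex[OF emp_JJ, of RR] by (auto simp: II_def)
lemma cov_JJ_II: "cov JJ II" using cov_JJ_fs by (simp add: II_def)

lemma cov_JJ_PP: "cov JJ PP"
proof -
 obtain \<alpha> where \<alpha>: "\<alpha> : el II" using II_ex by blast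
 show ?thesis unfolding PP_def
 proof (rule cov_trans[OF _ cov_PAs[OF \<alpha>]], rule cov_mono_tms[OF cov_JJ_sq])
  show "cov JJ (fs om II)" using cov_trans[OF cov_JJ_fs cov_fs[OF cov_JJ_II cov_RR_om \<alpha>]] .
  have "cov om two" by (rule cov_sub) (use om_elem[of two] in \<open>auto simp: two_def\<close>)
  then have "cov om (tms om (tms two (tms om om)))"
   by (intro cov_mono_tms[OF countable_square] cov_refl)
  then have "cov RR (pw (tms om (tms two (tms om om))))" unfolding RR_def by (rule cov_pw)
  then show "cov JJ (pw (tms om (tms two (tms om om))))" using cov_JJ_RR cov_trans by blast
 qed
qed

text \<open>\<open>a\<close> contains all that \<open>q\<close> says about columns in
  \<open>A\<close>. Hence the union behaves like \<open>a\<close> on these columns and like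
  \<open>q\<close> on the others.\<close>

lemma merge:
 assumes a: "PA A a" and q: "cnd q" and sub: "!!z. z : el q ==> fst' (fst' z) : el A ==> z : el a"
 shows "cnd (un2 a q)" "fst' e ~: el A ==> al (un2 a q) e = al q e"
proof -
 have ca: "cnd a" "!!z. z : el a ==> fst' (fst' z) : el A" using a by (auto simp: PA_def)
 show out: "al (un2 a q) e = al q e" if "fst' e ~: el A" for e
  by (rule eqI) (use ca(2)[of "pr e _"] that in \<open>auto simp: el_al\<close>)
 have inn: "al (un2 a q) e = al a e" if "fst' e : el A" for e
  by (rule eqI) (use sub[of "pr e _"] that in \<open>auto simp: el_al\<close>)
 have e: "al (un2 a q) e = al a e | al (un2 a q) e = al q e" for e using out inn by blast
 show "cnd (un2 a q)" unfolding cnd_def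
 proof (intro conjI ballI)
  show "EX e:el Ps. EX i:el (fl e). z = pr e i" if "z : el (un2 a q)" for z using ca(1) q that unfolding cnd_def by auto
  show "al (un2 a q) e ~= emp" if "e : el Ps" for e using e[of e] ca(1) q that unfolding cnd_def by auto
  obtain C D where "cov om C" "ALL z:el a. fst' (fst' z) : el C" "cov om D" "ALL z:el q. fst' (fst' z) : el D"
   using ca(1) q unfolding cnd_def by blast
  moreover have "cov om (un2 C D)" if C: "cov om C" and D: "cov om D" for C D
  proof -
   have d: "dt (%v. v 0)" by (intro dfns)
   have "cov om (tms om om)" by (rule countable_square)
   moreover have "cov (tms (up C D) om) (mk (UN x:el (up C D). el x))" by (rule cov_UN[OF d]) (use C D in auto)
   moreover have "mk (UN x:el (up C D). el x) = un2 C D" by (rule eqI) (simp add: el_mk S_Un)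
   moreover have "cov om (up C D)" using Fin_iff_cov[of "up C D"] cov_trans[OF cov_sub]
   proof -
    have "up C D = ins C (ins D emp)" by (rule eqI) simp
    then have "Fin (up C D)" by simp
    then obtain n where "n : el om" "cov n (up C D)" by (auto simp: Fin_iff_cov)
    then show ?thesis using cov_trans[OF cov_sub] om_elem by blast
   qed
   ultimately show ?thesis using cov_trans cov_tms[OF _ cov_refl] by metis
  qed
  ultimately show "EX C. cov om C & (ALL z:el (un2 a q). fst' (fst' z) : el C)" by (metis UnCI UnE el_un2)
  fix \<alpha> j K assume \<alpha>: "\<alpha> : el II" "j : el two" "K : el om"
  show "EX n:el om. K : el n & rq j K (al (un2 a q) (pos \<alpha> j n))"
  proof (cases "\<alpha> : el A")
   case True
   then have "al (un2 a q) (pos \<alpha> j n) = al a (pos \<alpha> j n)" for n using inn[of "pos \<alpha> j n"] by simp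
   then show ?thesis using ca(1) \<alpha> unfolding cnd_def by simp
  next
   case False
   then have "al (un2 a q) (pos \<alpha> j n) = al q (pos \<alpha> j n)" for n using out[of "pos \<alpha> j n"] by simp
   then show ?thesis using q \<alpha> unfolding cnd_def by simp
  qed
 qed
qed

definition cols :: "'a => 'a" where "cols p = mk ((%z. fst' (fst' z)) ` el p)"
lemma S_cols: "S ((%z. fst' (fst' z)) ` el p)" by (rule S_img) (auto intro!: dfns)
lemma el_cols: "el (cols p) = (%z. fst' (fst' z)) ` el p" by (simp add: cols_def el_mk S_cols)
lemma dt_cols [dfns]: "dt t ==> dt (%v. cols (t v))"
 by (rule dt_comp1[where f=cols, rotated], assumption+, unfold cols_def, rule dt_mk, rule S_cols, unfold image_iff, intro dfns)
lemma cov_cols: "cnd p ==> cov om (cols p)"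
proof -
 assume "cnd p"
 then obtain C where C: "cov om C" "ALL z:el p. fst' (fst' z) : el C" unfolding cnd_def by blast
 then have "el (cols p) <= el C" by (auto simp: el_cols)
 then show ?thesis using C(1) cov_sub cov_trans by blast
qed

text \<open>A set of columns of size at most \<^term>\<open>RR\<close> closed under a given operation on conditions is obtained by
 iterating up to the first uncountable ordinal.\<close>

lemma closed_columns:
 assumes h: "isf h PP PP"
 shows "EX A. (EX \<alpha>. \<alpha> : el A) & el A <= el II & cov RR A & (ALL p. PA A p --> PA A (ap h p))"
proof -
 obtain \<alpha>0 where \<alpha>0: "\<alpha>0 : el II" using II_ex by blast
 obtain W where W: "Ord W" "W ~= emp" "cov (pw om) W"
  "!!f. (ALL n:el om. ap f n : el W) ==> (EX \<beta>:el W. ALL n:el om. ap f n : el \<beta>)"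
  using uncountable_ordinal by blast
 define cl where "cl U = un2 U (mk (UN p:el (PAs U). el (cols (ap h p))))" for U
 have sc': "S (UN p:el (PAs U). el (cols (ap h p)))" for U by (intro S_UN S_el dfns)
 have ecl: "el (cl U) = el U \<union> (UN p:el (PAs U). el (cols (ap h p)))" for U by (simp add: cl_def el_mk[OF sc'])
 have dcl: "dt t ==> dt (%v. cl (t v))" for t
  by (rule dt_comp1[where f=cl, rotated], assumption+, unfold cl_def, intro dfns, rule dt_mk, rule sc', intro dfns)
 define F where "F Y = cl (ins \<alpha>0 (un Y))" for Y
 have "dt (%v. F (v 0))" unfolding F_def by (intro dfns dcl)
 then obtain H where dH0: "dt (%v. H (v 0))" and H: "!!x. H x = F (mk (H ` el x))" using eps_rec by blast
 have dH: "dt t ==> dt (%v. H (t v))" for t by (rule dt_comp1[OF dH0])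
 define U where "U \<beta> = ins \<alpha>0 (un (mk (H ` el \<beta>)))" for \<beta>
 have eU: "el (U \<beta>) = insert \<alpha>0 (UN \<gamma>:el \<beta>. el (H \<gamma>))" for \<beta> by (simp add: U_def el_mk S_img dH0)
 have HU: "H \<beta> = cl (U \<beta>)" for \<beta> using H[of \<beta>] by (simp add: F_def U_def)
 have HI: "el (H \<beta>) <= el II" for \<beta>
 proof (rule eps_induct[where x=\<beta>])
  show "dfn (%v. el (H (v 0)) <= el II)" by (intro dfns dH)
  fix \<beta> assume "!!\<gamma>. \<gamma> : el \<beta> ==> el (H \<gamma>) <= el II"
  then have "el (U \<beta>) <= el II" using \<alpha>0 by (auto simp: eU)
  moreover have "el (cols (ap h p)) <= el II" if "PA (U \<beta>) p" for p
  proof -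
   have "p : el PP" using that by (auto simp: el_PP PA_def)
   then have "PA II (ap h p)" using isf_in[OF h] cnd_PA by (auto simp: el_PP)
   then show ?thesis by (auto simp: el_cols PA_def)
  qed
  ultimately show "el (H \<beta>) <= el II" unfolding HU ecl el_PAs by blast
 qed
 have ch: "cov RR (cols (ap h p))" if "PA X p" for p X
 proof -
  have "p : el PP" using that by (auto simp: el_PP PA_def)
  then have "cnd (ap h p)" using isf_in[OF h] by (auto simp: el_PP)
  then show ?thesis using cov_trans[OF cov_RR_om cov_cols] by blast
 qed
 have covW: "cov RR W" using W(3) by (simp add: RR_def)
 have cun: "cov RR (mk (UN x:el X. el (K x)))" if "dt (%v. K (v 0))" "cov RR X" "!!x. x : el X ==> cov RR (K x)" for K X
  using cov_trans[OF cov_mono_tms[OF cov_RR_sq that(2) cov_refl] cov_UN[OF that(1,3)]] .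
 have cins: "cov RR (ins x X)" if "cov RR X" for x X
 proof -
  have "cov RR (mk (UN y:el (up X (ins x emp)). el y))"
  proof (rule cun[OF dt_proj])
   have "cov om (ins X (ins (ins x emp) emp))" by (intro cov_om_ins cov_sub) simp
   moreover have "ins X (ins (ins x emp) emp) = up X (ins x emp)" by (rule eqI) simp
   ultimately show "cov RR (up X (ins x emp))" using cov_trans[OF cov_RR_om] by simp
   have "cov om (ins x emp)" by (intro cov_om_ins cov_sub) simp
   then show "cov RR y" if "y : el (up X (ins x emp))" for y using that \<open>cov RR X\<close> cov_trans[OF cov_RR_om] by auto
  qed
  moreover have "mk (UN y:el (up X (ins x emp)). el y) = ins x X" by (rule eqI) (simp add: el_mk S_Un)
  ultimately show ?thesis by simp
 qed
 have covH: "\<beta> : el W --> cov RR (H \<beta>)" for \<beta>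
 proof (rule eps_induct[where x=\<beta>])
  show "dfn (%v. v 0 : el W --> cov RR (H (v 0)))" by (intro dfns dH)
  fix \<beta> assume IH: "!!\<gamma>. \<gamma> : el \<beta> ==> \<gamma> : el W --> cov RR (H \<gamma>)"
  show "\<beta> : el W --> cov RR (H \<beta>)"
  proof
   assume \<beta>: "\<beta> : el W"
   have "cov RR \<beta>" using cov_trans[OF covW cov_sub[OF Ord_elem_sub[OF W(1) \<beta>]]] .
   then have "cov RR (mk (UN \<gamma>:el \<beta>. el (H \<gamma>)))" using cun[OF dH0] IH Ord_trans[OF W(1) \<beta>] by blast
   then have "cov RR (ins \<alpha>0 (mk (UN \<gamma>:el \<beta>. el (H \<gamma>))))" by (rule cins)
   moreover have "ins \<alpha>0 (mk (UN \<gamma>:el \<beta>. el (H \<gamma>))) = U \<beta>" by (rule eqI) (simp add: eU el_mk S_UN dH0)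
   ultimately have cU: "cov RR (U \<beta>)" by simp
   have "cov RR (PAs (U \<beta>))" by (rule cov_RR_PAs[OF _ cU, of \<alpha>0]) (simp add: eU)
   moreover have "dt (%v. cols (ap h (v 0)))" by (intro dfns)
   moreover have "cov RR (cols (ap h p))" if "p : el (PAs (U \<beta>))" for p using ch that unfolding el_PAs by blast
   ultimately have "cov RR (mk (UN p:el (PAs (U \<beta>)). el (cols (ap h p))))" using cun[of "%p. cols (ap h p)"] by blast
   moreover have "dt (%v. v 0)" by (intro dfns)
   ultimately have "cov RR (mk (UN x:el (up (U \<beta>) (mk (UN p:el (PAs (U \<beta>)). el (cols (ap h p))))). el x))"
   proof (intro cun)
    let ?Y = "mk (UN p:el (PAs (U \<beta>)). el (cols (ap h p)))"
    have "cov om (ins (U \<beta>) (ins ?Y emp))" by (intro cov_om_ins cov_sub) simp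
    moreover have "ins (U \<beta>) (ins ?Y emp) = up (U \<beta>) ?Y" by (rule eqI) simp
    ultimately show "cov RR (up (U \<beta>) ?Y)" using cov_trans[OF cov_RR_om] by simp
   qed (use cU in auto)
   moreover have "mk (UN x:el (up (U \<beta>) (mk (UN p:el (PAs (U \<beta>)). el (cols (ap h p))))). el x) = H \<beta>"
    unfolding HU cl_def by (rule eqI) (simp add: el_mk S_Un sc')
   ultimately show "cov RR (H \<beta>)" by simp
  qed
 qed
 define A where "A = mk (UN \<beta>:el W. el (H \<beta>))"
 have eA: "el A = (UN \<beta>:el W. el (H \<beta>))" unfolding A_def by (rule el_mk[OF S_UN[OF S_el dH0]])
 have cA: "cov RR A" unfolding A_def using cun[OF dH0 covW] covH by blast
 have \<alpha>A: "\<alpha>0 : el A"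
 proof -
  obtain \<beta> where "\<beta> : el W" using W(2) ne_emp by blast
  moreover have "\<alpha>0 : el (H \<beta>)" unfolding HU[of \<beta>] ecl eU[of \<beta>] by blast
  ultimately show ?thesis unfolding eA by blast
 qed
 have "PA A (ap h p)" if p: "PA A p" for p
 proof -
  have pP: "p : el PP" "cnd p" using p by (auto simp: el_PP PA_def)
  \<comment> \<open>The countably many columns of \<open>p\<close> appear at stages with a common
    bound \<open>\<beta>\<close> below \<open>W\<close>, so \<open>p\<close> is supported by
    \<open>U \<beta>\<close>, and stage \<open>\<beta>\<close> adds the columns of
    \<open>ap h p\<close>.\<close>
  obtain f where f: "el (cols p) <= ap f ` el om" using cov_cols[OF pP(2)] by (auto simp: cov_def)
  have "EX g. isf g om W & (ALL n:el om. ap f n : el A --> ap f n : el (H (ap g n)))"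
  proof (rule ac)
   show "dfn (%v. ap f (v 0) : el A --> ap f (v 0) : el (H (v 1)))" by (intro dfns dH)
   show "EX \<beta>:el W. ap f n : el A --> ap f n : el (H \<beta>)" for n
    using W(2) unfolding ne_emp eA by blast
  qed
  then obtain g where g: "isf g om W" "!!n. n : el om ==> ap f n : el A ==> ap f n : el (H (ap g n))" by blast
  have "ALL n:el om. ap g n : el W" using isf_in[OF g(1)] by blast
  then obtain \<beta> where \<beta>: "\<beta> : el W" "ALL n:el om. ap g n : el \<beta>" using W(4) by blast
  have "fst' (fst' z) : el (U \<beta>)" if z: "z : el p" for z
  proof -
   have zA: "fst' (fst' z) : el A" using p z by (simp add: PA_def)
   have "fst' (fst' z) : el (cols p)" using z by (auto simp: el_cols)
   then have "fst' (fst' z) : ap f ` el om" using f by (rule subsetD[rotated])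
   then obtain n where n: "n : el om" "fst' (fst' z) = ap f n" by blast
   then have "n : el om" "fst' (fst' z) : el (H (ap g n))" using g(2)[OF n(1)] zA by simp_all
   then have "fst' (fst' z) : (UN \<gamma>:el \<beta>. el (H \<gamma>))" using \<beta>(2) by blast
   then show ?thesis unfolding eU[of \<beta>] by blast
  qed
  then have "PA (U \<beta>) p" using pP by (simp add: PA_def)
  then have "el (cols (ap h p)) <= el (H \<beta>)" unfolding HU ecl el_PAs by blast
  then have "el (cols (ap h p)) <= el A" using \<beta>(1) eA by blast
  moreover have "cnd (ap h p)" using isf_in[OF h pP(1)] by (simp add: el_PP)
  ultimately show ?thesis by (auto simp: PA_def el_cols)
 qed
 moreover have "el A <= el II" using HI eA by blast
 ultimately show ?thesis using \<alpha>A cA by blast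
qed

text \<open>\<open>h\<close> extends each condition to one that decides or is incompatible with
  \<open>p0\<close>. Over a set \<open>A\<close> closed under \<open>h\<close>, the part of
  \<open>q\<close> living on \<open>A\<close> is extended within \<open>A\<close>. The result is
  compatible with \<open>q\<close>, hence with \<open>p0\<close>, so it decides, and the columns of
  \<open>q\<close> outside \<open>A\<close> are left alone.\<close>

lemma chain_condition:
 assumes dD: "dfn (%v. D (v 0) (v 1))" and mono: "!!p q y. D p y ==> el p <= el q ==> cnd q ==> D q y"
  and p0: "cnd p0" and tot: "!!q. cnd q ==> el p0 <= el q ==> EX r y. cnd r & el q <= el r & y : el V & D r y"
 shows "EX A. (EX \<alpha>. \<alpha> : el A) & el A <= el II & cov RR A & (ALL q. cnd q --> el p0 <= el q -->
  (EX a y. PA A a & y : el V & D a y & cnd (un2 a q) & (ALL e. fst' e ~: el A --> al (un2 a q) e = al q e)))"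
proof -
 have dD': "dt t ==> dt u ==> dfn (%v. D (t v) (u v))" for t u by (rule dfn_comp2[OF dD])
 let ?R = "%p r. el p <= el r & ((EX y:el V. D r y) | (ALL s. cnd s --> el r <= el s --> ~ el p0 <= el s))"
 have "EX h. isf h PP PP & (ALL p:el PP. ?R p (ap h p))"
 proof (rule ac)
  show "dfn (%v. ?R (v 0) (v 1))" by (intro dfns dD')
  fix p assume "p : el PP"
  then have p: "cnd p" by (simp add: el_PP)
  show "EX r:el PP. ?R p r"
  proof (cases "EX s. cnd s & el p <= el s & el p0 <= el s")
   case True
   then obtain s where "cnd s" "el p <= el s" "el p0 <= el s" by blast
   then obtain r y where "cnd r" "el p <= el r" "y : el V" "D r y" using tot[of s] by (meson order_trans)
   then show ?thesis by (auto simp: el_PP)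
  next
   case False
   then show ?thesis using p by (intro bexI[of _ p]) (auto simp: el_PP)
  qed
 qed
 then obtain h where h: "isf h PP PP" "!!p. p : el PP ==> ?R p (ap h p)" by blast
 obtain A where A: "EX \<alpha>. \<alpha> : el A" "el A <= el II" "cov RR A" "!!p. PA A p ==> PA A (ap h p)" using closed_columns[OF h(1)] by blast
 have "EX a y. PA A a & y : el V & D a y & cnd (un2 a q) & (ALL e. fst' e ~: el A --> al (un2 a q) e = al q e)"
  if q: "cnd q" "el p0 <= el q" for q
 proof -
  have "S {z : el q. fst' (fst' z) : el A}" by (rule S_Collect[OF S_el]) (intro dfns)
  then obtain b where b: "el b = {z : el q. fst' (fst' z) : el A}" by (auto simp: S_def)
  have "PA A b" using cnd_subset[OF q(1), of b] b by (auto simp: PA_def)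
  then have a: "PA A (ap h b)" and hb: "?R b (ap h b)" using A(4) h(2)[of b] by (auto simp: el_PP PA_def)
  have sub: "z : el (ap h b)" if "z : el q" "fst' (fst' z) : el A" for z using hb b that by auto
  note m = merge[OF a q(1) sub]
  have "el p0 <= el (un2 (ap h b) q)" using q(2) by auto
  moreover have "el (ap h b) <= el (un2 (ap h b) q)" by simp
  ultimately obtain y where "y : el V" "D (ap h b) y" using hb m(1) by blast
  then show ?thesis using a m by blast
 qed
 then show ?thesis using A by blast
qed

text \<open>Koenig's diagonal argument: as \<open>B\<close> does not cover \<open>JJ\<close>, some
  function differs at each \<open>r\<close> from all \<open>ap f (pr b r)\<close>, and is therefore
  not in the range of \<open>f\<close>.\<close>

lemma column_outside:
 assumes no: "~ cov B JJ" and cov: "cov (tms B RR) A" shows "EX \<alpha>:el II. \<alpha> ~: el A"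
proof (rule ccontr)
 assume "~ ?thesis"
 then have "el II <= el A" by blast
 then obtain f where f: "el II <= ap f ` el (tms B RR)" using cov unfolding cov_def by blast
 have "EX y. isf y RR JJ & (ALL r:el RR. ALL b:el B. ap y r ~= ap (ap f (pr b r)) r)"
 proof (rule ac)
  show "dfn (%v. ALL b:el B. v 1 ~= ap (ap f (pr b (v 0))) (v 0))" by (intro dfns)
  fix r assume "r : el RR"
  have d: "dt (%v. ap (ap f (pr (v 0) r)) r)" by (intro dfns)
  show "EX y:el JJ. ALL b:el B. y ~= ap (ap f (pr b r)) r" using no covI[OF d, of JJ B] by blast
 qed
 then obtain y where y: "isf y RR JJ" "ALL r:el RR. ALL b:el B. ap y r ~= ap (ap f (pr b r)) r" by blast
 then have "y : el II" by (simp add: II_def)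
 then obtain b r where "b : el B" "r : el RR" "y = ap f (pr b r)" using f by auto
 then show False using y(2) by blast
qed

end

section \<open>Generic functions against small families of names\<close>

section \<open>The extension by columns\<close>

locale silver_ext = silver E k + generic E P G val EN
 for E :: "'a => 'a => bool" and k P :: 'a and G :: "'a set" and val :: "'a => 'b" and EN :: "'b => 'b => bool" +
 assumes P_PP: "P = PP"
begin

lemma el_P: "el P = {p. cnd p}" using P_PP el_PP by simp
lemma le_iff: "le q p \<longleftrightarrow> cnd q & el p <= el q" by (simp add: le_def el_P)
lemma G_cnd: "p : G ==> cnd p" using G_P el_P by blast
lemma G_sub: "p : G ==> el q <= el p ==> q : G"
proof -
 assume p: "p : G" "el q <= el p"
 then have "cnd q" using cnd_subset G_cnd by blast
 then show ?thesis using G_up[OF p(1), of q] p G_cnd by (simp add: le_iff el_P)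
qed

text \<open>The conclusion of \<open>chain_condition\<close>, for the decision of the value of a
  name at \<open>x\<close>.\<close>

definition decides_in :: "'a => 'a => 'a => 'a => 'a => bool" where
 "decides_in \<gamma> V p0 x A \<longleftrightarrow> (EX \<alpha>. \<alpha> : el A) & el A <= el II & cov RR A & (ALL q. cnd q --> el p0 <= el q -->
  (EX a y. PA A a & y : el V & dec \<gamma> a x y & cnd (un2 a q) & (ALL e. fst' e ~: el A --> al (un2 a q) e = al q e)))"

lemma dfn_decides_in [dfns]: "dt t ==> dt u ==> dfn (%v. decides_in \<gamma> V p0 (t v) (u v))"
 by (rule dfn_comp2[where P="decides_in \<gamma> V p0"]; (assumption | (unfold decides_in_def, intro dfns)))

lemma decides_inD:
 assumes "decides_in \<gamma> V p0 x A" "cnd q" "el p0 <= el q"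
 obtains a y where "PA A a" "y : el V" "dec \<gamma> a x y" "cnd (un2 a q)" "!!e. fst' e ~: el A ==> al (un2 a q) e = al q e"
 using assms unfolding decides_in_def by metis

lemma name_chain_condition:
 assumes f: "fname \<gamma> B V p0" "cnd p0" "x : el B"
 shows "EX A. decides_in \<gamma> V p0 x A"
 unfolding decides_in_def
proof (rule chain_condition)
 show "dfn (%v. dec \<gamma> (v 0) x (v 1))" by (intro dfns)
 show "dec \<gamma> q x y" if "dec \<gamma> p x y" "el p <= el q" "cnd q" for p q y using dec_mono that by (auto simp: le_iff)
 show "EX r y. cnd r & el q <= el r & y : el V & dec \<gamma> r x y" if "cnd q" "el p0 <= el q" for q
  using f that unfolding fname_def le_iff by blast
qed (rule f)

definition Gn :: 'a where "Gn = mk {z. EX p:el P. z = pr (chk p) p}"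
lemma el_Gn: "el Gn = {z. EX p:el P. z = pr (chk p) p}"
proof -
 have "S ((%p. pr (chk p) p) ` el P)" by (rule S_img) (auto intro!: dfns)
 also have "(%p. pr (chk p) p) ` el P = {z. EX p:el P. z = pr (chk p) p}" by auto
 finally show ?thesis unfolding Gn_def by (rule el_mk)
qed
lemma N_el_Gn: "N.el (val Gn) = vc ` G" unfolding N_el_val nm_def el_Gn using G_P by auto

text \<open>Nice names: the values of a real are decided by conditions on at most continuum many
  columns, so a set of at most continuum many triples (condition, number, value) describes it. By
  the sizes computed in the ground model \<open>JJ\<close> covers the collection of such sets, and
  the generic filter evaluates each of them.\<close>

lemma reals_covered: "N.cov (vc JJ) (N.fs N.om (vc two))"
proof -
 let ?Q = "tms PP (tms om two)"
 have "S {d. el d <= el ?Q & (EX z. z : el d) & cov RR d}"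
  by (rule S_sub[OF S_el[of "pw ?Q"]]) (simp, blast, intro dfns)
 then obtain ZZ where ZZ: "el ZZ = {d. el d <= el ?Q & (EX z. z : el d) & cov RR d}" by (auto simp: S_def)
 have "cov JJ ?Q" by (intro cov_mono_tms[OF cov_JJ_sq] cov_JJ_PP cov_trans[OF cov_JJ_RR] cov_RR_om cov_RR_two)
 moreover have qex: "pr emp (pr emp emp) : el ?Q" using cnd_emp by (auto simp: el_PP el_two)
 ultimately have "cov JJ (fs RR ?Q)" using cov_trans[OF cov_JJ_fs cov_fs[OF _ cov_refl]] by blast
 moreover have "cov (fs RR ?Q) ZZ"
 proof (rule covI[of "%f. img f RR"], intro dfns, rule subsetI)
  fix d assume "d : el ZZ"
  then obtain z f where d: "el d <= el ?Q" "z : el d" "el d <= ap f ` el RR" using ZZ by (auto simp: cov_def)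
  define g where "g r = (if ap f r : el d then ap f r else z)" for r
  have dg: "dt (%v. g (v 0))" unfolding g_def by (intro dfns)
  have "isf (lam RR g) RR ?Q" by (rule isfI[OF dg]) (use d in \<open>auto simp: g_def simp del: el_tms\<close>)
  moreover have "img (lam RR g) RR = d"
  proof (rule eqI)
   have "ap (lam RR g) ` el RR = g ` el RR" by (rule image_cong[OF refl]) (rule ap_lam[OF dg])
   also have "\<dots> = el d" using d by (force simp: g_def)
   finally show "el (img (lam RR g) RR) = el d" by simp
  qed
  ultimately show "d : (%f. img f RR) ` el (fs RR ?Q)" by (intro image_eqI[of _ _ "lam RR g"]) auto
 qed
 ultimately have "cov JJ ZZ" using cov_trans by blast
 then have 1: "N.cov (vc JJ) (vc ZZ)" by (rule vc_cov)
 define F where "F D = N.mk {z. EX p:N.el (val Gn). EX n:N.el N.om. EX y:N.el (vc two). z = N.pr n y & N.pr p (N.pr n y) : N.el D}" for D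
 have sF: "N.S {z. EX p:N.el (val Gn). EX n:N.el N.om. EX y:N.el (vc two). z = N.pr n y & N.pr p (N.pr n y) : N.el D}" for D
  by (rule N.S_sub[OF N.S_el[of "N.tms N.om (vc two)"]]) (auto intro!: dfns)
 have dF: "N.dt (%v. F (v 0))" unfolding F_def by (rule N.dt_mk, rule sF, intro dfns)
 have "N.cov (vc ZZ) (N.fs N.om (vc two))"
 proof (rule N.covI[OF dF], rule subsetI)
  fix f assume "f : N.el (N.fs N.om (vc two))"
  then have f0: "N.isf f N.om (vc two)" by simp
  obtain \<gamma> where \<gamma>: "f = val \<gamma>" by (rule val_cases)
  have f: "N.isf (val \<gamma>) (vc om) (vc two)" using f0 \<gamma> vc_om by simp
  obtain p0 where p0: "p0 : G" "fname \<gamma> om two p0" using function_name[OF f] by blast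
  let ?R = "%n A. decides_in \<gamma> two p0 n A"
  have "EX A. fn A om & (ALL n:el om. ?R n (ap A n))"
  proof (rule ac_class)
   show "dfn (%v. ?R (v 0) (v 1))" by (intro dfns)
   show "EX A. ?R n A" if "n : el om" for n by (rule name_chain_condition[OF p0(2) G_cnd[OF p0(1)] that])
  qed
  then obtain As where As: "!!n. n : el om ==> ?R n (ap As n)" by blast
  define A where "A = mk (UN n:el om. el (ap As n))"
  have eA: "el A = (UN n:el om. el (ap As n))" unfolding A_def by (rule el_mk[OF S_UN[OF S_el dt_ap1]])
  have cA: "cov RR A" unfolding A_def
  proof (rule cov_trans[OF cov_mono_tms[OF cov_RR_sq cov_RR_om cov_refl] cov_UN[OF dt_ap1]])
   show "cov RR (ap As x)" if "x : el om" for x using As[OF that] by (simp add: decides_in_def)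
  qed
  obtain \<alpha> where "\<alpha> : el (ap As emp)" using As[OF zero_om] unfolding decides_in_def by blast
  then have \<alpha>: "\<alpha> : el A" using eA zero_om by blast
  let ?dd = "{z. EX a:el (PAs A). EX n:el om. EX y:el two. z = pr a (pr n y) & dec \<gamma> a n y}"
  have sub1: "?dd <= el (tms (PAs A) (tms om two))" by auto
  have "S ?dd" by (rule S_sub[OF S_el sub1]) (intro dfns)
  then obtain d where d: "el d = ?dd" by (auto simp: S_def)
  have "cov RR (tms (PAs A) (tms om two))"
   by (intro cov_mono_tms[OF cov_RR_sq] cov_RR_PAs[OF \<alpha> cA] cov_RR_om cov_RR_two)
  then have cd: "cov RR d" using cov_trans[OF _ cov_sub] sub1 d by metis
  have hit: "EX a:G. EX y:el two. pr a (pr n y) : el d" if n: "n : el om" for n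
  proof -
   have "EX q:G. le q p0 & (EX a. EX y:el two. PA A a & dec \<gamma> a n y & el a <= el q)"
   proof (rule generic_below[OF p0(1)])
    show "dfn (%v. EX a. EX y:el two. PA A a & dec \<gamma> a n y & el a <= el (v 0))" by (intro dfns)
    fix q assume "le q p0"
    then have q: "cnd q" "el p0 <= el q" by (auto simp: le_iff)
    then obtain a y where a: "y : el two" "PA (ap As n) a" "dec \<gamma> a n y" "cnd (un2 a q)"
     using decides_inD[OF As[OF n]] by metis
    have "PA A a" using PA_mono[OF a(2)] eA n by blast
    then show "EX r. le r q & (EX a. EX y:el two. PA A a & dec \<gamma> a n y & el a <= el r)"
     using a by (intro exI[of _ "un2 a q"]) (auto simp: le_iff)
   qed
   then obtain q a y where "q : G" "y : el two" "PA A a" "dec \<gamma> a n y" "el a <= el q" by blast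
   moreover then have "a : G" using G_sub by blast
   ultimately show ?thesis using n d by (auto simp: el_PAs)
  qed
  have "d : el ZZ" unfolding ZZ
  proof (intro CollectI conjI)
   show "EX z. z : el d" using hit[OF zero_om] by blast
   show "el d <= el ?Q" using d by (auto simp: el_PAs PA_def el_PP)
  qed (rule cd)
  moreover have "F (vc d) = f"
  proof (rule N.eqI)
   have e1: "N.el f = {z. EX n:el om. EX y:el two. z = N.pr (vc n) (vc y) & N.ap (val \<gamma>) (vc n) = vc y}"
   proof -
    have "EX y:el two. N.ap (val \<gamma>) (vc n) = vc y" if n: "n : el om" for n
    proof -
     have "vc n : N.el (vc om)" using n by simp
     then have "N.ap (val \<gamma>) (vc n) : N.el (vc two)" by (rule N.isf_in[OF f])
     then show ?thesis unfolding N_el_vc by blast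
    qed
    then show ?thesis unfolding \<gamma> N.isf_el[OF f] N_el_vc by auto
   qed
   have e2: "N.el (F (vc d)) = {z. EX p:G. EX n:el om. EX y:el two. z = N.pr (vc n) (vc y) & pr p (pr n y) : el d}"
   proof -
    have "N.el (F (vc d)) = {z. EX p:N.el (val Gn). EX n:N.el N.om. EX y:N.el (vc two). z = N.pr n y & N.pr p (N.pr n y) : N.el (vc d)}"
     unfolding F_def by (rule N.el_mk[OF sF])
    then show ?thesis unfolding N_el_Gn vc_om N_el_vc by (auto simp flip: vc_pr)
   qed
   have iff: "(EX p:G. pr p (pr n y) : el d) \<longleftrightarrow> N.ap (val \<gamma>) (vc n) = vc y" if n: "n : el om" and y: "y : el two" for n y
   proof
    assume "EX p:G. pr p (pr n y) : el d"
    then show "N.ap (val \<gamma>) (vc n) = vc y" using dec_val[OF f] d by auto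
   next
    assume v: "N.ap (val \<gamma>) (vc n) = vc y"
    obtain a y' where a: "a : G" "y' : el two" "pr a (pr n y') : el d" using hit[OF n] by blast
    then have "N.ap (val \<gamma>) (vc n) = vc y'" using dec_val[OF f] d by auto
    then show "EX p:G. pr p (pr n y) : el d" using a v by auto
   qed
   show "N.el (F (vc d)) = N.el f"
   proof (intro set_eqI iffI)
    fix z assume "z : N.el (F (vc d))"
    then obtain p n y where "p : G" "n : el om" "y : el two" "z = N.pr (vc n) (vc y)" "pr p (pr n y) : el d"
     unfolding e2 by blast
    moreover from this have "N.ap (val \<gamma>) (vc n) = vc y" using iff by metis
    ultimately show "z : N.el f" unfolding e1 by (intro CollectI bexI[of _ n] bexI[of _ y] conjI)
   next
    fix z assume "z : N.el f"
    then obtain n y where *: "n : el om" "y : el two" "z = N.pr (vc n) (vc y)" "N.ap (val \<gamma>) (vc n) = vc y"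
     unfolding e1 by blast
    then obtain p where "p : G" "pr p (pr n y) : el d" using iff by metis
    then show "z : N.el (F (vc d))" unfolding e2 using *(1-3) by (intro CollectI bexI[of _ p] bexI[of _ n] bexI[of _ y] conjI)
   qed
  qed
  ultimately show "f : F ` N.el (vc ZZ)" by (intro image_eqI[of _ _ "vc d"]) (auto simp: N_el_vc)
 qed
 then show ?thesis using 1 N.cov_trans by blast
qed

definition xn :: "'a => 'a => 'a" where
 "xn \<alpha> j = mk {z. EX p:el P. EX n:el om. EX v:el om. z = pr (opn (chk n) (chk v)) p & al p (pos \<alpha> j n) = ins v emp}"
definition xr :: "'a => 'a => 'b" where "xr \<alpha> j = val (xn \<alpha> j)"

lemma el_xn: "el (xn \<alpha> j) = {z. EX p:el P. EX n:el om. EX v:el om. z = pr (opn (chk n) (chk v)) p & al p (pos \<alpha> j n) = ins v emp}"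
proof -
 have s: "S ((%x. opn (chk (fst' x)) (chk (snd' x))) ` el (tms om om))" by (rule S_img[OF S_el]) (intro dfns)
 show ?thesis unfolding xn_def
 proof (rule el_mk, rule S_sub[OF S_el[of "tms (mk ((%x. opn (chk (fst' x)) (chk (snd' x))) ` el (tms om om))) P"]])
  show "{z. EX p:el P. EX n:el om. EX v:el om. z = pr (opn (chk n) (chk v)) p & al p (pos \<alpha> j n) = ins v emp}
   <= el (tms (mk ((%x. opn (chk (fst' x)) (chk (snd' x))) ` el (tms om om))) P)"
  proof
   fix z assume "z : {z. EX p:el P. EX n:el om. EX v:el om. z = pr (opn (chk n) (chk v)) p & al p (pos \<alpha> j n) = ins v emp}"
   then obtain p n v where z: "p : el P" "n : el om" "v : el om" "z = pr (opn (chk n) (chk v)) p" by blast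
   have "pr n v : el (tms om om)" using z by auto
   then have "opn (chk n) (chk v) : (%x. opn (chk (fst' x)) (chk (snd' x))) ` el (tms om om)" by force
   then show "z : el (tms (mk ((%x. opn (chk (fst' x)) (chk (snd' x))) ` el (tms om om))) P)"
    unfolding el_tms[of _ P] el_mk[OF s] using z by blast
  qed
 qed (intro dfns)
qed

lemma fix_position: assumes "cnd q" "e : el Ps" "v : el (al q e)"
 shows "cnd (ps q (ins e emp) (ins (pr e v) emp))" "al (ps q (ins e emp) (ins (pr e v) emp)) e = ins v emp"
  "x ~= e ==> al (ps q (ins e emp) (ins (pr e v) emp)) x = al q x" "el q <= el (ps q (ins e emp) (ins (pr e v) emp))"
proof -
 have ap: "ap (ins (pr e v) emp) e = v" by (rule ap_eq) auto
 have fn: "fn (ins (pr e v) emp) (ins e emp)"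
  unfolding fn_def by (rule eqI) (auto simp: el_lam ap)
 have i: "isasg q (ins e emp) (ins (pr e v) emp)" using assms(3) ap fn by (simp add: isasg_def)
 show "cnd (ps q (ins e emp) (ins (pr e v) emp))" by (rule cnd_ps[OF assms(1) _ _ i]) (use assms(2) in auto)
 show "al (ps q (ins e emp) (ins (pr e v) emp)) e = ins v emp" by (rule eqI) (use al_ps(1)[OF i, of e] ap in auto)
 show "x ~= e ==> al (ps q (ins e emp) (ins (pr e v) emp)) x = al q x" by (rule al_ps(2)) simp
 show "el q <= el (ps q (ins e emp) (ins (pr e v) emp))" by (auto simp: el_ps)
qed

lemma N_el_xr: "N.el (xr \<alpha> j) = {z. EX p:G. EX n:el om. EX v:el om. z = N.pr (vc n) (vc v) & al p (pos \<alpha> j n) = ins v emp}"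
proof (rule set_eqI, rule iffI)
 fix z assume "z : N.el (xr \<alpha> j)"
 then obtain \<pi> r where "nm (xn \<alpha> j) \<pi> r" "r : G" "z = val \<pi>" unfolding xr_def N_el_val by blast
 then show "z : {z. EX p:G. EX n:el om. EX v:el om. z = N.pr (vc n) (vc v) & al p (pos \<alpha> j n) = ins v emp}"
  unfolding nm_def el_xn by (auto simp: val_opn)
next
 fix z assume "z : {z. EX p:G. EX n:el om. EX v:el om. z = N.pr (vc n) (vc v) & al p (pos \<alpha> j n) = ins v emp}"
 then obtain p n v where p: "p : G" "n : el om" "v : el om" "z = N.pr (vc n) (vc v)" "al p (pos \<alpha> j n) = ins v emp" by blast
 then have "nm (xn \<alpha> j) (opn (chk n) (chk v)) p" unfolding nm_def el_xn using G_P by blast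
 then show "z : N.el (xr \<alpha> j)" unfolding xr_def N_el_val mem_Collect_eq
  using p by (intro exI[of _ "opn (chk n) (chk v)"] exI[of _ p]) (simp add: val_opn)
qed

lemma xr_fun:
 assumes a: "\<alpha> : el II" "j : el two" and V: "!!n. n : el om ==> el (fl (pos \<alpha> j n)) <= el V"
 shows "N.isf (xr \<alpha> j) (vc om) (vc V)"
  "p : G ==> n : el om ==> al p (pos \<alpha> j n) = ins v emp ==> N.ap (xr \<alpha> j) (vc n) = vc v"
proof -
 have vin: "v : el V" "v : el om" if "n : el om" "al p (pos \<alpha> j n) = ins v emp" for n v p
 proof -
  have v: "v : el (fl (pos \<alpha> j n))" using that(2) al_fl[of p "pos \<alpha> j n"] by auto
  then show "v : el V" using V[OF that(1)] by blast
  show "v : el om" using om_elem[OF fl_om[OF pos_Ps[OF a that(1)]] v] .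
 qed
 have 1: "EX x:N.el (vc om). EX y:N.el (vc V). z = N.pr x y" if "z : N.el (xr \<alpha> j)" for z
  using that vin unfolding N_el_xr N_el_vc by blast
 have 2: "EX y. N.pr x y : N.el (xr \<alpha> j)" if "x : N.el (vc om)" for x
 proof -
  obtain n where n: "n : el om" "x = vc n" using \<open>x : N.el (vc om)\<close> by (auto simp: N_el_vc)
  let ?e = "pos \<alpha> j n"
  have e: "?e : el Ps" by (rule pos_Ps[OF a n(1)])
  have "EX q:G. EX v. al q ?e = ins v emp"
  proof (rule generic_dense)
   show "dfn (%v. EX w. al (v 0) ?e = ins w emp)" by (intro dfns)
   fix q assume "q : el P"
   then have q: "cnd q" by (simp add: el_P)
   then obtain v where "v : el (al q ?e)" using e unfolding cnd_def ne_emp by blast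
   note f = fix_position[OF q e this]
   show "EX r. le r q & (EX v. al r ?e = ins v emp)" using f(1,2,4) unfolding le_iff by blast
  qed
  then obtain q v where "q : G" "al q ?e = ins v emp" by blast
  then show ?thesis using n vin[OF n(1)] unfolding N_el_xr by blast
 qed
 have 3: "y = y'" if h: "N.pr x y : N.el (xr \<alpha> j)" "N.pr x y' : N.el (xr \<alpha> j)" for x y y'
 proof -
  obtain p n v p' v' where p: "p : G" "p' : G" "x = vc n" "y = vc v" "y' = vc v'" "n : el om"
   "al p (pos \<alpha> j n) = ins v emp" "al p' (pos \<alpha> j n) = ins v' emp"
  proof -
   obtain p n v where 1: "p : G" "n : el om" "x = vc n" "y = vc v" "al p (pos \<alpha> j n) = ins v emp"
    using h(1) unfolding N_el_xr by auto
   obtain p' n' v' where 2: "p' : G" "x = vc n'" "y' = vc v'" "al p' (pos \<alpha> j n') = ins v' emp"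
    using h(2) unfolding N_el_xr by auto
   have "n' = n" using 1 2 by simp
   then show thesis using that[of p p' n v v'] 1 2 by simp
  qed
  obtain r where r: "r : G" "le r p" "le r p'" using G_dir p by blast
  then have "al r (pos \<alpha> j n) ~= emp" using G_cnd pos_Ps[OF a p(6)] unfolding cnd_def by blast
  then obtain i where "i : el (al r (pos \<alpha> j n))" unfolding ne_emp by blast
  then have "i = v" "i = v'" using al_mono[of p r "pos \<alpha> j n"] al_mono[of p' r "pos \<alpha> j n"] r p by (auto simp: le_iff)
  then show ?thesis using p by simp
 qed
 note r = N.isf_rel[of "xr \<alpha> j" "vc om" "vc V", OF 1 2 3]
 show "N.isf (xr \<alpha> j) (vc om) (vc V)" by (rule r(1))
 show "N.ap (xr \<alpha> j) (vc n) = vc v" if "p : G" "n : el om" "al p (pos \<alpha> j n) = ins v emp"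
  by (rule r(2)) (use that vin[OF that(2,3)] in \<open>auto simp: N_el_xr\<close>)
qed

lemma xr_restrict:
 assumes x: "N.isf (xr \<alpha> j) (vc om) (vc V)" and n: "n : el om" and u: "isf u n V"
  and p: "!!i. i : el n ==> N.ap (xr \<alpha> j) (vc i) = vc (ap u i)"
 shows "N.lam (vc n) (N.ap (xr \<alpha> j)) = vc u"
proof (rule N.isf_ext[OF _ vc_isf(1)[OF u]])
 show "N.isf (N.lam (vc n) (N.ap (xr \<alpha> j))) (vc n) (vc V)"
  by (rule N.isfI) (use N.isf_in[OF x] om_elem[OF n] in \<open>auto simp: N_el_vc\<close>)
 fix y assume "y : N.el (vc n)"
 then show "N.ap (N.lam (vc n) (N.ap (xr \<alpha> j))) y = N.ap (vc u) y"
  using p vc_isf(2)[OF u] by (auto simp: N.ap_lam N_el_vc)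
qed

lemma fix_initial:
 assumes q: "cnd q" and a: "\<alpha> : el II" "j : el two" and n: "n : el om"
  and V: "!!n. n : el om ==> el (fl (pos \<alpha> j n)) <= el V"
 shows "EX r u. cnd r & el q <= el r & isf u n V & (ALL i:el n. al r (pos \<alpha> j i) = ins (ap u i) emp) &
  (ALL x. (ALL i:el n. x ~= pos \<alpha> j i) --> al r x = al q x)"
proof -
 have d: "dt (%v. pos \<alpha> j (v 0))" by (intro dfns)
 let ?F = "mk (pos \<alpha> j ` el n)"
 have eF: "el ?F = pos \<alpha> j ` el n" by (rule el_mk[OF S_img[OF S_el d]])
 have F: "Fin ?F" "el ?F <= el Ps" using Fin_img[OF d Fin_nat[OF n]] pos_Ps[OF a] om_elem[OF n] unfolding eF by auto
 have "EX \<tau>. fn \<tau> ?F & (ALL e:el ?F. ap \<tau> e : el (al q e))"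
 proof (rule ac_class)
  show "EX i. i : el (al q e)" if "e : el ?F" for e using q F(2) that unfolding cnd_def ne_emp by blast
 qed (intro dfns)
 then obtain \<tau> where \<tau>: "isasg q ?F \<tau>" by (auto simp: isasg_def)
 define u where "u = lam n (%i. ap \<tau> (pos \<alpha> j i))"
 have du: "dt (%v. ap \<tau> (pos \<alpha> j (v 0)))" by (intro dfns)
 have ui: "ap u i = ap \<tau> (pos \<alpha> j i)" if "i : el n" for i unfolding u_def by (rule ap_lam[OF du that])
 have "ap \<tau> (pos \<alpha> j i) : el V" if "i : el n" for i
  using \<tau> V[OF om_elem[OF n that]] al_fl[of q "pos \<alpha> j i"] that unfolding isasg_def eF by blast
 then have "isf u n V" unfolding u_def by (rule isfI[OF du])
 moreover have "al (ps q ?F \<tau>) (pos \<alpha> j i) = ins (ap u i) emp" if "i : el n" for i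
  by (rule eqI) (use al_ps(1)[OF \<tau>, of "pos \<alpha> j i"] ui that in \<open>auto simp: eF\<close>)
 moreover have "al (ps q ?F \<tau>) x = al q x" if "ALL i:el n. x ~= pos \<alpha> j i" for x
  by (rule al_ps(2)) (use that eF in auto)
 moreover have "cnd (ps q ?F \<tau>)" by (rule cnd_ps[OF q F \<tau>])
 ultimately show ?thesis by (intro exI[of _ "ps q ?F \<tau>"] exI[of _ u]) (auto simp: el_ps)
qed

end

context silver_ext
begin

text \<open>All values of a name on \<open>tms B T\<close> depend on a set of columns covered by
  \<open>tms B RR\<close>, and this is not all of \<open>II\<close>.\<close>

lemma fresh_column:
 assumes f: "fname \<gamma> (tms B T) V p0" "cnd p0" and no: "~ cov B JJ" and T: "cov RR T"
 shows "EX \<alpha>:el II. ALL x:el (tms B T). EX A. decides_in \<gamma> V p0 x A & \<alpha> ~: el A"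
proof -
 have "EX As. fn As (tms B T) & (ALL x:el (tms B T). decides_in \<gamma> V p0 x (ap As x))"
  by (rule ac_class, intro dfns) (rule name_chain_condition[OF f])
 then obtain As where As: "!!x. x : el (tms B T) ==> decides_in \<gamma> V p0 x (ap As x)" by blast
 define A where "A = mk (UN x:el (tms B T). el (ap As x))"
 have eA: "el A = (UN x:el (tms B T). el (ap As x))" unfolding A_def by (rule el_mk[OF S_UN[OF S_el dt_ap1]])
 have 1: "cov (tms (tms B T) RR) A" unfolding A_def
  by (rule cov_UN[OF dt_ap1]) (use As in \<open>auto simp: decides_in_def simp del: el_tms\<close>)
 have 2: "cov (tms B RR) (tms B (tms T RR))"
  by (rule cov_tms[OF cov_refl]) (rule cov_mono_tms[OF cov_RR_sq T cov_refl])
 have 3: "cov (tms B (tms T RR)) (tms (tms B T) RR)"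
 proof (rule covI[of "%z. pr (pr (fst' z) (fst' (snd' z))) (snd' (snd' z))"], intro dfns, rule subsetI)
  fix z assume "z : el (tms (tms B T) RR)"
  then obtain b t r where "b : el B" "t : el T" "r : el RR" "z = pr (pr b t) r" by auto
  then show "z : (%z. pr (pr (fst' z) (fst' (snd' z))) (snd' (snd' z))) ` el (tms B (tms T RR))"
   by (intro image_eqI[of _ _ "pr b (pr t r)"]) auto
 qed
 have "cov (tms B RR) A" using cov_trans[OF 2 cov_trans[OF 3 1]] .
 then obtain \<alpha> where "\<alpha> : el II" "\<alpha> ~: el A" using column_outside[OF no] by blast
 then show ?thesis using As eA by blast
qed

lemma cov_RR_seq: "cov RR (sq om)"
proof -
 have "cov RR (pw (tms om om))" unfolding RR_def by (rule cov_pw[OF countable_square])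
 moreover have "el (sq om) <= el (pw (tms om om))"
 proof (rule subsetI, simp, elim bexE, rule subsetI)
  fix u n z assume n: "n : el om" "isf u n om" "z : el u"
  then obtain x where "x : el n" "z = pr x (ap u x)" using isf_el[OF n(2)] by blast
  then show "z : {z. EX x:el om. EX y:el om. z = pr x y}" using isf_in[OF n(2)] om_elem[OF n(1)] by blast
 qed
 ultimately show ?thesis using cov_trans[OF _ cov_sub] by blast
qed

lemma sq_mono: "el A <= el B ==> el (sq A) <= el (sq B)" using isf_mono by (auto simp: subset_iff) blast

lemma k_sub_om: "el k <= el om" using om_elem[OF k_om] by blast

lemma hit_value:
 assumes no: "~ cov B JJ" and g: "N.isf (val \<gamma>) (vc (tms B (sq k))) (vc k)"
 shows "EX \<alpha>:el II. N.isf (xr \<alpha> emp) (vc om) (vc k) & (ALL \<xi>:el B. EX n:el om.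
  N.ap (xr \<alpha> emp) (vc n) = N.ap (val \<gamma>) (N.pr (vc \<xi>) (N.lam (vc n) (N.ap (xr \<alpha> emp)))))"
proof -
 obtain p0 where p0: "p0 : G" "fname \<gamma> (tms B (sq k)) k p0" using function_name[OF g] by blast
 have "cov RR (sq k)" using cov_trans[OF cov_RR_seq cov_sub[OF sq_mono[OF k_sub_om]]] .
 then obtain \<alpha> where \<alpha>: "\<alpha> : el II" "!!x. x : el (tms B (sq k)) ==> EX A. decides_in \<gamma> k p0 x A & \<alpha> ~: el A"
  using fresh_column[OF p0(2) G_cnd[OF p0(1)] no] by blast
 have j: "emp : el two" by (simp add: el_two)
 have V: "el (fl (pos \<alpha> emp n)) <= el k" for n by (simp add: fl_pos)
 note x = xr_fun[OF \<alpha>(1) j V]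
 have "EX n:el om. N.ap (xr \<alpha> emp) (vc n) = N.ap (val \<gamma>) (N.pr (vc \<xi>) (N.lam (vc n) (N.ap (xr \<alpha> emp))))"
  if \<xi>: "\<xi> : el B" for \<xi>
 proof -
  let ?D = "%q. EX n:el om. EX u y. isf u n k & (ALL i:el n. al q (pos \<alpha> emp i) = ins (ap u i) emp) &
   dec \<gamma> q (pr \<xi> u) y & al q (pos \<alpha> emp n) = ins y emp"
  have "EX q:G. le q p0 & ?D q"
  proof (rule generic_below[OF p0(1)])
   show "dfn (%v. ?D (v 0))" by (intro dfns)
   fix q assume "le q p0"
   then have q: "cnd q" "el p0 <= el q" by (auto simp: le_iff)
   obtain n where n: "n : el om" "rq emp emp (al q (pos \<alpha> emp n))" using q(1) \<alpha>(1) j zero_om unfolding cnd_def by blast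
   obtain r u where r: "cnd r" "el q <= el r" "isf u n k" "ALL i:el n. al r (pos \<alpha> emp i) = ins (ap u i) emp"
    "ALL x. (ALL i:el n. x ~= pos \<alpha> emp i) --> al r x = al q x" using fix_initial[OF q(1) \<alpha>(1) j n(1) V] by blast
   have "ALL i:el n. pos \<alpha> emp n ~= pos \<alpha> emp i" using mem_irrefl[of n] by auto
   then have rn: "al r (pos \<alpha> emp n) = al q (pos \<alpha> emp n)" using r(5) by blast
   have xm: "pr \<xi> u : el (tms B (sq k))" using \<xi> r(3) n(1) by auto
   then obtain A where A: "decides_in \<gamma> k p0 (pr \<xi> u) A" "\<alpha> ~: el A" using \<alpha>(2) by blast
   have "el p0 <= el r" using q(2) r(2) by blast
   then obtain a y where a: "y : el k" "dec \<gamma> a (pr \<xi> u) y" "cnd (un2 a r)"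
    "!!e. fst' e ~: el A ==> al (un2 a r) e = al r e" using decides_inD[OF A(1) r(1)] by metis
   have same: "al (un2 a r) (pos \<alpha> emp i) = al r (pos \<alpha> emp i)" for i using a(4)[of "pos \<alpha> emp i"] A(2) by simp
   have y: "y : el (al (un2 a r) (pos \<alpha> emp n))" using n(2) a(1) same rn by (auto simp: rq_def)
   note s = fix_position[OF a(3) pos_Ps[OF \<alpha>(1) j n(1)] y]
   let ?s = "ps (un2 a r) (ins (pos \<alpha> emp n) emp) (ins (pr (pos \<alpha> emp n) y) emp)"
   have qs: "el a <= el ?s" "el q <= el ?s" using s(4) r(2) by auto
   have "le ?s q" using s(1) qs by (simp add: le_iff)
   moreover have "dec \<gamma> ?s (pr \<xi> u) y" using dec_mono[OF a(2)] s(1) qs by (simp add: le_iff)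
   moreover have "al ?s (pos \<alpha> emp i) = ins (ap u i) emp" if i: "i : el n" for i
   proof -
    have "pos \<alpha> emp i ~= pos \<alpha> emp n" using i by auto
    then show ?thesis using s(3) same r(4) i by simp
   qed
   ultimately show "EX r. le r q & ?D r" using n(1) r(3) s(2) by blast
  qed
  then obtain q n u y where q: "q : G" "n : el om" "isf u n k" "ALL i:el n. al q (pos \<alpha> emp i) = ins (ap u i) emp"
   "dec \<gamma> q (pr \<xi> u) y" "al q (pos \<alpha> emp n) = ins y emp" by blast
  have "N.lam (vc n) (N.ap (xr \<alpha> emp)) = vc u"
   by (rule xr_restrict[OF x(1) q(2,3)]) (use x(2)[OF q(1) om_elem[OF q(2)]] q(4) in auto)
  then have "N.ap (val \<gamma>) (N.pr (vc \<xi>) (N.lam (vc n) (N.ap (xr \<alpha> emp)))) = vc y"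
   using dec_val[OF g q(1,5)] by (simp add: vc_pr)
  moreover have "N.ap (xr \<alpha> emp) (vc n) = vc y" using x(2)[OF q(1,2,6)] .
  ultimately show ?thesis using q(2) by metis
 qed
 then show ?thesis using \<alpha>(1) x(1) by blast
qed

text \<open>The same order of choices as in \<open>hit_value\<close>, at a position of the other
  kind beyond \<open>m\<close> that admits more than \<open>K\<close> values: one of them is not
  among the \<open>K\<close> values answered.\<close>

lemma escape_prediction:
 assumes no: "~ cov B JJ" and g: "N.isf (val \<gamma>) (vc (tms B (sq om))) (vc (fs K om))" and K: "K : el om"
 shows "EX x. N.isf x (vc om) (vc om) & (ALL \<xi>:el B. ALL m:el om. EX n:el om. m : el n &
  (ALL i:el K. N.ap x (vc n) ~= N.ap (N.ap (val \<gamma>) (N.pr (vc \<xi>) (N.lam (vc n) (N.ap x)))) (vc i)))"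
proof -
 obtain p0 where p0: "p0 : G" "fname \<gamma> (tms B (sq om)) (fs K om) p0" using function_name[OF g] by blast
 obtain \<alpha> where \<alpha>: "\<alpha> : el II" "!!x. x : el (tms B (sq om)) ==> EX A. decides_in \<gamma> (fs K om) p0 x A & \<alpha> ~: el A"
  using fresh_column[OF p0(2) G_cnd[OF p0(1)] no cov_RR_seq] by blast
 let ?j = "sc emp"
 have j: "?j : el two" by (simp add: el_two)
 have j0: "?j ~= emp" by (metis el_emp el_ins insert_not_empty)
 have V: "el (fl (pos \<alpha> ?j n)) <= el om" if "n : el om" for n using om_elem[OF fl_om[OF pos_Ps[OF \<alpha>(1) j that]]] by blast
 note x = xr_fun[OF \<alpha>(1) j V]
 let ?x = "xr \<alpha> ?j"
 have "EX n:el om. m : el n & (ALL i:el K. N.ap ?x (vc n) ~= N.ap (N.ap (val \<gamma>) (N.pr (vc \<xi>) (N.lam (vc n) (N.ap ?x)))) (vc i))"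
  if \<xi>: "\<xi> : el B" and m: "m : el om" for \<xi> m
 proof -
  let ?D = "%q. EX n:el om. EX u w v. m : el n & isf u n om & (ALL i:el n. al q (pos \<alpha> ?j i) = ins (ap u i) emp) &
   isf w K om & dec \<gamma> q (pr \<xi> u) w & al q (pos \<alpha> ?j n) = ins v emp & (ALL i:el K. ap w i ~= v)"
  have "EX q:G. le q p0 & ?D q"
  proof (rule generic_below[OF p0(1)])
   show "dfn (%v. ?D (v 0))" by (intro dfns)
   fix q assume "le q p0"
   then have q: "cnd q" "el p0 <= el q" by (auto simp: le_iff)
   obtain M where M: "M : el om" "el (sc m) <= el M" "el (sc K) <= el M" using om_max[OF sc_om[OF m] sc_om[OF K]] by blast
   obtain n where n: "n : el om" "M : el n" "rq ?j M (al q (pos \<alpha> ?j n))" using q(1) \<alpha>(1) j M(1) unfolding cnd_def by blast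
   have mn: "m : el n" using M(2) om_mem_trans[OF n(1,2), of m] by auto
   obtain r u where r: "cnd r" "el q <= el r" "isf u n om" "ALL i:el n. al r (pos \<alpha> ?j i) = ins (ap u i) emp"
    "ALL x. (ALL i:el n. x ~= pos \<alpha> ?j i) --> al r x = al q x" using fix_initial[OF q(1) \<alpha>(1) j n(1) V] by blast
   have "ALL i:el n. pos \<alpha> ?j n ~= pos \<alpha> ?j i" using mem_irrefl[of n] by auto
   then have rn: "al r (pos \<alpha> ?j n) = al q (pos \<alpha> ?j n)" using r(5) by blast
   have xm: "pr \<xi> u : el (tms B (sq om))" using \<xi> r(3) n(1) by auto
   then obtain A where A: "decides_in \<gamma> (fs K om) p0 (pr \<xi> u) A" "\<alpha> ~: el A" using \<alpha>(2) by blast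
   have "el p0 <= el r" using q(2) r(2) by blast
   then obtain a w where a: "w : el (fs K om)" "dec \<gamma> a (pr \<xi> u) w" "cnd (un2 a r)"
    "!!e. fst' e ~: el A ==> al (un2 a r) e = al r e" using decides_inD[OF A(1) r(1)] by metis
   have same: "al (un2 a r) (pos \<alpha> ?j i) = al r (pos \<alpha> ?j i)" for i using a(4)[of "pos \<alpha> ?j i"] A(2) by simp
   have lepM: "lep M (al q (pos \<alpha> ?j n))" using n(3) j0 by (simp add: rq_def)
   have "EX v:el (al q (pos \<alpha> ?j n)). ALL i:el K. ap w i ~= v"
   proof (rule ccontr)
    assume "~ ?thesis"
    then have h: "ALL v. v : el (al q (pos \<alpha> ?j n)) --> (EX i:el K. ap w i = v)" by simp
    have "el (al q (pos \<alpha> ?j n)) <= ap w ` el K"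
    proof (rule subsetI)
     fix v assume "v : el (al q (pos \<alpha> ?j n))"
     with h obtain i where "i : el K" "ap w i = v" by blast
     then show "v : ap w ` el K" by (intro image_eqI[of _ _ i]) auto
    qed
    then have "cov K (al q (pos \<alpha> ?j n))" by (auto simp: cov_def)
    then have "lep M K" using lep_trans[OF lepM cov_lep] by blast
    then have "lep (sc K) K" using lep_trans[OF lep_sub[OF M(3)]] by blast
    then show False using lep_cov not_cov_sc[OF K] by blast
   qed
   then obtain v where v: "v : el (al (un2 a r) (pos \<alpha> ?j n))" "ALL i:el K. ap w i ~= v" using same rn by auto
   note s = fix_position[OF a(3) pos_Ps[OF \<alpha>(1) j n(1)] v(1)]
   let ?s = "ps (un2 a r) (ins (pos \<alpha> ?j n) emp) (ins (pr (pos \<alpha> ?j n) v) emp)"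
   have qs: "el a <= el ?s" "el q <= el ?s" using s(4) r(2) by auto
   have "le ?s q" using s(1) qs by (simp add: le_iff)
   moreover have "dec \<gamma> ?s (pr \<xi> u) w" using dec_mono[OF a(2)] s(1) qs by (simp add: le_iff)
   moreover have "al ?s (pos \<alpha> ?j i) = ins (ap u i) emp" if i: "i : el n" for i
   proof -
    have "pos \<alpha> ?j i ~= pos \<alpha> ?j n" using i by auto
    then show ?thesis using s(3) same r(4) i by simp
   qed
   moreover have "isf w K om" using a(1) by simp
   ultimately show "EX r. le r q & ?D r" using n(1) r(3) s(2) v(2) mn by blast
  qed
  then obtain q n u w v where q: "q : G" "n : el om" "isf u n om" "ALL i:el n. al q (pos \<alpha> ?j i) = ins (ap u i) emp"
   "dec \<gamma> q (pr \<xi> u) w" "al q (pos \<alpha> ?j n) = ins v emp" "m : el n" "isf w K om" "ALL i:el K. ap w i ~= v" by blast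
  have "N.lam (vc n) (N.ap ?x) = vc u"
   by (rule xr_restrict[OF x(1) q(2,3)]) (use x(2)[OF _ q(1) om_elem[OF q(2)]] q(4) in auto)
  then have "N.ap (val \<gamma>) (N.pr (vc \<xi>) (N.lam (vc n) (N.ap ?x))) = vc w"
   using dec_val[OF g q(1,5)] by (simp add: vc_pr)
  moreover have "N.ap ?x (vc n) = vc v" using x(2)[OF _ q(1,2,6)] by blast
  ultimately show ?thesis using q(2,7,9) vc_isf(2)[OF q(8)] by (intro bexI[of _ n]) auto
 qed
 then show ?thesis using x(1) by blast
qed

text \<open>\<open>localize\<close> works below every extension of \<open>p0\<close>, so some
  \<open>q\<close> in \<open>G\<close> comes with its function \<open>j\<close>. If \<open>f\<close>
  obeyed \<open>j\<close> at \<open>n\<close>, a condition in \<open>G\<close> below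
  \<open>q\<close> deciding the first \<open>n + 1\<close> values would decide exactly the forbidden
  sequence.\<close>

lemma ground_localization:
 assumes f: "N.isf f (vc om) (vc (sc k))"
 shows "EX j. isf j (sq (sc k)) (sc k) & (ALL n:el om. N.ap f (vc n) ~= N.ap (vc j) (N.lam (vc n) (N.ap f)))"
proof -
 obtain \<gamma> where \<gamma>: "f = val \<gamma>" by (rule val_cases)
 have g: "N.isf (val \<gamma>) (vc om) (vc (sc k))" using f \<gamma> by simp
 obtain p0 where p0: "p0 : G" "fname \<gamma> om (sc k) p0" using function_name[OF g] by blast
 have loc: "localization E k (dec \<gamma>) p" if p: "cnd p" "el p0 <= el p" for p
 proof unfold_locales
  show "dfn (%v. dec \<gamma> (v 0) (v 1) (v 2))" by (intro dfns)
  show "dec \<gamma> q x y" if "dec \<gamma> p x y" "el p <= el q" "cnd q" for p q x y using dec_mono that by (auto simp: le_iff)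
  show "cnd p" by (rule p)
  show "EX r. cnd r & el q <= el r & (EX y:el (sc k). dec \<gamma> r n y)" if "cnd q" "el p <= el q" "n : el om" for q n
  proof -
   have "le q p0" using that p by (auto simp: le_iff)
   then show ?thesis using p0(2) that unfolding fname_def le_iff by blast
  qed
  show "y = y'" if "cnd q" "el p <= el q" "n : el om" "y : el (sc k)" "y' : el (sc k)" "dec \<gamma> q n y" "dec \<gamma> q n y'" for q n y y'
  proof -
   have "le q p0" using that p by (auto simp: le_iff)
   then show ?thesis using p0(2) that unfolding fname_def by blast
  qed
 qed
 interpret L: localization E k "dec \<gamma>" p0 by (rule loc[OF G_cnd[OF p0(1)]]) simp
 let ?D = "%q j. isf j (sq (sc k)) (sc k) &
  (ALL n:el om. ALL u r. isf u n (sc k) --> cnd r --> el q <= el r --> ~ L.ds (sc n) (ins (pr n (ap j u)) u) r)"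
 have "EX q:G. le q p0 & (EX j. ?D q j)"
 proof (rule generic_below[OF p0(1)])
  show "dfn (%v. EX j. ?D (v 0) j)" by (intro dfns)
  fix q assume "le q p0"
  then have q: "cnd q" "el p0 <= el q" by (auto simp: le_iff)
  interpret K: localization E k "dec \<gamma>" q by (rule loc[OF q])
  show "EX r. le r q & (EX j. ?D r j)" using K.localize unfolding le_iff by blast
 qed
 then obtain q j where q: "q : G" "le q p0" and j: "isf j (sq (sc k)) (sc k)"
  and D: "!!n u r. n : el om ==> isf u n (sc k) ==> cnd r ==> el q <= el r ==> ~ L.ds (sc n) (ins (pr n (ap j u)) u) r" by blast
 have "N.ap f (vc n) ~= N.ap (vc j) (N.lam (vc n) (N.ap f))" if n: "n : el om" for n
 proof
  assume eq: "N.ap f (vc n) = N.ap (vc j) (N.lam (vc n) (N.ap f))"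
  have "N.isf (N.lam (vc n) (N.ap f)) (vc n) (vc (sc k))"
   by (rule N.isfI) (use N.isf_in[OF f] om_elem[OF n] in \<open>auto simp: N_el_vc simp del: el_ins\<close>)
  then obtain u where u: "isf u n (sc k)" "N.lam (vc n) (N.ap f) = vc u" using ground_sequence[OF n] by blast
  have uS: "u : el (sq (sc k))" using u(1) n by auto
  have fn: "N.ap f (vc n) = vc (ap j u)" using eq u(2) vc_isf(2)[OF j uS] by simp
  have fi: "N.ap f (vc i) = vc (ap u i)" if i: "i : el n" for i
  proof -
   have "vc i : N.el (vc n)" using i by simp
   then have "N.ap (N.lam (vc n) (N.ap f)) (vc i) = N.ap f (vc i)" by (rule N.ap_lam[OF N.dt_ap1])
   then show ?thesis using u(2) vc_isf(2)[OF u(1) i] by simp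
  qed
  have "EX r:G. le r q & (EX w. L.ds (sc n) w r)"
  proof (rule generic_below[OF q(1)])
   show "dfn (%v. EX w. L.ds (sc n) w (v 0))" by (intro dfns)
   show "EX r. le r s & (EX w. L.ds (sc n) w r)" if "le s q" for s
    using L.ds_exists[OF sc_om[OF n], of s] that q(2) unfolding le_iff by blast
  qed
  then obtain r w where r: "r : G" "le r q" "L.ds (sc n) w r" by blast
  have w: "isf w (sc n) (sc k)" and wd: "!!i. i : el (sc n) ==> N.ap f (vc i) = vc (ap w i)"
   using r(3) dec_val[OF g r(1)] unfolding L.ds_def \<gamma> by blast+
  have "ap j u : el (sc k)" by (rule isf_in[OF j uS])
  note e = isf_extend[OF u(1) mem_irrefl this]
  have "w = ins (pr n (ap j u)) u"
  proof (rule isf_ext[OF w e(1)])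
   fix i assume i: "i : el (sc n)"
   show "ap w i = ap (ins (pr n (ap j u)) u) i"
   proof (cases "i = n")
    case True then show ?thesis using wd[OF i] fn e(2) by simp
   next
    case False
    then have "i : el n" using i by simp
    then show ?thesis using wd[OF i] fi e(3) by simp
   qed
  qed
  then show False using D[OF n u(1), of r] r by (auto simp: le_iff)
 qed
 then show ?thesis using j by blast
qed

end

section \<open>The sentence read inside a model\<close>

section \<open>Meaning of the cardinal invariants in a model\<close>

context zf
begin

primrec num :: "nat => 'a" where
 "num 0 = emp"
| "num (Suc n) = sc (num n)"

text \<open>Restriction as \<open>is_restr\<close> has it, cut out of an arbitrary set; for
  functions it agrees with \<open>lam A (ap f)\<close> by \<open>rst_lam\<close>.\<close>

definition rst :: "'a => 'a => 'a" where "rst f A = mk {p : el f. EX x y. x : el A & p = pr x y}"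

lemma S_rst: "S {p : el f. EX x y. x : el A & p = pr x y}"
 by (rule S_sub[OF S_el]) (auto intro!: dfns)

lemma el_rst: "el (rst f A) = {p : el f. EX x y. x : el A & p = pr x y}"
 unfolding rst_def by (rule el_mk[OF S_rst])

lemma dt_rst [dfns]: "dt t ==> dt u ==> dt (%v. rst (t v) (u v))"
 by (rule dt_comp2[where f=rst, rotated], assumption+, unfold rst_def, rule dt_mk, rule S_rst, simp, intro dfns)

lemma rst_lam: assumes "isf f D B" "el A <= el D" shows "rst f A = lam A (ap f)"
 by (rule eqI) (use assms(2) in \<open>auto simp: el_rst isf_el[OF assms(1)] el_lam[OF dt_ap1]\<close>)

lemma rst_all: assumes "isf f D B" "el D <= el A" shows "rst f A = f"
 by (rule eqI) (use assms(2) in \<open>auto simp: el_rst isf_el[OF assms(1)]\<close>)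

text \<open>This and the following predicates mirror the formulas of the theory clause by clause, so
  that each formula evaluates to its predicate.\<close>

definition tree_on :: "'a => bool" where
 "tree_on T \<longleftrightarrow> (ALL t:el T. EX n:el om. isf t n om) & (ALL t:el T. ALL n:el om. rst t n : el T)"

definition next_node :: "'a => 'a => 'a => bool" where
 "next_node T t u \<longleftrightarrow> u : el T & (EX n:el om. isf t n om & isf u (sc n) om & t = rst u n)"

definition btree :: "'a => 'a => bool" where
 "btree k T \<longleftrightarrow> tree_on T &
  (ALL t:el T. EX s. el s = {u. next_node T t u} & (eqp s (sc emp) | eqp s k))"

definition locfam :: "'a => 'a => bool" where
 "locfam k F \<longleftrightarrow> (ALL T:el F. btree k T) &
  (ALL f. isf f om (sc k) --> (EX T:el F. isf f om om & (ALL n:el om. rst f n : el T)))"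

definition predictr :: "'a => 'a => bool" where
 "predictr k \<pi> \<longleftrightarrow> fn \<pi> om & (ALL n:el om. EX Y. el Y = {a. el a <= el om & eqp a k} & isf (ap \<pi> n) (fs n om) Y)"

definition prdfam :: "'a => 'a => bool" where
 "prdfam k F \<longleftrightarrow> (ALL \<pi>:el F. predictr k \<pi>) & (ALL f. isf f om om --> (EX \<pi>:el F. EX m:el om. ALL n:el om.
  m : el n --> (EX a. pr (rst f n) a : el (ap \<pi> n) & ap f n : el a)))"

definition leastcard :: "('a => bool) => 'a => bool" where
 "leastcard Q c \<longleftrightarrow> Card c & (EX F. Q F & eqp F c) & (ALL F b. Q F & Card b & eqp F b --> c : el b | c = b)"

lemma E_el: "E x y \<longleftrightarrow> x : el y" by (simp add: el_def)
lemma eq_iff: "x = y \<longleftrightarrow> (ALL z. z : el x \<longleftrightarrow> z : el y)" using eqI by blast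

lemma fn_iff: "fn f A \<longleftrightarrow> (ALL p:el f. EX x y. x : el A & p = pr x y) & (ALL x:el A. EX! y. pr x y : el f)"
proof
 assume "fn f A"
 then have "el f = {z. EX x:el A. z = pr x (ap f x)}" unfolding fn_def using el_lam[OF dt_ap1] by metis
 then show "(ALL p:el f. EX x y. x : el A & p = pr x y) & (ALL x:el A. EX! y. pr x y : el f)" by auto
next
 assume *: "(ALL p:el f. EX x y. x : el A & p = pr x y) & (ALL x:el A. EX! y. pr x y : el f)"
 have ap: "ap f x = y" if h: "x : el A" "pr x y : el f" for x y
 proof (rule ap_eq)
  show "pr x y : el f" by (rule h)
  show "y' = y" if "pr x y' : el f" for y' using * h that by blast
 qed
 show "fn f A" unfolding fn_def
 proof (rule eqI, rule set_eqI)
  fix z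
  show "z : el f \<longleftrightarrow> z : el (lam A (ap f))" unfolding el_lam[OF dt_ap1] using * ap by auto
 qed
qed

lemma isf_iff: "isf f A B \<longleftrightarrow> fn f A & (ALL x y. pr x y : el f --> y : el B)"
proof -
 have "el f = {z. EX x:el A. z = pr x (ap f x)}" if "fn f A" using that unfolding fn_def using el_lam[OF dt_ap1] by metis
 then show ?thesis unfolding isf_def fn_def[symmetric] by auto
qed

lemma fn_mem: "fn f A ==> pr x y : el f \<longleftrightarrow> x : el A & y = ap f x"
proof -
 assume "fn f A"
 then have "el f = {z. EX x:el A. z = pr x (ap f x)}" unfolding fn_def using el_lam[OF dt_ap1] by metis
 then show ?thesis by auto
qed

lemma isf_mem: "isf f A B ==> pr x y : el f \<longleftrightarrow> x : el A & y = ap f x"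
 by (rule fn_mem) (simp add: isf_iff)

lemma eqp_iff: "eqp A B \<longleftrightarrow> (EX f. isf f A B & (ALL y:el B. EX! x. pr x y : el f))"
proof -
 have "bij_betw (ap f) (el A) (el B) \<longleftrightarrow> (ALL y:el B. EX! x. pr x y : el f)" if f: "isf f A B" for f
 proof -
  have "(ALL y:el B. EX! x. x : el A & y = ap f x) \<longleftrightarrow> bij_betw (ap f) (el A) (el B)" (is "?L \<longleftrightarrow> ?R")
  proof
   assume ?L
   then show ?R using isf_in[OF f] unfolding bij_betw_def inj_on_def by blast
  next
   assume ?R
   then show ?L unfolding bij_betw_def inj_on_def by blast
  qed
  then show ?thesis unfolding isf_mem[OF f] by blast
 qed
 then show ?thesis unfolding eqp_def by blast
qed

lemma is_om: "x = om \<longleftrightarrow> indset x & (ALL w. indset w --> el x <= el w)"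
proof
 assume "x = om" then show "indset x & (ALL w. indset w --> el x <= el w)"
  using el_om zero_om sc_om by (auto simp: indset_def)
next
 assume *: "indset x & (ALL w. indset w --> el x <= el w)"
 show "x = om" by (rule eqI) (use * in \<open>auto simp: el_om\<close>)
qed

lemma tsat_subset: "x < d ==> y < d ==> tsat (=) E u d \<rho> (x \<^bold>\<subseteq> y) \<longleftrightarrow> el (\<rho> x) <= el (\<rho> y)"
 by (simp add: is_subset_def tsat_eval E_el subset_iff del: fun_upd_apply)
lemma tsat_empty: "x < d ==> tsat (=) E u d \<rho> (is_empty x) \<longleftrightarrow> \<rho> x = emp"
 by (simp add: is_empty_def tsat_eval E_el eq_iff[of _ emp] del: fun_upd_apply)
lemma tsat_succ: "x < d ==> y < d ==> tsat (=) E u d \<rho> (is_succ x y) \<longleftrightarrow> \<rho> y = sc (\<rho> x)"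
 by (simp add: is_succ_def tsat_eval E_el eq_iff[of _ "sc _"] disj_commute del: fun_upd_apply)
lemma tsat_upair: "x < d ==> y < d ==> p < d ==> tsat (=) E u d \<rho> (is_upair x y p) \<longleftrightarrow> \<rho> p = up (\<rho> x) (\<rho> y)"
 by (simp add: is_upair_def tsat_eval E_el eq_iff[of _ "up _ _"] del: fun_upd_apply)
lemma tsat_pair: "x < d ==> y < d ==> p < d ==> tsat (=) E u d \<rho> (is_pair x y p) \<longleftrightarrow> \<rho> p = pr (\<rho> x) (\<rho> y)"
 by (simp add: is_pair_def tsat_eval tsat_upair pr_def del: fun_upd_apply)
lemma tsat_inductive: "x < d ==> tsat (=) E u d \<rho> (is_inductive x) \<longleftrightarrow> indset (\<rho> x)"
 by (simp add: is_inductive_def tsat_eval tsat_empty tsat_succ E_el indset_def Ball_def del: fun_upd_apply)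
lemma tsat_omega: "x < d ==> tsat (=) E u d \<rho> (is_omega x) \<longleftrightarrow> \<rho> x = om"
 by (simp add: is_omega_def tsat_eval tsat_inductive tsat_subset is_om del: fun_upd_apply)
lemma tsat_numeral: "x < d ==> tsat (=) E u d \<rho> (is_numeral n x) \<longleftrightarrow> \<rho> x = num n"
 by (induction n arbitrary: x d \<rho>) (simp_all add: tsat_eval tsat_empty tsat_succ del: fun_upd_apply)
lemma tsat_app: "f < d ==> x < d ==> y < d ==> tsat (=) E u d \<rho> (app f x y) \<longleftrightarrow> pr (\<rho> x) (\<rho> y) : el (\<rho> f)"
 by (simp add: app_def tsat_eval tsat_pair E_el del: fun_upd_apply)
lemma tsat_func_on: "f < d ==> A < d ==> tsat (=) E u d \<rho> (func_on A f) \<longleftrightarrow> fn (\<rho> f) (\<rho> A)"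
 by (simp add: func_on_def tsat_eval tsat_pair tsat_app E_el fn_iff Ball_def Ex1_def del: fun_upd_apply)
lemma tsat_func: "f < d ==> A < d ==> B < d ==> tsat (=) E u d \<rho> (func A B f) \<longleftrightarrow> isf (\<rho> f) (\<rho> A) (\<rho> B)"
 by (simp add: func_def tsat_eval tsat_func_on tsat_app E_el isf_iff del: fun_upd_apply)
lemma tsat_funspace: "A < d ==> B < d ==> X < d ==> tsat (=) E u d \<rho> (is_funspace A B X) \<longleftrightarrow> \<rho> X = fs (\<rho> A) (\<rho> B)"
 by (simp add: is_funspace_def tsat_eval tsat_func E_el eq_iff[of _ "fs _ _"] del: fun_upd_apply)
lemma tsat_restr: "f < d ==> A < d ==> g < d ==> tsat (=) E u d \<rho> (is_restr f A g) \<longleftrightarrow> \<rho> g = rst (\<rho> f) (\<rho> A)"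
 by (simp add: is_restr_def tsat_eval tsat_pair E_el eq_iff[of _ "rst _ _"] el_rst del: fun_upd_apply)
lemma tsat_equinum: "A < d ==> B < d ==> tsat (=) E u d \<rho> (A \<^bold>\<approx> B) \<longleftrightarrow> eqp (\<rho> A) (\<rho> B)"
 by (simp add: equinum_def tsat_eval tsat_func tsat_app E_el eqp_iff Ball_def Ex1_def del: fun_upd_apply)
lemma tsat_ordinal: "c < d ==> tsat (=) E u d \<rho> (ordinal c) \<longleftrightarrow> Ord (\<rho> c)"
 by (simp add: ordinal_def tsat_eval tsat_subset E_el Ord_def Ball_def del: fun_upd_apply) blast
lemma tsat_cardinal: "c < d ==> tsat (=) E u d \<rho> (cardinal c) \<longleftrightarrow> Card (\<rho> c)"
 by (simp add: cardinal_def tsat_eval tsat_ordinal tsat_equinum E_el Card_def Ball_def del: fun_upd_apply)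

text \<open>The family property may refer to a parameter at level \<open>k\<close>; the premise
  therefore covers all assignments that retain the value of \<open>k\<close>.\<close>

lemma tsat_least_cardinality:
 assumes "!!F d \<rho>'. c < d ==> F < d ==> k < d ==> \<rho>' k = \<rho> k ==> tsat (=) E u d \<rho>' (P F) \<longleftrightarrow> Q (\<rho>' F)"
 shows "c < d ==> k < d ==> tsat (=) E u d \<rho> (least_cardinality P c) \<longleftrightarrow> leastcard Q (\<rho> c)"
 by (simp add: least_cardinality_def tsat_eval tsat_cardinal tsat_equinum assms E_el leastcard_def del: fun_upd_apply)

lemma tsat_fin_seq: "n < d ==> t < d ==> tsat (=) E u d \<rho> (fin_seq n t) \<longleftrightarrow> \<rho> n : el om & isf (\<rho> t) (\<rho> n) om"
 by (simp add: fin_seq_def tsat_eval tsat_omega tsat_func E_el del: fun_upd_apply)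
lemma tsat_tree: "T < d ==> tsat (=) E u d \<rho> (tree T) \<longleftrightarrow> tree_on (\<rho> T)"
 by (simp add: tree_def tsat_eval tsat_omega tsat_fin_seq tsat_restr E_el tree_on_def Ball_def Bex_def del: fun_upd_apply) blast
lemma tsat_immediate_successor: "T < d ==> t < d ==> v < d ==>
  tsat (=) E u d \<rho> (immediate_successor T t v) \<longleftrightarrow> next_node (\<rho> T) (\<rho> t) (\<rho> v)"
proof -
 assume d: "T < d" "t < d" "v < d"
 have "tsat (=) E u d \<rho> (immediate_successor T t v) \<longleftrightarrow> \<rho> v : el (\<rho> T) & (EX n. n : el om & isf (\<rho> t) n om &
   sc n : el om & isf (\<rho> v) (sc n) om & \<rho> t = rst (\<rho> v) n)"
  using d by (simp add: immediate_successor_def tsat_eval tsat_succ tsat_fin_seq tsat_restr E_el del: fun_upd_apply el_ins)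
 then show ?thesis unfolding next_node_def using sc_om by blast
qed
lemma tsat_branching_tree: "T < d ==> k < d ==> tsat (=) E u d \<rho> (branching_tree k T) \<longleftrightarrow> btree (\<rho> k) (\<rho> T)"
 by (simp add: branching_tree_def tsat_eval tsat_tree tsat_numeral tsat_immediate_successor tsat_equinum E_el btree_def
   Ball_def set_eq_iff del: fun_upd_apply is_numeral.simps)
lemma tsat_branch: "f < d ==> T < d ==> tsat (=) E u d \<rho> (branch f T) \<longleftrightarrow> isf (\<rho> f) om om & (ALL n:el om. rst (\<rho> f) n : el (\<rho> T))"
 by (simp add: branch_def tsat_eval tsat_omega tsat_func tsat_restr E_el Ball_def del: fun_upd_apply)
lemma tsat_localizing_family: "F < d ==> k < d ==> tsat (=) E u d \<rho> (localizing_family k F) \<longleftrightarrow> locfam (\<rho> k) (\<rho> F)"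
 by (simp add: localizing_family_def tsat_eval tsat_omega tsat_succ tsat_func tsat_branch tsat_branching_tree E_el locfam_def
   Ball_def Bex_def del: fun_upd_apply) blast
lemma tsat_is_L: "c < d ==> k < d ==> tsat (=) E u d \<rho> (is_L k c) \<longleftrightarrow> leastcard (locfam (\<rho> k)) (\<rho> c)"
 unfolding is_L_def by (rule tsat_least_cardinality[where k=k]) (simp_all add: tsat_localizing_family)

lemma tsat_subsets_of_size: "k < d ==> A < d ==> X < d ==>
  tsat (=) E u d \<rho> (is_subsets_of_size k A X) \<longleftrightarrow> el (\<rho> X) = {a. el a <= el (\<rho> A) & eqp a (\<rho> k)}"
 by (simp add: is_subsets_of_size_def tsat_eval tsat_subset tsat_equinum E_el set_eq_iff del: fun_upd_apply)
lemma tsat_predictor: "\<pi> < d ==> k < d ==> tsat (=) E u d \<rho> (predictor k \<pi>) \<longleftrightarrow> predictr (\<rho> k) (\<rho> \<pi>)"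
proof -
 assume d: "\<pi> < d" "k < d"
 have "tsat (=) E u d \<rho> (predictor k \<pi>) \<longleftrightarrow> fn (\<rho> \<pi>) om & (ALL n p. pr n p : el (\<rho> \<pi>) -->
   (EX Y. el Y = {a. el a <= el om & eqp a (\<rho> k)} & isf p (fs n om) Y))"
  using d by (simp add: predictor_def tsat_eval tsat_omega tsat_func_on tsat_app tsat_funspace tsat_subsets_of_size tsat_func
    del: fun_upd_apply)
 then show ?thesis unfolding predictr_def using fn_mem by auto
qed
text \<open>Application describes the formula correctly for functions. The typing is assumed here
  and comes from the surrounding clauses of \<open>predicting_family\<close>.\<close>

lemma tsat_predicts: "\<pi> < d ==> f < d ==> fn (\<rho> \<pi>) om ==> isf (\<rho> f) om om ==> tsat (=) E u d \<rho> (predicts \<pi> f) \<longleftrightarrow>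
  (EX m:el om. ALL n:el om. m : el n --> (EX a. pr (rst (\<rho> f) n) a : el (ap (\<rho> \<pi>) n) & ap (\<rho> f) n : el a))"
 by (simp add: predicts_def tsat_eval tsat_omega tsat_restr tsat_app E_el fn_mem isf_mem Bex_def del: fun_upd_apply) blast
lemma tsat_predicting_family: "F < d ==> k < d ==> tsat (=) E u d \<rho> (predicting_family k F) \<longleftrightarrow> prdfam (\<rho> k) (\<rho> F)"
proof -
 assume d: "F < d" "k < d"
 let ?p = "%\<pi> f. EX m:el om. ALL n:el om. m : el n --> (EX a. pr (rst f n) a : el (ap \<pi> n) & ap f n : el a)"
 have "tsat (=) E u d \<rho> (predicting_family k F) \<longleftrightarrow> (ALL \<pi>:el (\<rho> F). predictr (\<rho> k) \<pi>) &
   (ALL f. isf f om om --> (EX \<pi>:el (\<rho> F). tsat (=) E u (Suc (Suc (Suc d))) (\<rho>(d := om, Suc d := f, Suc (Suc d) := \<pi>)) (predicts (Suc (Suc d)) (Suc d))))"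
  using d by (simp add: predicting_family_def tsat_eval tsat_omega tsat_func tsat_predictor E_el Ball_def Bex_def
    del: fun_upd_apply)
 moreover have "tsat (=) E u (Suc (Suc (Suc d))) (\<rho>(d := om, Suc d := f, Suc (Suc d) := \<pi>)) (predicts (Suc (Suc d)) (Suc d)) \<longleftrightarrow> ?p \<pi> f"
  if "isf f om om" "predictr (\<rho> k) \<pi>" for f \<pi>
  using that by (subst tsat_predicts) (auto simp: predictr_def)
 ultimately show ?thesis unfolding prdfam_def by blast
qed
lemma tsat_is_v: "c < d ==> k < d ==> tsat (=) E u d \<rho> (is_v k c) \<longleftrightarrow> leastcard (prdfam (\<rho> k)) (\<rho> c)"
 unfolding is_v_def by (rule tsat_least_cardinality[where k=k]) (simp_all add: tsat_predicting_family)

lemma sat_invariants_sentence: "sat (=) E u (invariants_sentence s) \<longleftrightarrow>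
 (ALL k:el om. el (num 2) <= el k --> (EX a b. leastcard (locfam (num (s + 1))) a & leastcard (locfam (num s)) b &
  leastcard (prdfam k) b & Card b & eqp (fs om (num 2)) b & a : el b))"
 by (simp add: invariants_sentence_def is_continuum_def sat_closure tsat_eval tsat_omega tsat_numeral tsat_subset tsat_is_L
   tsat_is_v tsat_cardinal tsat_funspace tsat_equinum E_el Ball_def del: fun_upd_apply num.simps is_numeral.simps) blast

end

section \<open>Trees and predictors under choice\<close>

context zfc
begin

lemma dfn_next_node [dfns]: "dt a ==> dt b ==> dt c ==> dfn (%v. next_node (a v) (b v) (c v))"
 by (rule dfn_comp3[where P=next_node]; (assumption | (unfold next_node_def, intro dfns)))
lemma dfn_btree [dfns]: "dt a ==> dt b ==> dfn (%v. btree (a v) (b v))"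
 by (rule dfn_comp2[where P=btree]; (assumption | (unfold btree_def tree_on_def set_eq_iff mem_Collect_eq, intro dfns)))
lemma dfn_locfam [dfns]: "dt a ==> dt b ==> dfn (%v. locfam (a v) (b v))"
 by (rule dfn_comp2[where P=locfam]; (assumption | (unfold locfam_def, intro dfns)))
lemma dfn_predictr [dfns]: "dt a ==> dt b ==> dfn (%v. predictr (a v) (b v))"
 by (rule dfn_comp2[where P=predictr]; (assumption | (unfold predictr_def set_eq_iff mem_Collect_eq, intro dfns)))

lemma rst_isf: "isf f D B ==> el A <= el D ==> isf (rst f A) A B"
 unfolding rst_lam by (rule isfI[OF dt_ap1]) (use isf_in in blast)

lemma ap_rst: assumes "isf f D B" "el A <= el D" "x : el A" shows "ap (rst f A) x = ap f x"
 unfolding rst_lam[OF assms(1,2)] by (rule ap_lam[OF dt_ap1 assms(3)])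

lemma rst_rst: assumes "isf f D B" "el A <= el D" "el C <= el A" shows "rst (rst f A) C = rst f C"
 by (rule eqI) (use assms(3) in \<open>auto simp: el_rst\<close>)

lemma rst_sc: assumes "isf f D B" "n : el D" shows "rst f (sc n) = ins (pr n (ap f n)) (rst f n)"
 by (rule eqI) (use assms(2) in \<open>auto simp: el_rst isf_el[OF assms(1)]\<close>)

lemma rst_ins: assumes "isf t n B" shows "rst (ins (pr n x) t) n = t"
 by (rule eqI) (auto simp: el_rst isf_el[OF assms])

lemma om_sub: "n : el om ==> m : el n ==> el m <= el n" using om_trans_el unfolding trans_def by blast
lemma om_sub_om: "n : el om ==> el n <= el om" using om_elem by blast

lemma next_node_iff:
 assumes n: "n : el om" and t: "isf t n om"
 shows "next_node T t u \<longleftrightarrow> u : el T & (EX x:el om. u = ins (pr n x) t)"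
proof
 assume "next_node T t u"
 then obtain m where u: "u : el T" and m: "isf t m om" "isf u (sc m) om" "t = rst u m" unfolding next_node_def by blast
 have mn: "m = n" by (rule isf_dom_unique[OF m(1) t])
 have u': "isf u (sc n) om" using m(2) mn by simp
 have "u = rst u (sc n)" by (rule rst_all[OF u', symmetric]) simp
 also have "\<dots> = ins (pr n (ap u n)) t" using rst_sc[OF u'] m(3) mn by simp
 finally have "u = ins (pr n (ap u n)) t" .
 moreover have "ap u n : el om" by (rule isf_in[OF u']) simp
 ultimately show "u : el T & (EX x:el om. u = ins (pr n x) t)" using u by blast
next
 assume "u : el T & (EX x:el om. u = ins (pr n x) t)"
 then obtain x where x: "u : el T" "x : el om" "u = ins (pr n x) t" by blast
 have "isf u (sc n) om" using isf_extend(1)[OF t mem_irrefl x(2)] x(3) by simp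
 moreover have "t = rst u n" using rst_ins[OF t] x(3) by simp
 ultimately show "next_node T t u" unfolding next_node_def using x(1) n t by blast
qed

lemma ins_inject: assumes "isf t n B" "ins (pr n x) t = ins (pr n y) t" shows "x = y"
proof -
 have "pr n x : el (ins (pr n y) t)" unfolding assms(2)[symmetric] by simp
 moreover have "pr n x ~: el t" by (auto simp: isf_el[OF assms(1)])
 ultimately show ?thesis by simp
qed

text \<open>A node has one successor or \<open>i\<close> of them, in either case at most
  \<open>i\<close> because \<open>i\<close> is positive; so not all of \<open>i + 1\<close> values
  continue it inside the tree.\<close>

lemma btree_not_full:
 assumes T: "btree i T" "t : el T" and n: "n : el om" "isf t n om" and i: "i : el om" "emp : el i"
 shows "EX x:el (sc i). ins (pr n x) t ~: el T"
proof (rule ccontr)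
 assume no: "~ ?thesis"
 obtain s where s: "el s = {u. next_node T t u}" "eqp s (sc emp) | eqp s i" using T unfolding btree_def by blast
 have "cov i (sc emp)" by (rule cov_sub) (use i(2) in auto)
 then have 1: "cov i s" using s(2) eqp_cov[OF eqp_sym] cov_trans by blast
 have "cov s (sc i)"
 proof (rule covI[of "%u. ap u n"], intro dfns, rule subsetI)
  fix x assume x: "x : el (sc i)"
  then have "ins (pr n x) t : el T" using no by blast
  moreover have xo: "x : el om" using x sc_om[OF i(1)] om_elem by blast
  ultimately have "ins (pr n x) t : el s" unfolding s(1) using next_node_iff[OF n] by blast
  moreover have "ap (ins (pr n x) t) n = x" by (rule isf_extend(2)[OF n(2) mem_irrefl xo])
  ultimately show "x : (%u. ap u n) ` el s" by (intro image_eqI[of _ _ "ins (pr n x) t"]) auto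
 qed
 then show False using cov_trans[OF 1] not_cov_sc[OF i(1)] by blast
qed

text \<open>The initial segments of one function form a tree in which each node has one successor,
  which is admissible for every \<open>i\<close>. With one such tree for every function, the
  continuum is seen to be an upper bound.\<close>

lemma single_branch_tree:
 assumes f: "isf f om om" shows "EX T. btree i T & (ALL n:el om. rst f n : el T)"
proof -
 define T where "T = mk ((%n. rst f n) ` el om)"
 have eT: "el T = (%n. rst f n) ` el om" unfolding T_def by (rule el_mk, rule S_img[OF S_el], intro dfns)
 have fn: "isf (rst f n) n om" if n: "n : el om" for n by (rule rst_isf[OF f om_sub_om[OF n]])
 have "tree_on T" unfolding tree_on_def
 proof (intro conjI ballI)
  fix t assume "t : el T"
  then obtain n where n: "n : el om" "t = rst f n" unfolding eT by blast
  then show "EX n:el om. isf t n om" using fn by blast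
  fix m assume m: "m : el om"
  have "rst t m = rst f m" if "el m <= el n" unfolding n(2) by (rule rst_rst[OF f om_sub_om[OF n(1)] that])
  moreover have "rst t m = t" if "el n <= el m" unfolding n(2) by (rule rst_all[OF fn[OF n(1)] that])
  moreover have "el m <= el n | el n <= el m" using om_linear[OF m n(1)] om_sub[OF n(1)] om_sub[OF m] by blast
  ultimately show "rst t m : el T" unfolding eT using n m by blast
 qed
 moreover have "EX s. el s = {u. next_node T t u} & (eqp s (sc emp) | eqp s i)" if t: "t : el T" for t
 proof -
  obtain n where n: "n : el om" "t = rst f n" using t unfolding eT by blast
  have tf: "isf t n om" using fn n by simp
  have r: "rst f (sc n) = ins (pr n (ap f n)) t" using rst_sc[OF f n(1)] n(2) by simp
  have iff: "next_node T t u \<longleftrightarrow> u = rst f (sc n)" for u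
  proof
   assume "next_node T t u"
   then obtain x where x: "x : el om" "u = ins (pr n x) t" "u : el T" using next_node_iff[OF n(1) tf] by blast
   then obtain m where m: "m : el om" "u = rst f m" unfolding eT by blast
   have "isf u (sc n) om" using isf_extend(1)[OF tf mem_irrefl x(1)] x(2) by simp
   then have "sc n = m" using isf_dom_unique fn[OF m(1)] m(2) by blast
   then show "u = rst f (sc n)" using m(2) by simp
  next
   assume u: "u = rst f (sc n)"
   then have "u : el T" unfolding eT using sc_om[OF n(1)] by blast
   then show "next_node T t u" using next_node_iff[OF n(1) tf] r u isf_in[OF f n(1)] by blast
  qed
  have "eqp (ins (rst f (sc n)) emp) (sc emp)"
  proof (rule eqpI[of "%x. emp"])
   show "bij_betw (%x. emp) (el (ins (rst f (sc n)) emp)) (el (sc emp))" by (simp add: bij_betw_def)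
  qed (intro dfns)
  then show ?thesis using iff by (intro exI[of _ "ins (rst f (sc n)) emp"]) auto
 qed
 ultimately have "btree i T" unfolding btree_def by blast
 then show ?thesis unfolding eT by (intro exI[of _ T]) (auto simp: eT)
qed

lemma choice_family:
 assumes d: "dfn (%v. R (v 0) (v 1))" and ex: "!!x. x : el A ==> EX y. R x y"
 shows "EX F. cov A F & (ALL x:el A. EX y:el F. R x y) & (ALL y:el F. EX x:el A. R x y)"
proof -
 obtain g where g: "ALL x:el A. R x (ap g x)" using ac_class[OF d ex] by blast
 define F where "F = mk (ap g ` el A)"
 have eF: "el F = ap g ` el A" unfolding F_def by (rule el_mk[OF S_img[OF S_el dt_ap1]])
 then have "cov A F" unfolding cov_def by blast
 moreover have "ALL x:el A. EX y:el F. R x y" using g unfolding eF by blast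
 moreover have "ALL y:el F. EX x:el A. R x y" using g unfolding eF by blast
 ultimately show ?thesis by blast
qed

lemma cov_reals_seq: "cov (fs om (sc (sc emp))) (fs om om)"
proof -
 have "cov (fs om (sc (sc emp))) (pw om)"
 proof (rule covI[of "%f. mk {n : el om. ap f n = emp}"])
  show "dt (%v. mk {n : el om. ap (v 0) n = emp})"
   by (rule dt_mk, rule S_sub[OF S_el]) (auto intro!: dfns)
  show "el (pw om) <= (%f. mk {n : el om. ap f n = emp}) ` el (fs om (sc (sc emp)))"
  proof
   fix a assume a: "a : el (pw om)"
   define c where "c n = (if n : el a then emp else sc emp)" for n
   have dc: "dt (%v. c (v 0))" unfolding c_def by (intro dfns)
   have ne: "sc emp ~= emp" by (metis el_emp el_ins insert_not_empty)
   have "mk {n : el om. ap (lam om c) n = emp} = a"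
   proof -
    have "ap (lam om c) n = emp \<longleftrightarrow> n : el a" if "n : el om" for n
     unfolding ap_lam[OF dc that] using ne by (simp add: c_def)
    then have "{n : el om. ap (lam om c) n = emp} = el a" using a by auto
    then show ?thesis by (metis eqI el_mk S_el)
   qed
   moreover have "isf (lam om c) om (sc (sc emp))" by (rule isfI[OF dc]) (simp add: c_def)
   ultimately show "a : (%f. mk {n : el om. ap f n = emp}) ` el (fs om (sc (sc emp)))"
    by (intro image_eqI[of _ _ "lam om c"]) auto
  qed
 qed
 moreover have "cov (pw om) (pw (tms om om))" by (rule cov_pw[OF countable_square])
 moreover have "el (fs om om) <= el (pw (tms om om))"
 proof
  fix f assume "f : el (fs om om)"
  then have f: "isf f om om" by simp
  show "f : el (pw (tms om om))" using isf_in[OF f] by (auto simp: isf_el[OF f])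
 qed
 ultimately show ?thesis using cov_trans cov_sub by blast
qed

lemma locfam_reals:
 assumes i: "i : el om" shows "EX F. locfam i F & cov (fs om (sc (sc emp))) F"
proof -
 have sub: "isf f om om" if "isf f om (sc i)" for f using isf_mono[OF that] om_sub_om[OF sc_om[OF i]] by blast
 let ?R = "%f T. btree i T & (ALL n:el om. rst f n : el T)"
 have "EX F. cov (fs om (sc i)) F & (ALL f:el (fs om (sc i)). EX T:el F. ?R f T) & (ALL T:el F. EX f:el (fs om (sc i)). ?R f T)"
  by (rule choice_family, intro dfns) (use single_branch_tree sub in auto)
 then obtain F where F: "cov (fs om (sc i)) F" "ALL f:el (fs om (sc i)). EX T:el F. ?R f T"
  "ALL T:el F. EX f:el (fs om (sc i)). ?R f T" by blast
 have "el (fs om (sc i)) <= el (fs om om)" using sub by auto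
 then have "cov (fs om (sc (sc emp))) F" using cov_trans[OF cov_reals_seq cov_trans[OF cov_sub F(1)]] by blast
 moreover have "locfam i F" unfolding locfam_def
 proof (intro conjI allI impI ballI)
  show "btree i T" if "T : el F" for T using F(3) that by blast
  show "EX T:el F. isf f om om & (ALL n:el om. rst f n : el T)" if f: "isf f om (sc i)" for f
  proof -
   have "f : el (fs om (sc i))" using f by simp
   then obtain T where "T : el F" "?R f T" using F(2) by blast
   then show ?thesis using sub[OF f] by blast
  qed
 qed
 ultimately show ?thesis by blast
qed

text \<open>Predicted sets have exactly \<open>K\<close> elements. If \<open>x\<close> is not among
  the numbers below \<open>K\<close>, it replaces the last of them.\<close>

lemma subset_of_size_through:
 assumes K: "K : el om" "emp : el K" and x: "x : el om"
 shows "EX a. el a <= el om & eqp a K & x : el a"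
proof (cases "x : el K")
 case True then show ?thesis using om_sub_om[OF K(1)] eqp_refl by blast
next
 case False
 obtain m where m: "m : el om" "K = sc m" using om_cases[OF K(1)] K(2) by auto
 have xm: "x ~: el m" using False m(2) by auto
 have "eqp (ins x m) K"
 proof (rule eqpI[of "%z. if z = x then m else z"])
  show "bij_betw (%z. if z = x then m else z) (el (ins x m)) (el K)"
   unfolding bij_betw_def inj_on_def using xm mem_irrefl[of m] by (auto simp: m(2))
 qed (intro dfns)
 then show ?thesis using om_sub_om[OF m(1)] x by (intro exI[of _ "ins x m"]) auto
qed

text \<open>A predictor may disregard the past: at level \<open>n\<close> it constantly offers one
  set containing \<open>ap f n\<close>.\<close>

lemma predictor_of:
 assumes K: "K : el om" "emp : el K" and f: "isf f om om"
 shows "EX \<pi>. predictr K \<pi> & (ALL n:el om. EX a. pr (rst f n) a : el (ap \<pi> n) & ap f n : el a)"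
proof -
 define Y where "Y = mk {a. el a <= el om & eqp a K}"
 have "S {a. el a <= el om & eqp a K}" by (rule S_sub[OF S_el[of "pw om"]]) (auto simp: subset_iff intro!: dfns)
 then have eY: "el Y = {a. el a <= el om & eqp a K}" unfolding Y_def by (rule el_mk)
 let ?R = "%n p. isf p (fs n om) Y & (ALL t. isf t n om --> ap f n : el (ap p t))"
 have "EX \<pi>. fn \<pi> om & (ALL n:el om. ?R n (ap \<pi> n))"
 proof (rule ac_class, intro dfns)
  fix n assume n: "n : el om"
  obtain a where a: "el a <= el om" "eqp a K" "ap f n : el a" using subset_of_size_through[OF K isf_in[OF f n]] by blast
  have "isf (lam (fs n om) (%t. a)) (fs n om) Y" by (rule isfI, intro dfns) (use a eY in auto)
  moreover have "ap (lam (fs n om) (%t. a)) t = a" if "isf t n om" for t by (rule ap_lam, intro dfns) (use that in auto)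
  ultimately show "EX p. ?R n p" using a(3) by (intro exI[of _ "lam (fs n om) (%t. a)"]) auto
 qed
 then obtain \<pi> where \<pi>: "fn \<pi> om" "!!n. n : el om ==> ?R n (ap \<pi> n)" by blast
 have "predictr K \<pi>" unfolding predictr_def using \<pi> eY by blast
 moreover have "EX a. pr (rst f n) a : el (ap \<pi> n) & ap f n : el a" if n: "n : el om" for n
 proof -
  have r: "isf (rst f n) n om" by (rule rst_isf[OF f om_sub_om[OF n]])
  have p: "isf (ap \<pi> n) (fs n om) Y" using \<pi>(2)[OF n] by blast
  have "pr (rst f n) (ap (ap \<pi> n) (rst f n)) : el (ap \<pi> n)" using isf_mem[OF p] r by simp
  then show ?thesis using \<pi>(2)[OF n] r by blast
 qed
 ultimately show ?thesis by blast
qed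

lemma prdfam_reals:
 assumes K: "K : el om" "emp : el K" shows "EX F. prdfam K F & cov (fs om (sc (sc emp))) F"
proof -
 let ?R = "%f \<pi>. predictr K \<pi> & (ALL n:el om. EX a. pr (rst f n) a : el (ap \<pi> n) & ap f n : el a)"
 have "EX F. cov (fs om om) F & (ALL f:el (fs om om). EX \<pi>:el F. ?R f \<pi>) & (ALL \<pi>:el F. EX f:el (fs om om). ?R f \<pi>)"
  by (rule choice_family, intro dfns) (use predictor_of[OF K] in auto)
 then obtain F where F: "cov (fs om om) F" "ALL f:el (fs om om). EX \<pi>:el F. ?R f \<pi>"
  "ALL \<pi>:el F. EX f:el (fs om om). ?R f \<pi>" by blast
 have "prdfam K F" unfolding prdfam_def
 proof (intro conjI allI impI ballI)
  show "predictr K \<pi>" if "\<pi> : el F" for \<pi> using F(3) that by blast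
  show "EX \<pi>:el F. EX m:el om. ALL n:el om. m : el n --> (EX a. pr (rst f n) a : el (ap \<pi> n) & ap f n : el a)" if f: "isf f om om" for f
  proof -
   have "f : el (fs om om)" using f by simp
   then obtain \<pi> where "\<pi> : el F" "?R f \<pi>" using F(2) by blast
   then show ?thesis using zero_om by blast
  qed
 qed
 then show ?thesis using cov_trans[OF cov_reals_seq F(1)] by blast
qed

definition avoid :: "'a => 'a => 'a" where
 "avoid A j = mk {t : el (sq A). ALL m:el om. ALL n:el m. isf t m A --> ap t n ~= ap j (rst t n)}"

lemma S_avoid: "S {t : el (sq A). ALL m:el om. ALL n:el m. isf t m A --> ap t n ~= ap j (rst t n)}"
 by (rule S_sub[OF S_el[of "sq A"]], blast) (unfold mem_Collect_eq, intro dfns)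

lemma mem_avoid: assumes m: "m : el om" "isf t m A"
 shows "t : el (avoid A j) \<longleftrightarrow> (ALL n:el m. ap t n ~= ap j (rst t n))"
proof -
 have "el (avoid A j) = {t : el (sq A). ALL m:el om. ALL n:el m. isf t m A --> ap t n ~= ap j (rst t n)}"
  unfolding avoid_def by (rule el_mk[OF S_avoid])
 moreover have "m' = m" if "isf t m' A" for m' by (rule isf_dom_unique[OF that m(2)])
 moreover have "t : el (sq A)" using m by auto
 ultimately show ?thesis using m by blast
qed

lemma avoid_sq: "t : el (avoid A j) ==> EX m:el om. isf t m A"
 unfolding avoid_def el_mk[OF S_avoid] by simp

lemma dt_avoid [dfns]: "dt t ==> dt u ==> dt (%v. avoid (t v) (u v))"
 by (rule dt_comp2[where f=avoid, rotated], assumption+, unfold avoid_def, rule dt_mk, rule S_avoid, unfold mem_Collect_eq, intro dfns)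

lemma eqp_remove: "y : el (sc k) ==> eqp (df (sc k) (ins y emp)) k"
proof (rule eqpI[of "%z. if z = k then y else z"])
 assume y: "y : el (sc k)"
 have b: "bij_betw (%z. if z = k then y else z) (insert k K - {y}) K" if h: "k ~: K" "y : insert k K" for K
  by (rule bij_betw_byWitness[where f'="%z. if z = y then k else z"]) (use h in \<open>auto split: if_splits\<close>)
 show "bij_betw (%z. if z = k then y else z) (el (df (sc k) (ins y emp))) (el k)"
  using b[of "el k"] y by simp
qed (intro dfns)

text \<open>At a node \<open>t\<close> of the tree the sole value ruled out is
  \<open>ap j t\<close>, and removing one element of \<open>sc k\<close> leaves a set equinumerous
  with \<open>k\<close>.\<close>

lemma avoid_btree:
 assumes k: "k : el om" and j: "isf j (sq (sc k)) (sc k)"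
 shows "btree k (avoid (sc k) j)"
proof -
 let ?A = "sc k"
 let ?T = "avoid ?A j"
 have A: "el ?A <= el om" by (rule om_sub_om[OF sc_om[OF k]])
 have "tree_on ?T" unfolding tree_on_def
 proof (intro conjI ballI)
  fix t assume tT: "t : el ?T"
  then obtain n where n: "n : el om" "isf t n ?A" using avoid_sq by blast
  then show "EX n:el om. isf t n om" using isf_mono A by blast
  fix m assume m: "m : el om"
  show "rst t m : el ?T"
  proof (cases "el n <= el m")
   case True then show ?thesis using rst_all[OF n(2) True] tT by simp
  next
   case False
   then have mn: "el m <= el n" using om_linear[OF m n(1)] om_sub[OF n(1)] om_sub[OF m] by blast
   note r = rst_isf[OF n(2) mn]
   have "ap (rst t m) i ~= ap j (rst (rst t m) i)" if i: "i : el m" for i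
   proof -
    have "rst (rst t m) i = rst t i" by (rule rst_rst[OF n(2) mn om_sub[OF m i]])
    moreover have "ap t i ~= ap j (rst t i)" using mem_avoid[OF n] tT i mn by blast
    ultimately show ?thesis using ap_rst[OF n(2) mn i] by simp
   qed
   then show ?thesis using mem_avoid[OF m r] by blast
  qed
 qed
 moreover have "EX s. el s = {u. next_node ?T t u} & (eqp s (sc emp) | eqp s k)" if t: "t : el ?T" for t
 proof -
  obtain n where n: "n : el om" "isf t n ?A" using t avoid_sq by blast
  have t': "isf t n om" by (rule isf_mono[OF n(2) A])
  have tj: "ap j t : el ?A" by (rule isf_in[OF j]) (use n in auto)
  let ?D = "df ?A (ins (ap j t) emp)"
  define s where "s = mk ((%x. ins (pr n x) t) ` el ?D)"
  have es: "el s = (%x. ins (pr n x) t) ` el ?D" unfolding s_def by (rule el_mk, rule S_img[OF S_el], intro dfns)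
  have mem: "ins (pr n x) t : el ?T \<longleftrightarrow> x ~= ap j t" if x: "x : el ?A" for x
  proof -
   note e = isf_extend[OF n(2) mem_irrefl x]
   have "rst (ins (pr n x) t) i = rst t i" if i: "i : el n" for i
   proof -
    have "rst (rst (ins (pr n x) t) n) i = rst (ins (pr n x) t) i" by (rule rst_rst[OF e(1)]) (use om_sub[OF n(1) i] in auto)
    then show ?thesis using rst_ins[OF n(2)] by simp
   qed
   moreover have "ap t i ~= ap j (rst t i)" if "i : el n" for i using mem_avoid[OF n] t that by blast
   ultimately show ?thesis using mem_avoid[OF sc_om[OF n(1)] e(1)] e(2,3) rst_ins[OF n(2)] by auto
  qed
  have "el s = {u. next_node ?T t u}"
  proof (intro set_eqI iffI)
   fix u assume "u : el s"
   then obtain x where "x : el ?A" "x ~= ap j t" "u = ins (pr n x) t" unfolding es by auto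
   then show "u : {u. next_node ?T t u}" using mem A next_node_iff[OF n(1) t'] by blast
  next
   fix u assume "u : {u. next_node ?T t u}"
   then obtain x where x: "u : el ?T" "x : el om" "u = ins (pr n x) t" using next_node_iff[OF n(1) t'] by blast
   obtain m where m: "m : el om" "isf u m ?A" using avoid_sq[OF x(1)] by blast
   note e = isf_extend[OF t' mem_irrefl x(2)]
   have "m = sc n" using isf_dom_unique m(2) e(1) x(3) by blast
   then have "ap u n : el ?A" using isf_in[OF m(2), of n] by simp
   then have xA: "x : el ?A" using e(2) x(3) by simp
   then have "x ~= ap j t" using mem x by blast
   then show "u : el s" unfolding es using xA x(3) by auto
  qed
  moreover have "eqp s k"
  proof -
   have "eqp ?D s" by (rule eqpI[of "%x. ins (pr n x) t"], intro dfns) (use ins_inject[OF n(2)] es in \<open>auto simp: bij_betw_def inj_on_def\<close>)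
   then show ?thesis using eqp_trans[OF eqp_sym eqp_remove[OF tj]] by blast
  qed
  ultimately show ?thesis by blast
 qed
 ultimately show ?thesis unfolding btree_def by blast
qed

lemma branch_avoid:
 assumes f: "isf f om A" and n: "n : el om" and ne: "!!m. m : el om ==> ap f m ~= ap j (lam m (ap f))"
 shows "rst f n : el (avoid A j)"
proof -
 have s: "el n <= el om" by (rule om_sub_om[OF n])
 have "ap (rst f n) i ~= ap j (rst (rst f n) i)" if i: "i : el n" for i
 proof -
  have "rst (rst f n) i = lam i (ap f)"
   using rst_rst[OF f s om_sub[OF n i]] rst_lam[OF f om_sub_om[OF om_elem[OF n i]]] by simp
  then show ?thesis using ap_rst[OF f s i] ne[OF om_elem[OF n i]] by simp
 qed
 then show ?thesis using mem_avoid[OF n rst_isf[OF f s]] by blast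
qed

lemma cov_om_sq: "cov om (sq om)"
proof -
 have c: "cov om (fs n om)" if "n : el om" for n
 proof (rule om_induct[OF that])
  show "dfn (%v. cov om (fs (v 0) om))" by (intro dfns)
  have "el (fs emp om) <= {emp}" using isf_el eqI[of _ emp] by auto
  moreover have "{emp} <= (%x. emp) ` el om" using zero_om by blast
  ultimately show "cov om (fs emp om)" by (intro covI[of "%x. emp"], intro dfns) blast
  fix n assume n: "n : el om" "cov om (fs n om)"
  have "cov (tms (fs n om) om) (fs (sc n) om)"
  proof (rule covI[of "%z. ins (pr n (snd' z)) (fst' z)"], intro dfns, rule subsetI)
   fix u assume "u : el (fs (sc n) om)"
   then have u: "isf u (sc n) om" by simp
   have "isf (rst u n) n om" by (rule rst_isf[OF u]) auto
   moreover have "ap u n : el om" by (rule isf_in[OF u]) simp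
   moreover have "rst u (sc n) = ins (pr n (ap u n)) (rst u n)" by (rule rst_sc[OF u]) simp
   then have "u = ins (pr n (ap u n)) (rst u n)" using rst_all[OF u subset_refl] by simp
   ultimately show "u : (%z. ins (pr n (snd' z)) (fst' z)) ` el (tms (fs n om) om)"
    by (intro image_eqI[of _ _ "pr (rst u n) (ap u n)"]) auto
  qed
  then show "cov om (fs (sc n) om)" using cov_trans[OF countable_square cov_trans[OF cov_tms[OF n(2) cov_refl]]] by blast
 qed
 have "cov (tms om om) (mk (UN n:el om. el (fs n om)))" by (rule cov_UN) (intro dfns, rule c)
 moreover have "mk (UN n:el om. el (fs n om)) = sq om"
 proof (rule eqI)
  have "S (UN n:el om. el (fs n om))" by (rule S_UN[OF S_el], intro dfns)
  then have "el (mk (UN n:el om. el (fs n om))) = (UN n:el om. el (fs n om))" by (rule el_mk)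
  then show "el (mk (UN n:el om. el (fs n om))) = el (sq om)" by auto
 qed
 ultimately show ?thesis using cov_trans[OF countable_square] by simp
qed

lemma leastcard_ex:
 assumes d: "dfn (%v. Q (v 0))" and F: "Q F" "Card c" "eqp F c"
 shows "EX a. leastcard Q a & (a : el c | a = c)"
proof -
 let ?Q = "%c. Card c & (EX F. Q F & eqp F c)"
 have Ord: "Ord c" if "Card c" for c using that unfolding Card_def by blast
 have dQ: "dfn (%v. Q (t v))" if "dt t" for t by (rule dfn_comp1[where P=Q]) (use d that in auto)
 have "dfn (%v. ?Q (v 0))" by (intro dfns dQ)
 then obtain a where a: "Ord a" "?Q a" "ALL b. Ord b --> ?Q b --> el a <= el b"
  using Ord_least[of ?Q c] F Ord by blast
 have "a : el b | a = b" if "Q F" "Card b" "eqp F b" for F b using a that Ord[of b] Ord_sub_mem[of a b] by blast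
 then show ?thesis unfolding leastcard_def using a(2) F by blast
qed

end

section \<open>Values of the invariants in the extension\<close>

context silver_ext
begin

lemma vc_sq: "N.sq (vc A) = vc (sq A)"
proof (rule N.eqI, intro set_eqI iffI)
 fix t assume "t : N.el (N.sq (vc A))"
 then obtain n where n: "n : el om" "N.isf t (vc n) (vc A)" by (auto simp: vc_om N_el_vc)
 then obtain u where "isf u n A" "t = vc u" using ground_sequence by blast
 then show "t : N.el (vc (sq A))" using n(1) by (auto simp: N_el_vc)
next
 fix t assume "t : N.el (vc (sq A))"
 then obtain u n where "n : el om" "isf u n A" "t = vc u" by (auto simp: N_el_vc)
 then show "t : N.el (N.sq (vc A))" using vc_isf(1) by (auto simp: vc_om N_el_vc)
qed

text \<open>A choice of solutions is turned into a name with ground model domain and range, the form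
  in which \<open>hit_value\<close> and \<open>escape_prediction\<close> accept it. Where no
  solution exists, an arbitrary value is allowed; the element \<open>y\<close> guarantees that there
  is one.\<close>

lemma choose_values:
 assumes dR: "N.dfn (%v. R (v 0) (v 1))" and y: "y : el V"
 shows "EX \<gamma>. N.isf (val \<gamma>) (vc A) (vc V) &
  (ALL z:N.el (vc A). (EX y:N.el (vc V). R z y) --> R z (N.ap (val \<gamma>) z))"
proof -
 let ?Q = "%z y. y : N.el (vc V) & ((EX y':N.el (vc V). R z y') --> R z y)"
 have dR': "N.dfn (%v. R (t v) (u v))" if "N.dt t" "N.dt u" for t u
  by (rule N.dfn_comp2[where P=R]) (use dR that in auto)
 have "EX g. N.fn g (vc A) & (ALL z:N.el (vc A). ?Q z (N.ap g z))"
 proof (rule N.ac_class)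
  show "N.dfn (%v. ?Q (v 0) (v 1))" by (intro dfns dR')
  have "vc y : N.el (vc V)" using y by simp
  then show "EX y. ?Q z y" for z by blast
 qed
 then obtain g where g: "N.fn g (vc A)" "ALL z:N.el (vc A). ?Q z (N.ap g z)" by blast
 obtain \<gamma> where "g = val \<gamma>" by (rule val_cases)
 moreover have "N.isf g (vc A) (vc V)" using g unfolding N.isf_def N.fn_def by blast
 ultimately show ?thesis using g(2) by blast
qed

text \<open>For a tree with index \<open>\<xi>\<close> and a node, \<open>\<gamma>\<close> names a
  value by which the node leaves the tree; it exists among the \<open>k = i + 1\<close> values by
  \<open>btree_not_full\<close>. A fresh column yields one function that takes the named value at
  some node for every \<open>\<xi>\<close>, so it is a branch of none of the trees.\<close>

lemma not_locfam:
 assumes no: "~ cov B JJ" and F: "N.cov (vc B) F" and i: "k = sc i" "i : el om" "emp : el i"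
 shows "~ N.locfam (vc i) F"
proof
 assume loc: "N.locfam (vc i) F"
 obtain h where h: "N.el F <= N.ap h ` N.el (vc B)" using F unfolding N.cov_def by blast
 let ?R = "%z y. ALL n:N.el N.om. N.isf (N.snd' z) n N.om --> N.ins (N.pr n y) (N.snd' z) ~: N.el (N.ap h (N.fst' z))"
 have k0: "emp : el k" using i by simp
 have dR: "N.dfn (%v. ?R (v 0) (v 1))" by (intro dfns)
 obtain \<gamma> where g: "N.isf (val \<gamma>) (vc (tms B (sq k))) (vc k)"
  and gR: "!!z. z : N.el (vc (tms B (sq k))) ==> EX y:N.el (vc k). ?R z y ==> ?R z (N.ap (val \<gamma>) z)"
  using choose_values[OF dR k0, of "tms B (sq k)"] by blast
 obtain \<alpha> where x: "N.isf (xr \<alpha> emp) (vc om) (vc k)" and hit: "ALL \<xi>:el B. EX n:el om.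
  N.ap (xr \<alpha> emp) (vc n) = N.ap (val \<gamma>) (N.pr (vc \<xi>) (N.lam (vc n) (N.ap (xr \<alpha> emp))))" using hit_value[OF no g] by blast
 define x where "x = xr \<alpha> emp"
 have xf: "N.isf x N.om (N.sc (vc i))" using x unfolding x_def vc_om i(1) vc_ins .
 obtain T where T: "T : N.el F" "N.isf x N.om N.om" "ALL n:N.el N.om. N.rst x n : N.el T" using loc xf unfolding N.locfam_def by blast
 have "T : N.ap h ` N.el (vc B)" using T(1) h by blast
 then obtain \<xi> where \<xi>: "\<xi> : el B" "T = N.ap h (vc \<xi>)" unfolding N_el_vc by blast
 obtain n where n: "n : el om" "N.ap x (vc n) = N.ap (val \<gamma>) (N.pr (vc \<xi>) (N.lam (vc n) (N.ap x)))" using hit \<xi>(1) unfolding x_def by blast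
 have nN: "vc n : N.el N.om" using n(1) unfolding vc_om by simp
 have ns: "N.el (vc n) <= N.el N.om" by (rule N.om_sub_om[OF nN])
 define t where "t = N.rst x (vc n)"
 have tl: "t = N.lam (vc n) (N.ap x)" unfolding t_def by (rule N.rst_lam[OF xf ns])
 have tf: "N.isf t (vc n) N.om" unfolding t_def by (rule N.rst_isf[OF T(2) ns])
 have "N.isf t (vc n) (vc k)" unfolding t_def i(1) vc_ins by (rule N.rst_isf[OF xf ns])
 then obtain u where u: "isf u n k" "t = vc u" using ground_sequence[OF n(1)] by blast
 let ?z = "N.pr (vc \<xi>) t"
 have "pr \<xi> u : el (tms B (sq k))" using \<xi>(1) u(1) n(1) by auto
 then have zD: "?z : N.el (vc (tms B (sq k)))" unfolding u(2) vc_pr[symmetric] by simp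
 have tT: "t : N.el T" unfolding t_def using T(3) nN by blast
 have iN: "vc i : N.el N.om" "N.emp : N.el (vc i)" using i(2,3) unfolding vc_om vc_emp[symmetric] by simp_all
 have "N.btree (vc i) T" using loc T(1) unfolding N.locfam_def by blast
 then obtain y where y: "y : N.el (N.sc (vc i))" "N.ins (N.pr (vc n) y) t ~: N.el T"
  using N.btree_not_full[OF _ tT nN tf iN] by blast
 have "?R ?z y"
 proof (intro ballI impI)
  fix m assume "m : N.el N.om" "N.isf (N.snd' ?z) m N.om"
  then have "m = vc n" using N.isf_dom_unique[OF _ tf] by simp
  then show "N.ins (N.pr m y) (N.snd' ?z) ~: N.el (N.ap h (N.fst' ?z))" using y(2) \<xi>(2) by simp
 qed
 moreover have "y : N.el (vc k)" using y(1) unfolding i(1) vc_ins .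
 ultimately have "?R ?z (N.ap (val \<gamma>) ?z)" using gR[OF zD] by blast
 then have "N.isf (N.snd' ?z) (vc n) N.om --> N.ins (N.pr (vc n) (N.ap (val \<gamma>) ?z)) (N.snd' ?z) ~: N.el (N.ap h (N.fst' ?z))" using nN by blast
 then have "N.ins (N.pr (vc n) (N.ap x (vc n))) t ~: N.el T" using tf n(2) \<xi>(2) tl by simp
 moreover have "N.rst x (N.sc (vc n)) = N.ins (N.pr (vc n) (N.ap x (vc n))) t" unfolding t_def by (rule N.rst_sc[OF T(2) nN])
 ultimately show False using T(3) N.sc_om[OF nN] by metis
qed

text \<open>For a predictor with index \<open>\<xi>\<close> and a node, \<open>\<gamma>\<close>
  names an enumeration of the \<open>K\<close> predicted numbers. Being a finite sequence of old
  numbers, the enumeration belongs to the ground model, as \<open>escape_prediction\<close> demands.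
  The function obtained misses all of them at arbitrarily late levels.\<close>

lemma not_prdfam:
 assumes no: "~ cov B JJ" and F: "N.cov (vc B) F" and K: "K : el om"
 shows "~ N.prdfam (vc K) F"
proof
 assume loc: "N.prdfam (vc K) F"
 obtain h where h: "N.el F <= N.ap h ` N.el (vc B)" using F unfolding N.cov_def by blast
 let ?R = "%z y. ALL n:N.el N.om. ALL a. N.isf (N.snd' z) n N.om --> N.pr (N.snd' z) a : N.el (N.ap (N.ap h (N.fst' z)) n) -->
  (ALL c:N.el a. EX j:N.el (vc K). c = N.ap y j)"
 have dR: "N.dfn (%v. ?R (v 0) (v 1))" by (intro dfns)
 have "isf (lam K (%x. emp)) K om" by (rule isfI, intro dfns) (rule zero_om)
 then have V0: "lam K (%x. emp) : el (fs K om)" by simp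
 obtain \<gamma> where g: "N.isf (val \<gamma>) (vc (tms B (sq om))) (vc (fs K om))"
  and gR: "!!z. z : N.el (vc (tms B (sq om))) ==> EX y:N.el (vc (fs K om)). ?R z y ==> ?R z (N.ap (val \<gamma>) z)"
  using choose_values[OF dR V0, of "tms B (sq om)"] by blast
 obtain x where x: "N.isf x N.om N.om" and esc: "ALL \<xi>:el B. ALL m:el om. EX n:el om. m : el n &
  (ALL i:el K. N.ap x (vc n) ~= N.ap (N.ap (val \<gamma>) (N.pr (vc \<xi>) (N.lam (vc n) (N.ap x)))) (vc i))"
  using escape_prediction[OF no g K] unfolding vc_om by blast
 obtain \<pi> m' where \<pi>: "\<pi> : N.el F" and m': "m' : N.el N.om" and pred: "ALL n:N.el N.om. m' : N.el n -->
  (EX a. N.pr (N.rst x n) a : N.el (N.ap \<pi> n) & N.ap x n : N.el a)" using loc x unfolding N.prdfam_def by blast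
 have "\<pi> : N.ap h ` N.el (vc B)" using \<pi> h by blast
 then obtain \<xi> where \<xi>: "\<xi> : el B" "\<pi> = N.ap h (vc \<xi>)" unfolding N_el_vc by blast
 obtain m where m: "m : el om" "m' = vc m" using m' unfolding vc_om N_el_vc by blast
 obtain n where n: "n : el om" "m : el n"
  "ALL i:el K. N.ap x (vc n) ~= N.ap (N.ap (val \<gamma>) (N.pr (vc \<xi>) (N.lam (vc n) (N.ap x)))) (vc i)" using esc \<xi>(1) m(1) by blast
 have nN: "vc n : N.el N.om" using n(1) unfolding vc_om by simp
 have ns: "N.el (vc n) <= N.el N.om" by (rule N.om_sub_om[OF nN])
 define t where "t = N.rst x (vc n)"
 have tl: "t = N.lam (vc n) (N.ap x)" unfolding t_def by (rule N.rst_lam[OF x ns])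
 have tf: "N.isf t (vc n) N.om" unfolding t_def by (rule N.rst_isf[OF x ns])
 obtain u where u: "isf u n om" "t = vc u" using ground_sequence[OF n(1)] tf unfolding vc_om by blast
 let ?z = "N.pr (vc \<xi>) t"
 have "pr \<xi> u : el (tms B (sq om))" using \<xi>(1) u(1) n(1) by auto
 then have zD: "?z : N.el (vc (tms B (sq om)))" unfolding u(2) vc_pr[symmetric] by simp
 have "m' : N.el (vc n)" using n(2) m(2) by simp
 then obtain a where a: "N.pr t a : N.el (N.ap \<pi> (vc n))" "N.ap x (vc n) : N.el a" using pred nN unfolding t_def by blast
 have "N.predictr (vc K) \<pi>" using loc \<pi> unfolding N.prdfam_def by blast
 then obtain Y where Y: "N.el Y = {a. N.el a <= N.el N.om & N.eqp a (vc K)}" "N.isf (N.ap \<pi> (vc n)) (N.fs (vc n) N.om) Y"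
  using nN unfolding N.predictr_def by blast
 have at: "a = N.ap (N.ap \<pi> (vc n)) t" using N.isf_mem[OF Y(2)] a(1) by blast
 have "t : N.el (N.fs (vc n) N.om)" using tf by simp
 then have "a : N.el Y" unfolding at by (rule N.isf_in[OF Y(2)])
 then have aY: "N.el a <= N.el N.om" "N.eqp a (vc K)" using Y(1) by blast+
 obtain e where e: "N.isf e (vc K) a" "bij_betw (N.ap e) (N.el (vc K)) (N.el a)" using N.eqp_sym[OF aY(2)] unfolding N.eqp_def by blast
 have "N.isf e (vc K) (vc om)" using N.isf_mono[OF e(1) aY(1)] unfolding vc_om .
 then obtain e' where e': "isf e' K om" "e = vc e'" using ground_sequence[OF K] by blast
 have eV: "e : N.el (vc (fs K om))" using e' by simp
 have "?R ?z e"
 proof (intro ballI allI impI)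
  fix m b c assume "m : N.el N.om" "N.isf (N.snd' ?z) m N.om" and b: "N.pr (N.snd' ?z) b : N.el (N.ap (N.ap h (N.fst' ?z)) m)" and c: "c : N.el b"
  then have "m = vc n" using N.isf_dom_unique[OF _ tf] by simp
  then have "N.pr t b : N.el (N.ap \<pi> (vc n))" using b \<xi>(2) by simp
  then have "b = a" using N.isf_mem[OF Y(2)] at by blast
  then show "EX j:N.el (vc K). c = N.ap e j" using c e(2) unfolding bij_betw_def by blast
 qed
 then have "?R ?z (N.ap (val \<gamma>) ?z)" using gR[OF zD] eV by blast
 then have "N.isf (N.snd' ?z) (vc n) N.om --> N.pr (N.snd' ?z) a : N.el (N.ap (N.ap h (N.fst' ?z)) (vc n)) -->
  (ALL c:N.el a. EX j:N.el (vc K). c = N.ap (N.ap (val \<gamma>) ?z) j)" using nN by blast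
 then have "ALL c:N.el a. EX j:N.el (vc K). c = N.ap (N.ap (val \<gamma>) ?z) j" using tf a(1) \<xi>(2) by simp
 then obtain j where "j : N.el (vc K)" "N.ap x (vc n) = N.ap (N.ap (val \<gamma>) ?z) j" using a(2) by blast
 then show False using n(3) tl unfolding N_el_vc by blast
qed

abbreviation reals :: 'b where "reals == N.fs N.om (N.sc (N.sc N.emp))"

lemma vc_two: "vc two = N.sc (N.sc N.emp)" by (simp add: two_def vc_ins vc_emp)

lemma cov_reals: "N.cov (vc JJ) reals" using reals_covered unfolding vc_two .

lemma N_card_Ord: "N.Card c ==> N.Ord c" unfolding N.Card_def by blast

text \<open>The continuum of the extension is at most the ground model cardinal of
  \<open>JJ\<close>, so a smaller ordinal is the check name value of some \<open>B\<close>. If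
  \<open>B\<close> covered \<open>JJ\<close>, it would cover the reals of the extension and be no
  smaller than the continuum.\<close>

lemma below_continuum:
 assumes \<theta>: "N.Card \<theta>" "N.eqp reals \<theta>" and b: "b : N.el \<theta>"
 shows "EX B. b = vc B & ~ cov B JJ"
proof -
 have c: "N.cov X \<theta>" if "N.cov X (vc JJ)" for X
  using N.cov_trans[OF that N.cov_trans[OF cov_reals N.eqp_cov[OF \<theta>(2)]]] .
 obtain \<mu> where \<mu>: "Card \<mu>" "eqp JJ \<mu>" using card_ex by blast
 have "Ord \<mu>" using \<mu>(1) unfolding Card_def by blast
 then have "N.Ord (vc \<mu>)" by (rule N_Ord_vc)
 moreover have "N.cov (vc \<mu>) \<theta>" using c[OF vc_cov[OF eqp_cov[OF eqp_sym[OF \<mu>(2)]]]] .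
 ultimately have "N.el \<theta> <= N.el (vc \<mu>)" using N.Card_cov[OF \<theta>(1)] by blast
 then obtain B where B: "b = vc B" using b unfolding N_el_vc by blast
 have "~ cov B JJ"
 proof
  assume "cov B JJ"
  then have "N.cov b \<theta>" using c vc_cov B by blast
  moreover have "N.Ord b" using N.Ord_elem[OF N_card_Ord[OF \<theta>(1)] b] .
  ultimately have "N.el \<theta> <= N.el b" using N.Card_cov[OF \<theta>(1)] by blast
  then show False using b N.mem_irrefl by blast
 qed
 then show ?thesis using B by blast
qed

text \<open>A family smaller than the continuum is covered by an old set that does not cover
  \<open>JJ\<close>, which \<open>no\<close> rules out; a family covered by the reals gives the
  other inequality. This serves trees and predictors alike.\<close>

lemma leastcard_continuum:
 assumes \<theta>: "N.Card \<theta>" "N.eqp reals \<theta>" and no: "!!B F. ~ cov B JJ ==> N.cov (vc B) F ==> ~ Q F"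
  and F: "Q F" "N.cov reals F"
 shows "N.leastcard Q \<theta>"
proof -
 have low: "~ b : N.el \<theta>" if "Q F" "N.eqp F b" for F b
 proof
  assume "b : N.el \<theta>"
  then obtain B where "b = vc B" "~ cov B JJ" using below_continuum[OF \<theta>] by blast
  then show False using no[of B F] that N.eqp_cov[OF N.eqp_sym] by blast
 qed
 obtain c where c: "N.Card c" "N.eqp F c" using N.card_ex by blast
 have "N.cov \<theta> c" using N.cov_trans[OF N.eqp_cov[OF N.eqp_sym[OF \<theta>(2)]] N.cov_trans[OF F(2) N.eqp_cov[OF c(2)]]] .
 then have "N.el c <= N.el \<theta>" using N.Card_cov[OF c(1) N_card_Ord[OF \<theta>(1)]] by blast
 then have "c = \<theta>" using N.Ord_sub_mem[OF N_card_Ord[OF c(1)] N_card_Ord[OF \<theta>(1)]] low[OF F(1) c(2)] by blast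
 moreover have "\<theta> : N.el b | \<theta> = b" if "Q F" "N.Card b" "N.eqp F b" for F b
  using N.Ord_linear[OF N_card_Ord[OF \<theta>(1)] N_card_Ord[OF that(2)]] low that by blast
 ultimately show ?thesis unfolding N.leastcard_def using F(1) c by blast
qed

text \<open>The trees are indexed by the old functions on \<open>sq (sc k)\<close>, a countable set,
  and these are covered by the ground model reals.\<close>

lemma ground_locfam: "EX F. N.locfam (vc k) F & N.cov (vc RR) F"
proof -
 let ?J = "vc (fs (sq (sc k)) (sc k))"
 have kN: "vc k : N.el N.om" using k_om unfolding vc_om by simp
 define F where "F = N.mk ((%j. N.avoid (vc (sc k)) j) ` N.el ?J)"
 have eF: "N.el F = (%j. N.avoid (vc (sc k)) j) ` N.el ?J"
  unfolding F_def by (rule N.el_mk, rule N.S_img[OF N.S_el], intro dfns)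
 have "cov RR (fs (sq (sc k)) (sc k))"
 proof -
  have ks: "el (sc k) <= el om" by (rule om_sub_om[OF sc_om[OF k_om]])
  have "cov om (sq (sc k))" using cov_trans[OF cov_om_sq cov_sub[OF sq_mono[OF ks]]] .
  then have "cov om (tms (sq (sc k)) (sc k))" using cov_trans[OF countable_square cov_tms[OF _ cov_sub[OF ks]]] by blast
  then have "cov RR (pw (tms (sq (sc k)) (sc k)))" unfolding RR_def by (rule cov_pw)
  moreover have "el (fs (sq (sc k)) (sc k)) <= el (pw (tms (sq (sc k)) (sc k)))"
  proof
   fix f assume "f : el (fs (sq (sc k)) (sc k))"
   then have f: "isf f (sq (sc k)) (sc k)" by simp
   have "el f <= el (tms (sq (sc k)) (sc k))"
   proof
    fix z assume "z : el f"
    then obtain x where "x : el (sq (sc k))" "z = pr x (ap f x)" unfolding isf_el[OF f] by blast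
    then show "z : el (tms (sq (sc k)) (sc k))" unfolding el_tms using isf_in[OF f] by blast
   qed
   then show "f : el (pw (tms (sq (sc k)) (sc k)))" unfolding el_pw by blast
  qed
  ultimately show ?thesis using cov_trans cov_sub by blast
 qed
 moreover have "N.cov ?J F" by (rule N.covI[of "%j. N.avoid (vc (sc k)) j"], intro dfns) (simp add: eF)
 ultimately have "N.cov (vc RR) F" using N.cov_trans vc_cov by blast
 moreover have "N.locfam (vc k) F" unfolding N.locfam_def
 proof (intro conjI allI impI ballI)
  fix T assume "T : N.el F"
  then obtain j where j: "isf j (sq (sc k)) (sc k)" "T = N.avoid (vc (sc k)) (vc j)" unfolding eF N_el_vc by auto
  have "N.isf (vc j) (N.sq (N.sc (vc k))) (N.sc (vc k))" using vc_isf(1)[OF j(1)] unfolding vc_sq[symmetric] vc_ins .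
  then show "N.btree (vc k) T" unfolding j(2) vc_ins by (rule N.avoid_btree[OF kN])
 next
  fix f assume "N.isf f N.om (N.sc (vc k))"
  then have f: "N.isf f (vc om) (vc (sc k))" unfolding vc_om vc_ins .
  then obtain j where j: "isf j (sq (sc k)) (sc k)" "ALL n:el om. N.ap f (vc n) ~= N.ap (vc j) (N.lam (vc n) (N.ap f))"
   using ground_localization by blast
  have "N.rst f n : N.el (N.avoid (vc (sc k)) (vc j))" if n: "n : N.el N.om" for n
  proof (rule N.branch_avoid[OF _ n])
   show "N.isf f N.om (vc (sc k))" using f unfolding vc_om .
   show "N.ap f m ~= N.ap (vc j) (N.lam m (N.ap f))" if "m : N.el N.om" for m using that j(2) unfolding vc_om N_el_vc by blast
  qed
  moreover have "N.avoid (vc (sc k)) (vc j) : N.el F" unfolding eF using j(1) by (intro imageI) simp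
  moreover have "N.isf f N.om N.om"
   by (rule N.isf_mono[OF _ N.om_sub_om[OF N.sc_om[OF kN]]]) (use f in \<open>simp add: vc_om vc_ins\<close>)
  ultimately show "EX T:N.el F. N.isf f N.om N.om & (ALL n:N.el N.om. N.rst f n : N.el T)" by blast
 qed
 ultimately show ?thesis by blast
qed

theorem invariants:
 assumes i: "k = sc i" "i : el om" "emp : el i" and K: "K : el om" "emp : el K"
 shows "EX a b. N.leastcard (N.locfam (vc k)) a & N.leastcard (N.locfam (vc i)) b &
  N.leastcard (N.prdfam (vc K)) b & N.Card b & N.eqp reals b & a : N.el b"
proof -
 obtain \<theta> where \<theta>: "N.Card \<theta>" "N.eqp reals \<theta>" using N.card_ex by blast
 have iN: "vc i : N.el N.om" using i(2) unfolding vc_om by simp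
 have KN: "vc K : N.el N.om" "N.emp : N.el (vc K)" using K unfolding vc_om vc_emp[symmetric] by simp_all
 obtain F where F: "N.locfam (vc i) F" "N.cov reals F" using N.locfam_reals[OF iN] by blast
 have L: "N.leastcard (N.locfam (vc i)) \<theta>" by (rule leastcard_continuum[where Q="N.locfam (vc i)", OF \<theta> not_locfam[OF _ _ i] F])
 obtain F' where F': "N.prdfam (vc K) F'" "N.cov reals F'" using N.prdfam_reals[OF KN] by blast
 have v: "N.leastcard (N.prdfam (vc K)) \<theta>" by (rule leastcard_continuum[where Q="N.prdfam (vc K)", OF \<theta> not_prdfam[OF _ _ K(1)] F'])
 obtain H where H: "N.locfam (vc k) H" "N.cov (vc RR) H" using ground_locfam by blast
 obtain c where c: "N.Card c" "N.eqp H c" using N.card_ex by blast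
 \<comment> \<open>Otherwise the ground model reals would cover the continuum of the extension and
   with it the localizing family \<open>F\<close> for \<open>i\<close>. But \<open>RR\<close> does
   not cover its power set \<open>JJ\<close>, so \<open>not_locfam\<close> forbids this.\<close>
 have "c : N.el \<theta>"
 proof (rule ccontr)
  assume "c ~: N.el \<theta>"
  then have "\<theta> : N.el c | \<theta> = c" using N.Ord_linear[OF N_card_Ord[OF c(1)] N_card_Ord[OF \<theta>(1)]] by blast
  then have "N.el \<theta> <= N.el c" using N_card_Ord[OF c(1)] unfolding N.Ord_def by blast
  then have "N.cov (vc RR) \<theta>" using N.cov_trans[OF N.cov_trans[OF H(2) N.eqp_cov[OF c(2)]] N.cov_sub] by blast
  then have "N.cov (vc RR) F" using N.cov_trans[OF N.cov_trans[OF _ N.eqp_cov[OF N.eqp_sym[OF \<theta>(2)]]] F(2)] by blast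
  moreover have "~ cov RR JJ" unfolding JJ_def by (rule cantor)
  ultimately show False using not_locfam[OF _ _ i] F(1) by blast
 qed
 moreover obtain a where a: "N.leastcard (N.locfam (vc k)) a" "a : N.el c | a = c"
  using N.leastcard_ex[of "N.locfam (vc k)", OF N.dfn_locfam[OF N.dt_const N.dt_proj] H(1) c] by blast
 ultimately have "a : N.el \<theta>" using N_card_Ord[OF \<theta>(1)] unfolding N.Ord_def by blast
 then show ?thesis using L v a(1) \<theta> by blast
qed

end

context zf
begin

lemma num_om: "num n : el om" by (induction n) (simp_all add: zero_om sc_om del: el_ins)

lemma num_mem: "m < n ==> num m : el (num n)" by (induction n) (auto simp: less_Suc_eq)

end

context silver_ext
begin

lemma N_num: "N.num n = vc (num n)" by (induction n) (simp_all add: vc_emp vc_ins)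

lemma invariants_sentence_holds:
 assumes s: "2 \<le> s" and k: "k = num (Suc s)"
 shows "sat (=) EN u (invariants_sentence s)"
 unfolding N.sat_invariants_sentence
proof (intro ballI impI)
 fix K' assume "K' : N.el N.om" and two: "N.el (N.num 2) <= N.el K'"
 then obtain K where K: "K : el om" "K' = vc K" unfolding vc_om N_el_vc by blast
 have "vc emp : N.el (N.num 2)" using num_mem[of 0 2] unfolding N_num by simp
 then have "emp : el K" using two K(2) by auto
 moreover have "emp : el (num s)" using num_mem[of 0 s] s by simp
 moreover have "k = sc (num s)" unfolding k by simp
 ultimately have "EX a b. N.leastcard (N.locfam (vc k)) a & N.leastcard (N.locfam (vc (num s))) b &
   N.leastcard (N.prdfam (vc K)) b & N.Card b & N.eqp reals b & a : N.el b"
  using invariants[OF _ num_om _ K(1)] by blast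
 moreover have "N.num (s + 1) = vc k" unfolding N_num k by simp
 moreover have "N.num 2 = N.sc (N.sc N.emp)" by (simp add: numeral_2_eq_2)
 ultimately show "EX a b. N.leastcard (N.locfam (N.num (s + 1))) a & N.leastcard (N.locfam (N.num s)) b &
   N.leastcard (N.prdfam K') b & N.Card b & N.eqp (N.fs N.om (N.num 2)) b & a : N.el b"
  unfolding K(2) N_num[of s] by simp
qed

end

section \<open>Constructing the extension and concluding consistency\<close>

section \<open>Generic filters over countable models\<close>

text \<open>The universe of the model is \<open>nat\<close>, so its elements enumerate all its sets,
  in particular all dense ones. Step \<open>n\<close> moves into \<open>el n\<close> whenever some
  extension allows it.\<close>

lemma generic_filter:
 fixes E :: "nat => nat => bool"
 assumes "forcing E P"
 shows "EX G. G <= zf.el E P & zf.emp E : G &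
  (ALL p q. p : G --> forcing.le E P p q --> q : zf.el E P --> q : G) &
  (ALL p:G. ALL q:G. EX r:G. forcing.le E P r p & forcing.le E P r q) &
  (ALL D. zf.S E D --> D <= zf.el E P --> (ALL p:zf.el E P. EX q:D. forcing.le E P q p) --> (EX p:G. p : D))"
proof -
 interpret forcing E P by (rule assms)
 define step where "step p n = (if EX q. q : el n & le q p then SOME q. q : el n & le q p else p)" for p n
 define c where "c = rec_nat emp (%n p. step p n)"
 have c0: "c 0 = emp" and cS: "c (Suc n) = step (c n) n" for n by (simp_all add: c_def)
 have step: "q : el n & le q p ==> step p n : el n & le (step p n) p" for p q n
  using someI[of "%q. q : el n & le q p" q] by (auto simp: step_def)
 have le_step: "le (step p n) p" if "p : el P" for p n
 proof (cases "EX q. q : el n & le q p")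
  case True then show ?thesis using step[of _ n p] by blast
 next
  case False
  then have "step p n = p" unfolding step_def by (rule if_not_P)
  then show ?thesis using le_refl[OF that] by simp
 qed
 have cP: "c n : el P" for n
 proof (induction n)
  case 0 then show ?case using c0 emp_P by simp
 next
  case (Suc n) then show ?case using le_step[OF Suc] cS le_P by metis
 qed
 have mono: "el (c m) <= el (c n)" if "m \<le> n" for m n
 proof (rule lift_Suc_mono_le[OF _ that])
  show "el (c n) <= el (c (Suc n))" for n using le_step[OF cP] unfolding cS le_def by blast
 qed
 define G where "G = {q : el P. EX n. el q <= el (c n)}"
 have cG: "c n : G" for n using cP by (auto simp: G_def)
 show ?thesis
 proof (intro exI[of _ G] conjI allI impI ballI)
  show "G <= el P" by (auto simp: G_def)
  show "emp : G" using cG[of 0] c0 by simp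
  show "q : G" if "p : G" "le p q" "q : el P" for p q using that unfolding G_def le_def by blast
  show "EX r:G. le r p & le r q" if pq: "p : G" "q : G" for p q
  proof -
   obtain m n where mn: "el p <= el (c m)" "el q <= el (c n)" using pq unfolding G_def by blast
   then have "le (c (max m n)) p" "le (c (max m n)) q"
    using mono[of m "max m n"] mono[of n "max m n"] cP unfolding le_def by auto
   then show ?thesis using cG by blast
  qed
  show "EX p:G. p : D" if D: "S D" "ALL p:el P. EX q:D. le q p" for D
  proof -
   obtain d where d: "el d = D" using D(1) unfolding S_def by blast
   obtain q where "q : el d" "le q (c d)" using D(2) cP d by blast
   then have "c (Suc d) : D" using step unfolding cS d[symmetric] by blast
   then show ?thesis using cG by blast
  qed
 qed
qed

lemma generic_extension:
 fixes E :: "nat => nat => bool"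
 assumes "forcing E P"
 shows "EX G (val :: nat => nat) EN. generic E P G val EN"
proof -
 interpret forcing E P by (rule assms)
 obtain G where G: "G <= el P" "emp : G" "ALL p q. p : G --> le p q --> q : el P --> q : G"
  "ALL p:G. ALL q:G. EX r:G. le r p & le r q"
  "ALL D. S D --> D <= el P --> (ALL p:el P. EX q:D. le q p) --> (EX p:G. p : D)"
  using generic_filter[OF assms] by auto
 define eq where "eq \<sigma> \<tau> \<longleftrightarrow> (EX p:G. EQ p \<sigma> \<tau>)" for \<sigma> \<tau>
 define mem where "mem \<sigma> \<tau> \<longleftrightarrow> (EX p:G. MEM p \<sigma> \<tau>)" for \<sigma> \<tau>
 have eq_refl: "eq \<sigma> \<sigma>" for \<sigma> unfolding eq_def using G(1,2) EQ_refl by blast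
 have eq_sym: "eq \<tau> \<sigma>" if "eq \<sigma> \<tau>" for \<sigma> \<tau> using that EQ_sym unfolding eq_def by blast
 have eq_trans: "eq \<sigma> \<rho>" if st: "eq \<sigma> \<tau>" "eq \<tau> \<rho>" for \<sigma> \<tau> \<rho>
 proof -
  obtain p q where pq: "p : G" "EQ p \<sigma> \<tau>" "q : G" "EQ q \<tau> \<rho>" using st unfolding eq_def by blast
  obtain r where r: "r : G" "le r p" "le r q" using G(4) pq(1,3) by blast
  have "EQ r \<sigma> \<rho>" by (rule EQ_trans[OF EQ_mono[OF pq(2) r(2)] EQ_mono[OF pq(4) r(3)]])
  then show ?thesis using r(1) unfolding eq_def by blast
 qed
 have equiv: "equivp eq" by (intro equivpI reflpI sympI transpI) (fact eq_refl eq_sym eq_trans)+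
 have cong: "mem \<sigma>' \<tau>'" if h: "mem \<sigma> \<tau>" "eq \<sigma> \<sigma>'" "eq \<tau> \<tau>'" for \<sigma> \<sigma>' \<tau> \<tau>'
 proof -
  obtain p q w where p: "p : G" "MEM p \<sigma> \<tau>" "q : G" "EQ q \<sigma> \<sigma>'" "w : G" "EQ w \<tau> \<tau>'" using h unfolding eq_def mem_def by blast
  obtain a where a: "a : G" "le a p" "le a q" using G(4) p(1,3) by blast
  obtain r where r: "r : G" "le r a" "le r w" using G(4) a(1) p(5) by blast
  have "MEM r \<sigma>' \<tau>'" by (rule MEM_cong[OF MEM_mono[OF p(2) le_trans[OF r(2) a(2)]]
    EQ_mono[OF p(4) le_trans[OF r(2) a(3)]] EQ_mono[OF p(6) r(3)]])
  then show ?thesis using r(1) unfolding mem_def by blast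
 qed
 \<comment> \<open>Check names of distinct sets are never identified; hence the quotient is infinite
   and can again be placed on \<open>nat\<close>.\<close>
 have "inj (%x. Collect (eq (chk x)))"
 proof (rule injI)
  fix x y assume "Collect (eq (chk x)) = Collect (eq (chk y))"
  then have "eq (chk x) (chk y)" using eq_refl by blast
  then show "x = y" unfolding eq_def using EQ_chk by blast
 qed
 then have "infinite (range (%x. Collect (eq (chk x))))" using finite_imageD infinite_UNIV_nat by blast
 then have "infinite (range (%x. Collect (eq x)))" by (rule contrapos_nn) (erule rev_finite_subset, blast)
 then obtain val :: "nat => nat" where val: "surj val" "!!\<sigma> \<tau>. val \<sigma> = val \<tau> \<longleftrightarrow> eq \<sigma> \<tau>" using quotient_map[OF equiv] by blast
 define EN where "EN a b \<longleftrightarrow> (EX \<sigma> \<tau>. a = val \<sigma> & b = val \<tau> & mem \<sigma> \<tau>)" for a b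
 have EN: "EN (val \<sigma>) (val \<tau>) \<longleftrightarrow> mem \<sigma> \<tau>" for \<sigma> \<tau> unfolding EN_def val(2) using cong eq_refl eq_sym by blast
 have "generic E P G val EN"
 proof unfold_locales
  show "q : G" if "p : G" "le p q" "q : el P" for p q using G(3) that by blast
  show "EX r:G. le r p & le r q" if "p : G" "q : G" for p q using G(4) that by blast
  show "EX p:G. p : D" if "S D" "D <= el P" "!!p. p : el P ==> EX q:D. le q p" for D using G(5) that by blast
  show "val \<sigma> = val \<tau> \<longleftrightarrow> (EX p:G. EQ p \<sigma> \<tau>)" for \<sigma> \<tau> unfolding val(2) eq_def ..
  show "EN (val \<sigma>) (val \<tau>) \<longleftrightarrow> (EX p:G. MEM p \<sigma> \<tau>)" for \<sigma> \<tau> unfolding EN mem_def ..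
 qed (fact G(1) val(1))+
 then show ?thesis by blast
qed

lemma countable_model:
 assumes "consistent ZFC" shows "EX E :: nat => nat => bool. zfc E"
proof -
 obtain eq E and v :: "nat => nat" where eq: "equivp eq" and cong: "ALL x x' y y'. eq x x' --> eq y y' --> E x y = E x' y'"
  and M: "ALL p:ZFC. sat eq E v p" using model_existence[OF assms] by blast
 obtain h :: "nat => nat" where h: "surj h" "!!x y. h x = h y \<longleftrightarrow> eq x y"
  using quotient_map[OF eq infinite_quotient[OF eq cong M]] by blast
 define E' where "E' a b \<longleftrightarrow> (EX x y. a = h x & b = h y & E x y)" for a b
 have refl: "eq x x" for x using eq by (simp add: equivp_reflp)
 have "E' (h x) (h y) \<longleftrightarrow> E x y" for x y unfolding E'_def h(2) using cong refl by blast
 then have "ALL p:ZFC. sat (=) E' (%i. h (v i)) p" using sat_quotient[OF h, of E' E v] M by blast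
 then show ?thesis using sat_ZFC_iff by blast
qed

theorem mainTheorem2:
  fixes s :: nat
  assumes "s \<ge> 2"
    and "consistent ZFC"
  shows "consistent (insert (invariants_sentence s) ZFC)"
proof -
 obtain E :: "nat => nat => bool" where "zfc E" using countable_model[OF assms(2)] by blast
 then interpret M: zfc E .
 interpret M: silver E "M.num (Suc s)"
 proof unfold_locales
  show "M.num (Suc s) : M.el M.om" by (rule M.num_om)
  have "M.num 1 : M.el (M.num (Suc s))" by (rule M.num_mem) (use assms(1) in simp)
  then show "M.sc M.emp : M.el (M.num (Suc s))" by (simp del: M.el_ins)
 qed
 have "forcing E M.PP"
 proof unfold_locales
  show "M.emp : M.el M.PP" unfolding M.el_PP using M.cnd_emp by blast
 qed
 then obtain G and val :: "nat => nat" and EN where "generic E M.PP G val EN" using generic_extension by blast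
 then interpret generic E M.PP G val EN .
 interpret silver_ext E "M.num (Suc s)" M.PP G val EN by unfold_locales (rule refl)
 have "sat (=) EN u p" if "p : insert (invariants_sentence s) ZFC" for u p
  using that invariants_sentence_holds[OF assms(1) refl] sat_ZFC_iff[of EN u] N.zfc_axioms by blast
 then show ?thesis unfolding consistent_def using soundness[of _ Bot EN] by (metis sat.simps(1))
qed

end
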